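(* Let $\mathcal{A}$ be an abelian Bénabou cosmos with enough projectives and let $\mathcal{C}$ be an augmented $\mathcal{A}$-flat $\mathcal{A}$-category. Then for any $\mathcal{C}$-module $M$ there is an isomorphism $$H_*(\mathcal{C},M)\cong H_*(S_\bullet(\mathcal{C},M)).$$
   Context: A Bénabou cosmos is a complete and cocomplete symmetric closed monoidal category (tensor $\otimes$, unit $\mathbb{1}$, inner hom $\mathcal{A}(-,-)$). It is abelian if its underlying category is abelian and satisfies (AB4) and (AB4* ) (small coproducts, resp. products, of short exact sequences are short exact). An $\mathcal{A}$-category $\mathcal{C}$ is $\mathcal{A}$-flat if $\mathcal{C}(c,c')\otimes-$ is an exact functor for all objects $c,c'$. A $\mathcal{C}$-module is an $\mathcal{A}$-functor $\mathcal{C}\to\mathcal{A}$; $\mathrm{Mod}(\mathcal{C})$ is the (abelian) category of $\mathcal{C}$-modules and $\mathcal{A}$-natural transformations; it has enough projectives if $\mathcal{A}$ does. $\mathsf{pt}$ is the $\mathcal{A}$-category with one object and hom $\mathbb{1}$. An augmented $\mathcal{A}$-category is a small non-empty $\mathcal{A}$-category $\mathcal{C}$ with an $\mathcal{A}$-functor $\varepsilon:\mathcal{C}\to\mathsf{pt}$. Identifying $\mathrm{Mod}(\mathsf{pt})$ with $\mathcal{A}$, let $\mathrm{Triv}=\varepsilon^*:\mathcal{A}\to\mathrm{Mod}(\mathcal{C})$ be restriction along $\varepsilon$ and $\mathrm{Coinv}=\varepsilon_!:\mathrm{Mod}(\mathcal{C})\to\mathcal{A}$ its left adjoint (enriched left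 Kan extension); define $H_n(\mathcal{C},M)=(L_n\mathrm{Coinv})(M)$. $S_\bullet(\mathcal{C},M)$ is the simplicial object of $\mathcal{A}$ with $$S_n(\mathcal{C},M)=\coprod_{c_0,\dots,c_n}Mc_0\otimes\mathcal{C}(c_0,c_1)\otimes\dots\otimes\mathcal{C}(c_{n-1},c_n).$$ For $0<i<n$ the face $d_i$ is induced by $\mathcal{C}(c_{i-1},c_i)\otimes\mathcal{C}(c_i,c_{i+1})\cong\mathcal{C}(c_i,c_{i+1})\otimes\mathcal{C}(c_{i-1},c_i)\xrightarrow{\circ}\mathcal{C}(c_{i-1},c_{i+1})$; $d_0$ is induced by $Mc_0\otimes\mathcal{C}(c_0,c_1)\to Mc_1$ adjoint to $\mathcal{C}(c_0,c_1)\to\mathcal{A}(Mc_0,Mc_1)$; $d_n$ is induced by $\varepsilon:\mathcal{C}(c_{n-1},c_n)\to\mathbb{1}$; degeneracies are induced by the identities $\mathbb{1}\to\mathcal{C}(c_i,c_i)$. $H_*$ of a simplicial object is the homology of its (normalised or unnormalised) chain complex. *)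

theory Defs
  imports "HOL-Algebra.FiniteProduct"
begin

section \<open>Categories, functors, (co)limits\<close>

record ('o, 'a) cat =
  Obj :: "'o set"
  Arr :: "'a set"
  Dom :: "'a \<Rightarrow> 'o"
  Cod :: "'a \<Rightarrow> 'o"
  Ide :: "'o \<Rightarrow> 'a"
  Cmp :: "'a \<Rightarrow> 'a \<Rightarrow> 'a"  (infixl "\<cdot>\<index>" 75)

definition homset :: "('o, 'a, 'z) cat_scheme \<Rightarrow> 'o \<Rightarrow> 'o \<Rightarrow> 'a set" where
  "homset C x y = {f \<in> Arr C. Dom C f = x \<and> Cod C f = y}"

locale category =
  fixes C :: "('o, 'a, 'z) cat_scheme" (structure)
  assumes Dom_Obj: "f \<in> Arr C \<Longrightarrow> Dom C f \<in> Obj C"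
    and Cod_Obj: "f \<in> Arr C \<Longrightarrow> Cod C f \<in> Obj C"
    and Ide_homset: "x \<in> Obj C \<Longrightarrow> Ide C x \<in> homset C x x"
    and Cmp_homset: "f \<in> homset C x y \<Longrightarrow> g \<in> homset C y z \<Longrightarrow> g \<cdot> f \<in> homset C x z"
    and Cmp_Ide_right: "f \<in> homset C x y \<Longrightarrow> f \<cdot> Ide C x = f"
    and Cmp_Ide_left: "f \<in> homset C x y \<Longrightarrow> Ide C y \<cdot> f = f"
    and Cmp_assoc: "f \<in> homset C w x \<Longrightarrow> g \<in> homset C x y \<Longrightarrow> h \<in> homset C y z
          \<Longrightarrow> (h \<cdot> g) \<cdot> f = h \<cdot> (g \<cdot> f)"

definition inverse_arrows :: "('o, 'a, 'z) cat_scheme \<Rightarrow> 'a \<Rightarrow> 'a \<Rightarrow> bool" where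
  "inverse_arrows C f g \<longleftrightarrow> f \<in> Arr C \<and> g \<in> homset C (Cod C f) (Dom C f)
     \<and> g \<cdot>\<^bsub>C\<^esub> f = Ide C (Dom C f) \<and> f \<cdot>\<^bsub>C\<^esub> g = Ide C (Cod C f)"

definition iso_arrow :: "('o, 'a, 'z) cat_scheme \<Rightarrow> 'a \<Rightarrow> bool" where
  "iso_arrow C f \<longleftrightarrow> (\<exists>g. inverse_arrows C f g)"

definition inv_arrow :: "('o, 'a, 'z) cat_scheme \<Rightarrow> 'a \<Rightarrow> 'a" where
  "inv_arrow C f = (THE g. inverse_arrows C f g)"

definition isomorphic :: "('o, 'a, 'z) cat_scheme \<Rightarrow> 'o \<Rightarrow> 'o \<Rightarrow> bool" where
  "isomorphic C x y \<longleftrightarrow> (\<exists>f \<in> homset C x y. iso_arrow C f)"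

definition mono_arrow :: "('o, 'a, 'z) cat_scheme \<Rightarrow> 'a \<Rightarrow> bool" where
  "mono_arrow C m \<longleftrightarrow> m \<in> Arr C
     \<and> (\<forall>x. \<forall>f \<in> homset C x (Dom C m). \<forall>g \<in> homset C x (Dom C m).
          m \<cdot>\<^bsub>C\<^esub> f = m \<cdot>\<^bsub>C\<^esub> g \<longrightarrow> f = g)"

definition epi_arrow :: "('o, 'a, 'z) cat_scheme \<Rightarrow> 'a \<Rightarrow> bool" where
  "epi_arrow C e \<longleftrightarrow> e \<in> Arr C
     \<and> (\<forall>y. \<forall>f \<in> homset C (Cod C e) y. \<forall>g \<in> homset C (Cod C e) y.
          f \<cdot>\<^bsub>C\<^esub> e = g \<cdot>\<^bsub>C\<^esub> e \<longrightarrow> f = g)"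

record ('o, 'a, 'p, 'b) func =
  FO :: "'o \<Rightarrow> 'p"
  FA :: "'a \<Rightarrow> 'b"

definition is_functor ::
  "('o, 'a, 'z) cat_scheme \<Rightarrow> ('p, 'b, 'y) cat_scheme \<Rightarrow> ('o, 'a, 'p, 'b) func \<Rightarrow> bool" where
  "is_functor C D F \<longleftrightarrow>
     (\<forall>x \<in> Obj C. FO F x \<in> Obj D)
   \<and> (\<forall>x y. \<forall>f \<in> homset C x y. FA F f \<in> homset D (FO F x) (FO F y))
   \<and> (\<forall>x \<in> Obj C. FA F (Ide C x) = Ide D (FO F x))
   \<and> (\<forall>x y z. \<forall>f \<in> homset C x y. \<forall>g \<in> homset C y z.
        FA F (g \<cdot>\<^bsub>C\<^esub> f) = FA F g \<cdot>\<^bsub>D\<^esub> FA F f)"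

definition comp_func ::
  "('p, 'b, 'q, 'c) func \<Rightarrow> ('o, 'a, 'p, 'b) func \<Rightarrow> ('o, 'a, 'q, 'c) func" where
  "comp_func G F = \<lparr>FO = (\<lambda>x. FO G (FO F x)), FA = (\<lambda>f. FA G (FA F f))\<rparr>"

definition left_adjoint ::
  "('o, 'a, 'z) cat_scheme \<Rightarrow> ('p, 'b, 'y) cat_scheme
    \<Rightarrow> ('o, 'a, 'p, 'b) func \<Rightarrow> ('p, 'b, 'o, 'a) func \<Rightarrow> bool" where
  "left_adjoint C D F G \<longleftrightarrow> is_functor C D F \<and> is_functor D C G
     \<and> (\<exists>\<eta>. (\<forall>x \<in> Obj C. \<eta> x \<in> homset C x (FO G (FO F x)))
          \<and> (\<forall>x y. \<forall>f \<in> homset C x y. \<eta> y \<cdot>\<^bsub>C\<^esub> f = FA G (FA F f) \<cdot>\<^bsub>C\<^esub> \<eta> x)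
          \<and> (\<forall>x \<in> Obj C. \<forall>y \<in> Obj D. \<forall>g \<in> homset C x (FO G y).
               \<exists>!f. f \<in> homset D (FO F x) y \<and> FA G f \<cdot>\<^bsub>C\<^esub> \<eta> x = g))"

definition is_product ::
  "('o, 'a, 'z) cat_scheme \<Rightarrow> 'i set \<Rightarrow> ('i \<Rightarrow> 'o) \<Rightarrow> 'o \<Rightarrow> ('i \<Rightarrow> 'a) \<Rightarrow> bool" where
  "is_product C I X P \<pi> \<longleftrightarrow> P \<in> Obj C \<and> (\<forall>i \<in> I. \<pi> i \<in> homset C P (X i))
     \<and> (\<forall>y \<in> Obj C. \<forall>f. (\<forall>i \<in> I. f i \<in> homset C y (X i)) \<longrightarrow>
          (\<exists>!u. u \<in> homset C y P \<and> (\<forall>i \<in> I. \<pi> i \<cdot>\<^bsub>C\<^esub> u = f i)))"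

definition is_coproduct ::
  "('o, 'a, 'z) cat_scheme \<Rightarrow> 'i set \<Rightarrow> ('i \<Rightarrow> 'o) \<Rightarrow> 'o \<Rightarrow> ('i \<Rightarrow> 'a) \<Rightarrow> bool" where
  "is_coproduct C I X Q \<iota> \<longleftrightarrow> Q \<in> Obj C \<and> (\<forall>i \<in> I. \<iota> i \<in> homset C (X i) Q)
     \<and> (\<forall>y \<in> Obj C. \<forall>f. (\<forall>i \<in> I. f i \<in> homset C (X i) y) \<longrightarrow>
          (\<exists>!u. u \<in> homset C Q y \<and> (\<forall>i \<in> I. u \<cdot>\<^bsub>C\<^esub> \<iota> i = f i)))"

definition coprod ::
  "('o, 'a, 'z) cat_scheme \<Rightarrow> 'i set \<Rightarrow> ('i \<Rightarrow> 'o) \<Rightarrow> 'o \<times> ('i \<Rightarrow> 'a)" where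
  "coprod C I X = (SOME (Q, \<iota>). is_coproduct C I X Q \<iota>)"

definition coprod_desc ::
  "('o, 'a, 'z) cat_scheme \<Rightarrow> 'i set \<Rightarrow> ('i \<Rightarrow> 'o) \<Rightarrow> 'o \<Rightarrow> ('i \<Rightarrow> 'a) \<Rightarrow> 'a" where
  "coprod_desc C I X y f =
     (THE u. u \<in> homset C (fst (coprod C I X)) y
           \<and> (\<forall>i \<in> I. u \<cdot>\<^bsub>C\<^esub> snd (coprod C I X) i = f i))"

definition is_limit ::
  "('j, 'k, 'y) cat_scheme \<Rightarrow> ('o, 'a, 'z) cat_scheme \<Rightarrow> ('j, 'k, 'o, 'a) func
    \<Rightarrow> 'o \<Rightarrow> ('j \<Rightarrow> 'a) \<Rightarrow> bool" where
  "is_limit J C F L \<pi> \<longleftrightarrow> (let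
       cone = (\<lambda>x \<sigma>. x \<in> Obj C \<and> (\<forall>j \<in> Obj J. \<sigma> j \<in> homset C x (FO F j))
         \<and> (\<forall>k \<in> Arr J. FA F k \<cdot>\<^bsub>C\<^esub> \<sigma> (Dom J k) = \<sigma> (Cod J k)))
     in cone L \<pi> \<and> (\<forall>x \<sigma>. cone x \<sigma> \<longrightarrow>
          (\<exists>!u. u \<in> homset C x L \<and> (\<forall>j \<in> Obj J. \<pi> j \<cdot>\<^bsub>C\<^esub> u = \<sigma> j))))"

definition is_colimit ::
  "('j, 'k, 'y) cat_scheme \<Rightarrow> ('o, 'a, 'z) cat_scheme \<Rightarrow> ('j, 'k, 'o, 'a) func
    \<Rightarrow> 'o \<Rightarrow> ('j \<Rightarrow> 'a) \<Rightarrow> bool" where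
  "is_colimit J C F Q \<iota> \<longleftrightarrow> (let
       cocone = (\<lambda>x \<sigma>. x \<in> Obj C \<and> (\<forall>j \<in> Obj J. \<sigma> j \<in> homset C (FO F j) x)
         \<and> (\<forall>k \<in> Arr J. \<sigma> (Cod J k) \<cdot>\<^bsub>C\<^esub> FA F k = \<sigma> (Dom J k)))
     in cocone Q \<iota> \<and> (\<forall>x \<sigma>. cocone x \<sigma> \<longrightarrow>
          (\<exists>!u. u \<in> homset C Q x \<and> (\<forall>j \<in> Obj J. u \<cdot>\<^bsub>C\<^esub> \<iota> j = \<sigma> j))))"

text \<open>HOL has no set/class distinction.  Smallness is measured by a type \<open>'u\<close>: a small set is
  (up to bijection) a set of elements of \<open>'u\<close>, so small diagrams are indexed by categories whose
  objects and arrows are elements of \<open>'u\<close>.  The types of objects and arrows of the categories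
  under consideration are unrelated to \<open>'u\<close>; in particular hom-sets are not required to be small.\<close>

definition small_complete :: "'u itself \<Rightarrow> ('o, 'a, 'z) cat_scheme \<Rightarrow> bool" where
  "small_complete U C \<longleftrightarrow> (\<forall>(J :: ('u, 'u) cat) F. category J \<and> is_functor J C F
     \<longrightarrow> (\<exists>L \<pi>. is_limit J C F L \<pi>))"

definition small_cocomplete :: "'u itself \<Rightarrow> ('o, 'a, 'z) cat_scheme \<Rightarrow> bool" where
  "small_cocomplete U C \<longleftrightarrow> (\<forall>(J :: ('u, 'u) cat) F. category J \<and> is_functor J C F
     \<longrightarrow> (\<exists>Q \<iota>. is_colimit J C F Q \<iota>))"


section \<open>Abelian categories\<close>

definition zero_object :: "('o, 'a, 'z) cat_scheme \<Rightarrow> 'o \<Rightarrow> bool" where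
  "zero_object C z \<longleftrightarrow> z \<in> Obj C
     \<and> (\<forall>x \<in> Obj C. (\<exists>!f. f \<in> homset C x z) \<and> (\<exists>!f. f \<in> homset C z x))"

definition is_zero_arrow :: "('o, 'a, 'z) cat_scheme \<Rightarrow> 'a \<Rightarrow> bool" where
  "is_zero_arrow C f \<longleftrightarrow> f \<in> Arr C
     \<and> (\<exists>z g h. zero_object C z \<and> g \<in> homset C (Dom C f) z \<and> h \<in> homset C z (Cod C f)
          \<and> f = h \<cdot>\<^bsub>C\<^esub> g)"

definition zero_arrow :: "('o, 'a, 'z) cat_scheme \<Rightarrow> 'o \<Rightarrow> 'o \<Rightarrow> 'a" where
  "zero_arrow C x y = (THE f. f \<in> homset C x y \<and> is_zero_arrow C f)"

definition is_kernel :: "('o, 'a, 'z) cat_scheme \<Rightarrow> 'a \<Rightarrow> 'a \<Rightarrow> bool" where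
  "is_kernel C k f \<longleftrightarrow> k \<in> Arr C \<and> f \<in> Arr C \<and> Cod C k = Dom C f
     \<and> is_zero_arrow C (f \<cdot>\<^bsub>C\<^esub> k)
     \<and> (\<forall>h \<in> Arr C. Cod C h = Dom C f \<and> is_zero_arrow C (f \<cdot>\<^bsub>C\<^esub> h) \<longrightarrow>
          (\<exists>!u. u \<in> homset C (Dom C h) (Dom C k) \<and> k \<cdot>\<^bsub>C\<^esub> u = h))"

definition is_cokernel :: "('o, 'a, 'z) cat_scheme \<Rightarrow> 'a \<Rightarrow> 'a \<Rightarrow> bool" where
  "is_cokernel C q f \<longleftrightarrow> q \<in> Arr C \<and> f \<in> Arr C \<and> Dom C q = Cod C f
     \<and> is_zero_arrow C (q \<cdot>\<^bsub>C\<^esub> f)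
     \<and> (\<forall>h \<in> Arr C. Dom C h = Cod C f \<and> is_zero_arrow C (h \<cdot>\<^bsub>C\<^esub> f) \<longrightarrow>
          (\<exists>!u. u \<in> homset C (Cod C q) (Cod C h) \<and> u \<cdot>\<^bsub>C\<^esub> q = h))"

text \<open>The additive structure of an additive category is unique, so being additive (or abelian)
  is a property, and \<open>hom_add\<close> below selects that structure.\<close>

definition hom_group ::
  "('o, 'a, 'z) cat_scheme \<Rightarrow> ('a \<Rightarrow> 'a \<Rightarrow> 'a) \<Rightarrow> 'o \<Rightarrow> 'o \<Rightarrow> 'a monoid" where
  "hom_group C add x y =
     \<lparr>carrier = homset C x y, monoid.mult = add, one = zero_arrow C x y\<rparr>"

definition additive_structure ::
  "('o, 'a, 'z) cat_scheme \<Rightarrow> ('a \<Rightarrow> 'a \<Rightarrow> 'a) \<Rightarrow> bool" where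
  "additive_structure C add \<longleftrightarrow>
     (\<forall>x \<in> Obj C. \<forall>y \<in> Obj C. comm_group (hom_group C add x y))
   \<and> (\<forall>x y z. \<forall>f \<in> homset C x y. \<forall>f' \<in> homset C x y. \<forall>g \<in> homset C y z.
        g \<cdot>\<^bsub>C\<^esub> add f f' = add (g \<cdot>\<^bsub>C\<^esub> f) (g \<cdot>\<^bsub>C\<^esub> f'))
   \<and> (\<forall>x y z. \<forall>f \<in> homset C x y. \<forall>g \<in> homset C y z. \<forall>g' \<in> homset C y z.
        add g g' \<cdot>\<^bsub>C\<^esub> f = add (g \<cdot>\<^bsub>C\<^esub> f) (g' \<cdot>\<^bsub>C\<^esub> f))"

definition hom_add :: "('o, 'a, 'z) cat_scheme \<Rightarrow> 'a \<Rightarrow> 'a \<Rightarrow> 'a" where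
  "hom_add C = (SOME add. additive_structure C add)"

locale abelian_category = category C for C :: "('o, 'a, 'z) cat_scheme" (structure) +
  assumes has_zero: "\<exists>z. zero_object C z"
    and has_additive_structure: "\<exists>add. additive_structure C add"
    and has_binary_products:
      "\<And>X :: bool \<Rightarrow> 'o. range X \<subseteq> Obj C \<Longrightarrow> \<exists>P \<pi>. is_product C UNIV X P \<pi>"
    and has_binary_coproducts:
      "\<And>X :: bool \<Rightarrow> 'o. range X \<subseteq> Obj C \<Longrightarrow> \<exists>Q \<iota>. is_coproduct C UNIV X Q \<iota>"
    and has_kernels: "f \<in> Arr C \<Longrightarrow> \<exists>k. is_kernel C k f"
    and has_cokernels: "f \<in> Arr C \<Longrightarrow> \<exists>q. is_cokernel C q f"
    and mono_is_kernel: "mono_arrow C m \<Longrightarrow> \<exists>f. is_kernel C m f"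
    and epi_is_cokernel: "epi_arrow C e \<Longrightarrow> \<exists>f. is_cokernel C e f"

definition short_exact :: "('o, 'a, 'z) cat_scheme \<Rightarrow> 'a \<Rightarrow> 'a \<Rightarrow> bool" where
  "short_exact C f g \<longleftrightarrow> is_kernel C f g \<and> is_cokernel C g f"

text \<open>Exactness of \<open>\<bullet> \<rightarrow>f \<bullet> \<rightarrow>g \<bullet>\<close>: the kernel of \<open>g\<close> is the image of \<open>f\<close>, i.e. the kernel of a
  cokernel of \<open>f\<close>.\<close>

definition exact_at :: "('o, 'a, 'z) cat_scheme \<Rightarrow> 'a \<Rightarrow> 'a \<Rightarrow> bool" where
  "exact_at C f g \<longleftrightarrow> (\<exists>k q. is_cokernel C q f \<and> is_kernel C k q \<and> is_kernel C k g)"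

definition exact_functor ::
  "('o, 'a, 'z) cat_scheme \<Rightarrow> ('p, 'b, 'y) cat_scheme \<Rightarrow> ('o, 'a, 'p, 'b) func \<Rightarrow> bool" where
  "exact_functor C D F \<longleftrightarrow> is_functor C D F
     \<and> (\<forall>f g. short_exact C f g \<longrightarrow> short_exact D (FA F f) (FA F g))"

definition AB4 :: "'u itself \<Rightarrow> ('o, 'a, 'z) cat_scheme \<Rightarrow> bool" where
  "AB4 U C \<longleftrightarrow> (\<forall>(I :: 'u set) X Y Z f g QX \<iota>X QY \<iota>Y QZ \<iota>Z F G.
      (\<forall>i \<in> I. f i \<in> homset C (X i) (Y i) \<and> g i \<in> homset C (Y i) (Z i)
               \<and> short_exact C (f i) (g i))
    \<and> is_coproduct C I X QX \<iota>X \<and> is_coproduct C I Y QY \<iota>Y \<and> is_coproduct C I Z QZ \<iota>Z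
    \<and> F \<in> homset C QX QY \<and> (\<forall>i \<in> I. F \<cdot>\<^bsub>C\<^esub> \<iota>X i = \<iota>Y i \<cdot>\<^bsub>C\<^esub> f i)
    \<and> G \<in> homset C QY QZ \<and> (\<forall>i \<in> I. G \<cdot>\<^bsub>C\<^esub> \<iota>Y i = \<iota>Z i \<cdot>\<^bsub>C\<^esub> g i)
    \<longrightarrow> short_exact C F G)"

definition AB4_star :: "'u itself \<Rightarrow> ('o, 'a, 'z) cat_scheme \<Rightarrow> bool" where
  "AB4_star U C \<longleftrightarrow> (\<forall>(I :: 'u set) X Y Z f g PX \<pi>X PY \<pi>Y PZ \<pi>Z F G.
      (\<forall>i \<in> I. f i \<in> homset C (X i) (Y i) \<and> g i \<in> homset C (Y i) (Z i)
               \<and> short_exact C (f i) (g i))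
    \<and> is_product C I X PX \<pi>X \<and> is_product C I Y PY \<pi>Y \<and> is_product C I Z PZ \<pi>Z
    \<and> F \<in> homset C PX PY \<and> (\<forall>i \<in> I. \<pi>Y i \<cdot>\<^bsub>C\<^esub> F = f i \<cdot>\<^bsub>C\<^esub> \<pi>X i)
    \<and> G \<in> homset C PY PZ \<and> (\<forall>i \<in> I. \<pi>Z i \<cdot>\<^bsub>C\<^esub> G = g i \<cdot>\<^bsub>C\<^esub> \<pi>Y i)
    \<longrightarrow> short_exact C F G)"


section \<open>Homology and left derived functors\<close>

definition projective :: "('o, 'a, 'z) cat_scheme \<Rightarrow> 'o \<Rightarrow> bool" where
  "projective C p \<longleftrightarrow> p \<in> Obj C
     \<and> (\<forall>e f. epi_arrow C e \<and> f \<in> homset C p (Cod C e) \<longrightarrow>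
          (\<exists>f' \<in> homset C p (Dom C e). e \<cdot>\<^bsub>C\<^esub> f' = f))"

definition enough_projectives :: "('o, 'a, 'z) cat_scheme \<Rightarrow> bool" where
  "enough_projectives C \<longleftrightarrow>
     (\<forall>x \<in> Obj C. \<exists>p e. projective C p \<and> e \<in> homset C p x \<and> epi_arrow C e)"

text \<open>Chain complexes are concentrated in degrees \<open>\<ge> 0\<close> and given by objects \<open>X n\<close> and boundary maps
  \<open>d n : X (Suc n) \<rightarrow> X n\<close>; the boundary map leaving \<open>X 0\<close> is the arrow to a zero object.\<close>

definition outgoing :: "('o, 'a, 'z) cat_scheme \<Rightarrow> (nat \<Rightarrow> 'o) \<Rightarrow> (nat \<Rightarrow> 'a) \<Rightarrow> nat \<Rightarrow> 'a" where
  "outgoing C X d n =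
     (case n of 0 \<Rightarrow> zero_arrow C (X 0) (SOME z. zero_object C z) | Suc m \<Rightarrow> d m)"

definition is_homology ::
  "('o, 'a, 'z) cat_scheme \<Rightarrow> (nat \<Rightarrow> 'o) \<Rightarrow> (nat \<Rightarrow> 'a) \<Rightarrow> nat \<Rightarrow> 'o \<Rightarrow> bool" where
  "is_homology C X d n H \<longleftrightarrow>
     (\<exists>k u q. is_kernel C k (outgoing C X d n)
        \<and> u \<in> homset C (X (Suc n)) (Dom C k) \<and> k \<cdot>\<^bsub>C\<^esub> u = d n
        \<and> is_cokernel C q u \<and> Cod C q = H)"

definition homology ::
  "('o, 'a, 'z) cat_scheme \<Rightarrow> (nat \<Rightarrow> 'o) \<Rightarrow> (nat \<Rightarrow> 'a) \<Rightarrow> nat \<Rightarrow> 'o" where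
  "homology C X d n = (SOME H. is_homology C X d n H)"

definition projective_resolution ::
  "('o, 'a, 'z) cat_scheme \<Rightarrow> 'o \<Rightarrow> (nat \<Rightarrow> 'o) \<Rightarrow> (nat \<Rightarrow> 'a) \<Rightarrow> 'a \<Rightarrow> bool" where
  "projective_resolution C M P d e \<longleftrightarrow>
     (\<forall>n. projective C (P n)) \<and> (\<forall>n. d n \<in> homset C (P (Suc n)) (P n))
   \<and> e \<in> homset C (P 0) M \<and> epi_arrow C e
   \<and> exact_at C (d 0) e \<and> (\<forall>n. exact_at C (d (Suc n)) (d n))"

definition left_derived ::
  "('o, 'a, 'z) cat_scheme \<Rightarrow> ('p, 'b, 'y) cat_scheme \<Rightarrow> ('o, 'a, 'p, 'b) func
    \<Rightarrow> nat \<Rightarrow> 'o \<Rightarrow> 'p" where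
  "left_derived C D F n M =
     (let (P, d, e) = (SOME (P, d, e). projective_resolution C M P d e)
      in homology D (\<lambda>i. FO F (P i)) (\<lambda>i. FA F (d i)) n)"

text \<open>\<open>face S n i : S\<^sub>n\<^sub>+\<^sub>1 \<rightarrow> S\<^sub>n\<close> for \<open>i \<le> n + 1\<close> and \<open>degen S n i : S\<^sub>n \<rightarrow> S\<^sub>n\<^sub>+\<^sub>1\<close> for \<open>i \<le> n\<close>.\<close>

record ('o, 'a) simplicial =
  simp_ob :: "nat \<Rightarrow> 'o"
  face :: "nat \<Rightarrow> nat \<Rightarrow> 'a"
  degen :: "nat \<Rightarrow> nat \<Rightarrow> 'a"

text \<open>The boundary \<open>\<Sum>\<^sub>i (-1)\<^sup>i d\<^sub>i\<close> of the unnormalised chain complex; the sum in the abelian group of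
  arrows is the product \<open>finprod\<close> of the multiplicatively written \<open>hom_group\<close>.\<close>

definition alt_boundary ::
  "('o, 'a, 'z) cat_scheme \<Rightarrow> ('o, 'a) simplicial \<Rightarrow> nat \<Rightarrow> 'a" where
  "alt_boundary C S n =
     (let G = hom_group C (hom_add C) (simp_ob S (Suc n)) (simp_ob S n)
      in finprod G (\<lambda>i. if even i then face S n i else m_inv G (face S n i)) {..Suc n})"

definition simplicial_homology ::
  "('o, 'a, 'z) cat_scheme \<Rightarrow> ('o, 'a) simplicial \<Rightarrow> nat \<Rightarrow> 'o" where
  "simplicial_homology C S n = homology C (simp_ob S) (alt_boundary C S) n"


section \<open>Benabou cosmoi\<close>

record ('o, 'a) moncat = "('o, 'a) cat" +
  ten :: "'o \<Rightarrow> 'o \<Rightarrow> 'o"  (infixl "\<boxtimes>\<index>" 80)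
  tenA :: "'a \<Rightarrow> 'a \<Rightarrow> 'a"  (infixl "\<boxdot>\<index>" 80)
  unt :: "'o"
  asc :: "'o \<Rightarrow> 'o \<Rightarrow> 'o \<Rightarrow> 'a"
  lun :: "'o \<Rightarrow> 'a"
  run :: "'o \<Rightarrow> 'a"
  swp :: "'o \<Rightarrow> 'o \<Rightarrow> 'a"
  iho :: "'o \<Rightarrow> 'o \<Rightarrow> 'o"
  evl :: "'o \<Rightarrow> 'o \<Rightarrow> 'a"

locale symmetric_closed_monoidal = category V
  for V :: "('o, 'a, 'z) moncat_scheme" (structure) +
  assumes ten_Obj: "x \<in> Obj V \<Longrightarrow> y \<in> Obj V \<Longrightarrow> x \<boxtimes> y \<in> Obj V"
    and tenA_homset: "f \<in> homset V x x' \<Longrightarrow> g \<in> homset V y y'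
          \<Longrightarrow> f \<boxdot> g \<in> homset V (x \<boxtimes> y) (x' \<boxtimes> y')"
    and tenA_Ide: "x \<in> Obj V \<Longrightarrow> y \<in> Obj V \<Longrightarrow> Ide V x \<boxdot> Ide V y = Ide V (x \<boxtimes> y)"
    and tenA_Cmp: "f \<in> homset V x x' \<Longrightarrow> f' \<in> homset V x' x''
          \<Longrightarrow> g \<in> homset V y y' \<Longrightarrow> g' \<in> homset V y' y''
          \<Longrightarrow> (f' \<cdot> f) \<boxdot> (g' \<cdot> g) = (f' \<boxdot> g') \<cdot> (f \<boxdot> g)"
    and unt_Obj: "unt V \<in> Obj V"
    and asc_homset: "x \<in> Obj V \<Longrightarrow> y \<in> Obj V \<Longrightarrow> z \<in> Obj V
          \<Longrightarrow> asc V x y z \<in> homset V ((x \<boxtimes> y) \<boxtimes> z) (x \<boxtimes> (y \<boxtimes> z))"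
    and asc_iso: "x \<in> Obj V \<Longrightarrow> y \<in> Obj V \<Longrightarrow> z \<in> Obj V \<Longrightarrow> iso_arrow V (asc V x y z)"
    and asc_natural: "f \<in> homset V x x' \<Longrightarrow> g \<in> homset V y y' \<Longrightarrow> h \<in> homset V z z'
          \<Longrightarrow> asc V x' y' z' \<cdot> ((f \<boxdot> g) \<boxdot> h) = (f \<boxdot> (g \<boxdot> h)) \<cdot> asc V x y z"
    and lun_homset: "x \<in> Obj V \<Longrightarrow> lun V x \<in> homset V (unt V \<boxtimes> x) x"
    and lun_iso: "x \<in> Obj V \<Longrightarrow> iso_arrow V (lun V x)"
    and lun_natural: "f \<in> homset V x x' \<Longrightarrow> lun V x' \<cdot> (Ide V (unt V) \<boxdot> f) = f \<cdot> lun V x"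
    and run_homset: "x \<in> Obj V \<Longrightarrow> run V x \<in> homset V (x \<boxtimes> unt V) x"
    and run_iso: "x \<in> Obj V \<Longrightarrow> iso_arrow V (run V x)"
    and run_natural: "f \<in> homset V x x' \<Longrightarrow> run V x' \<cdot> (f \<boxdot> Ide V (unt V)) = f \<cdot> run V x"
    and pentagon: "w \<in> Obj V \<Longrightarrow> x \<in> Obj V \<Longrightarrow> y \<in> Obj V \<Longrightarrow> z \<in> Obj V
          \<Longrightarrow> asc V w x (y \<boxtimes> z) \<cdot> asc V (w \<boxtimes> x) y z
            = (Ide V w \<boxdot> asc V x y z) \<cdot> (asc V w (x \<boxtimes> y) z \<cdot> (asc V w x y \<boxdot> Ide V z))"
    and triangle: "x \<in> Obj V \<Longrightarrow> y \<in> Obj V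
          \<Longrightarrow> (Ide V x \<boxdot> lun V y) \<cdot> asc V x (unt V) y = run V x \<boxdot> Ide V y"
    and swp_homset: "x \<in> Obj V \<Longrightarrow> y \<in> Obj V \<Longrightarrow> swp V x y \<in> homset V (x \<boxtimes> y) (y \<boxtimes> x)"
    and swp_natural: "f \<in> homset V x x' \<Longrightarrow> g \<in> homset V y y'
          \<Longrightarrow> swp V x' y' \<cdot> (f \<boxdot> g) = (g \<boxdot> f) \<cdot> swp V x y"
    and swp_swp: "x \<in> Obj V \<Longrightarrow> y \<in> Obj V \<Longrightarrow> swp V y x \<cdot> swp V x y = Ide V (x \<boxtimes> y)"
    and hexagon: "x \<in> Obj V \<Longrightarrow> y \<in> Obj V \<Longrightarrow> z \<in> Obj V
          \<Longrightarrow> asc V y z x \<cdot> (swp V x (y \<boxtimes> z) \<cdot> asc V x y z)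
            = (Ide V y \<boxdot> swp V x z) \<cdot> (asc V y x z \<cdot> (swp V x y \<boxdot> Ide V z))"
    and iho_Obj: "x \<in> Obj V \<Longrightarrow> y \<in> Obj V \<Longrightarrow> iho V x y \<in> Obj V"
    and evl_homset: "x \<in> Obj V \<Longrightarrow> y \<in> Obj V \<Longrightarrow> evl V x y \<in> homset V (iho V x y \<boxtimes> x) y"
    and closed: "x \<in> Obj V \<Longrightarrow> y \<in> Obj V \<Longrightarrow> z \<in> Obj V \<Longrightarrow> f \<in> homset V (z \<boxtimes> x) y
          \<Longrightarrow> \<exists>!g. g \<in> homset V z (iho V x y) \<and> evl V x y \<cdot> (g \<boxdot> Ide V x) = f"

text \<open>\<open>curry V z x y f : z \<rightarrow> [x, y]\<close> is the transpose of \<open>f : z \<otimes> x \<rightarrow> y\<close>.\<close>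

definition curry_arrow :: "('o, 'a, 'z) moncat_scheme \<Rightarrow> 'o \<Rightarrow> 'o \<Rightarrow> 'o \<Rightarrow> 'a \<Rightarrow> 'a" where
  "curry_arrow V z x y f =
     (THE g. g \<in> homset V z (iho V x y) \<and> evl V x y \<cdot>\<^bsub>V\<^esub> (g \<boxdot>\<^bsub>V\<^esub> Ide V x) = f)"

definition benabou_cosmos :: "'u itself \<Rightarrow> ('o, 'a, 'z) moncat_scheme \<Rightarrow> bool" where
  "benabou_cosmos U V \<longleftrightarrow> symmetric_closed_monoidal V \<and> small_complete U V \<and> small_cocomplete U V"

definition abelian_cosmos :: "'u itself \<Rightarrow> ('o, 'a, 'z) moncat_scheme \<Rightarrow> bool" where
  "abelian_cosmos U V \<longleftrightarrow>
     benabou_cosmos U V \<and> abelian_category V \<and> AB4 U V \<and> AB4_star U V"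


section \<open>Enriched categories\<close>

text \<open>\<open>eCmp C a b c : C(b,c) \<otimes> C(a,b) \<rightarrow> C(a,c)\<close>.\<close>

record ('c, 'o, 'a) ecat =
  eObj :: "'c set"
  eHom :: "'c \<Rightarrow> 'c \<Rightarrow> 'o"
  eIde :: "'c \<Rightarrow> 'a"
  eCmp :: "'c \<Rightarrow> 'c \<Rightarrow> 'c \<Rightarrow> 'a"

locale enriched_category =
  fixes V :: "('o, 'a, 'z) moncat_scheme" (structure)
    and C :: "('c, 'o, 'a) ecat"
  assumes eHom_Obj: "a \<in> eObj C \<Longrightarrow> b \<in> eObj C \<Longrightarrow> eHom C a b \<in> Obj V"
    and eIde_homset: "a \<in> eObj C \<Longrightarrow> eIde C a \<in> homset V (unt V) (eHom C a a)"
    and eCmp_homset: "a \<in> eObj C \<Longrightarrow> b \<in> eObj C \<Longrightarrow> c \<in> eObj C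
          \<Longrightarrow> eCmp C a b c \<in> homset V (eHom C b c \<boxtimes> eHom C a b) (eHom C a c)"
    and eCmp_assoc: "a \<in> eObj C \<Longrightarrow> b \<in> eObj C \<Longrightarrow> c \<in> eObj C \<Longrightarrow> d \<in> eObj C
          \<Longrightarrow> eCmp C a b d \<cdot> (eCmp C b c d \<boxdot> Ide V (eHom C a b))
            = eCmp C a c d \<cdot> ((Ide V (eHom C c d) \<boxdot> eCmp C a b c)
                \<cdot> asc V (eHom C c d) (eHom C b c) (eHom C a b))"
    and eCmp_eIde_left: "a \<in> eObj C \<Longrightarrow> b \<in> eObj C
          \<Longrightarrow> eCmp C a b b \<cdot> (eIde C b \<boxdot> Ide V (eHom C a b)) = lun V (eHom C a b)"
    and eCmp_eIde_right: "a \<in> eObj C \<Longrightarrow> b \<in> eObj C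
          \<Longrightarrow> eCmp C a a b \<cdot> (Ide V (eHom C a b) \<boxdot> eIde C a) = run V (eHom C a b)"

record ('c, 'd, 'a) efunc =
  EO :: "'c \<Rightarrow> 'd"
  EA :: "'c \<Rightarrow> 'c \<Rightarrow> 'a"

text \<open>Enriched functors and transformations are required to be \<open>undefined\<close> off the objects of their
  source, so that equality in HOL is the mathematical equality.\<close>

definition enriched_functor ::
  "('o, 'a, 'z) moncat_scheme \<Rightarrow> ('c, 'o, 'a) ecat \<Rightarrow> ('d, 'o, 'a) ecat
    \<Rightarrow> ('c, 'd, 'a) efunc \<Rightarrow> bool" where
  "enriched_functor V C D F \<longleftrightarrow>
     EO F \<in> eObj C \<rightarrow>\<^sub>E eObj D
   \<and> EA F \<in> extensional (eObj C) \<and> (\<forall>a \<in> eObj C. EA F a \<in> extensional (eObj C))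
   \<and> (\<forall>a \<in> eObj C. \<forall>b \<in> eObj C.
        EA F a b \<in> homset V (eHom C a b) (eHom D (EO F a) (EO F b)))
   \<and> (\<forall>a \<in> eObj C. EA F a a \<cdot>\<^bsub>V\<^esub> eIde C a = eIde D (EO F a))
   \<and> (\<forall>a \<in> eObj C. \<forall>b \<in> eObj C. \<forall>c \<in> eObj C.
        EA F a c \<cdot>\<^bsub>V\<^esub> eCmp C a b c
          = eCmp D (EO F a) (EO F b) (EO F c) \<cdot>\<^bsub>V\<^esub> (EA F b c \<boxdot>\<^bsub>V\<^esub> EA F a b))"

definition enriched_transformation ::
  "('o, 'a, 'z) moncat_scheme \<Rightarrow> ('c, 'o, 'a) ecat \<Rightarrow> ('d, 'o, 'a) ecat
    \<Rightarrow> ('c, 'd, 'a) efunc \<Rightarrow> ('c, 'd, 'a) efunc \<Rightarrow> ('c \<Rightarrow> 'a) \<Rightarrow> bool" where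
  "enriched_transformation V C D F G \<alpha> \<longleftrightarrow>
     \<alpha> \<in> extensional (eObj C)
   \<and> (\<forall>c \<in> eObj C. \<alpha> c \<in> homset V (unt V) (eHom D (EO F c) (EO G c)))
   \<and> (\<forall>a \<in> eObj C. \<forall>b \<in> eObj C.
        eCmp D (EO F a) (EO F b) (EO G b)
          \<cdot>\<^bsub>V\<^esub> ((\<alpha> b \<boxdot>\<^bsub>V\<^esub> EA F a b) \<cdot>\<^bsub>V\<^esub> inv_arrow V (lun V (eHom C a b)))
      = eCmp D (EO F a) (EO G a) (EO G b)
          \<cdot>\<^bsub>V\<^esub> ((EA G a b \<boxdot>\<^bsub>V\<^esub> \<alpha> a) \<cdot>\<^bsub>V\<^esub> inv_arrow V (run V (eHom C a b))))"

text \<open>The category of enriched functors \<open>C \<rightarrow> D\<close>; an arrow \<open>F \<rightarrow> G\<close> is a triple \<open>(F, \<alpha>, G)\<close>.\<close>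

definition enriched_functor_category ::
  "('o, 'a, 'z) moncat_scheme \<Rightarrow> ('c, 'o, 'a) ecat \<Rightarrow> ('d, 'o, 'a) ecat
    \<Rightarrow> (('c, 'd, 'a) efunc,
        ('c, 'd, 'a) efunc \<times> ('c \<Rightarrow> 'a) \<times> ('c, 'd, 'a) efunc) cat" where
  "enriched_functor_category V C D =
    \<lparr>Obj = {F. enriched_functor V C D F},
     Arr = {(F, \<alpha>, G). enriched_functor V C D F \<and> enriched_functor V C D G
                       \<and> enriched_transformation V C D F G \<alpha>},
     Dom = (\<lambda>(F, \<alpha>, G). F),
     Cod = (\<lambda>(F, \<alpha>, G). G),
     Ide = (\<lambda>F. (F, \<lambda>c \<in> eObj C. eIde D (EO F c), F)),
     Cmp = (\<lambda>(G', \<beta>, H) (F, \<alpha>, G).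
       (F, \<lambda>c \<in> eObj C. eCmp D (EO F c) (EO G c) (EO H c)
              \<cdot>\<^bsub>V\<^esub> ((\<beta> c \<boxdot>\<^bsub>V\<^esub> \<alpha> c) \<cdot>\<^bsub>V\<^esub> inv_arrow V (lun V (unt V))), H))\<rparr>"

definition self_enriched :: "('o, 'a, 'z) moncat_scheme \<Rightarrow> ('o, 'o, 'a) ecat" where
  "self_enriched V =
    \<lparr>eObj = Obj V,
     eHom = iho V,
     eIde = (\<lambda>x. curry_arrow V (unt V) x x (lun V x)),
     eCmp = (\<lambda>x y z. curry_arrow V (iho V y z \<boxtimes>\<^bsub>V\<^esub> iho V x y) x z
       (evl V y z \<cdot>\<^bsub>V\<^esub> ((Ide V (iho V y z) \<boxdot>\<^bsub>V\<^esub> evl V x y)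
                      \<cdot>\<^bsub>V\<^esub> asc V (iho V y z) (iho V x y) x)))\<rparr>"

definition Mod_cat ::
  "('o, 'a, 'z) moncat_scheme \<Rightarrow> ('c, 'o, 'a) ecat
    \<Rightarrow> (('c, 'o, 'a) efunc,
        ('c, 'o, 'a) efunc \<times> ('c \<Rightarrow> 'a) \<times> ('c, 'o, 'a) efunc) cat" where
  "Mod_cat V C = enriched_functor_category V C (self_enriched V)"

definition flat_ecat :: "('o, 'a, 'z) moncat_scheme \<Rightarrow> ('c, 'o, 'a) ecat \<Rightarrow> bool" where
  "flat_ecat V C \<longleftrightarrow> (\<forall>a \<in> eObj C. \<forall>b \<in> eObj C.
     exact_functor V V \<lparr>FO = (\<lambda>x. eHom C a b \<boxtimes>\<^bsub>V\<^esub> x),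
                        FA = (\<lambda>f. Ide V (eHom C a b) \<boxdot>\<^bsub>V\<^esub> f)\<rparr>)"


section \<open>Augmented categories and their homology\<close>

definition pt :: "('o, 'a, 'z) moncat_scheme \<Rightarrow> (unit, 'o, 'a) ecat" where
  "pt V = \<lparr>eObj = UNIV, eHom = (\<lambda>_ _. unt V), eIde = (\<lambda>_. Ide V (unt V)),
           eCmp = (\<lambda>_ _ _. lun V (unt V))\<rparr>"

definition augmented_category ::
  "('o, 'a, 'z) moncat_scheme \<Rightarrow> ('c, 'o, 'a) ecat \<Rightarrow> ('c, unit, 'a) efunc \<Rightarrow> bool" where
  "augmented_category V C \<epsilon> \<longleftrightarrow>
     enriched_category V C \<and> eObj C \<noteq> {} \<and> enriched_functor V C (pt V) \<epsilon>"

text \<open>The identification of \<open>V\<close> with \<open>Mod(pt)\<close>: an object \<open>x\<close> corresponds to the functor with value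
  \<open>x\<close> acting by \<open>1 \<rightarrow> [x, x]\<close>, an arrow \<open>f : x \<rightarrow> y\<close> to its name \<open>1 \<rightarrow> [x, y]\<close>.\<close>

definition pt_module :: "('o, 'a, 'z) moncat_scheme \<Rightarrow> 'o \<Rightarrow> (unit, 'o, 'a) efunc" where
  "pt_module V x = \<lparr>EO = (\<lambda>_. x), EA = (\<lambda>_ _. eIde (self_enriched V) x)\<rparr>"

definition to_Mod_pt ::
  "('o, 'a, 'z) moncat_scheme
    \<Rightarrow> ('o, 'a, (unit, 'o, 'a) efunc,
        (unit, 'o, 'a) efunc \<times> (unit \<Rightarrow> 'a) \<times> (unit, 'o, 'a) efunc) func" where
  "to_Mod_pt V =
    \<lparr>FO = pt_module V,
     FA = (\<lambda>f. (pt_module V (Dom V f),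
                \<lambda>_. curry_arrow V (unt V) (Dom V f) (Cod V f) (f \<cdot>\<^bsub>V\<^esub> lun V (Dom V f)),
                pt_module V (Cod V f)))\<rparr>"

definition restrict_efunc ::
  "('o, 'a, 'z) moncat_scheme \<Rightarrow> ('c, 'o, 'a) ecat \<Rightarrow> ('c, 'd, 'a) efunc
    \<Rightarrow> ('d, 'e, 'a) efunc \<Rightarrow> ('c, 'e, 'a) efunc" where
  "restrict_efunc V C \<phi> F =
    \<lparr>EO = (\<lambda>c \<in> eObj C. EO F (EO \<phi> c)),
     EA = (\<lambda>a \<in> eObj C. \<lambda>b \<in> eObj C. EA F (EO \<phi> a) (EO \<phi> b) \<cdot>\<^bsub>V\<^esub> EA \<phi> a b)\<rparr>"

definition restriction ::
  "('o, 'a, 'z) moncat_scheme \<Rightarrow> ('c, 'o, 'a) ecat \<Rightarrow> ('c, 'd, 'a) efunc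
    \<Rightarrow> (('d, 'o, 'a) efunc, ('d, 'o, 'a) efunc \<times> ('d \<Rightarrow> 'a) \<times> ('d, 'o, 'a) efunc,
        ('c, 'o, 'a) efunc, ('c, 'o, 'a) efunc \<times> ('c \<Rightarrow> 'a) \<times> ('c, 'o, 'a) efunc) func" where
  "restriction V C \<phi> =
    \<lparr>FO = restrict_efunc V C \<phi>,
     FA = (\<lambda>(F, \<alpha>, G). (restrict_efunc V C \<phi> F, \<lambda>c \<in> eObj C. \<alpha> (EO \<phi> c),
                        restrict_efunc V C \<phi> G))\<rparr>"

definition Triv ::
  "('o, 'a, 'z) moncat_scheme \<Rightarrow> ('c, 'o, 'a) ecat \<Rightarrow> ('c, unit, 'a) efunc
    \<Rightarrow> ('o, 'a, ('c, 'o, 'a) efunc,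
        ('c, 'o, 'a) efunc \<times> ('c \<Rightarrow> 'a) \<times> ('c, 'o, 'a) efunc) func" where
  "Triv V C \<epsilon> = comp_func (restriction V C \<epsilon>) (to_Mod_pt V)"

definition Coinv ::
  "('o, 'a, 'z) moncat_scheme \<Rightarrow> ('c, 'o, 'a) ecat \<Rightarrow> ('c, unit, 'a) efunc
    \<Rightarrow> (('c, 'o, 'a) efunc, ('c, 'o, 'a) efunc \<times> ('c \<Rightarrow> 'a) \<times> ('c, 'o, 'a) efunc,
        'o, 'a) func" where
  "Coinv V C \<epsilon> = (SOME F. left_adjoint (Mod_cat V C) V F (Triv V C \<epsilon>))"

definition enriched_homology ::
  "('o, 'a, 'z) moncat_scheme \<Rightarrow> ('c, 'o, 'a) ecat \<Rightarrow> ('c, unit, 'a) efunc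
    \<Rightarrow> nat \<Rightarrow> ('c, 'o, 'a) efunc \<Rightarrow> 'o" where
  "enriched_homology V C \<epsilon> n M = left_derived (Mod_cat V C) V (Coinv V C \<epsilon>) n M"


section \<open>The simplicial object \<open>S\<^sub>\<bullet>(C, M)\<close>\<close>

text \<open>\<open>M(c) \<otimes> C(c,c') \<rightarrow> M(c')\<close>.\<close>

definition mod_action ::
  "('o, 'a, 'z) moncat_scheme \<Rightarrow> ('c, 'o, 'a) ecat \<Rightarrow> ('c, 'o, 'a) efunc
    \<Rightarrow> 'c \<Rightarrow> 'c \<Rightarrow> 'a" where
  "mod_action V C M c c' =
     evl V (EO M c) (EO M c') \<cdot>\<^bsub>V\<^esub> ((EA M c c' \<boxdot>\<^bsub>V\<^esub> Ide V (EO M c))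
       \<cdot>\<^bsub>V\<^esub> swp V (EO M c) (eHom C c c'))"

text \<open>A tuple \<open>(c\<^sub>0,\<dots>,c\<^sub>n)\<close> is a list of length \<open>n + 1\<close>.  The summand at that tuple is bracketed to the
  left, \<open>(\<dots>((Mc\<^sub>0 \<otimes> C(c\<^sub>0,c\<^sub>1)) \<otimes> C(c\<^sub>1,c\<^sub>2))\<dots>) \<otimes> C(c\<^sub>n\<^sub>-\<^sub>1,c\<^sub>n)\<close>.\<close>

fun bar_summand ::
  "('o, 'a, 'z) moncat_scheme \<Rightarrow> ('c, 'o, 'a) ecat \<Rightarrow> ('c, 'o, 'a) efunc
    \<Rightarrow> 'c list \<Rightarrow> nat \<Rightarrow> 'o" where
  "bar_summand V C M cs 0 = EO M (cs ! 0)"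
| "bar_summand V C M cs (Suc n) =
     bar_summand V C M cs n \<boxtimes>\<^bsub>V\<^esub> eHom C (cs ! n) (cs ! Suc n)"

text \<open>\<open>bar_face V C \<epsilon> M cs n i\<close> is the restriction of \<open>d\<^sub>i\<close> to the summand at
  \<open>cs = (c\<^sub>0,\<dots>,c\<^sub>n\<^sub>+\<^sub>1)\<close>, with values in the summand at the tuple with \<open>c\<^sub>i\<close> removed.\<close>

fun bar_face ::
  "('o, 'a, 'z) moncat_scheme \<Rightarrow> ('c, 'o, 'a) ecat \<Rightarrow> ('c, unit, 'a) efunc
    \<Rightarrow> ('c, 'o, 'a) efunc \<Rightarrow> 'c list \<Rightarrow> nat \<Rightarrow> nat \<Rightarrow> 'a" where
  "bar_face V C \<epsilon> M cs 0 i =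
     (if i = 0 then mod_action V C M (cs ! 0) (cs ! 1)
      else run V (EO M (cs ! 0))
             \<cdot>\<^bsub>V\<^esub> (Ide V (EO M (cs ! 0)) \<boxdot>\<^bsub>V\<^esub> EA \<epsilon> (cs ! 0) (cs ! 1)))"
| "bar_face V C \<epsilon> M cs (Suc n) i =
     (let a = cs ! n; b = cs ! Suc n; c = cs ! Suc (Suc n) in
      if i \<le> n then bar_face V C \<epsilon> M cs n i \<boxdot>\<^bsub>V\<^esub> Ide V (eHom C b c)
      else if i = Suc n then
        (Ide V (bar_summand V C M cs n)
           \<boxdot>\<^bsub>V\<^esub> (eCmp C a b c \<cdot>\<^bsub>V\<^esub> swp V (eHom C a b) (eHom C b c)))
         \<cdot>\<^bsub>V\<^esub> asc V (bar_summand V C M cs n) (eHom C a b) (eHom C b c)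
      else run V (bar_summand V C M cs (Suc n))
             \<cdot>\<^bsub>V\<^esub> (Ide V (bar_summand V C M cs (Suc n)) \<boxdot>\<^bsub>V\<^esub> EA \<epsilon> b c))"

text \<open>\<open>bar_degen V C M cs n i\<close> is the restriction of \<open>s\<^sub>i\<close> to the summand at \<open>cs = (c\<^sub>0,\<dots>,c\<^sub>n)\<close>, with
  values in the summand at the tuple with \<open>c\<^sub>i\<close> repeated.\<close>

fun bar_degen ::
  "('o, 'a, 'z) moncat_scheme \<Rightarrow> ('c, 'o, 'a) ecat \<Rightarrow> ('c, 'o, 'a) efunc
    \<Rightarrow> 'c list \<Rightarrow> nat \<Rightarrow> nat \<Rightarrow> 'a" where
  "bar_degen V C M cs 0 i =
     (Ide V (EO M (cs ! 0)) \<boxdot>\<^bsub>V\<^esub> eIde C (cs ! 0)) \<cdot>\<^bsub>V\<^esub> inv_arrow V (run V (EO M (cs ! 0)))"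
| "bar_degen V C M cs (Suc n) i =
     (if i \<le> n then bar_degen V C M cs n i \<boxdot>\<^bsub>V\<^esub> Ide V (eHom C (cs ! n) (cs ! Suc n))
      else (Ide V (bar_summand V C M cs (Suc n)) \<boxdot>\<^bsub>V\<^esub> eIde C (cs ! Suc n))
             \<cdot>\<^bsub>V\<^esub> inv_arrow V (run V (bar_summand V C M cs (Suc n))))"

definition bar_index :: "('c, 'o, 'a) ecat \<Rightarrow> nat \<Rightarrow> 'c list set" where
  "bar_index C n = {cs. length cs = Suc n \<and> set cs \<subseteq> eObj C}"

definition bar_coprod ::
  "('o, 'a, 'z) moncat_scheme \<Rightarrow> ('c, 'o, 'a) ecat \<Rightarrow> ('c, 'o, 'a) efunc
    \<Rightarrow> nat \<Rightarrow> 'o \<times> ('c list \<Rightarrow> 'a)" where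
  "bar_coprod V C M n = coprod V (bar_index C n) (\<lambda>cs. bar_summand V C M cs n)"

definition bar_simplicial ::
  "('o, 'a, 'z) moncat_scheme \<Rightarrow> ('c, 'o, 'a) ecat \<Rightarrow> ('c, unit, 'a) efunc
    \<Rightarrow> ('c, 'o, 'a) efunc \<Rightarrow> ('o, 'a) simplicial" where
  "bar_simplicial V C \<epsilon> M =
    \<lparr>simp_ob = (\<lambda>n. fst (bar_coprod V C M n)),
     face = (\<lambda>n i. coprod_desc V (bar_index C (Suc n)) (\<lambda>cs. bar_summand V C M cs (Suc n))
       (fst (bar_coprod V C M n))
       (\<lambda>cs. snd (bar_coprod V C M n) (take i cs @ drop (Suc i) cs)
              \<cdot>\<^bsub>V\<^esub> bar_face V C \<epsilon> M cs n i)),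
     degen = (\<lambda>n i. coprod_desc V (bar_index C n) (\<lambda>cs. bar_summand V C M cs n)
       (fst (bar_coprod V C M (Suc n)))
       (\<lambda>cs. snd (bar_coprod V C M (Suc n)) (take (Suc i) cs @ drop i cs)
              \<cdot>\<^bsub>V\<^esub> bar_degen V C M cs n i))\<rparr>"

end

theory Submission
  imports Defs
begin

text \<open>In a category with enough projectives, exactness and isomorphisms can be tested on
  \<open>p\<close>-valued points for projective \<open>p\<close>. Take a projective resolution
  \<open>P\<^sub>\<bullet> \<rightarrow> M\<close> and consider the double complex \<open>S\<^sub>i(C, P\<^sub>j)\<close>.
  Flatness and (AB4) make each \<open>S\<^sub>i(C, -)\<close> exact, so its columns resolve
  \<open>S\<^sub>i(C, M)\<close>. The cokernel of \<open>d\<^sub>0 - d\<^sub>1\<close> is \<open>Coinv\<close>,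
  and for projective \<open>P\<close>, a retract of the free module on its underlying family of objects,
  the complex \<open>S\<^sub>\<bullet>(C, P)\<close> has an extra degeneracy; hence the rows resolve
  \<open>Coinv(P\<^sub>j)\<close>. A zigzag argument in the double complex identifies the two homologies.
  Modules are handled as families of objects with right actions
  \<open>Mc \<otimes> C(c,c') \<rightarrow> Mc'\<close>.\<close>

section \<open>Chasing in abelian categories with enough projectives\<close>

text \<open>The chosen \<open>Coinv\<close> is an arbitrary left adjoint. The cokernel of
  \<open>bd M 0\<close> therefore serves twice: it shows that a left adjoint exists, and,
  conversely, any left adjoint turns out to be such a cokernel, naturally in the module. The
  simplicial identities are not verified one by one. Let TM be the free module on the family
  underlying M. Absorbing the first hom into the coefficient identifies S_{n+1}(M) with S_n(TM)
  through an isomorphism \<theta>, and yields bd_{n+1} \<theta> = S_{n+1}(counit) - \<theta>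
  bd_n(TM). This one formula gives bd bd = 0, by induction over the degree for all modules at once
  with only d_1 d_1 = d_1 d_2 computed, and also the contracting homotopy on a projective module,
  where the counit has a section. Smallness is indexed by elements of \<open>'u\<close>, the bar
  summands by lists over \<open>'u\<close>. Infinitude of \<open>'u\<close> encodes lists of a fixed
  length as elements, so that cocompleteness and (AB4) reach these coproducts. Homology objects are
  compared by an additive relation between points valued in projectives, which takes the place of
  total complexes and connecting maps.\<close>

context category
begin

abbreviation "Hom \<equiv> homset C"

text \<open>Typing is phrased with \<open>Arr\<close>, \<open>Dom\<close> and \<open>Cod\<close>
  because the simplifier can compute these; membership in a \<open>homset\<close> leaves the middle
  object of a composite undetermined.\<close>

lemma Arr_Cmp [simp]: "f \<in> Arr C \<Longrightarrow> g \<in> Arr C \<Longrightarrow> Cod C f = Dom C g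
  \<Longrightarrow> g \<cdot> f \<in> Arr C"
  and Dom_Cmp [simp]: "f \<in> Arr C \<Longrightarrow> g \<in> Arr C \<Longrightarrow> Cod C f = Dom C g
    \<Longrightarrow> Dom C (g \<cdot> f) = Dom C f"
  and Cod_Cmp [simp]: "f \<in> Arr C \<Longrightarrow> g \<in> Arr C \<Longrightarrow> Cod C f = Dom C g
    \<Longrightarrow> Cod C (g \<cdot> f) = Cod C g"
  using Cmp_homset[of f "Dom C f" "Cod C f" g "Cod C g"] by (auto simp: homset_def)

lemma Cmp_assoc' [simp]:
  "f \<in> Arr C \<Longrightarrow> g \<in> Arr C \<Longrightarrow> h \<in> Arr C \<Longrightarrow> Cod C f =
    Dom C g \<Longrightarrow> Cod C g = Dom C h
    \<Longrightarrow> (h \<cdot> g) \<cdot> f = h \<cdot> (g \<cdot> f)"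
  using Cmp_assoc[of f "Dom C f" "Cod C f" g "Cod C g" h "Cod C h"] by (auto simp: homset_def)

lemma Ide_arrow [simp]:
  assumes "x \<in> Obj C" shows "Ide C x \<in> Arr C" "Dom C (Ide C x) = x" "Cod C (Ide C x) = x"
  using Ide_homset[OF assms] by (auto simp: homset_def)

lemma Cmp_Ide [simp]:
  "f \<in> Arr C \<Longrightarrow> x = Dom C f \<Longrightarrow> f \<cdot> Ide C x = f"
    "f \<in> Arr C \<Longrightarrow> x = Cod C f \<Longrightarrow> Ide C x \<cdot> f = f"
  using Cmp_Ide_right Cmp_Ide_left by (auto simp: homset_def)

lemma Ide_Hom [simp]: "x \<in> Obj C \<Longrightarrow> Ide C x \<in> Hom x x"
  by (simp add: homset_def)

declare Dom_Obj [simp] Cod_Obj [simp]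

lemma Hom_ArrD: "f \<in> Hom x y \<Longrightarrow> f \<in> Arr C"
  "f \<in> Hom x y \<Longrightarrow> Dom C f = x" "f \<in> Hom x y \<Longrightarrow> Cod C f = y"
  by (auto simp: homset_def)

lemma Hom_Obj: "f \<in> Hom x y \<Longrightarrow> x \<in> Obj C" "f \<in> Hom x y \<Longrightarrow> y \<in> Obj C"
  using Dom_Obj Cod_Obj by (auto simp: homset_def)

lemma inverse_arrows_unique: "inverse_arrows C f g \<Longrightarrow> inverse_arrows C f g' \<Longrightarrow> g = g'"
  unfolding inverse_arrows_def homset_def
  by (smt (verit) Cmp_Ide(1) Cmp_Ide(2) Cmp_assoc' mem_Collect_eq)

lemma inv_arrow_inverse: "iso_arrow C f \<Longrightarrow> inverse_arrows C f (inv_arrow C f)"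
  unfolding iso_arrow_def inv_arrow_def
  by (rule theI') (auto intro: inverse_arrows_unique)

lemma inv_arrow [simp]:
  assumes "iso_arrow C f"
  shows "inv_arrow C f \<in> Arr C" "Dom C (inv_arrow C f) = Cod C f" "Cod C (inv_arrow C f) = Dom C f"
    "inv_arrow C f \<cdot> f = Ide C (Dom C f)" "f \<cdot> inv_arrow C f = Ide C (Cod C f)" "f \<in> Arr C"
  using inv_arrow_inverse[OF assms] by (auto simp: inverse_arrows_def homset_def)

text \<open>Since \<open>Cmp_assoc'\<close> brackets composites to the right, an inverse pair at the
  front of a longer composite is visible only together with its tail \<open>h\<close>; hence both
  cancellation rules carry that tail.\<close>

lemma inv_arrow_Cmp [simp]:
  assumes "iso_arrow C f" "h \<in> Arr C"
  shows "Cod C h = Dom C f \<Longrightarrow> inv_arrow C f \<cdot> (f \<cdot> h) = h"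
    and "Cod C h = Cod C f \<Longrightarrow> f \<cdot> (inv_arrow C f \<cdot> h) = h"
proof -
  show "inv_arrow C f \<cdot> (f \<cdot> h) = h" if h: "Cod C h = Dom C f"
  proof -
    have "inv_arrow C f \<cdot> (f \<cdot> h) = (inv_arrow C f \<cdot> f) \<cdot> h"
      by (rule Cmp_assoc'[symmetric]) (use assms h in simp_all)
    then show ?thesis using assms h by (simp del: Cmp_assoc')
  qed
  show "f \<cdot> (inv_arrow C f \<cdot> h) = h" if h: "Cod C h = Cod C f"
  proof -
    have "f \<cdot> (inv_arrow C f \<cdot> h) = (f \<cdot> inv_arrow C f) \<cdot> h"
      by (rule Cmp_assoc'[symmetric]) (use assms h in simp_all)
    then show ?thesis using assms h by (simp del: Cmp_assoc')
  qed
qed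

lemma iso_arrowI:
  assumes "f \<in> Hom x y" "g \<in> Hom y x" "g \<cdot> f = Ide C x" "f \<cdot> g = Ide C y"
  shows "iso_arrow C f"
  using assms unfolding iso_arrow_def inverse_arrows_def by (auto simp: homset_def)

lemma iso_mono_eq:
  assumes "iso_arrow C m" "f \<in> Arr C" "g \<in> Arr C" "Cod C f = Dom C m" "Cod C g = Dom C m"
    "m \<cdot> f = m \<cdot> g"
  shows "f = g"
  using assms by (metis inv_arrow_Cmp(1))

lemma iso_epi_eq:
  assumes "iso_arrow C e" "f \<in> Arr C" "g \<in> Arr C" "Dom C f = Cod C e" "Dom C g = Cod C e"
    "f \<cdot> e = g \<cdot> e"
  shows "f = g"
  using assms
  by (metis Cmp_Ide(1) Cmp_assoc' inv_arrow(1,2,3,5,6))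

lemma mono_arrowD:
  "mono_arrow C m \<Longrightarrow> f \<in> Arr C \<Longrightarrow> g \<in> Arr C \<Longrightarrow> Dom C f =
    Dom C g \<Longrightarrow> Cod C f = Dom C m
    \<Longrightarrow> Cod C g = Dom C m \<Longrightarrow> m \<cdot> f = m \<cdot> g \<Longrightarrow> f = g"
  unfolding mono_arrow_def homset_def by auto

lemma epi_arrowD:
  "epi_arrow C e \<Longrightarrow> f \<in> Arr C \<Longrightarrow> g \<in> Arr C \<Longrightarrow> Cod C f =
    Cod C g \<Longrightarrow> Dom C f = Cod C e
    \<Longrightarrow> Dom C g = Cod C e \<Longrightarrow> f \<cdot> e = g \<cdot> e \<Longrightarrow> f = g"
  unfolding epi_arrow_def homset_def by auto

lemma split_epi:
  assumes "e \<in> Hom x y" "s \<in> Hom y x" "e \<cdot> s = Ide C y"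
  shows "epi_arrow C e"
  unfolding epi_arrow_def
proof (safe)
  show "e \<in> Arr C" using assms by (simp add: homset_def)
  fix z f g assume "f \<in> Hom (Cod C e) z" "g \<in> Hom (Cod C e) z"
  then have eq': "(f \<cdot> e) \<cdot> s = f" "(g \<cdot> e) \<cdot> s = g" using assms by (simp_all add: homset_def)
  assume eq: "f \<cdot> e = g \<cdot> e"
  show "f = g" using eq' unfolding eq by simp
qed

end

section \<open>Zero arrows, kernels and cokernels\<close>

locale category_with_zero = category C for C :: "('o, 'a, 'z) cat_scheme" (structure) +
  assumes has_zero_object: "\<exists>z. zero_object C z"
begin

abbreviation zero ("\<zero>\<^bsub>_,_\<^esub>") where "zero x y \<equiv> zero_arrow C x y"

text \<open>Two zero objects are linked by a unique arrow \<open>t\<close>, and both halves of a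
  factorisation through one of them differ from those of the other by \<open>t\<close>; so the
  composite does not depend on the zero object.\<close>

lemma zero_arrow_ex1:
  assumes "x \<in> Obj C" "y \<in> Obj C"
  shows "\<exists>!f. f \<in> Hom x y \<and> is_zero_arrow C f"
proof -
  obtain z where z: "zero_object C z" using has_zero_object by blast
  then obtain g h where gh: "g \<in> Hom x z" "h \<in> Hom z y" using assms unfolding zero_object_def by metis
  show ?thesis
  proof (rule ex1I)
    show "h \<cdot> g \<in> Hom x y \<and> is_zero_arrow C (h \<cdot> g)"
      using gh z unfolding is_zero_arrow_def by (auto simp: homset_def)
    fix f assume f: "f \<in> Hom x y \<and> is_zero_arrow C f"
    then obtain z' g' h' where z': "zero_object C z'" "g' \<in> Hom x z'" "h' \<in> Hom z' y" "f = h' \<cdot> g'"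
      unfolding is_zero_arrow_def by (auto simp: homset_def)
    obtain t where t: "t \<in> Hom z z'" using z z' unfolding zero_object_def by metis
    have "g' = t \<cdot> g" using z' t gh assms Cmp_homset[OF gh(1) t] unfolding zero_object_def by metis
    moreover have "h = h' \<cdot> t" using z z' t gh assms Cmp_homset[OF t z'(3)] unfolding zero_object_def by metis
    ultimately show "f = h \<cdot> g" using z' t gh by (simp add: homset_def)
  qed
qed

lemma zero_Hom [simp]: "x \<in> Obj C \<Longrightarrow> y \<in> Obj C \<Longrightarrow>
  \<zero>\<^bsub>x,y\<^esub> \<in> Hom x y"
  and zero_is_zero: "x \<in> Obj C \<Longrightarrow> y \<in> Obj C \<Longrightarrow> is_zero_arrow C
    \<zero>\<^bsub>x,y\<^esub>"
  using theI'[OF zero_arrow_ex1[of x y]] unfolding zero_arrow_def by auto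

lemma zero_arrow [simp]:
  assumes "x \<in> Obj C" "y \<in> Obj C"
  shows "\<zero>\<^bsub>x,y\<^esub> \<in> Arr C" "Dom C \<zero>\<^bsub>x,y\<^esub> = x"
    "Cod C \<zero>\<^bsub>x,y\<^esub> = y"
  using zero_Hom[OF assms] by (auto simp: homset_def)

lemma is_zero_arrow_iff: "is_zero_arrow C f \<longleftrightarrow> f \<in> Arr C \<and> f = \<zero>\<^bsub>Dom
  C f, Cod C f\<^esub>"
proof
  assume f: "is_zero_arrow C f"
  then have "f \<in> Arr C" by (simp add: is_zero_arrow_def)
  then show "f \<in> Arr C \<and> f = \<zero>\<^bsub>Dom C f, Cod C f\<^esub>"
    using f zero_arrow_ex1[of "Dom C f" "Cod C f"] zero_is_zero[of "Dom C f" "Cod C f"] zero_Hom[of "Dom C f" "Cod C f"]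
    by (auto simp: homset_def)
next
  assume "f \<in> Arr C \<and> f = \<zero>\<^bsub>Dom C f, Cod C f\<^esub>"
  then show "is_zero_arrow C f" by (metis zero_is_zero Cod_Obj Dom_Obj)
qed

lemma is_zero_arrow_Hom_iff: "f \<in> Hom x y \<Longrightarrow> is_zero_arrow C f \<longleftrightarrow> f =
  \<zero>\<^bsub>x,y\<^esub>"
  by (auto simp: is_zero_arrow_iff homset_def)

lemma Cmp_zero [simp]:
  assumes "f \<in> Arr C" "y \<in> Obj C"
  shows "x = Cod C f \<Longrightarrow> \<zero>\<^bsub>x,y\<^esub> \<cdot> f = \<zero>\<^bsub>Dom C
    f,y\<^esub>" "x = Dom C f \<Longrightarrow> f \<cdot> \<zero>\<^bsub>y,x\<^esub> = \<zero>\<^bsub>y,Cod C f\<^esub>"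
proof -
  show "\<zero>\<^bsub>x,y\<^esub> \<cdot> f = \<zero>\<^bsub>Dom C f,y\<^esub>" if x: "x = Cod C f"
  proof -
    have "is_zero_arrow C \<zero>\<^bsub>x,y\<^esub>" using zero_is_zero assms x by simp
    then obtain z g h where z: "zero_object C z" "g \<in> Hom x z" "h \<in> Hom z y"
      "\<zero>\<^bsub>x,y\<^esub> = h \<cdot> g"
      using assms x unfolding is_zero_arrow_def by auto
    have "\<zero>\<^bsub>x,y\<^esub> \<cdot> f = h \<cdot> (g \<cdot> f)" using z assms x by (simp add: homset_def)
    then have "is_zero_arrow C (\<zero>\<^bsub>x,y\<^esub> \<cdot> f)" unfolding is_zero_arrow_def using z assms x
      by (intro conjI exI[of _ z] exI[of _ "g \<cdot> f"] exI[of _ h]) (auto simp: homset_def)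
    then show ?thesis using assms x by (auto simp: is_zero_arrow_iff)
  qed
  show "f \<cdot> \<zero>\<^bsub>y,x\<^esub> = \<zero>\<^bsub>y,Cod C f\<^esub>" if x: "x = Dom C f"
  proof -
    have "is_zero_arrow C \<zero>\<^bsub>y,x\<^esub>" using zero_is_zero assms x by simp
    then obtain z g h where z: "zero_object C z" "g \<in> Hom y z" "h \<in> Hom z x"
      "\<zero>\<^bsub>y,x\<^esub> = h \<cdot> g"
      using assms x unfolding is_zero_arrow_def by auto
    have "f \<cdot> \<zero>\<^bsub>y,x\<^esub> = (f \<cdot> h) \<cdot> g" using z assms x by (simp add: homset_def)
    then have "is_zero_arrow C (f \<cdot> \<zero>\<^bsub>y,x\<^esub>)" unfolding is_zero_arrow_def using z assms x
      by (intro conjI exI[of _ z] exI[of _ g] exI[of _ "f \<cdot> h"]) (auto simp: homset_def)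
    then show ?thesis using assms x by (auto simp: is_zero_arrow_iff)
  qed
qed

text \<open>The definition speaks of \<open>is_zero_arrow\<close> and of endpoints read off the
  arrows. With fixed endpoints the condition becomes an equation with a named zero arrow, the form
  in which chases can rewrite.\<close>

lemma is_kernel_iff:
  assumes "k \<in> Hom w x" "f \<in> Hom x y"
  shows "is_kernel C k f \<longleftrightarrow> f \<cdot> k = \<zero>\<^bsub>w,y\<^esub> \<and>
    (\<forall>v h. h \<in> Hom v x \<and> f \<cdot> h = \<zero>\<^bsub>v,y\<^esub> \<longrightarrow>
      (\<exists>!u. u \<in> Hom v w \<and> k \<cdot> u = h))"
proof -
  have z: "is_zero_arrow C (f \<cdot> h) \<longleftrightarrow> f \<cdot> h = \<zero>\<^bsub>v,y\<^esub>" if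
    "h \<in> Hom v x" for v h
    using is_zero_arrow_Hom_iff[OF Cmp_homset[OF that assms(2)]] .
  have "is_kernel C k f \<longleftrightarrow> is_zero_arrow C (f \<cdot> k) \<and>
    (\<forall>v h. h \<in> Hom v x \<and> is_zero_arrow C (f \<cdot> h) \<longrightarrow> (\<exists>!u. u
      \<in> Hom v w \<and> k \<cdot> u = h))"
    unfolding is_kernel_def using Hom_ArrD[OF assms(1)] Hom_ArrD[OF assms(2)]
    by (simp add: homset_def) blast
  then show ?thesis using z assms(1) by metis
qed

lemma is_cokernel_iff:
  assumes "q \<in> Hom y z" "f \<in> Hom x y"
  shows "is_cokernel C q f \<longleftrightarrow> q \<cdot> f = \<zero>\<^bsub>x,z\<^esub> \<and>
    (\<forall>v h. h \<in> Hom y v \<and> h \<cdot> f = \<zero>\<^bsub>x,v\<^esub> \<longrightarrow>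
      (\<exists>!u. u \<in> Hom z v \<and> u \<cdot> q = h))"
proof -
  have z: "is_zero_arrow C (h \<cdot> f) \<longleftrightarrow> h \<cdot> f = \<zero>\<^bsub>x,v\<^esub>" if
    "h \<in> Hom y v" for v h
    using is_zero_arrow_Hom_iff[OF Cmp_homset[OF assms(2) that]] .
  have "is_cokernel C q f \<longleftrightarrow> is_zero_arrow C (q \<cdot> f) \<and>
    (\<forall>v h. h \<in> Hom y v \<and> is_zero_arrow C (h \<cdot> f) \<longrightarrow> (\<exists>!u. u
      \<in> Hom z v \<and> u \<cdot> q = h))"
    unfolding is_cokernel_def using Hom_ArrD[OF assms(1)] Hom_ArrD[OF assms(2)]
    by (simp add: homset_def) blast
  then show ?thesis using z assms(1) by metis
qed

lemma is_kernel_Hom: "is_kernel C k f \<Longrightarrow> f \<in> Hom x y \<Longrightarrow> k \<in> Hom (Dom C k) x"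
  by (auto simp: is_kernel_def homset_def)

lemma is_cokernel_Hom: "is_cokernel C q f \<Longrightarrow> f \<in> Hom x y \<Longrightarrow> q \<in> Hom y (Cod C q)"
  by (auto simp: is_cokernel_def homset_def)

text \<open>The composite \<open>k \<cdot> a\<close> is annihilated by \<open>f\<close>, so it
  factors uniquely through \<open>k\<close>; both \<open>a\<close> and \<open>b\<close> are such
  factorisations.\<close>

lemma kernel_mono: assumes "is_kernel C k f" shows "mono_arrow C k"
  unfolding mono_arrow_def
proof safe
  show k: "k \<in> Arr C" using assms by (simp add: is_kernel_def)
  fix x a b assume ab: "a \<in> Hom x (Dom C k)" "b \<in> Hom x (Dom C k)" "k \<cdot> a = k \<cdot> b"
  have f: "f \<in> Hom (Cod C k) (Cod C f)" "k \<in> Hom (Dom C k) (Cod C k)" using assms by (auto simp: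
    is_kernel_def homset_def)
  have z: "f \<cdot> k = \<zero>\<^bsub>Dom C k,Cod C f\<^esub>" using assms is_kernel_iff[OF f(2,1)] by blast
  have "f \<cdot> (k \<cdot> a) = (f \<cdot> k) \<cdot> a" using f ab by (simp add: homset_def)
  also have "\<dots> = \<zero>\<^bsub>x, Cod C f\<^esub>" using f ab unfolding z by (auto simp: homset_def)
  finally have "f \<cdot> (k \<cdot> a) = \<zero>\<^bsub>x, Cod C f\<^esub>" .
  moreover have "k \<cdot> a \<in> Hom x (Cod C k)" using ab k by (auto simp: homset_def)
  ultimately have "\<exists>!u. u \<in> Hom x (Dom C k) \<and> k \<cdot> u = k \<cdot> a" using assms
    is_kernel_iff[OF f(2,1)] by blast
  then show "a = b" using ab by metis
qed

lemma cokernel_epi: assumes "is_cokernel C k f" shows "epi_arrow C k"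
  unfolding epi_arrow_def
proof safe
  show k: "k \<in> Arr C" using assms by (simp add: is_cokernel_def)
  fix x a b assume ab: "a \<in> Hom (Cod C k) x" "b \<in> Hom (Cod C k) x" "a \<cdot> k = b \<cdot> k"
  have f: "f \<in> Hom (Dom C f) (Dom C k)" "k \<in> Hom (Dom C k) (Cod C k)" using assms by (auto simp:
    is_cokernel_def homset_def)
  have z: "k \<cdot> f = \<zero>\<^bsub>Dom C f,Cod C k\<^esub>" using assms is_cokernel_iff[OF f(2,1)] by blast
  have "(a \<cdot> k) \<cdot> f = \<zero>\<^bsub>Dom C f, x\<^esub>" using f ab z by (auto simp: homset_def)
  moreover have "a \<cdot> k \<in> Hom (Dom C k) x" using ab k by (auto simp: homset_def)
  ultimately have "\<exists>!u. u \<in> Hom (Cod C k) x \<and> u \<cdot> k = a \<cdot> k" using assms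
    is_cokernel_iff[OF f(2,1)] by blast
  then show "a = b" using ab by metis
qed

lemma kernel_zero: "is_kernel C k f \<Longrightarrow> k \<in> Hom w x \<Longrightarrow> f \<in> Hom x y
  \<Longrightarrow> f \<cdot> k = \<zero>\<^bsub>w,y\<^esub>"
  using is_kernel_iff by blast

lemma cokernel_zero: "is_cokernel C q f \<Longrightarrow> q \<in> Hom y z \<Longrightarrow> f \<in> Hom x y
  \<Longrightarrow> q \<cdot> f = \<zero>\<^bsub>x,z\<^esub>"
  using is_cokernel_iff by blast

lemma kernel_lift:
  "is_kernel C k f \<Longrightarrow> k \<in> Hom w x \<Longrightarrow> f \<in> Hom x y \<Longrightarrow> h
    \<in> Hom v x \<Longrightarrow> f \<cdot> h = \<zero>\<^bsub>v,y\<^esub>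
    \<Longrightarrow> \<exists>u \<in> Hom v w. k \<cdot> u = h"
  using is_kernel_iff[of k w x f y] by blast

lemma cokernel_desc:
  "is_cokernel C q f \<Longrightarrow> q \<in> Hom y z \<Longrightarrow> f \<in> Hom x y \<Longrightarrow> h
    \<in> Hom y v \<Longrightarrow> h \<cdot> f = \<zero>\<^bsub>x,v\<^esub>
    \<Longrightarrow> \<exists>u \<in> Hom z v. u \<cdot> q = h"
  using is_cokernel_iff[of q y z f x] by blast

end

sublocale abelian_category \<subseteq> category_with_zero C
  using has_zero by unfold_locales

section \<open>The additive structure and alternating sums of arrows\<close>

context abelian_category
begin

definition hadd (infixl "\<oplus>" 65) where "hadd = hom_add C"

text \<open>Each homset is a group of its own, so the inverse depends on the endpoints. Reading them
  off \<open>f\<close> gives a binary operation without indices, meaningful when \<open>g\<close> is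
  parallel to \<open>f\<close>.\<close>

definition hsub (infixl "\<ominus>" 65) where
  "hsub f g = hom_add C f (m_inv (hom_group C (hom_add C) (Dom C f) (Cod C f)) g)"

abbreviation "HG \<equiv> hom_group C (hom_add C)"

lemma additive: "additive_structure C (hom_add C)"
  unfolding hom_add_def by (rule someI_ex[OF has_additive_structure])

lemma HG: "x \<in> Obj C \<Longrightarrow> y \<in> Obj C \<Longrightarrow> comm_group (HG x y)"
  using additive unfolding additive_structure_def by blast

lemma HG_sel [simp]: "carrier (HG x y) = Hom x y" "monoid.mult (HG x y) = (\<oplus>)"
  "one (HG x y) = \<zero>\<^bsub>x,y\<^esub>"
  by (auto simp: hom_group_def hadd_def)

lemma hsub_eq: "f \<in> Hom x y \<Longrightarrow> f \<ominus> g = f \<oplus> m_inv (HG x y) g"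
  by (simp add: hsub_def hadd_def homset_def)

lemma hadd_Hom: "f \<in> Hom x y \<Longrightarrow> g \<in> Hom x y \<Longrightarrow> f \<oplus> g \<in> Hom x y"
  using comm_group.axioms(2)[OF HG[of x y]] monoid.m_closed[of "HG x y" f g] Hom_Obj[of f x y]
  by (simp add: group_def)

lemma hneg_Hom: "f \<in> Hom x y \<Longrightarrow> m_inv (HG x y) f \<in> Hom x y"
  using comm_group.axioms(2)[OF HG[of x y]] group.inv_closed[of "HG x y" f] Hom_Obj[of f x y]
  by simp

lemma hsub_Hom: "f \<in> Hom x y \<Longrightarrow> g \<in> Hom x y \<Longrightarrow> f \<ominus> g \<in> Hom x y"
  using hadd_Hom hneg_Hom hsub_eq by metis

lemma hadd_distrib: 
  "f \<in> Hom x y \<Longrightarrow> f' \<in> Hom x y \<Longrightarrow> g \<in> Hom y z \<Longrightarrow> g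
    \<cdot> (f \<oplus> f') = g \<cdot> f \<oplus> g \<cdot> f'"
  "f \<in> Hom x y \<Longrightarrow> g \<in> Hom y z \<Longrightarrow> g' \<in> Hom y z \<Longrightarrow> (g
    \<oplus> g') \<cdot> f = g \<cdot> f \<oplus> g' \<cdot> f"
  using additive unfolding additive_structure_def hadd_def by blast+

text \<open>Composition distributes over sums, so g(-f) + gf = g0 = 0, and inverses in the target
  group are unique; likewise on the other side.\<close>

lemma hneg_distrib:
  assumes f: "f \<in> Hom x y" and g: "g \<in> Hom y z"
  shows "g \<cdot> m_inv (HG x y) f = m_inv (HG x z) (g \<cdot> f)"
    "m_inv (HG y z) g \<cdot> f = m_inv (HG x z) (g \<cdot> f)"
proof -
  interpret xy: comm_group "HG x y" using HG Hom_Obj f by blast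
  interpret yz: comm_group "HG y z" using HG Hom_Obj g by blast
  interpret xz: comm_group "HG x z" using HG Hom_Obj f g by blast
  note m = Cmp_homset[OF f g] Cmp_homset[OF hneg_Hom[OF f] g] Cmp_homset[OF f hneg_Hom[OF g]]
  note o = Hom_Obj[OF f] Hom_Obj[OF g]
  have "g \<cdot> m_inv (HG x y) f \<oplus> g \<cdot> f = g \<cdot> (m_inv (HG x y) f \<oplus> f)"
    using hadd_distrib(1)[OF hneg_Hom[OF f] f g] by simp
  also have "\<dots> = \<zero>\<^bsub>x,z\<^esub>" using xy.l_inv[of f] f g o by (simp add: Hom_ArrD)
  finally show "g \<cdot> m_inv (HG x y) f = m_inv (HG x z) (g \<cdot> f)"
    using xz.inv_equality[of "g \<cdot> m_inv (HG x y) f" "g \<cdot> f"] m by simp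
  have "m_inv (HG y z) g \<cdot> f \<oplus> g \<cdot> f = (m_inv (HG y z) g \<oplus> g) \<cdot> f"
    using hadd_distrib(2)[OF f hneg_Hom[OF g] g] by simp
  also have "\<dots> = \<zero>\<^bsub>x,z\<^esub>" using yz.l_inv[of g] f g o by (simp add: Hom_ArrD)
  finally show "m_inv (HG y z) g \<cdot> f = m_inv (HG x z) (g \<cdot> f)"
    using xz.inv_equality[of "m_inv (HG y z) g \<cdot> f" "g \<cdot> f"] m by simp
qed

lemma hsub_distrib:
  "f \<in> Hom x y \<Longrightarrow> f' \<in> Hom x y \<Longrightarrow> g \<in> Hom y z \<Longrightarrow> g
    \<cdot> (f \<ominus> f') = g \<cdot> f \<ominus> g \<cdot> f'"
  "f \<in> Hom x y \<Longrightarrow> g \<in> Hom y z \<Longrightarrow> g' \<in> Hom y z \<Longrightarrow> (g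
    \<ominus> g') \<cdot> f = g \<cdot> f \<ominus> g' \<cdot> f"
proof -
  show "g \<cdot> (f \<ominus> f') = g \<cdot> f \<ominus> g \<cdot> f'" if "f \<in> Hom x y"
    "f' \<in> Hom x y" "g \<in> Hom y z"
    using hsub_eq[OF that(1)] hadd_distrib(1)[OF that(1) hneg_Hom[OF that(2)] that(3)] hneg_distrib(1)[OF that(2,3)]
      hsub_eq[OF Cmp_homset[OF that(1,3)]] by simp
  show "(g \<ominus> g') \<cdot> f = g \<cdot> f \<ominus> g' \<cdot> f" if "f \<in> Hom x y"
    "g \<in> Hom y z" "g' \<in> Hom y z"
    using hsub_eq[OF that(2)] hadd_distrib(2)[OF that(1,2) hneg_Hom[OF that(3)]] hneg_distrib(2)[OF that(1,3)]
      hsub_eq[OF Cmp_homset[OF that(1,2)]] by simp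
qed

lemma hsub_hadd: "f \<in> Hom x y \<Longrightarrow> g \<in> Hom x y \<Longrightarrow> (f \<ominus> g) \<oplus> g = f"
  and hadd_commute: "f \<in> Hom x y \<Longrightarrow> g \<in> Hom x y \<Longrightarrow> f \<oplus> g = g \<oplus> f"
  and hsub_zero: "f \<in> Hom x y \<Longrightarrow> f \<ominus> \<zero>\<^bsub>x,y\<^esub> = f"
  and hadd_zero: "f \<in> Hom x y \<Longrightarrow> f \<oplus> \<zero>\<^bsub>x,y\<^esub> = f"
    "f \<in> Hom x y \<Longrightarrow> \<zero>\<^bsub>x,y\<^esub> \<oplus> f = f"
proof -
  assume f: "f \<in> Hom x y"
  then interpret comm_group "HG x y" using HG Hom_Obj by blast
  show "f \<ominus> \<zero>\<^bsub>x,y\<^esub> = f" "f \<oplus> \<zero>\<^bsub>x,y\<^esub> = f"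
    "\<zero>\<^bsub>x,y\<^esub> \<oplus> f = f" using inv_one r_one[of f] l_one[of f] f hsub_eq[OF f, of
    "\<zero>\<^bsub>x,y\<^esub>"] by simp_all
  assume g: "g \<in> Hom x y"
  note i = hneg_Hom[OF f] hneg_Hom[OF g]
  show "f \<oplus> g = g \<oplus> f" using m_comm[of f g] f g by simp
  show "(f \<ominus> g) \<oplus> g = f" using m_assoc[of f "m_inv (HG x y) g" g] f g i r_one[of f] hsub_eq[OF
    f] l_inv[of g] by simp
qed

lemma hsub_eq_zero_iff:
  assumes fg: "f \<in> Hom x y" "g \<in> Hom x y" shows "f \<ominus> g = \<zero>\<^bsub>x,y\<^esub>
    \<longleftrightarrow> f = g"
proof -
  interpret comm_group "HG x y" using HG Hom_Obj fg by blast
  show ?thesis using r_inv[of g] hsub_eq[OF fg(1), of g] hsub_hadd[OF fg] hadd_zero(2)[OF fg(2)] fg by auto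
qed

text \<open>The sum inside \<open>alt_boundary\<close>, detached from simplicial objects: the
  endpoints are free and there are \<open>n + 1\<close> terms. Free endpoints allow composing all
  terms with one arrow, and the index can be shifted.\<close>

definition alt_sum :: "'o \<Rightarrow> 'o \<Rightarrow> (nat \<Rightarrow> 'a) \<Rightarrow> nat
  \<Rightarrow> 'a" where
  "alt_sum x y f n = finprod (HG x y) (\<lambda>i. if even i then f i else m_inv (HG x y) (f i)) {..n}"

lemma alt_sum_0: "f 0 \<in> Hom x y \<Longrightarrow> alt_sum x y f 0 = f 0"
proof -
  assume f: "f 0 \<in> Hom x y"
  then interpret comm_group "HG x y" using HG Hom_Obj by blast
  show ?thesis using f by (simp add: alt_sum_def hadd_zero)
qed

lemma finprod_inv_Hom:
  fixes n :: nat
  assumes "x \<in> Obj C" "y \<in> Obj C" "\<And>i. i \<le> n \<Longrightarrow> f i \<in> Hom x y"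
  shows "finprod (HG x y) (\<lambda>i. m_inv (HG x y) (f i)) {..n} = m_inv (HG x y) (finprod (HG x y) f {..n})"
proof -
  interpret comm_group "HG x y" using HG assms by blast
  show ?thesis using assms(3)
  proof (induction n)
    case 0
    then show ?case using hneg_Hom[of "f 0"] by (simp add: hadd_zero)
  next
    case (Suc n)
    have c: "f \<in> {..Suc n} \<rightarrow> Hom x y" "(\<lambda>i. m_inv (HG x y) (f i)) \<in> {..Suc n}
      \<rightarrow> Hom x y"
      using Suc.prems hneg_Hom by auto
    have "finprod (HG x y) f {..n} \<in> carrier (HG x y)" by (rule finprod_closed) (use Suc.prems in auto)
    then show ?case using Suc c finprod_Suc[of f n] finprod_Suc[of "\<lambda>i. m_inv (HG x y) (f i)" n]
      inv_mult[of "f (Suc n)" "finprod (HG x y) f {..n}"] Suc.prems[of "Suc n"] by simp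
  qed
qed

lemma alt_sum_Hom: "x \<in> Obj C \<Longrightarrow> y \<in> Obj C \<Longrightarrow> (\<And>i. i \<le> n
  \<Longrightarrow> f i \<in> Hom x y) \<Longrightarrow> alt_sum x y f n \<in> Hom x y"
proof -
  assume o: "x \<in> Obj C" "y \<in> Obj C" and f: "\<And>i. i \<le> n \<Longrightarrow> f i \<in> Hom x y"
  then interpret comm_group "HG x y" using HG by blast
  have "alt_sum x y f n \<in> carrier (HG x y)" unfolding alt_sum_def
    by (rule finprod_closed) (use f hneg_Hom in auto)
  then show ?thesis by simp
qed

text \<open>Dropping the first term changes the parity of every remaining index, so the tail enters
  with a minus sign. In this form d_0 is later split off from the other faces.\<close>

lemma alt_sum_Suc:
  assumes o: "x \<in> Obj C" "y \<in> Obj C" and f: "\<And>i. i \<le> Suc n \<Longrightarrow> f i \<in> Hom x y"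
  shows "alt_sum x y f (Suc n) = f 0 \<ominus> alt_sum x y (\<lambda>i. f (Suc i)) n"
proof -
  interpret comm_group "HG x y" using HG o by blast
  let ?g = "\<lambda>i. if even i then f i else m_inv (HG x y) (f i)"
  have c: "?g \<in> {..Suc n} \<rightarrow> carrier (HG x y)" using f hneg_Hom by auto
  have "alt_sum x y f (Suc n) = finprod (HG x y) (\<lambda>i. ?g (Suc i)) {..n} \<oplus> f 0"
    using finprod_Suc2[OF c] by (simp add: alt_sum_def)
  \<comment> \<open>For odd \<open>i\<close> the term is written as a double inverse, so that a
    single inverse can be taken out of the whole product.\<close>
  also have "finprod (HG x y) (\<lambda>i. ?g (Suc i)) {..n} = finprod (HG x y) (\<lambda>i. m_inv (HG x y)
    (if even i then f (Suc i) else m_inv (HG x y) (f (Suc i)))) {..n}"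
    by (rule finprod_cong') (use f hneg_Hom inv_inv in auto)
  also have "\<dots> = m_inv (HG x y) (alt_sum x y (\<lambda>i. f (Suc i)) n)"
    unfolding alt_sum_def by (rule finprod_inv_Hom) (use o f hneg_Hom in auto)
  finally show ?thesis
    using hsub_eq[of "f 0" x y] hadd_commute[of "f 0" x y] f[of 0] hneg_Hom[OF alt_sum_Hom[OF o, of n
      "\<lambda>i. f (Suc i)"]] f
    by simp
qed

lemma alt_sum_cong: "x \<in> Obj C \<Longrightarrow> y \<in> Obj C \<Longrightarrow> (\<And>i. i \<le> n
  \<Longrightarrow> f i = g i) \<Longrightarrow> (\<And>i. i \<le> n \<Longrightarrow> g i \<in> Hom x y)
  \<Longrightarrow> alt_sum x y f n = alt_sum x y g n"
proof -
  assume o: "x \<in> Obj C" "y \<in> Obj C" and f: "\<And>i. i \<le> n \<Longrightarrow> f i = g i" and g: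
    "\<And>i. i \<le> n \<Longrightarrow> g i \<in> Hom x y"
  then interpret comm_group "HG x y" using HG by blast
  show ?thesis unfolding alt_sum_def by (rule finprod_cong') (use f g hneg_Hom in auto)
qed

lemma Cmp_alt_sum:
  assumes "h \<in> Hom y z" "\<And>i. i \<le> n \<Longrightarrow> f i \<in> Hom x y" "x \<in> Obj C"
  shows "h \<cdot> alt_sum x y f n = alt_sum x z (\<lambda>i. h \<cdot> f i) n"
  using assms(2)
proof (induction n arbitrary: f)
  case 0
  then show ?case using Cmp_homset[OF 0[of 0] assms(1)] by (simp add: alt_sum_0)
next
  case (Suc n)
  have o: "y \<in> Obj C" "z \<in> Obj C" using assms(1) Hom_Obj by auto
  have "h \<cdot> alt_sum x y f (Suc n) = h \<cdot> f 0 \<ominus> h \<cdot> alt_sum x y (\<lambda>i. f (Suc i)) n"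
    using hsub_distrib(1)[OF Suc.prems[of 0] alt_sum_Hom[OF assms(3) o(1), of n "\<lambda>i. f (Suc i)"] assms(1)]
      Suc.prems alt_sum_Suc[OF assms(3) o(1), of n f] by simp
  also have "\<dots> = alt_sum x z (\<lambda>i. h \<cdot> f i) (Suc n)"
    using Suc.IH[of "\<lambda>i. f (Suc i)"] Suc.prems alt_sum_Suc[OF assms(3) o(2), of n
      "\<lambda>i. h \<cdot> f i"] Cmp_homset[OF _ assms(1)] by simp
  finally show ?case .
qed

lemma alt_sum_Cmp:
  assumes "h \<in> Hom w x" "\<And>i. i \<le> n \<Longrightarrow> f i \<in> Hom x y" "y \<in> Obj C"
  shows "alt_sum x y f n \<cdot> h = alt_sum w y (\<lambda>i. f i \<cdot> h) n"
  using assms(2)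
proof (induction n arbitrary: f)
  case 0
  then show ?case using Cmp_homset[OF assms(1) 0[of 0]] by (simp add: alt_sum_0)
next
  case (Suc n)
  have o: "w \<in> Obj C" "x \<in> Obj C" using assms(1) Hom_Obj by auto
  have "alt_sum x y f (Suc n) \<cdot> h = f 0 \<cdot> h \<ominus> alt_sum x y (\<lambda>i. f (Suc i)) n \<cdot> h"
    using hsub_distrib(2)[OF assms(1) Suc.prems[of 0] alt_sum_Hom[OF o(2) assms(3), of n "\<lambda>i. f (Suc i)"]]
      Suc.prems alt_sum_Suc[OF o(2) assms(3), of n f] by simp
  also have "\<dots> = alt_sum w y (\<lambda>i. f i \<cdot> h) (Suc n)"
    using Suc.IH[of "\<lambda>i. f (Suc i)"] Suc.prems alt_sum_Suc[OF o(1) assms(3), of n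
      "\<lambda>i. f i \<cdot> h"] Cmp_homset[OF assms(1)] by simp
  finally show ?case .
qed

end

lemma (in category) comm_square:
  assumes "f \<in> Hom w x" "g \<in> Hom x y" "f' \<in> Hom w x'" "g' \<in> Hom x' y"
    "g \<cdot> f = g' \<cdot> f'" "h \<in> Hom v w"
  shows "g \<cdot> (f \<cdot> h) = g' \<cdot> (f' \<cdot> h)"
  using Cmp_assoc[OF assms(6,1,2)] Cmp_assoc[OF assms(6,3,4)] assms(5) by simp

section \<open>Images, homology objects and exactness on projective points\<close>

context abelian_category
begin

text \<open>By additivity, the difference of two arrows that \<open>m\<close> identifies is
  annihilated by \<open>m\<close>, so cancellation only has to be tested against zero.\<close>

lemma mono_via_zero:
  assumes m: "m \<in> Hom x y" and *: "\<And>w a. a \<in> Hom w x \<Longrightarrow> m \<cdot> a =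
    \<zero>\<^bsub>w,y\<^esub> \<Longrightarrow> a = \<zero>\<^bsub>w,x\<^esub>"
  shows "mono_arrow C m"
  unfolding mono_arrow_def
proof safe
  show "m \<in> Arr C" using m by (simp add: Hom_ArrD)
  fix w f g assume "f \<in> Hom w (Dom C m)" "g \<in> Hom w (Dom C m)" and eq: "m \<cdot> f = m \<cdot> g"
  then have f: "f \<in> Hom w x" "g \<in> Hom w x" using m by (simp_all add: Hom_ArrD)
  have "m \<cdot> (f \<ominus> g) = \<zero>\<^bsub>w,y\<^esub>"
    using hsub_distrib(1)[OF f m] hsub_eq_zero_iff[OF Cmp_homset[OF f(1) m] Cmp_homset[OF f(2) m]] eq by simp
  then show "f = g" using *[OF hsub_Hom[OF f]] hsub_eq_zero_iff[OF f] by simp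
qed

lemma epi_via_zero:
  assumes m: "m \<in> Hom x y" and *: "\<And>w a. a \<in> Hom y w \<Longrightarrow> a \<cdot> m =
    \<zero>\<^bsub>x,w\<^esub> \<Longrightarrow> a = \<zero>\<^bsub>y,w\<^esub>"
  shows "epi_arrow C m"
  unfolding epi_arrow_def
proof safe
  show "m \<in> Arr C" using m by (simp add: Hom_ArrD)
  fix w f g assume "f \<in> Hom (Cod C m) w" "g \<in> Hom (Cod C m) w" and eq: "f \<cdot> m = g \<cdot> m"
  then have f: "f \<in> Hom y w" "g \<in> Hom y w" using m by (simp_all add: Hom_ArrD)
  have "(f \<ominus> g) \<cdot> m = \<zero>\<^bsub>x,w\<^esub>"
    using hsub_distrib(2)[OF m f] hsub_eq_zero_iff[OF Cmp_homset[OF m f(1)] Cmp_homset[OF m f(2)]] eq by simp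
  then show "f = g" using *[OF hsub_Hom[OF f]] hsub_eq_zero_iff[OF f] by simp
qed

lemma mono_Cmp: "mono_arrow C m \<Longrightarrow> mono_arrow C n \<Longrightarrow> Dom C m = Cod C n
  \<Longrightarrow> mono_arrow C (m \<cdot> n)"
  unfolding mono_arrow_def by (auto simp: homset_def)

text \<open>\<open>m\<close> is the kernel of some \<open>f\<close>; being epi it forces
  \<open>f\<close> to be zero, so the identity of the target factors through \<open>m\<close>. This
  gives a right inverse, which is two-sided because \<open>m\<close> is mono.\<close>

lemma mono_epi_iso:
  assumes "mono_arrow C m" "epi_arrow C m"
  shows "iso_arrow C m"
proof -
  obtain f where f: "is_kernel C m f" using mono_is_kernel assms(1) by blast
  define x y z where "x = Dom C m" "y = Cod C m" "z = Cod C f"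
  have h: "m \<in> Hom x y" "f \<in> Hom y z" using f by (auto simp: is_kernel_def homset_def x_y_z_def)
  note o = Hom_Obj[OF h(1)] Hom_Obj[OF h(2)]
  have "f \<cdot> m = \<zero>\<^bsub>y,z\<^esub> \<cdot> m" using kernel_zero[OF f h] h o by (simp add: Hom_ArrD)
  then have "f = \<zero>\<^bsub>y,z\<^esub>" by - (rule epi_arrowD[OF assms(2)], use h o in \<open>simp_all
    add: homset_def\<close>)
  then have "f \<cdot> Ide C y = \<zero>\<^bsub>y,z\<^esub>" using h o by (simp add: Hom_ArrD)
  then obtain u where u: "u \<in> Hom y x" "m \<cdot> u = Ide C y" using kernel_lift[OF f h Ide_Hom[OF o(2)]] by blast
  have "m \<cdot> (u \<cdot> m) = (m \<cdot> u) \<cdot> m" using u(1) h(1) by (simp add: homset_def)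
  also have "\<dots> = m \<cdot> Ide C x" unfolding u(2) using h(1) by (simp add: homset_def)
  finally have "u \<cdot> m = Ide C x" by - (rule mono_arrowD[OF assms(1)], use h u o in \<open>simp_all add:
    homset_def\<close>)
  then show ?thesis using iso_arrowI h u by blast
qed

text \<open>If \<open>a\<close> kills \<open>f'\<close>, then \<open>f\<close> already factors
  through the smaller subobject \<open>k \<cdot> m\<close>, where \<open>m\<close> is the kernel of
  \<open>a\<close>. That subobject is the kernel of some \<open>b\<close>; \<open>b\<close> kills
  \<open>f\<close>, hence factors through \<open>q\<close>, hence kills \<open>k\<close>. So
  \<open>k\<close> factors through \<open>k \<cdot> m\<close>, which makes \<open>m\<close> a split
  epimorphism and \<open>a\<close> zero.\<close>

lemma kernel_of_cokernel_epi:
  assumes q: "is_cokernel C q f" and k: "is_kernel C k q" and f': "f' \<in> Hom x w" "k \<in> Hom w y"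
    "k \<cdot> f' = f"
  shows "epi_arrow C f'"
proof (rule epi_via_zero[OF f'(1)])
  fix v a assume a: "a \<in> Hom w v" and az: "a \<cdot> f' = \<zero>\<^bsub>x,v\<^esub>"
  have f: "f \<in> Hom x y" using f' Cmp_homset by blast
  obtain z where qz: "q \<in> Hom y z" using q is_cokernel_Hom f by blast
  obtain m where m: "is_kernel C m a" using has_kernels[OF Hom_ArrD(1)[OF a]] by blast
  obtain l where mh: "m \<in> Hom l w" using is_kernel_Hom[OF m a] by blast
  obtain f'' where f'': "f'' \<in> Hom x l" "m \<cdot> f'' = f'" using kernel_lift[OF m mh a f'(1) az] by blast
  have "mono_arrow C (k \<cdot> m)" using mono_Cmp[OF kernel_mono[OF k] kernel_mono[OF m]] mh f'(2) by (simp
    add: Hom_ArrD)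
  then obtain b where b: "is_kernel C (k \<cdot> m) b" using mono_is_kernel by blast
  have km: "k \<cdot> m \<in> Hom l y" using Cmp_homset[OF mh f'(2)] .
  obtain t where t: "b \<in> Hom y t" using b km by (auto simp: is_kernel_def homset_def)
  have "b \<cdot> f = (b \<cdot> (k \<cdot> m)) \<cdot> f''" using t f'(2) f'(3)[symmetric] f''(1)
    f''(2)[symmetric] mh by (simp add: homset_def)
  also have "\<dots> = \<zero>\<^bsub>x,t\<^esub>" using kernel_zero[OF b km t] f'' Hom_Obj[OF t] by (simp
    add: Hom_ArrD)
  finally obtain b' where b': "b' \<in> Hom z t" "b' \<cdot> q = b" using cokernel_desc[OF q qz f t] by blast
  have "b \<cdot> k = b' \<cdot> (q \<cdot> k)" using b'(1) b'(2)[symmetric] qz f'(2) by (simp add: homset_def)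
  also have "\<dots> = \<zero>\<^bsub>w,t\<^esub>" using kernel_zero[OF k f'(2) qz] b' Hom_Obj[OF a] by (simp
    add: Hom_ArrD)
  finally obtain s where s: "s \<in> Hom w l" "k \<cdot> m \<cdot> s = k" using kernel_lift[OF b km t f'(2)] by blast
  have "k \<cdot> (m \<cdot> s) = k \<cdot> Ide C w" using s f'(2) mh Hom_Obj[OF a] by (simp add: homset_def)
  then have ms: "m \<cdot> s = Ide C w"
    by - (rule mono_arrowD[OF kernel_mono[OF k]], use s f'(2) mh Hom_Obj[OF a] in \<open>simp_all add:
      homset_def\<close>)
  have "a = a \<cdot> (m \<cdot> s)" unfolding ms using a by (simp add: Hom_ArrD)
  also have "\<dots> = (a \<cdot> m) \<cdot> s" using a mh s by (simp add: homset_def)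
  also have "\<dots> = \<zero>\<^bsub>w,v\<^esub>" using kernel_zero[OF m mh a] s Hom_Obj[OF a] by (simp add: Hom_ArrD)
  finally show "a = \<zero>\<^bsub>w,v\<^esub>" .
qed

text \<open>\<open>e\<close> is the cokernel of some \<open>f\<close>, and \<open>f\<close> factors
  through the kernel \<open>k\<close>; whatever kills \<open>k\<close> therefore kills
  \<open>f\<close> and descends along \<open>e\<close>.\<close>

lemma epi_cokernel_of_kernel:
  assumes e: "epi_arrow C e" and k: "is_kernel C k e"
  shows "is_cokernel C e k"
proof -
  obtain f where f: "is_cokernel C e f" using epi_is_cokernel[OF e] by blast
  define w x y z where "w = Dom C f" "x = Dom C k" "y = Dom C e" "z = Cod C e"
  have h: "f \<in> Hom w y" "k \<in> Hom x y" "e \<in> Hom y z" using f k by (auto simp: is_cokernel_def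
    is_kernel_def homset_def w_x_y_z_def)
  obtain f' where f': "f' \<in> Hom w x" "k \<cdot> f' = f" using kernel_lift[OF k h(2,3,1) cokernel_zero[OF f
    h(3,1)]] by blast
  have ex: "\<exists>u. u \<in> Hom z v \<and> u \<cdot> e = t" if t: "t \<in> Hom y v"
    "t \<cdot> k = \<zero>\<^bsub>x,v\<^esub>" for v t
  proof -
    have "t \<cdot> f = (t \<cdot> k) \<cdot> f'" using f'(1) f'(2)[symmetric] h(2) t(1) by (simp add: homset_def)
    also have "\<dots> = \<zero>\<^bsub>w,v\<^esub>" using t f' Hom_Obj[OF t(1)] by (simp add: Hom_ArrD)
    finally show ?thesis using cokernel_desc[OF f h(3,1) t(1)] by blast
  qed
  have un: "u = u'" if "u \<in> Hom z v" "u' \<in> Hom z v" "u \<cdot> e = u' \<cdot> e" for u u' v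
    by - (rule epi_arrowD[OF e], use that h in \<open>simp_all add: homset_def\<close>)
  show ?thesis unfolding is_cokernel_iff[OF h(3,2)] using kernel_zero[OF k h(2,3)] ex un by metis
qed

lemma kernel_Cmp_mono:
  assumes k: "k \<in> Hom w x" "g \<in> Hom x y" and m: "m \<in> Hom y z" "mono_arrow C m"
  shows "is_kernel C k (m \<cdot> g) \<longleftrightarrow> is_kernel C k g"
proof -
  have "(m \<cdot> g) \<cdot> t = \<zero>\<^bsub>v,z\<^esub> \<longleftrightarrow> g \<cdot> t =
    \<zero>\<^bsub>v,y\<^esub>" if t: "t \<in> Hom v x" for t v
  proof
    assume "(m \<cdot> g) \<cdot> t = \<zero>\<^bsub>v,z\<^esub>"
    then have "m \<cdot> (g \<cdot> t) = m \<cdot> \<zero>\<^bsub>v,y\<^esub>" using t k m Hom_Obj[OF t] by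
      (simp add: homset_def)
    then show "g \<cdot> t = \<zero>\<^bsub>v,y\<^esub>"
      by - (rule mono_arrowD[OF m(2)], use t k m Hom_Obj[OF t] Hom_Obj[OF m(1)] in \<open>simp_all add:
        homset_def\<close>)
  qed (use t k m Hom_Obj[OF t] in \<open>simp add: homset_def\<close>)
  then show ?thesis unfolding is_kernel_iff[OF k(1) Cmp_homset[OF k(2) m(1)]] is_kernel_iff[OF k] using k(1) by metis
qed

lemma factor_epi_mono:
  assumes f: "f \<in> Hom x y"
  obtains w e m where "e \<in> Hom x w" "m \<in> Hom w y" "m \<cdot> e = f" "epi_arrow C e" "mono_arrow C m"
proof -
  obtain q where q: "is_cokernel C q f" using has_cokernels[OF Hom_ArrD(1)[OF f]] by blast
  obtain z where qh: "q \<in> Hom y z" using is_cokernel_Hom[OF q f] by blast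
  obtain m where m: "is_kernel C m q" using has_kernels[OF Hom_ArrD(1)[OF qh]] by blast
  obtain w where mh: "m \<in> Hom w y" using is_kernel_Hom[OF m qh] by blast
  obtain e where e: "e \<in> Hom x w" "m \<cdot> e = f" using kernel_lift[OF m mh qh f cokernel_zero[OF q qh
    f]] by blast
  show ?thesis by (rule that[OF e(1) mh e(2) kernel_of_cokernel_epi[OF q m e(1) mh e(2)] kernel_mono[OF m]])
qed

text \<open>A uniform description of the two cases of \<open>outgoing\<close>: a cycle is a point
  killed by the preceding boundary if there is one, and any point in degree 0, where the target is a
  zero object. Later chases quantify over \<open>m\<close> with \<open>n = Suc m\<close> for this
  reason.\<close>

lemma outgoing_Hom:
  assumes "\<And>i. X i \<in> Obj C" "\<And>i. d i \<in> Hom (X (Suc i)) (X i)"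
  shows "\<exists>y. outgoing C X d n \<in> Hom (X n) y \<and>
    (\<forall>p z. z \<in> Hom p (X n) \<longrightarrow> (outgoing C X d n \<cdot> z =
      \<zero>\<^bsub>p,y\<^esub> \<longleftrightarrow> (\<forall>m. n = Suc m \<longrightarrow> d m \<cdot> z
      = \<zero>\<^bsub>p,X m\<^esub>)))"
proof (cases n)
  case 0
  define t where "t = (SOME z. zero_object C z)"
  have t: "zero_object C t" using someI_ex[OF has_zero] unfolding t_def by blast
  then have to: "t \<in> Obj C" by (simp add: zero_object_def)
  have "outgoing C X d n \<in> Hom (X n) t" using 0 assms(1) to by (simp add: outgoing_def t_def)
  moreover have "f = \<zero>\<^bsub>p,t\<^esub>" if "f \<in> Hom p t" for f p
    using t that Hom_Obj[OF that] zero_Hom[OF Hom_Obj(1)[OF that] to] unfolding zero_object_def by blast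
  ultimately show ?thesis using 0 Cmp_homset by blast
next
  case (Suc m)
  then show ?thesis using assms by (intro exI[of _ "X m"]) (auto simp: outgoing_def)
qed

lemma is_homologyE:
  assumes "\<And>i. X i \<in> Obj C" "\<And>i. d i \<in> Hom (X (Suc i)) (X i)" "is_homology C X d n H"
  obtains Z k u q where "k \<in> Hom Z (X n)" "is_kernel C k (outgoing C X d n)" "u \<in> Hom (X (Suc n)) Z"
    "k \<cdot> u = d n"
    "q \<in> Hom Z H" "is_cokernel C q u"
proof -
  obtain y where y: "outgoing C X d n \<in> Hom (X n) y" using outgoing_Hom[of X d n, OF assms(1,2)] by blast
  obtain k u q where *: "is_kernel C k (outgoing C X d n)"
        "u \<in> homset C (X (Suc n)) (Dom C k)" "k \<cdot>\<^bsub>C\<^esub> u = d n" "is_cokernel C q u" "Cod C q = H"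
    using assms(3) unfolding is_homology_def by blast
  show ?thesis by (rule that[OF is_kernel_Hom[OF *(1) y] *(1,2,3) _ *(4)]) (use is_cokernel_Hom[OF *(4,2)] *(5) in simp)
qed

text \<open>\<open>homology\<close> is a choice. For a complex the boundary factors through the
  kernel of the outgoing map, so some homology object exists and the choice is a genuine
  one.\<close>

lemma is_homology_ex:
  assumes X: "\<And>i. X i \<in> Obj C" and d: "\<And>i. d i \<in> Hom (X (Suc i)) (X i)" and dd:
    "\<And>i. d i \<cdot> d (Suc i) = \<zero>\<^bsub>X (Suc (Suc i)), X i\<^esub>"
  shows "is_homology C X d n (homology C X d n)"
proof -
  obtain y where y: "outgoing C X d n \<in> Hom (X n) y" and
    yz: "\<And>p z. z \<in> Hom p (X n) \<Longrightarrow> outgoing C X d n \<cdot> z =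
      \<zero>\<^bsub>p,y\<^esub> \<longleftrightarrow> (\<forall>m. n = Suc m \<longrightarrow> d m \<cdot> z
      = \<zero>\<^bsub>p,X m\<^esub>)"
    using outgoing_Hom[of X d n, OF X d] by blast
  obtain k where k: "is_kernel C k (outgoing C X d n)" using has_kernels[OF Hom_ArrD(1)[OF y]] by blast
  have "outgoing C X d n \<cdot> d n = \<zero>\<^bsub>X (Suc n),y\<^esub>" unfolding yz[OF d] using dd by auto
  then obtain u where u: "u \<in> Hom (X (Suc n)) (Dom C k)" "k \<cdot> u = d n" using kernel_lift[OF k
    is_kernel_Hom[OF k y] y d] by blast
  obtain q where "is_cokernel C q u" using has_cokernels[OF Hom_ArrD(1)[OF u(1)]] by blast
  then have "is_homology C X d n (Cod C q)" unfolding is_homology_def using k u by blast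
  then show ?thesis unfolding homology_def by (rule someI)
qed

text \<open>Exactness seen by arrows out of projectives. In contrast to \<open>exact_at\<close> it
  involves no chosen kernel or cokernel, and points can be lifted directly; with enough projectives
  it amounts to ordinary exactness.\<close>

definition chase_exact :: "'a \<Rightarrow> 'a \<Rightarrow> bool" where
  "chase_exact f g \<longleftrightarrow> f \<in> Arr C \<and> g \<in> Arr C \<and> Cod C f = Dom C g \<and> g
    \<cdot> f = \<zero>\<^bsub>Dom C f, Cod C g\<^esub> \<and>
    (\<forall>p h. projective C p \<and> h \<in> Hom p (Dom C g) \<and> g \<cdot> h = \<zero>\<^bsub>p, Cod C
      g\<^esub> \<longrightarrow> (\<exists>u \<in> Hom p (Dom C f). f \<cdot> u = h))"

lemma chase_exactD:
  assumes "chase_exact f g" "f \<in> Hom x y" "g \<in> Hom y z"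
  shows "g \<cdot> f = \<zero>\<^bsub>x,z\<^esub>"
    and "projective C p \<Longrightarrow> h \<in> Hom p y \<Longrightarrow> g \<cdot> h =
      \<zero>\<^bsub>p,z\<^esub> \<Longrightarrow> \<exists>u \<in> Hom p x. f \<cdot> u = h"
  using assms unfolding chase_exact_def by (auto simp: homset_def)

lemma chase_exactI:
  assumes "f \<in> Hom x y" "g \<in> Hom y z" "g \<cdot> f = \<zero>\<^bsub>x,z\<^esub>"
    "\<And>p h. projective C p \<Longrightarrow> h \<in> Hom p y \<Longrightarrow> g \<cdot> h =
      \<zero>\<^bsub>p,z\<^esub> \<Longrightarrow> \<exists>u \<in> Hom p x. f \<cdot> u = h"
  shows "chase_exact f g"
  using assms unfolding chase_exact_def by (auto simp: homset_def)

lemma epi_lift: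
  "epi_arrow C e \<Longrightarrow> e \<in> Hom x y \<Longrightarrow> projective C p \<Longrightarrow> h \<in>
    Hom p y \<Longrightarrow> \<exists>u \<in> Hom p x. e \<cdot> u = h"
  unfolding projective_def using Hom_ArrD by metis

text \<open>A point killed by \<open>g\<close> factors through the kernel \<open>k\<close>, and a
  projective source allows this factorisation to be lifted along \<open>e\<close>.\<close>

lemma chase_exact_factor:
  assumes e: "epi_arrow C e" "e \<in> Hom x w" and k: "is_kernel C k g" "k \<in> Hom w y" and g: "g \<in> Hom y z"
  shows "chase_exact (k \<cdot> e) g"
proof (rule chase_exactI)
  show "k \<cdot> e \<in> Hom x y" using e k Cmp_homset by blast
  show "g \<in> Hom y z" by fact
  have "g \<cdot> (k \<cdot> e) = (g \<cdot> k) \<cdot> e" using e k g by (simp add: homset_def)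
  then show "g \<cdot> (k \<cdot> e) = \<zero>\<^bsub>x,z\<^esub>" using kernel_zero[OF k g] e(2) Hom_Obj[OF
    g] by (simp add: Hom_ArrD)
  fix p h assume p: "projective C p" "h \<in> Hom p y" "g \<cdot> h = \<zero>\<^bsub>p,z\<^esub>"
  obtain v where v: "v \<in> Hom p w" "k \<cdot> v = h" using kernel_lift[OF k g p(2,3)] by blast
  obtain u where u: "u \<in> Hom p x" "e \<cdot> u = v" using epi_lift[OF e p(1) v(1)] by blast
  show "\<exists>u \<in> Hom p x. k \<cdot> e \<cdot> u = h" using u(1) u(2)[symmetric] v(1) v(2)[symmetric] e
    k by (intro bexI[of _ u]) (simp_all add: homset_def)
qed

lemma exact_at_chase_exact:
  assumes f: "f \<in> Hom x y" and g: "g \<in> Hom y z" and ex: "exact_at C f g"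
  shows "chase_exact f g"
proof -
  obtain k q where q: "is_cokernel C q f" and k: "is_kernel C k q" "is_kernel C k g" using ex unfolding
    exact_at_def by blast
  obtain w where kh: "k \<in> Hom w y" using is_kernel_Hom[OF k(2) g] by blast
  obtain t where qh: "q \<in> Hom y t" using is_cokernel_Hom[OF q f] by blast
  obtain f' where f': "f' \<in> Hom x w" "k \<cdot> f' = f" using kernel_lift[OF k(1) kh qh f cokernel_zero[OF
    q qh f]] by blast
  show ?thesis using chase_exact_factor[OF kernel_of_cokernel_epi[OF q k(1) f'(1) kh f'(2)] f'(1) k(2) kh g]
    f'(2) by simp
qed

text \<open>Any kernel of \<open>q\<close> is by definition the image of \<open>f\<close>, so it
  witnesses \<open>exact_at\<close>.\<close>

lemma cokernel_chase_exact:
  assumes q: "is_cokernel C q f" "q \<in> Hom y z" "f \<in> Hom x y"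
  shows "chase_exact f q"
proof -
  obtain k where k: "is_kernel C k q" using has_kernels[OF Hom_ArrD(1)[OF q(2)]] by blast
  then show ?thesis using exact_at_chase_exact[OF q(3,2)] q unfolding exact_at_def by blast
qed

end

section \<open>Additive relations between points, and double complexes\<close>

locale abelian_enough_projectives = abelian_category +
  assumes enough: "enough_projectives C"
begin

lemma projective_cover:
  assumes "x \<in> Obj C" obtains p e where "projective C p" "e \<in> Hom p x" "epi_arrow C e"
  using enough assms unfolding enough_projectives_def by blast

text \<open>By subtraction, a relation that pairs zero only with zero is single-valued in both
  directions. Evaluating it at a projective cover of \<open>A\<close> and descending along the cover
  produces the arrow \<phi>. Stability under restriction is demanded only along projective sources,
  because the relation it is applied to lives only on projectives.\<close>

lemma isomorphic_by_relation:
  assumes o: "A \<in> Obj C" "B \<in> Obj C"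
    and R: "\<And>p a b. R p a b \<Longrightarrow> a \<in> Hom p A \<and> b \<in> Hom p B"
    and pre: "\<And>p a b p' h. R p a b \<Longrightarrow> projective C p' \<Longrightarrow> h \<in> Hom p' p
      \<Longrightarrow> R p' (a \<cdot> h) (b \<cdot> h)"
    and sub: "\<And>p a b a' b'. R p a b \<Longrightarrow> R p a' b' \<Longrightarrow> R p (a \<ominus> a') (b
      \<ominus> b')"
    and totA: "\<And>p a. projective C p \<Longrightarrow> a \<in> Hom p A \<Longrightarrow> \<exists>b. R p a b"
    and totB: "\<And>p b. projective C p \<Longrightarrow> b \<in> Hom p B \<Longrightarrow> \<exists>a. R p a b"
    and zA: "\<And>p b. R p \<zero>\<^bsub>p,A\<^esub> b \<Longrightarrow> b = \<zero>\<^bsub>p,B\<^esub>"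
    and zB: "\<And>p a. R p a \<zero>\<^bsub>p,B\<^esub> \<Longrightarrow> a = \<zero>\<^bsub>p,A\<^esub>"
  shows "isomorphic C A B"
proof -
  have uniq: "b = b'" if "R p a b" "R p a b'" for p a b b'
    using sub[OF that] zA[of p "b \<ominus> b'"] R[OF that(1)] R[OF that(2)] hsub_eq_zero_iff[of a p A a]
      hsub_eq_zero_iff[of b p B b'] by auto
  obtain p0 e where e: "projective C p0" "e \<in> Hom p0 A" "epi_arrow C e" using projective_cover[OF o(1)] .
  obtain k where k: "is_kernel C k e" using has_kernels[OF Hom_ArrD(1)[OF e(2)]] by blast
  obtain K where kh: "k \<in> Hom K p0" using is_kernel_Hom[OF k e(2)] by blast
  \<comment> \<open>The kernel of the cover need not be projective, so it is covered once more
    before the relation is restricted to it.\<close>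
  obtain p1 t where t: "projective C p1" "t \<in> Hom p1 K" "epi_arrow C t" using projective_cover
    Hom_Obj(1)[OF kh] by blast
  obtain b where b: "R p0 e b" using totA[OF e(1,2)] by blast
  have bh: "b \<in> Hom p0 B" using R b by blast
  note oo = Hom_Obj[OF kh] Hom_Obj[OF t(2)]
  have "R p1 (e \<cdot> (k \<cdot> t)) (b \<cdot> (k \<cdot> t))" using pre[OF b t(1) Cmp_homset[OF t(2) kh]] .
  moreover have "e \<cdot> (k \<cdot> t) = (e \<cdot> k) \<cdot> t" using t(2) kh e(2) by (simp add: homset_def)
  ultimately have "b \<cdot> (k \<cdot> t) = \<zero>\<^bsub>p1,B\<^esub>" using zA kernel_zero[OF k kh e(2)]
    t(2) o by (simp add: Hom_ArrD)
  then have "(b \<cdot> k) \<cdot> t = \<zero>\<^bsub>K,B\<^esub> \<cdot> t" using t(2) kh bh o by (simp add: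
    homset_def)
  then have "b \<cdot> k = \<zero>\<^bsub>K,B\<^esub>" by - (rule epi_arrowD[OF t(3)], use t(2) kh bh o oo in
    \<open>simp_all add: homset_def\<close>)
  then obtain \<phi> where \<phi>: "\<phi> \<in> Hom A B" "\<phi> \<cdot> e = b" using cokernel_desc[OF
    epi_cokernel_of_kernel[OF e(3) k] e(2) kh bh] by blast
  have R\<phi>: "R p a (\<phi> \<cdot> a)" if p: "projective C p" "a \<in> Hom p A" for p a
  proof -
    obtain u where u: "u \<in> Hom p p0" "e \<cdot> u = a" using epi_lift[OF e(3,2) p] by blast
    have "b \<cdot> u = \<phi> \<cdot> a" using \<phi> u e(2) unfolding \<phi>(2)[symmetric] u(2)[symmetric]
      by (simp add: homset_def)
    then show ?thesis using pre[OF b p(1) u(1)] u(2) by simp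
  qed
  have "mono_arrow C \<phi>"
  proof (rule mono_via_zero[OF \<phi>(1)])
    fix w a assume a: "a \<in> Hom w A" "\<phi> \<cdot> a = \<zero>\<^bsub>w,B\<^esub>"
    obtain p s where s: "projective C p" "s \<in> Hom p w" "epi_arrow C s" using projective_cover
      Hom_Obj(1)[OF a(1)] by blast
    have "\<phi> \<cdot> (a \<cdot> s) = (\<phi> \<cdot> a) \<cdot> s" using a(1) s(2) \<phi>(1) by (simp add:
      homset_def)
    also have "\<dots> = \<zero>\<^bsub>p,B\<^esub>" using a(2) s(2) o by (simp add: Hom_ArrD)
    finally have "a \<cdot> s = \<zero>\<^bsub>p,A\<^esub>" using zB R\<phi>[OF s(1) Cmp_homset[OF s(2) a(1)]] by auto
    then have "a \<cdot> s = \<zero>\<^bsub>w,A\<^esub> \<cdot> s" using s(2) o by (simp add: Hom_ArrD)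
    then show "a = \<zero>\<^bsub>w,A\<^esub>" by - (rule epi_arrowD[OF s(3)], use a(1) s(2) o Hom_Obj[OF
      s(2)] in \<open>simp_all add: homset_def\<close>)
  qed
  moreover have "epi_arrow C \<phi>"
  proof (rule epi_via_zero[OF \<phi>(1)])
    fix w c assume c: "c \<in> Hom B w" "c \<cdot> \<phi> = \<zero>\<^bsub>A,w\<^esub>"
    obtain p s where s: "projective C p" "s \<in> Hom p B" "epi_arrow C s" using projective_cover o(2) by blast
    obtain a where a: "R p a s" using totB s by blast
    have ah: "a \<in> Hom p A" using R[OF a] by simp
    \<comment> \<open>Each projective point of \<open>B\<close> is related to a point of
      \<open>A\<close> and hence is its image; thus the cover \<open>s\<close> of \<open>B\<close>
      factors through \<phi>.\<close>
    have eq: "s = \<phi> \<cdot> a" using uniq[OF a R\<phi>[OF s(1) ah]] .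
    have "c \<cdot> s = (c \<cdot> \<phi>) \<cdot> a" unfolding eq using c(1) \<phi>(1) ah by (simp add: homset_def)
    also have "\<dots> = \<zero>\<^bsub>B,w\<^esub> \<cdot> s" using c ah s(2) Hom_Obj[OF c(1)] by (simp add: Hom_ArrD)
    finally show "c = \<zero>\<^bsub>B,w\<^esub>" by - (rule epi_arrowD[OF s(3)], use c(1) s(2) Hom_Obj[OF
      c(1)] in \<open>simp_all add: homset_def\<close>)
  qed
  ultimately show ?thesis unfolding isomorphic_def using mono_epi_iso \<phi>(1) by blast
qed

text \<open>A first-quadrant double complex: \<open>dh\<close> lowers the first index,
  \<open>dv\<close> the second. The complexes along \<open>dh\<close> resolve the objects
  \<open>A j\<close> through \<open>a\<close>, those along \<open>dv\<close> resolve the objects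
  \<open>B j\<close> through \<open>b\<close>. The two halves are symmetric, so each result about
  \<open>A\<close> transposes to one about \<open>B\<close>.\<close>

definition biresolution where
  "biresolution X dh dv A a da B b db \<longleftrightarrow>
    (\<forall>i j. X i j \<in> Obj C \<and> dh i j \<in> Hom (X (Suc i) j) (X i j) \<and> dv i j \<in> Hom (X
      i (Suc j)) (X i j)
      \<and> dh i j \<cdot> dv (Suc i) j = dv i j \<cdot> dh i (Suc j)
      \<and> chase_exact (dh (Suc i) j) (dh i j) \<and> chase_exact (dv i (Suc j)) (dv i j))
  \<and> (\<forall>j. A j \<in> Obj C \<and> a j \<in> Hom (X 0 j) (A j) \<and> epi_arrow C (a j) \<and>
    chase_exact (dh 0 j) (a j)
      \<and> da j \<in> Hom (A (Suc j)) (A j) \<and> a j \<cdot> dv 0 j = da j \<cdot> a (Suc j))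
  \<and> (\<forall>j. B j \<in> Obj C \<and> b j \<in> Hom (X j 0) (B j) \<and> epi_arrow C (b j) \<and>
    chase_exact (dv j 0) (b j)
      \<and> db j \<in> Hom (B (Suc j)) (B j) \<and> b j \<cdot> dh j 0 = db j \<cdot> b (Suc j))"

lemma biresolution_transpose:
  "biresolution X dh dv A a da B b db
    \<Longrightarrow> biresolution (\<lambda>i j. X j i) (\<lambda>i j. dv j i) (\<lambda>i j. dh j i) B b db A a da"
  unfolding biresolution_def by simp

text \<open>The squares of the double complex commute rather than anticommute, so zigzags need no signs.\<close>

definition zigzag where
  "zigzag X dh dv n p x \<longleftrightarrow> (\<forall>k\<le>n. x k \<in> Hom p (X k (n - k)))
     \<and> (\<forall>k<n. dv k (n - Suc k) \<cdot> x k = dh k (n - Suc k) \<cdot> x (Suc k))"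

text \<open>Reading the antidiagonal backwards turns index \<open>k\<close> into
  \<open>n - k\<close> and exchanges the end over \<open>A\<close> with the end over
  \<open>B\<close>.\<close>

lemma zigzag_transpose:
  assumes "zigzag X dh dv n p x"
  shows "zigzag (\<lambda>i j. X j i) (\<lambda>i j. dv j i) (\<lambda>i j. dh j i) n p (\<lambda>k. x (n - k))"
  unfolding zigzag_def
proof (intro conjI allI impI)
  fix k assume "k \<le> n"
  then show "x (n - k) \<in> Hom p (X (n - k) k)" using assms unfolding zigzag_def by (metis diff_diff_cancel
    diff_le_self)
next
  fix k assume k: "k < n"
  then have "n - Suc k < n" "n - Suc (n - Suc k) = k" "Suc (n - Suc k) = n - k" by auto
  then show "dh (n - Suc k) k \<cdot> x (n - k) = dv (n - Suc k) k \<cdot> x (n - Suc k)"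
    using assms unfolding zigzag_def by metis
qed

context
  fixes X dh dv A a da B b db
  assumes bi: "biresolution X dh dv A a da B b db"
begin

lemma bi_simps:
  shows "X i j \<in> Obj C" "dh i j \<in> Hom (X (Suc i) j) (X i j)" "dv i j \<in> Hom (X i (Suc j)) (X i j)"
    "dh i j \<cdot> dv (Suc i) j = dv i j \<cdot> dh i (Suc j)"
    "chase_exact (dh (Suc i) j) (dh i j)" "chase_exact (dv i (Suc j)) (dv i j)"
    "A j \<in> Obj C" "a j \<in> Hom (X 0 j) (A j)" "epi_arrow C (a j)" "chase_exact (dh 0 j) (a j)"
    "da j \<in> Hom (A (Suc j)) (A j)" "a j \<cdot> dv 0 j = da j \<cdot> a (Suc j)"
    "B j \<in> Obj C" "b j \<in> Hom (X j 0) (B j)" "epi_arrow C (b j)" "chase_exact (dv j 0) (b j)"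
    "db j \<in> Hom (B (Suc j)) (B j)" "b j \<cdot> dh j 0 = db j \<cdot> b (Suc j)"
  using bi unfolding biresolution_def by blast+

lemma comm_dh_dv: "x \<in> Hom p (X (Suc i) (Suc j)) \<Longrightarrow> dh i j \<cdot> (dv (Suc i) j \<cdot> x)
  = dv i j \<cdot> (dh i (Suc j) \<cdot> x)"
  by (rule comm_square[OF bi_simps(3,2,2,3,4)])

lemma comm_a: "x \<in> Hom p (X 0 (Suc j)) \<Longrightarrow> a j \<cdot> (dv 0 j \<cdot> x) = da j \<cdot> (a
  (Suc j) \<cdot> x)"
  by (rule comm_square[OF bi_simps(3,8,8,11,12)])

lemma comm_b: "x \<in> Hom p (X (Suc i) 0) \<Longrightarrow> b i \<cdot> (dh i 0 \<cdot> x) = db i \<cdot> (b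
  (Suc i) \<cdot> x)"
  by (rule comm_square[OF bi_simps(2,14,14,17,18)])

lemma chase_zero:
  "x \<in> Hom p (X i (Suc (Suc j))) \<Longrightarrow> dv i j \<cdot> (dv i (Suc j) \<cdot> x) =
    \<zero>\<^bsub>p,X i j\<^esub>"
  "x \<in> Hom p (X (Suc (Suc i)) j) \<Longrightarrow> dh i j \<cdot> (dh (Suc i) j \<cdot> x) =
    \<zero>\<^bsub>p,X i j\<^esub>"
  "x \<in> Hom p (X (Suc 0) j) \<Longrightarrow> a j \<cdot> (dh 0 j \<cdot> x) = \<zero>\<^bsub>p,A j\<^esub>"
  "x \<in> Hom p (X i (Suc 0)) \<Longrightarrow> b i \<cdot> (dv i 0 \<cdot> x) = \<zero>\<^bsub>p,B i\<^esub>"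
proof -
  have *: "g \<cdot> (f \<cdot> h) = \<zero>\<^bsub>p,z\<^esub>" if "f \<in> Hom x y" "g \<in> Hom y z"
    "h \<in> Hom p x" "chase_exact f g" for f g h x y z
    using chase_exactD(1)[OF that(4,1,2)] Cmp_assoc[OF that(3,1,2)] that(3) Hom_Obj[OF that(2)] by (simp add: Hom_ArrD)
  show "x \<in> Hom p (X i (Suc (Suc j))) \<Longrightarrow> dv i j \<cdot> (dv i (Suc j) \<cdot> x) =
    \<zero>\<^bsub>p,X i j\<^esub>"
    by (rule *[OF bi_simps(3,3) _ bi_simps(6)])
  show "x \<in> Hom p (X (Suc (Suc i)) j) \<Longrightarrow> dh i j \<cdot> (dh (Suc i) j \<cdot> x) =
    \<zero>\<^bsub>p,X i j\<^esub>"
    by (rule *[OF bi_simps(2,2) _ bi_simps(5)])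
  show "x \<in> Hom p (X (Suc 0) j) \<Longrightarrow> a j \<cdot> (dh 0 j \<cdot> x) = \<zero>\<^bsub>p,A j\<^esub>"
    by (rule *[OF bi_simps(2,8) _ bi_simps(10)])
  show "x \<in> Hom p (X i (Suc 0)) \<Longrightarrow> b i \<cdot> (dv i 0 \<cdot> x) = \<zero>\<^bsub>p,B i\<^esub>"
    by (rule *[OF bi_simps(3,14) _ bi_simps(16)])
qed

text \<open>The first joint moves \<open>dv 0 m \<cdot> x 0\<close> into the image of
  \<open>dh\<close>, which the augmentation \<open>a\<close> annihilates.\<close>

lemma zigzag_cycle:
  assumes z: "zigzag X dh dv n p x" and n: "n = Suc m"
  shows "da m \<cdot> (a n \<cdot> x 0) = \<zero>\<^bsub>p,A m\<^esub>"
proof -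
  have x: "x 0 \<in> Hom p (X 0 (Suc m))" "x 1 \<in> Hom p (X (Suc 0) m)" "dv 0 m \<cdot> x 0 = dh 0 m \<cdot> x 1"
    using z n unfolding zigzag_def by (auto dest: spec[of _ 0] spec[of _ "1 :: nat"])
  show ?thesis using comm_a[OF x(1)] x chase_zero(3)[OF x(2)] n by simp
qed

text \<open>The cycle is lifted along the epimorphism \<open>a\<close> and then continued along the
  antidiagonal: \<open>dv\<close> of the last entry found is killed by the next horizontal map, so
  exactness along \<open>dh\<close> supplies the next entry.\<close>

lemma zigzag_start:
  assumes p: "projective C p" and z: "z \<in> Hom p (A n)" "\<And>m. n = Suc m \<Longrightarrow> da m \<cdot>
    z = \<zero>\<^bsub>p,A m\<^esub>"
  shows "\<exists>x. zigzag X dh dv n p x \<and> a n \<cdot> x 0 = z"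
proof -
  have "\<exists>x. (\<forall>i\<le>k. x i \<in> Hom p (X i (n - i))) \<and> (\<forall>i<k. dv i (n - Suc i)
    \<cdot> x i = dh i (n - Suc i) \<cdot> x (Suc i)) \<and> a n \<cdot> x 0 = z"
    if "k \<le> n" for k
    using that
  proof (induction k)
    case 0
    then show ?case using epi_lift[OF bi_simps(9,8) p z(1)] by auto
  next
    case (Suc k)
    then obtain x where x: "\<And>i. i\<le>k \<Longrightarrow> x i \<in> Hom p (X i (n - i))"
      "\<And>i. i<k \<Longrightarrow> dv i (n - Suc i) \<cdot> x i = dh i (n - Suc i) \<cdot> x (Suc i)"
        "a n \<cdot> x 0 = z" by auto
    have xk: "x k \<in> Hom p (X k (Suc (n - Suc k)))" using x(1)[of k] Suc.prems by (simp add: Suc_diff_Suc)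
    define y where "y = dv k (n - Suc k) \<cdot> x k"
    have y: "y \<in> Hom p (X k (n - Suc k))" unfolding y_def using Cmp_homset[OF xk bi_simps(3)] .
    have "\<exists>w \<in> Hom p (X (Suc k) (n - Suc k)). dh k (n - Suc k) \<cdot> w = y"
    proof (cases k)
      \<comment> \<open>At the edge the row is continued by the augmentation, and the cycle
        condition on \<open>z\<close> takes the place of a previous joint.\<close>
      case 0
      have "a (n - 1) \<cdot> y = \<zero>\<^bsub>p,A (n - 1)\<^esub>"
        using comm_a[of "x 0" p "n - 1"] xk 0 z(2)[of "n - 1"] x(3) Suc.prems unfolding y_def by simp
      then show ?thesis using chase_exactD(2)[OF bi_simps(10) bi_simps(2,8) p, of y] y 0 by simp
    next
      case (Suc l)
      define r where "r = n - Suc k"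
      have nl: "n - Suc l = Suc r" using Suc Suc.prems unfolding r_def by simp
      have xl: "x l \<in> Hom p (X l (Suc (Suc r)))" using x(1)[of l] Suc Suc.prems unfolding r_def by (simp
        add: Suc_diff_Suc)
      \<comment> \<open>The previous joint replaces the horizontal image of \<open>x k\<close> by a
        vertical image of \<open>x l\<close>, and two consecutive vertical maps compose to
        zero.\<close>
      have "dh l r \<cdot> y = dv l r \<cdot> (dh l (Suc r) \<cdot> x k)"
        unfolding y_def using comm_dh_dv[of "x k" p l r] xk Suc r_def by simp
      also have "\<dots> = dv l r \<cdot> (dv l (Suc r) \<cdot> x l)" using x(2)[of l] Suc nl by simp
      also have "\<dots> = \<zero>\<^bsub>p,X l r\<^esub>" by (rule chase_zero(1)[OF xl])
      finally show ?thesis using chase_exactD(2)[OF bi_simps(5) bi_simps(2,2) p, of y l r] y Suc r_def by simp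
    qed
    then obtain w where w: "w \<in> Hom p (X (Suc k) (n - Suc k))" "dh k (n - Suc k) \<cdot> w = y" by blast
    show ?case
    proof (rule exI[of _ "x(Suc k := w)"], intro conjI allI impI)
      fix i assume "i \<le> Suc k" then show "(x(Suc k := w)) i \<in> Hom p (X i (n - i))" using x(1)[of i] w
        by (auto simp: le_Suc_eq)
    next
      fix i assume "i < Suc k" then show "dv i (n - Suc i) \<cdot> (x(Suc k := w)) i = dh i (n - Suc i)
        \<cdot> (x(Suc k := w)) (Suc i)"
        using x(2)[of i] w by (auto simp: less_Suc_eq y_def)
    qed (use x(3) in simp)
  qed
  from this[of n] show ?thesis unfolding zigzag_def by auto
qed

text \<open>Each entry \<open>x k\<close> is shown to be the sum of a vertical and a horizontal
  boundary; the point \<open>y'\<close> that bounds horizontally at one entry bounds vertically at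
  the next. At the last entry \<open>b\<close> kills the vertical part, and the horizontal part
  becomes a boundary in \<open>B\<close>.\<close>

lemma zigzag_boundary:
  assumes p: "projective C p" and z: "zigzag X dh dv n p x" and w: "w \<in> Hom p (A (Suc n))"
    "a n \<cdot> x 0 = da n \<cdot> w"
  shows "\<exists>v \<in> Hom p (B (Suc n)). b n \<cdot> x n = db n \<cdot> v"
proof -
  have x: "\<And>k. k \<le> n \<Longrightarrow> x k \<in> Hom p (X k (n - k))"
    "\<And>k. k < n \<Longrightarrow> dv k (n - Suc k) \<cdot> x k = dh k (n - Suc k) \<cdot> x (Suc k)"
    using z unfolding zigzag_def by auto
  have "\<exists>y \<in> Hom p (X k (Suc (n - k))). \<exists>y' \<in> Hom p (X (Suc k) (n - k)). x k \<ominus>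
    dv k (n - k) \<cdot> y = dh k (n - k) \<cdot> y'"
    if "k \<le> n" for k
    using that
  proof (induction k)
    case 0
    obtain y where y: "y \<in> Hom p (X 0 (Suc n))" "a (Suc n) \<cdot> y = w" using epi_lift[OF bi_simps(9,8)
      p w(1)] by blast
    have x0: "x 0 \<in> Hom p (X 0 n)" and dy: "dv 0 n \<cdot> y \<in> Hom p (X 0 n)" using x(1)[of 0]
      Cmp_homset[OF y(1) bi_simps(3)] by auto
    have "a n \<cdot> (x 0 \<ominus> dv 0 n \<cdot> y) = a n \<cdot> x 0 \<ominus> da n \<cdot> w"
      using hsub_distrib(1)[OF x0 dy bi_simps(8)] comm_a[OF y(1)] y(2) by simp
    also have "\<dots> = \<zero>\<^bsub>p,A n\<^esub>" using hsub_eq_zero_iff[OF Cmp_homset[OF x0 bi_simps(8)]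
      Cmp_homset[OF w(1) bi_simps(11)]] w(2) by simp
    finally obtain u where "u \<in> Hom p (X (Suc 0) n)" "dh 0 n \<cdot> u = x 0 \<ominus> dv 0 n \<cdot> y"
      using chase_exactD(2)[OF bi_simps(10) bi_simps(2,8) p hsub_Hom[OF x0 dy]] by blast
    then show ?case using y(1) by (intro bexI[of _ y] bexI[of _ u]) simp_all
  next
    case (Suc k)
    define r where "r = n - Suc k"
    have nk: "n - k = Suc r" using Suc.prems by (simp add: r_def)
    obtain y y' where y: "y \<in> Hom p (X k (Suc (Suc r)))" "y' \<in> Hom p (X (Suc k) (Suc r))"
       "x k \<ominus> dv k (Suc r) \<cdot> y = dh k (Suc r) \<cdot> y'" using Suc nk by auto
    have xk: "x k \<in> Hom p (X k (Suc r))" "x (Suc k) \<in> Hom p (X (Suc k) r)"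
      using x(1)[of k] x(1)[of "Suc k"] Suc.prems nk r_def by auto
    note h = Cmp_homset[OF y(1) bi_simps(3)] Cmp_homset[OF y(2) bi_simps(3)]
    have "dh k r \<cdot> x (Suc k) = dv k r \<cdot> x k" using x(2)[of k] Suc.prems r_def by simp
    also have "\<dots> = dv k r \<cdot> (x k \<ominus> dv k (Suc r) \<cdot> y)"
      using hsub_distrib(1)[OF xk(1) h(1) bi_simps(3)] chase_zero(1)[OF y(1)] hsub_zero[OF Cmp_homset[OF xk(1)
        bi_simps(3)]] by simp
    also have "\<dots> = dh k r \<cdot> (dv (Suc k) r \<cdot> y')" unfolding y(3) using comm_dh_dv[OF y(2)] by simp
    finally have "dh k r \<cdot> (x (Suc k) \<ominus> dv (Suc k) r \<cdot> y') = \<zero>\<^bsub>p,X k r\<^esub>"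
      using hsub_distrib(1)[OF xk(2) h(2) bi_simps(2)] hsub_eq_zero_iff[OF Cmp_homset[OF xk(2) bi_simps(2)]
        Cmp_homset[OF h(2) bi_simps(2)]] by simp
    then obtain y'' where y'': "y'' \<in> Hom p (X (Suc (Suc k)) r)"
      "dh (Suc k) r \<cdot> y'' = x (Suc k) \<ominus> dv (Suc k) r \<cdot> y'"
      using chase_exactD(2)[OF bi_simps(5) bi_simps(2,2) p hsub_Hom[OF xk(2) h(2)]] by blast
    then show ?case using y(2) r_def by (metis)
  qed
  from this[of n] obtain y y' where y: "y \<in> Hom p (X n (Suc 0))" "y' \<in> Hom p (X (Suc n) 0)"
    "x n \<ominus> dv n 0 \<cdot> y = dh n 0 \<cdot> y'" by auto
  have xn: "x n \<in> Hom p (X n 0)" using x(1)[of n] by simp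
  have "b n \<cdot> x n = b n \<cdot> (x n \<ominus> dv n 0 \<cdot> y)"
    using hsub_distrib(1)[OF xn Cmp_homset[OF y(1) bi_simps(3)] bi_simps(14)] chase_zero(4)[OF y(1)]
      hsub_zero[OF Cmp_homset[OF xn bi_simps(14)]] by simp
  also have "\<dots> = db n \<cdot> (b (Suc n) \<cdot> y')" unfolding y(3) using comm_b[OF y(2)] .
  finally show ?thesis using Cmp_homset[OF y(2) bi_simps(14)] by blast
qed

end

lemma zigzag_Cmp:
  assumes bi: "biresolution X dh dv A a da B b db" and "zigzag X dh dv n p x" "h \<in> Hom p' p"
  shows "zigzag X dh dv n p' (\<lambda>k. x k \<cdot> h)"
  unfolding zigzag_def
proof (intro conjI allI impI)
  fix k assume "k \<le> n" then show "x k \<cdot> h \<in> Hom p' (X k (n - k))" using assms Cmp_homset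
    unfolding zigzag_def by blast
next
  fix k assume k: "k < n"
  have h: "x k \<in> Hom p (X k (Suc (n - Suc k)))" "x (Suc k) \<in> Hom p (X (Suc k) (n - Suc k))"
     "dv k (n - Suc k) \<cdot> x k = dh k (n - Suc k) \<cdot> x (Suc k)"
    using assms(2) k unfolding zigzag_def by (auto simp: Suc_diff_Suc dest: spec[of _ k])
  show "dv k (n - Suc k) \<cdot> (x k \<cdot> h) = dh k (n - Suc k) \<cdot> (x (Suc k) \<cdot> h)"
    using Cmp_assoc[OF assms(3) h(1) bi_simps(3)[OF bi]] Cmp_assoc[OF assms(3) h(2) bi_simps(2)[OF bi]] h(3) by simp
qed

lemma zigzag_hsub:
  assumes bi: "biresolution X dh dv A a da B b db" and "zigzag X dh dv n p x" "zigzag X dh dv n p y"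
  shows "zigzag X dh dv n p (\<lambda>k. x k \<ominus> y k)"
  unfolding zigzag_def
proof (intro conjI allI impI)
  fix k assume "k \<le> n" then show "x k \<ominus> y k \<in> Hom p (X k (n - k))" using assms hsub_Hom
    unfolding zigzag_def by blast
next
  fix k assume k: "k < n"
  have *: "z k \<in> Hom p (X k (Suc (n - Suc k))) \<and> z (Suc k) \<in> Hom p (X (Suc k) (n - Suc k)) \<and>
     dv k (n - Suc k) \<cdot> z k = dh k (n - Suc k) \<cdot> z (Suc k)" if "zigzag X dh dv n p z" for z
    using that k unfolding zigzag_def by (auto simp: Suc_diff_Suc dest: spec[of _ k])
  note xx = *[OF assms(2)] note yy = *[OF assms(3)]
  show "dv k (n - Suc k) \<cdot> (x k \<ominus> y k) = dh k (n - Suc k) \<cdot> (x (Suc k) \<ominus> y (Suc k))"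
    using hsub_distrib(1)[OF _ _ bi_simps(3)[OF bi], of "x k" p k "n - Suc k" "y k"]
      hsub_distrib(1)[OF _ _ bi_simps(2)[OF bi], of "x (Suc k)" p k "n - Suc k" "y (Suc k)"] xx yy by simp
qed

text \<open>Classes in \<open>HA\<close> and \<open>HB\<close> are related when they are represented
  by the two ends of one zigzag. Starting a zigzag at a cycle gives totality, and carrying
  boundaries from one end to the other shows that zero is related only to zero. The direction from
  \<open>B\<close> to \<open>A\<close> uses the transposed double complex.\<close>

theorem balancing:
  assumes bi: "biresolution X dh dv A a da B b db"
    and HA: "is_homology C A da n HA" and HB: "is_homology C B db n HB"
  shows "isomorphic C HA HB"
proof -
  note s = bi_simps[OF bi]
  note bt = biresolution_transpose[OF bi]
  obtain ZA kA uA qA where A: "kA \<in> Hom ZA (A n)" "is_kernel C kA (outgoing C A da n)"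
    "uA \<in> Hom (A (Suc n)) ZA" "kA \<cdot> uA = da n"
    "qA \<in> Hom ZA HA" "is_cokernel C qA uA" by (rule is_homologyE[of A da n HA, OF s(7) s(11) HA])
  obtain ZB kB uB qB where B: "kB \<in> Hom ZB (B n)" "is_kernel C kB (outgoing C B db n)"
    "uB \<in> Hom (B (Suc n)) ZB" "kB \<cdot> uB = db n"
    "qB \<in> Hom ZB HB" "is_cokernel C qB uB" by (rule is_homologyE[of B db n HB, OF s(13) s(17) HB])
  obtain yA where yA: "outgoing C A da n \<in> Hom (A n) yA"
    "\<And>p z. z \<in> Hom p (A n) \<Longrightarrow> outgoing C A da n \<cdot> z =
      \<zero>\<^bsub>p,yA\<^esub> \<longleftrightarrow> (\<forall>m. n = Suc m \<longrightarrow> da m \<cdot>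
      z = \<zero>\<^bsub>p,A m\<^esub>)"
    using outgoing_Hom[of A da n, OF s(7) s(11)] by blast
  obtain yB where yB: "outgoing C B db n \<in> Hom (B n) yB"
    "\<And>p z. z \<in> Hom p (B n) \<Longrightarrow> outgoing C B db n \<cdot> z =
      \<zero>\<^bsub>p,yB\<^esub> \<longleftrightarrow> (\<forall>m. n = Suc m \<longrightarrow> db m \<cdot>
      z = \<zero>\<^bsub>p,B m\<^esub>)"
    using outgoing_Hom[of B db n, OF s(13) s(17)] by blast
  define R where "R p \<alpha> \<beta> \<longleftrightarrow> projective C p \<and> (\<exists>x u v. zigzag X
    dh dv n p x \<and> u \<in> Hom p ZA \<and> kA \<cdot> u = a n \<cdot> x 0 \<and> qA \<cdot> u = \<alpha>
     \<and> v \<in> Hom p ZB \<and> kB \<cdot> v = b n \<cdot> x n \<and> qB \<cdot> v =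
       \<beta>)" for p \<alpha> \<beta>
  have zx: "x 0 \<in> Hom p (X 0 n) \<and> x n \<in> Hom p (X n 0)" if "zigzag X dh dv n p x" for x p using
    that unfolding zigzag_def by auto
  \<comment> \<open>Boundaries are recognised after the monomorphism \<open>kB\<close>, where
    \<open>uB\<close> becomes \<open>db n\<close>; a cycle that bounds thus factors through
    \<open>uB\<close> and vanishes in \<open>HB\<close>.\<close>
  have bd: "v = uB \<cdot> w" if "v \<in> Hom p ZB" "w \<in> Hom p (B (Suc n))"
    "kB \<cdot> v = db n \<cdot> w" for p v w
  proof (rule mono_arrowD[OF kernel_mono[OF B(2)]])
    show "kB \<cdot> v = kB \<cdot> (uB \<cdot> w)" using that(3) Cmp_assoc[OF that(2) B(3,1)] B(4) by simp
  qed (use that(1,2) B(1,3) Cmp_homset[OF that(2) B(3)] in \<open>simp_all add: Hom_ArrD\<close>)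
  have ad: "v = uA \<cdot> w" if "v \<in> Hom p ZA" "w \<in> Hom p (A (Suc n))"
    "kA \<cdot> v = da n \<cdot> w" for p v w
  proof (rule mono_arrowD[OF kernel_mono[OF A(2)]])
    show "kA \<cdot> v = kA \<cdot> (uA \<cdot> w)" using that(3) Cmp_assoc[OF that(2) A(3,1)] A(4) by simp
  qed (use that(1,2) A(1,3) Cmp_homset[OF that(2) A(3)] in \<open>simp_all add: Hom_ArrD\<close>)
  show ?thesis
  proof (rule isomorphic_by_relation[of HA HB R])
    show "HA \<in> Obj C" "HB \<in> Obj C" using A B Hom_Obj by blast+
    fix p \<alpha> \<beta> assume Rp: "R p \<alpha> \<beta>"
    then obtain x u v where x: "zigzag X dh dv n p x" "u \<in> Hom p ZA" "kA \<cdot> u = a n \<cdot> x 0"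
      "qA \<cdot> u = \<alpha>" "v \<in> Hom p ZB" "kB \<cdot> v = b n \<cdot> x n" "qB \<cdot> v = \<beta>"
      unfolding R_def by blast
    have p: "projective C p" using Rp R_def by blast
    show "\<alpha> \<in> Hom p HA \<and> \<beta> \<in> Hom p HB" using Cmp_homset[OF x(2) A(5)] Cmp_homset[OF
      x(5) B(5)] x(4,7) by simp
    have x0: "x 0 \<in> Hom p (X 0 n)" "x n \<in> Hom p (X n 0)" using zx[OF x(1)] by auto
    show "R p' (\<alpha> \<cdot> h) (\<beta> \<cdot> h)" if "projective C p'" "h \<in> Hom p' p" for p' h
    proof -
      note h = that(2)
      have "kA \<cdot> (u \<cdot> h) = a n \<cdot> (x 0 \<cdot> h)"
        "kB \<cdot> (v \<cdot> h) = b n \<cdot> (x n \<cdot> h)"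
        by (rule comm_square[OF x(2) A(1) x0(1) s(8) x(3) h], rule comm_square[OF x(5) B(1) x0(2) s(14) x(6) h])
      moreover have "qA \<cdot> (u \<cdot> h) = \<alpha> \<cdot> h" "qB \<cdot> (v \<cdot> h) = \<beta> \<cdot> h"
        using Cmp_assoc[OF h x(2) A(5)] x(4) Cmp_assoc[OF h x(5) B(5)] x(7) by simp_all
      ultimately show ?thesis unfolding R_def
        using zigzag_Cmp[OF bi x(1) h] Cmp_homset[OF h x(2)] Cmp_homset[OF h x(5)] that(1) by blast
    qed
    show "R p (\<alpha> \<ominus> \<alpha>') (\<beta> \<ominus> \<beta>')" if R': "R p \<alpha>' \<beta>'" for
      \<alpha>' \<beta>'
    proof -
      obtain x' u' v' where x': "zigzag X dh dv n p x'" "u' \<in> Hom p ZA" "kA \<cdot> u' = a n \<cdot> x' 0"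
        "qA \<cdot> u' = \<alpha>'" "v' \<in> Hom p ZB" "kB \<cdot> v' = b n \<cdot> x' n" "qB \<cdot> v' = \<beta>'"
        using R' unfolding R_def by blast
      have x0': "x' 0 \<in> Hom p (X 0 n)" "x' n \<in> Hom p (X n 0)" using zx[OF x'(1)] by auto
      have "kA \<cdot> (u \<ominus> u') = a n \<cdot> (x 0 \<ominus> x' 0)"
        "kB \<cdot> (v \<ominus> v') = b n \<cdot> (x n \<ominus> x' n)"
        using hsub_distrib(1)[OF x(2) x'(2) A(1)] hsub_distrib(1)[OF x(5) x'(5) B(1)]
          hsub_distrib(1)[OF x0(1) x0'(1) s(8)] hsub_distrib(1)[OF x0(2) x0'(2) s(14)] x(3,6) x'(3,6) by simp_all
      moreover have "qA \<cdot> (u \<ominus> u') = \<alpha> \<ominus> \<alpha>'"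
        "qB \<cdot> (v \<ominus> v') = \<beta> \<ominus> \<beta>'"
        using hsub_distrib(1)[OF x(2) x'(2) A(5)] hsub_distrib(1)[OF x(5) x'(5) B(5)] x(4,7) x'(4,7) by simp_all
      ultimately show ?thesis unfolding R_def
        using zigzag_hsub[OF bi x(1) x'(1)] hsub_Hom[OF x(2) x'(2)] hsub_Hom[OF x(5) x'(5)] p by blast
    qed
  next
    fix p \<alpha> assume p: "projective C p" and al: "\<alpha> \<in> Hom p HA"
    obtain u where u: "u \<in> Hom p ZA" "qA \<cdot> u = \<alpha>" using epi_lift[OF cokernel_epi[OF A(6)]
      A(5) p al] by blast
    have "outgoing C A da n \<cdot> (kA \<cdot> u) = \<zero>\<^bsub>p,yA\<^esub>"
      using Cmp_assoc[OF u(1) A(1) yA(1)] kernel_zero[OF A(2,1) yA(1)] u(1) Hom_Obj[OF yA(1)] by (simp add: Hom_ArrD)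
    then obtain x where x: "zigzag X dh dv n p x" "a n \<cdot> x 0 = kA \<cdot> u"
      using zigzag_start[OF bi p Cmp_homset[OF u(1) A(1)]] yA(2)[OF Cmp_homset[OF u(1) A(1)]] by blast
    have bx: "b n \<cdot> x n \<in> Hom p (B n)" using zx[OF x(1)] s(14) Cmp_homset by blast
    have "outgoing C B db n \<cdot> (b n \<cdot> x n) = \<zero>\<^bsub>p,yB\<^esub>"
      unfolding yB(2)[OF bx] using zigzag_cycle[OF bt zigzag_transpose[OF x(1)]] by auto
    then obtain v where v: "v \<in> Hom p ZB" "kB \<cdot> v = b n \<cdot> x n" using kernel_lift[OF B(2,1)
      yB(1) bx] by blast
    show "\<exists>\<beta>. R p \<alpha> \<beta>"
      unfolding R_def by (intro exI conjI) (rule p x(1) u(1) x(2)[symmetric] u(2) v refl)+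
  next
    fix p \<beta> assume p: "projective C p" and be: "\<beta> \<in> Hom p HB"
    obtain v where v: "v \<in> Hom p ZB" "qB \<cdot> v = \<beta>" using epi_lift[OF cokernel_epi[OF B(6)] B(5)
      p be] by blast
    have "outgoing C B db n \<cdot> (kB \<cdot> v) = \<zero>\<^bsub>p,yB\<^esub>"
      using Cmp_assoc[OF v(1) B(1) yB(1)] kernel_zero[OF B(2,1) yB(1)] v(1) Hom_Obj[OF yB(1)] by (simp add: Hom_ArrD)
    then obtain x' where x': "zigzag (\<lambda>i j. X j i) (\<lambda>i j. dv j i) (\<lambda>i j. dh j i) n p
      x'" "b n \<cdot> x' 0 = kB \<cdot> v"
      using zigzag_start[OF bt p Cmp_homset[OF v(1) B(1)]] yB(2)[OF Cmp_homset[OF v(1) B(1)]] by blast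
    define x where "x k = x' (n - k)" for k
    have x: "zigzag X dh dv n p x" "b n \<cdot> x n = kB \<cdot> v" using zigzag_transpose[OF x'(1)] x'(2) by
      (simp_all add: x_def[abs_def])
    have ax: "a n \<cdot> x 0 \<in> Hom p (A n)" using zx[OF x(1)] s(8) Cmp_homset by blast
    have "outgoing C A da n \<cdot> (a n \<cdot> x 0) = \<zero>\<^bsub>p,yA\<^esub>"
      unfolding yA(2)[OF ax] using zigzag_cycle[OF bi x(1)] by auto
    then obtain u where u: "u \<in> Hom p ZA" "kA \<cdot> u = a n \<cdot> x 0" using kernel_lift[OF A(2,1)
      yA(1) ax] by blast
    show "\<exists>\<alpha>. R p \<alpha> \<beta>"
      unfolding R_def by (intro exI conjI) (rule p x(1) u(1) u(2) refl v(1) x(2)[symmetric] v(2))+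
  next
    fix p \<beta> assume "R p \<zero>\<^bsub>p,HA\<^esub> \<beta>"
    then obtain x u v where x: "projective C p" "zigzag X dh dv n p x" "u \<in> Hom p ZA"
      "kA \<cdot> u = a n \<cdot> x 0" "qA \<cdot> u = \<zero>\<^bsub>p,HA\<^esub>" "v \<in> Hom p ZB"
      "kB \<cdot> v = b n \<cdot> x n" "qB \<cdot> v = \<beta>"
      unfolding R_def by blast
    obtain w where w: "w \<in> Hom p (A (Suc n))" "uA \<cdot> w = u"
      using chase_exactD(2)[OF cokernel_chase_exact[OF A(6,5,3)] A(3,5) x(1,3,5)] by blast
    have "a n \<cdot> x 0 = da n \<cdot> w" using x(4) w(2) Cmp_assoc[OF w(1) A(3,1)] A(4) by simp
    then obtain t where t: "t \<in> Hom p (B (Suc n))" "b n \<cdot> x n = db n \<cdot> t" using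
      zigzag_boundary[OF bi x(1,2) w(1)] by blast
    have "v = uB \<cdot> t" using bd[OF x(6) t(1)] x(7) t(2) by simp
    then have "\<beta> = (qB \<cdot> uB) \<cdot> t" using x(8) Cmp_assoc[OF t(1) B(3,5)] by simp
    then show "\<beta> = \<zero>\<^bsub>p,HB\<^esub>" using cokernel_zero[OF B(6,5,3)] t(1) Hom_Obj[OF B(5)]
      by (simp add: Hom_ArrD)
  next
    fix p \<alpha> assume "R p \<alpha> \<zero>\<^bsub>p,HB\<^esub>"
    then obtain x u v where x: "projective C p" "zigzag X dh dv n p x" "u \<in> Hom p ZA"
      "kA \<cdot> u = a n \<cdot> x 0" "qA \<cdot> u = \<alpha>" "v \<in> Hom p ZB"
      "kB \<cdot> v = b n \<cdot> x n" "qB \<cdot> v = \<zero>\<^bsub>p,HB\<^esub>"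
      unfolding R_def by blast
    obtain w where w: "w \<in> Hom p (B (Suc n))" "uB \<cdot> w = v"
      using chase_exactD(2)[OF cokernel_chase_exact[OF B(6,5,3)] B(3,5) x(1,6,8)] by blast
    have "b n \<cdot> x n = db n \<cdot> w" using x(7) w(2) Cmp_assoc[OF w(1) B(3,1)] B(4) by simp
    then obtain t where t: "t \<in> Hom p (A (Suc n))" "a n \<cdot> x 0 = da n \<cdot> t"
      using zigzag_boundary[OF bt x(1) zigzag_transpose[OF x(2)] w(1)] by auto
    have "u = uA \<cdot> t" using ad[OF x(3) t(1)] x(4) t(2) by simp
    then have "\<alpha> = (qA \<cdot> uA) \<cdot> t" using x(5) Cmp_assoc[OF t(1) A(3,5)] by simp
    then show "\<alpha> = \<zero>\<^bsub>p,HA\<^esub>" using cokernel_zero[OF A(6,5,3)] t(1) Hom_Obj[OF A(5)]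
      by (simp add: Hom_ArrD)
  qed
qed

end

section \<open>Coherence and closedness\<close>

text \<open>Bracketing to the right hides the pair \<open>a \<cdot> b\<close> inside
  \<open>a \<cdot> (b \<cdot> h)\<close>. This rule applies a known equation there, \<open>h\<close>
  being the rest of the composite.\<close>

lemma (in category) post:
  assumes "a \<cdot> b = c" "a \<in> Arr C" "b \<in> Arr C" "Cod C b = Dom C a"
  shows "h \<in> Arr C \<Longrightarrow> Cod C h = Dom C b \<Longrightarrow> a \<cdot> (b \<cdot> h) = c \<cdot> h"
  using assms Cmp_assoc'[of h b a] by simp

context category
begin

lemma coproduct_Obj: "is_coproduct C I X Q \<iota> \<Longrightarrow> Q \<in> Obj C"
  and coproduct_Hom: "is_coproduct C I X Q \<iota> \<Longrightarrow> i \<in> I \<Longrightarrow> \<iota> i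
    \<in> Hom (X i) Q"
  unfolding is_coproduct_def by blast+

lemma coproduct_desc:
  assumes "is_coproduct C I X Q \<iota>" "y \<in> Obj C" "\<And>i. i \<in> I \<Longrightarrow> f i \<in> Hom (X i) y"
  shows "\<exists>u \<in> Hom Q y. \<forall>i\<in>I. u \<cdot> \<iota> i = f i"
  using assms unfolding is_coproduct_def by blast

lemma coproduct_eq:
  assumes "is_coproduct C I X Q \<iota>" "u \<in> Hom Q y" "u' \<in> Hom Q y"
    "\<And>i. i \<in> I \<Longrightarrow> u \<cdot> \<iota> i = u' \<cdot> \<iota> i"
  shows "u = u'"
proof -
  have "\<forall>i\<in>I. u \<cdot> \<iota> i \<in> Hom (X i) y" using coproduct_Hom[OF assms(1)]
    Cmp_homset[OF _ assms(2)] by blast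
  then have "\<exists>!w. w \<in> Hom Q y \<and> (\<forall>i\<in>I. w \<cdot> \<iota> i = u \<cdot> \<iota> i)"
    using assms(1) Hom_Obj(2)[OF assms(2)] unfolding is_coproduct_def by (elim conjE) (erule ballE, auto)
  then show ?thesis using assms(2-4) by (elim ex1E) metis
qed

lemma coproductI:
  assumes "Q \<in> Obj C" "\<And>i. i \<in> I \<Longrightarrow> \<iota> i \<in> Hom (X i) Q"
    "\<And>y f. y \<in> Obj C \<Longrightarrow> (\<And>i. i \<in> I \<Longrightarrow> f i \<in> Hom (X i) y)
      \<Longrightarrow> \<exists>u \<in> Hom Q y. \<forall>i\<in>I. u \<cdot> \<iota> i = f i"
    "\<And>y u u'. y \<in> Obj C \<Longrightarrow> u \<in> Hom Q y \<Longrightarrow> u' \<in> Hom Q y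
      \<Longrightarrow> (\<And>i. i \<in> I \<Longrightarrow> u \<cdot> \<iota> i = u' \<cdot> \<iota> i)
      \<Longrightarrow> u = u'"
  shows "is_coproduct C I X Q \<iota>"
  unfolding is_coproduct_def
proof (intro conjI ballI allI impI)
  fix y f assume y: "y \<in> Obj C" and f: "\<forall>i\<in>I. f i \<in> Hom (X i) y"
  obtain u where "u \<in> Hom Q y" "\<forall>i\<in>I. u \<cdot> \<iota> i = f i" using assms(3)[OF y, of f] f by blast
  then show "\<exists>!u. u \<in> Hom Q y \<and> (\<forall>i\<in>I. u \<cdot> \<iota> i = f i)" using
    assms(4)[OF y] by (intro ex1I[of _ u]) auto
qed (use assms in blast)+

end

section \<open>Unit coherence, reversal of three factors, and currying\<close>

context symmetric_closed_monoidal
begin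

lemma ten_Arr [simp]:
  assumes "f \<in> Arr V" "g \<in> Arr V"
  shows "f \<boxdot> g \<in> Arr V" "Dom V (f \<boxdot> g) = Dom V f \<boxtimes> Dom V g"
    "Cod V (f \<boxdot> g) = Cod V f \<boxtimes> Cod V g"
  using tenA_homset[of f "Dom V f" "Cod V f" g "Dom V g" "Cod V g"] assms by (auto simp: homset_def)

declare ten_Obj [simp] unt_Obj [simp] tenA_Ide [simp] asc_iso [simp] lun_iso [simp] run_iso [simp] iho_Obj [simp]

lemma structure_Arr [simp]:
  assumes "x \<in> Obj V"
  shows "lun V x \<in> Arr V" "Dom V (lun V x) = unt V \<boxtimes> x" "Cod V (lun V x) = x"
    "run V x \<in> Arr V" "Dom V (run V x) = x \<boxtimes> unt V" "Cod V (run V x) = x"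
    "y \<in> Obj V \<Longrightarrow> swp V x y \<in> Arr V" "y \<in> Obj V \<Longrightarrow> Dom V (swp V x y)
      = x \<boxtimes> y" "y \<in> Obj V \<Longrightarrow> Cod V (swp V x y) = y \<boxtimes> x"
    "y \<in> Obj V \<Longrightarrow> evl V x y \<in> Arr V" "y \<in> Obj V \<Longrightarrow> Dom V (evl V x y)
      = iho V x y \<boxtimes> x" "y \<in> Obj V \<Longrightarrow> Cod V (evl V x y) = y"
    "y \<in> Obj V \<Longrightarrow> z \<in> Obj V \<Longrightarrow> asc V x y z \<in> Arr V"
    "y \<in> Obj V \<Longrightarrow> z \<in> Obj V \<Longrightarrow> Dom V (asc V x y z) = (x \<boxtimes> y)
      \<boxtimes> z"
    "y \<in> Obj V \<Longrightarrow> z \<in> Obj V \<Longrightarrow> Cod V (asc V x y z) = x \<boxtimes> (y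
      \<boxtimes> z)"
  using lun_homset run_homset swp_homset evl_homset asc_homset assms by (auto simp: homset_def)

lemma swp_iso [simp]: "x \<in> Obj V \<Longrightarrow> y \<in> Obj V \<Longrightarrow> iso_arrow V (swp V x y)"
  using iso_arrowI[OF swp_homset swp_homset] swp_swp by blast

lemma interchange:
  "f \<in> Arr V \<Longrightarrow> f' \<in> Arr V \<Longrightarrow> g \<in> Arr V \<Longrightarrow> g' \<in>
    Arr V \<Longrightarrow> Cod V f = Dom V f' \<Longrightarrow> Cod V g = Dom V g'
    \<Longrightarrow> (f' \<boxdot> g') \<cdot> (f \<boxdot> g) = (f' \<cdot> f) \<boxdot> (g' \<cdot> g)"
  using tenA_Cmp[of f "Dom V f" "Cod V f" f' "Cod V f'" g "Dom V g" "Cod V g" g' "Cod V g'"] by (simp add: homset_def)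

lemma interchange':
  "f \<in> Arr V \<Longrightarrow> f' \<in> Arr V \<Longrightarrow> g \<in> Arr V \<Longrightarrow> g' \<in>
    Arr V \<Longrightarrow> Cod V f = Dom V f' \<Longrightarrow> Cod V g = Dom V g'
    \<Longrightarrow> h \<in> Arr V \<Longrightarrow> Cod V h = Dom V f \<boxtimes> Dom V g
    \<Longrightarrow> (f' \<boxdot> g') \<cdot> ((f \<boxdot> g) \<cdot> h) = ((f' \<cdot> f) \<boxdot> (g'
      \<cdot> g)) \<cdot> h"
  using post[OF interchange, of f f' g g' h] by simp

lemma asc_nat:
  "f \<in> Arr V \<Longrightarrow> g \<in> Arr V \<Longrightarrow> h \<in> Arr V \<Longrightarrow> x' = Cod V
    f \<Longrightarrow> y' = Cod V g \<Longrightarrow> z' = Cod V h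
   \<Longrightarrow> asc V x' y' z' \<cdot> ((f \<boxdot> g) \<boxdot> h) = (f \<boxdot> (g \<boxdot> h))
     \<cdot> asc V (Dom V f) (Dom V g) (Dom V h)"
  using asc_natural[of f "Dom V f" "Cod V f" g "Dom V g" "Cod V g" h "Dom V h" "Cod V h"] by (simp add: homset_def)

lemma lun_nat: "f \<in> Arr V \<Longrightarrow> x' = Cod V f \<Longrightarrow> lun V x' \<cdot> (Ide V (unt V)
  \<boxdot> f) = f \<cdot> lun V (Dom V f)"
  using lun_natural[of f "Dom V f" "Cod V f"] by (simp add: homset_def)

lemma run_nat: "f \<in> Arr V \<Longrightarrow> x' = Cod V f \<Longrightarrow> run V x' \<cdot> (f \<boxdot>
  Ide V (unt V)) = f \<cdot> run V (Dom V f)"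
  using run_natural[of f "Dom V f" "Cod V f"] by (simp add: homset_def)

lemma swp_nat: "f \<in> Arr V \<Longrightarrow> g \<in> Arr V \<Longrightarrow> x' = Cod V f \<Longrightarrow>
  y' = Cod V g
    \<Longrightarrow> swp V x' y' \<cdot> (f \<boxdot> g) = (g \<boxdot> f) \<cdot> swp V (Dom V f) (Dom V g)"
  using swp_natural[of f "Dom V f" "Cod V f" g "Dom V g" "Cod V g"] by (simp add: homset_def)

lemma iso_ten: assumes "iso_arrow V f" "iso_arrow V g" shows "iso_arrow V (f \<boxdot> g)"
  by (rule iso_arrowI[of _ "Dom V f \<boxtimes> Dom V g" "Cod V f \<boxtimes> Cod V g"
    "inv_arrow V f \<boxdot> inv_arrow V g"])
    (use assms in \<open>simp_all add: homset_def interchange\<close>)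

lemma iso_Ide [simp]: "x \<in> Obj V \<Longrightarrow> iso_arrow V (Ide V x)"
  by (rule iso_arrowI[OF Ide_Hom Ide_Hom]) simp_all

lemma iso_Cmp: assumes "iso_arrow V f" "iso_arrow V g" "Cod V f = Dom V g" shows "iso_arrow V (g \<cdot> f)"
  by (rule iso_arrowI[of _ "Dom V f" "Cod V g" "inv_arrow V f \<cdot> inv_arrow V g"])
    (use assms in \<open>simp_all add: homset_def\<close>)

text \<open>Naturality of \<open>run\<close> makes \<open>f \<boxdot> Ide V (unt V)\<close>
  conjugate to \<open>f\<close>, so tensoring with the unit is faithful. The coherence proofs below
  reach their equations tensored with the unit and cancel it in this way.\<close>

lemma unt_right_cancel:
  assumes "f \<in> Arr V" "g \<in> Arr V" "Dom V f = Dom V g" "Cod V f = Cod V g"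
    "f \<boxdot> Ide V (unt V) = g \<boxdot> Ide V (unt V)"
  shows "f = g"
proof -
  have "f \<cdot> run V (Dom V f) = g \<cdot> run V (Dom V f)" using run_nat[of f] run_nat[of g] assms by simp
  then show ?thesis by - (rule iso_epi_eq[of "run V (Dom V f)"], use assms in simp_all)
qed

lemma unt_left_cancel:
  assumes "f \<in> Arr V" "g \<in> Arr V" "Dom V f = Dom V g" "Cod V f = Cod V g"
    "Ide V (unt V) \<boxdot> f = Ide V (unt V) \<boxdot> g"
  shows "f = g"
proof -
  have "f \<cdot> lun V (Dom V f) = g \<cdot> lun V (Dom V f)" using lun_nat[of f] lun_nat[of g] assms by simp
  then show ?thesis by - (rule iso_epi_eq[of "lun V (Dom V f)"], use assms in simp_all)
qed

text \<open>Kelly's derivation of a unit law that is not among the axioms: the pentagon with two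
  leading units and two instances of the triangle give the equation tensored with the unit on the
  left, up to the isomorphism \<open>?p\<close>.\<close>

lemma lun_asc:
  assumes [simp]: "x \<in> Obj V" "y \<in> Obj V"
  shows "lun V (x \<boxtimes> y) \<cdot> asc V (unt V) x y = lun V x \<boxdot> Ide V y"
proof -
  let ?u = "unt V" let ?i = "Ide V"
  let ?p = "asc V ?u (?u \<boxtimes> x) y \<cdot> (asc V ?u ?u x \<boxdot> ?i y)"
  have pent: "(?i ?u \<boxdot> asc V ?u x y) \<cdot> ?p = asc V ?u ?u (x \<boxtimes> y) \<cdot> asc V (?u
    \<boxtimes> ?u) x y"
    by (rule pentagon[symmetric]) simp_all
  have "(?i ?u \<boxdot> (lun V (x \<boxtimes> y) \<cdot> asc V ?u x y)) \<cdot> ?p = (?i ?u \<boxdot> lun V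
    (x \<boxtimes> y)) \<cdot> ((?i ?u \<boxdot> asc V ?u x y) \<cdot> ?p)"
    by (simp add: interchange')
  also have "\<dots> = (run V ?u \<boxdot> ?i (x \<boxtimes> y)) \<cdot> asc V (?u \<boxtimes> ?u) x y"
    unfolding pent using post[OF triangle[of ?u "x \<boxtimes> y"], of "asc V (?u \<boxtimes> ?u) x y"] by simp
  also have "\<dots> = asc V ?u x y \<cdot> ((run V ?u \<boxdot> ?i x) \<boxdot> ?i y)"
    using asc_nat[of "run V ?u" "?i x" "?i y" ?u x y] by simp
  also have "\<dots> = asc V ?u x y \<cdot> (((?i ?u \<boxdot> lun V x) \<boxdot> ?i y) \<cdot> (asc V ?u ?u x
    \<boxdot> ?i y))"
    by (simp add: interchange triangle)
  also have "\<dots> = (?i ?u \<boxdot> (lun V x \<boxdot> ?i y)) \<cdot> ?p"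
    using post[OF asc_nat[of "?i ?u" "lun V x" "?i y" ?u x y], of "asc V ?u ?u x \<boxdot> ?i y"] by simp
  finally have "?i ?u \<boxdot> (lun V (x \<boxtimes> y) \<cdot> asc V ?u x y) = ?i ?u \<boxdot> (lun V x
    \<boxdot> ?i y)"
    by - (rule iso_epi_eq[of ?p], simp_all add: iso_Cmp iso_ten)
  then show ?thesis by - (rule unt_left_cancel, simp_all)
qed

text \<open>The mirror image of the preceding argument: the pentagon now ends in two units, and the
  equation appears tensored with the unit on the right.\<close>

lemma run_asc:
  assumes [simp]: "x \<in> Obj V" "y \<in> Obj V"
  shows "(Ide V x \<boxdot> run V y) \<cdot> asc V x y (unt V) = run V (x \<boxtimes> y)"
proof -
  let ?u = "unt V" let ?i = "Ide V"
  have pent: "asc V x y (?u \<boxtimes> ?u) \<cdot> asc V (x \<boxtimes> y) ?u ?u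
      = (?i x \<boxdot> asc V y ?u ?u) \<cdot> (asc V x (y \<boxtimes> ?u) ?u \<cdot> (asc V x y ?u \<boxdot> ?i ?u))"
    by (rule pentagon) simp_all
  have "asc V x y ?u \<cdot> (run V (x \<boxtimes> y) \<boxdot> ?i ?u) = asc V x y ?u \<cdot> ((?i (x
    \<boxtimes> y) \<boxdot> lun V ?u) \<cdot> asc V (x \<boxtimes> y) ?u ?u)"
    by (simp add: triangle)
  also have "\<dots> = (?i x \<boxdot> (?i y \<boxdot> lun V ?u)) \<cdot> (asc V x y (?u \<boxtimes> ?u)
    \<cdot> asc V (x \<boxtimes> y) ?u ?u)"
    using post[OF asc_nat[of "?i x" "?i y" "lun V ?u" x y ?u], of "asc V (x \<boxtimes> y) ?u ?u"] by simp
  also have "\<dots> = (?i x \<boxdot> (run V y \<boxdot> ?i ?u)) \<cdot> (asc V x (y \<boxtimes> ?u) ?u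
    \<cdot> (asc V x y ?u \<boxdot> ?i ?u))"
    unfolding pent by (simp add: interchange' triangle)
  also have "\<dots> = asc V x y ?u \<cdot> (((?i x \<boxdot> run V y) \<boxdot> ?i ?u) \<cdot> (asc V x y ?u
    \<boxdot> ?i ?u))"
    using post[OF asc_nat[of "?i x" "run V y" "?i ?u" x y ?u], of "asc V x y ?u \<boxdot> ?i ?u"] by simp
  also have "\<dots> = asc V x y ?u \<cdot> (((?i x \<boxdot> run V y) \<cdot> asc V x y ?u) \<boxdot> ?i ?u)"
    by (simp add: interchange)
  finally have "run V (x \<boxtimes> y) \<boxdot> ?i ?u = ((?i x \<boxdot> run V y) \<cdot> asc V x y ?u)
    \<boxdot> ?i ?u"
    by - (rule iso_mono_eq[of "asc V x y ?u"], simp_all)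
  then show ?thesis by - (rule unt_right_cancel, simp_all)
qed

text \<open>The hexagon is taken with two unit factors. Both of its sides, followed by
  \<open>lun\<close>, have \<open>swp V x ?u\<close> as their last factor; cancelling it leaves the
  claim tensored with the unit.\<close>

lemma lun_swp:
  assumes [simp]: "x \<in> Obj V"
  shows "lun V x \<cdot> swp V x (unt V) = run V x"
proof -
  let ?u = "unt V" let ?i = "Ide V"
  have hex: "asc V ?u ?u x \<cdot> (swp V x (?u \<boxtimes> ?u) \<cdot> asc V x ?u ?u)
            = (?i ?u \<boxdot> swp V x ?u) \<cdot> (asc V ?u x ?u \<cdot> (swp V x ?u \<boxdot> ?i ?u))"
    by (rule hexagon) simp_all
  have "lun V (?u \<boxtimes> x) \<cdot> (asc V ?u ?u x \<cdot> (swp V x (?u \<boxtimes> ?u) \<cdot> asc V x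
    ?u ?u)) = (lun V ?u \<boxdot> ?i x) \<cdot> (swp V x (?u \<boxtimes> ?u) \<cdot> asc V x ?u ?u)"
    using post[OF lun_asc[of ?u x], of "swp V x (?u \<boxtimes> ?u) \<cdot> asc V x ?u ?u"] by simp
  also have "\<dots> = swp V x ?u \<cdot> ((?i x \<boxdot> lun V ?u) \<cdot> asc V x ?u ?u)"
    using post[OF swp_nat[of "?i x" "lun V ?u" x ?u], of "asc V x ?u ?u"] by simp
  also have "\<dots> = swp V x ?u \<cdot> (run V x \<boxdot> ?i ?u)" by (simp add: triangle)
  finally have 1: "lun V (?u \<boxtimes> x) \<cdot> (asc V ?u ?u x \<cdot> (swp V x (?u \<boxtimes> ?u)
    \<cdot> asc V x ?u ?u)) = swp V x ?u \<cdot> (run V x \<boxdot> ?i ?u)" .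
  have "lun V (?u \<boxtimes> x) \<cdot> ((?i ?u \<boxdot> swp V x ?u) \<cdot> (asc V ?u x ?u \<cdot> (swp V x
    ?u \<boxdot> ?i ?u)))
      = swp V x ?u \<cdot> (lun V (x \<boxtimes> ?u) \<cdot> (asc V ?u x ?u \<cdot> (swp V x ?u \<boxdot> ?i ?u)))"
    using post[OF lun_nat[of "swp V x ?u" "?u \<boxtimes> x"], of
      "asc V ?u x ?u \<cdot> (swp V x ?u \<boxdot> ?i ?u)"] by simp
  also have "\<dots> = swp V x ?u \<cdot> ((lun V x \<boxdot> ?i ?u) \<cdot> (swp V x ?u \<boxdot> ?i ?u))"
    using post[OF lun_asc[of x ?u], of "swp V x ?u \<boxdot> ?i ?u"] by simp
  also have "\<dots> = swp V x ?u \<cdot> ((lun V x \<cdot> swp V x ?u) \<boxdot> ?i ?u)" by (simp add: interchange)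
  finally have "swp V x ?u \<cdot> (run V x \<boxdot> ?i ?u) = swp V x ?u \<cdot> ((lun V x \<cdot> swp V x
    ?u) \<boxdot> ?i ?u)"
    using 1 hex by metis
  then have "run V x \<boxdot> ?i ?u = (lun V x \<cdot> swp V x ?u) \<boxdot> ?i ?u"
    by - (rule iso_mono_eq[of "swp V x ?u"], simp_all)
  then show ?thesis by - (rule unt_right_cancel, simp_all)
qed

lemma run_swp: "x \<in> Obj V \<Longrightarrow> run V x \<cdot> swp V (unt V) x = lun V x"
  using lun_swp[of x] swp_swp[of "unt V" x] Cmp_assoc'[of "swp V (unt V) x" "swp V x (unt V)" "lun V x"] by simp

text \<open>This is what converts associativity of left actions into associativity of right actions.
  The hexagon axiom describes only a swap whose second argument is a product; the swap of
  \<open>x \<boxtimes> y\<close> past \<open>z\<close> in \<open>h3\<close> comes from inverting the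
  hexagon \<open>h2\<close>, as the symmetry is its own inverse.\<close>

lemma swp_reverse:
  assumes [simp]: "x \<in> Obj V" "y \<in> Obj V" "z \<in> Obj V"
  shows "asc V z y x \<cdot> ((swp V y z \<boxdot> Ide V x) \<cdot> (swp V x (y \<boxtimes> z) \<cdot> asc V x y z))
    = (Ide V z \<boxdot> swp V x y) \<cdot> swp V (x \<boxtimes> y) z"
proof -
  let ?i = "Ide V"
  have h1: "asc V z y x \<cdot> (swp V x (z \<boxtimes> y) \<cdot> asc V x z y) = (?i z \<boxdot> swp V x y)
    \<cdot> (asc V z x y \<cdot> (swp V x z \<boxdot> ?i y))"
    by (rule hexagon) simp_all
  have h2: "asc V x y z \<cdot> (swp V z (x \<boxtimes> y) \<cdot> asc V z x y) = (?i x \<boxdot> swp V z y)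
    \<cdot> (asc V x z y \<cdot> (swp V z x \<boxdot> ?i y))"
    by (rule hexagon) simp_all
  have h3: "swp V (x \<boxtimes> y) z = asc V z x y \<cdot> ((swp V x z \<boxdot> ?i y) \<cdot> (inv_arrow V
    (asc V x z y) \<cdot> ((?i x \<boxdot> swp V y z) \<cdot> asc V x y z)))"
    (is "_ = ?r")
  proof -
    let ?e = "swp V z (x \<boxtimes> y) \<cdot> asc V z x y"
    have sw: "(?i x \<boxdot> swp V y z) \<cdot> ((?i x \<boxdot> swp V z y) \<cdot> h) = h" if
      "h \<in> Arr V" "Cod V h = x \<boxtimes> (z \<boxtimes> y)" for h
      using that by (simp add: interchange' swp_swp)
    have "?r \<cdot> ?e = asc V z x y \<cdot> ((swp V x z \<boxdot> ?i y) \<cdot> (inv_arrow V (asc V x z y)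
      \<cdot> ((?i x \<boxdot> swp V y z) \<cdot> (asc V x y z \<cdot> ?e))))"
      by simp
    also have "\<dots> = asc V z x y \<cdot> ((swp V x z \<boxdot> ?i y) \<cdot> (swp V z x \<boxdot> ?i y))"
      unfolding h2 by (simp add: sw)
    also have "\<dots> = asc V z x y" by (simp add: interchange swp_swp)
    also have "\<dots> = swp V (x \<boxtimes> y) z \<cdot> ?e"
      using post[OF swp_swp[of z "x \<boxtimes> y"], of "asc V z x y"] by simp
    finally show ?thesis by - (rule iso_epi_eq[of ?e], simp_all add: iso_Cmp)
  qed
  have "asc V z y x \<cdot> ((swp V y z \<boxdot> ?i x) \<cdot> (swp V x (y \<boxtimes> z) \<cdot> asc V x y z))
     = asc V z y x \<cdot> (swp V x (z \<boxtimes> y) \<cdot> ((?i x \<boxdot> swp V y z) \<cdot> asc V x y z))"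
    using post[OF swp_nat[of "?i x" "swp V y z" x "z \<boxtimes> y"], of "asc V x y z"] by simp
  also have "\<dots> = (asc V z y x \<cdot> (swp V x (z \<boxtimes> y) \<cdot> asc V x z y)) \<cdot>
    (inv_arrow V (asc V x z y) \<cdot> ((?i x \<boxdot> swp V y z) \<cdot> asc V x y z))"
    by simp
  also have "\<dots> = (?i z \<boxdot> swp V x y) \<cdot> ?r" unfolding h1 by simp
  finally show ?thesis using h3 by simp
qed

abbreviation "cur \<equiv> curry_arrow V"

lemma closed':
  assumes "x \<in> Obj V" "z \<in> Obj V" "f \<in> Hom (z \<boxtimes> x) y"
  shows cur_Hom: "cur z x y f \<in> Hom z (iho V x y)" and evl_cur:
    "evl V x y \<cdot> (cur z x y f \<boxdot> Ide V x) = f"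
  using theI'[OF closed[OF assms(1) Hom_Obj(2)[OF assms(3)] assms(2,3)]] unfolding curry_arrow_def by auto

lemma uncurry_inj:
  assumes "x \<in> Obj V" "y \<in> Obj V" "g \<in> Hom z (iho V x y)" "g' \<in> Hom z (iho V x y)"
    "evl V x y \<cdot> (g \<boxdot> Ide V x) = evl V x y \<cdot> (g' \<boxdot> Ide V x)"
  shows "g = g'"
proof -
  have "evl V x y \<cdot> (g' \<boxdot> Ide V x) \<in> Hom (z \<boxtimes> x) y" using assms by (simp add: homset_def)
  then show ?thesis using closed[OF assms(1,2) Hom_Obj(1)[OF assms(3)]] assms(3-5) by metis
qed

lemma cur_Cmp:
  assumes "x \<in> Obj V" "f \<in> Hom (z \<boxtimes> x) y" "g \<in> Hom w z"
  shows "cur z x y f \<cdot> g = cur w x y (f \<cdot> (g \<boxdot> Ide V x))"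
proof -
  note z = Hom_Obj[OF assms(3)]
  have fg: "f \<cdot> (g \<boxdot> Ide V x) \<in> Hom (w \<boxtimes> x) y" using assms by (simp add: homset_def)
  note c = closed'[OF assms(1) z(2) assms(2)] closed'[OF assms(1) z(1) fg]
  show ?thesis
  proof (rule uncurry_inj[OF assms(1) Hom_Obj(2)[OF assms(2)] Cmp_homset[OF assms(3) c(1)] c(3)])
    have "evl V x y \<cdot> ((cur z x y f \<cdot> g) \<boxdot> Ide V x) = (evl V x y \<cdot> (cur z x y f
      \<boxdot> Ide V x)) \<cdot> (g \<boxdot> Ide V x)"
      using c(1) assms Hom_Obj(2)[OF assms(2)] by (simp add: homset_def interchange)
    then show "evl V x y \<cdot> ((cur z x y f \<cdot> g) \<boxdot> Ide V x) = evl V x y \<cdot> (cur w x y (f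
      \<cdot> (g \<boxdot> Ide V x)) \<boxdot> Ide V x)"
      unfolding c by simp
  qed
qed

text \<open>Tensoring with \<open>y\<close> is left adjoint to the inner hom: arrows out of the
  tensored coproduct are transposed, assembled or compared there by the universal property of
  \<open>Q\<close>, and transposed back.\<close>

lemma ten_coproduct:
  assumes Q: "is_coproduct V I X Q \<iota>" and y: "y \<in> Obj V"
  shows "is_coproduct V I (\<lambda>i. X i \<boxtimes> y) (Q \<boxtimes> y) (\<lambda>i. \<iota> i \<boxdot> Ide V y)"
proof (rule coproductI)
  note i = coproduct_Obj[OF Q] coproduct_Hom[OF Q]
  show "Q \<boxtimes> y \<in> Obj V" using i y by simp
  show "\<iota> i \<boxdot> Ide V y \<in> Hom (X i \<boxtimes> y) (Q \<boxtimes> y)" if "i \<in> I" for i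
    using tenA_homset[OF i(2)[OF that] Ide_Hom[OF y]] .
  fix w assume w: "w \<in> Obj V"
  show "\<exists>u \<in> Hom (Q \<boxtimes> y) w. \<forall>i\<in>I. u \<cdot> (\<iota> i \<boxdot> Ide V y) =
    f i" if f: "\<And>i. i \<in> I \<Longrightarrow> f i \<in> Hom (X i \<boxtimes> y) w" for f
  proof -
    have cf: "cur (X i) y w (f i) \<in> Hom (X i) (iho V y w)" if "i \<in> I" for i
      using cur_Hom[OF y Hom_Obj(1)[OF i(2)[OF that]] f[OF that]] .
    have "\<exists>u \<in> Hom Q (iho V y w). \<forall>i\<in>I. u \<cdot> \<iota> i = cur (X i) y w (f i)"
      by (rule coproduct_desc[OF Q iho_Obj[OF y w] cf])
    then obtain u where u: "u \<in> Hom Q (iho V y w)" "\<forall>i\<in>I. u \<cdot> \<iota> i = cur (X i) y w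
      (f i)" by blast
    have "(evl V y w \<cdot> (u \<boxdot> Ide V y)) \<cdot> (\<iota> j \<boxdot> Ide V y) = f j" if j: "j \<in> I" for j
    proof -
      have "(evl V y w \<cdot> (u \<boxdot> Ide V y)) \<cdot> (\<iota> j \<boxdot> Ide V y) = evl V y w
        \<cdot> ((u \<cdot> \<iota> j) \<boxdot> Ide V y)"
        using i(2)[OF j] u(1) y w by (simp add: homset_def interchange)
      then show ?thesis using u(2) j evl_cur[OF y Hom_Obj(1)[OF i(2)[OF j]] f[OF j]] by simp
    qed
    moreover have "evl V y w \<cdot> (u \<boxdot> Ide V y) \<in> Hom (Q \<boxtimes> y) w" using u(1) y w by
      (simp add: homset_def)
    ultimately show ?thesis by (intro bexI[of _ "evl V y w \<cdot> (u \<boxdot> Ide V y)"]) simp_all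
  qed
  fix u u' assume u: "u \<in> Hom (Q \<boxtimes> y) w" "u' \<in> Hom (Q \<boxtimes> y) w"
    "\<And>i. i \<in> I \<Longrightarrow> u \<cdot> (\<iota> i \<boxdot> Ide V y) = u' \<cdot> (\<iota> i
      \<boxdot> Ide V y)"
  have "cur Q y w u = cur Q y w u'"
  proof (rule coproduct_eq[OF Q cur_Hom[OF y i(1) u(1)] cur_Hom[OF y i(1) u(2)]])
    fix j assume j: "j \<in> I"
    show "cur Q y w u \<cdot> \<iota> j = cur Q y w u' \<cdot> \<iota> j"
      unfolding cur_Cmp[OF y u(1) i(2)[OF j]] cur_Cmp[OF y u(2) i(2)[OF j]] u(3)[OF j] ..
  qed
  then show "u = u'" using evl_cur[OF y i(1) u(1)] evl_cur[OF y i(1) u(2)] by metis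
qed

end

section \<open>Right exactness of the tensor product\<close>

locale abelian_monoidal = symmetric_closed_monoidal V + abelian_enough_projectives V
  for V :: "('o, 'a, 'z) moncat_scheme" (structure)
begin

notation zero ("\<zero>\<^bsub>_,_\<^esub>") and hsub (infixl "\<ominus>" 65)

text \<open>The zero arrow factors through a zero object \<open>z\<close>, and arrows out of
  \<open>z \<boxtimes> y\<close> correspond to arrows out of \<open>z\<close>, so there is only one
  for each target.\<close>

lemma ten_zero [simp]:
  assumes o: "x \<in> Obj V" "x' \<in> Obj V" "y \<in> Obj V"
  shows "\<zero>\<^bsub>x,x'\<^esub> \<boxdot> Ide V y = \<zero>\<^bsub>x \<boxtimes> y,x' \<boxtimes> y\<^esub>"
proof -
  obtain z g h where z: "zero_object V z" "g \<in> Hom x z" "h \<in> Hom z x'"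
    "\<zero>\<^bsub>x,x'\<^esub> = h \<cdot> g"
    using zero_is_zero[OF o(1,2)] o unfolding is_zero_arrow_def by auto
  have zo: "z \<in> Obj V" using z by (simp add: zero_object_def)
  have hy: "h \<boxdot> Ide V y \<in> Hom (z \<boxtimes> y) (x' \<boxtimes> y)" using tenA_homset[OF z(3)
    Ide_Hom[OF o(3)]] .
  have zy: "\<zero>\<^bsub>z \<boxtimes> y,x' \<boxtimes> y\<^esub> \<in> Hom (z \<boxtimes> y) (x'
    \<boxtimes> y)" using o zo by simp
  have "cur z y (x' \<boxtimes> y) (h \<boxdot> Ide V y) = cur z y (x' \<boxtimes> y) \<zero>\<^bsub>z
    \<boxtimes> y,x' \<boxtimes> y\<^esub>"
    using cur_Hom[OF o(3) zo hy] cur_Hom[OF o(3) zo zy] z(1) iho_Obj[OF o(3) ten_Obj[OF o(2,3)]] unfolding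
      zero_object_def by blast
  then have e: "h \<boxdot> Ide V y = \<zero>\<^bsub>z \<boxtimes> y,x' \<boxtimes> y\<^esub>" using
    evl_cur[OF o(3) zo hy] evl_cur[OF o(3) zo zy] by metis
  have "\<zero>\<^bsub>x,x'\<^esub> \<boxdot> Ide V y = (h \<boxdot> Ide V y) \<cdot> (g \<boxdot> Ide V y)"
    using z o by (simp add: homset_def interchange)
  then show ?thesis unfolding e using z(2) o by (simp add: homset_def)
qed

text \<open>The universal property of \<open>q\<close> is used for arrows into inner homs and
  transposed back. Through this, cokernels of module maps inherit an action.\<close>

lemma ten_cokernel:
  assumes q: "is_cokernel V q f" "q \<in> Hom b c" "f \<in> Hom a b" and y: "y \<in> Obj V"
  shows "is_cokernel V (q \<boxdot> Ide V y) (f \<boxdot> Ide V y)"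
proof -
  note o = Hom_Obj[OF q(2)] Hom_Obj[OF q(3)] y
  have h: "q \<boxdot> Ide V y \<in> Hom (b \<boxtimes> y) (c \<boxtimes> y)"
    "f \<boxdot> Ide V y \<in> Hom (a \<boxtimes> y) (b \<boxtimes> y)"
    using tenA_homset[OF q(2) Ide_Hom[OF y]] tenA_homset[OF q(3) Ide_Hom[OF y]] .
  have z: "(q \<boxdot> Ide V y) \<cdot> (f \<boxdot> Ide V y) = \<zero>\<^bsub>a \<boxtimes> y,c \<boxtimes> y\<^esub>"
    using q(2,3) o cokernel_zero[OF q] by (simp add: homset_def interchange)
  have curz: "cur a y v \<zero>\<^bsub>a \<boxtimes> y,v\<^esub> = \<zero>\<^bsub>a,iho V y v\<^esub>" if v:
    "v \<in> Obj V" for v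
    by (rule uncurry_inj[OF y v _ zero_Hom[OF o(3) iho_Obj[OF y v]]]) (use o v cur_Hom[OF y o(3), of
      "\<zero>\<^bsub>a \<boxtimes> y,v\<^esub>" v] evl_cur[OF y o(3), of
      "\<zero>\<^bsub>a \<boxtimes> y,v\<^esub>" v] in simp_all)
  have "\<exists>!u. u \<in> Hom (c \<boxtimes> y) v \<and> u \<cdot> (q \<boxdot> Ide V y) = t" if t:
    "t \<in> Hom (b \<boxtimes> y) v" "t \<cdot> (f \<boxdot> Ide V y) = \<zero>\<^bsub>a \<boxtimes>
    y,v\<^esub>" for v t
  proof -
    note v = Hom_Obj(2)[OF t(1)]
    have "cur b y v t \<cdot> f = \<zero>\<^bsub>a,iho V y v\<^esub>" using cur_Cmp[OF y t(1) q(3)] t(2)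
      curz[OF v] by simp
    then obtain u where u: "u \<in> Hom c (iho V y v)" "u \<cdot> q = cur b y v t" using cokernel_desc[OF q
      cur_Hom[OF y o(1) t(1)]] by blast
    show ?thesis
    proof (rule ex1I[of _ "evl V y v \<cdot> (u \<boxdot> Ide V y)"], intro conjI)
      show "evl V y v \<cdot> (u \<boxdot> Ide V y) \<in> Hom (c \<boxtimes> y) v" using u(1) y v by (simp
        add: homset_def)
      have "(evl V y v \<cdot> (u \<boxdot> Ide V y)) \<cdot> (q \<boxdot> Ide V y) = evl V y v \<cdot> ((u
        \<cdot> q) \<boxdot> Ide V y)"
        using u(1) q(2) y v by (simp add: homset_def interchange)
      then show "(evl V y v \<cdot> (u \<boxdot> Ide V y)) \<cdot> (q \<boxdot> Ide V y) = t" using u(2)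
        evl_cur[OF y o(1) t(1)] by metis
    next
      fix w assume w: "w \<in> Hom (c \<boxtimes> y) v \<and> w \<cdot> (q \<boxdot> Ide V y) = t"
      note wc = cur_Hom[OF y o(2) conjunct1[OF w]]
      have "cur c y v w \<cdot> q = u \<cdot> q" using cur_Cmp[OF y conjunct1[OF w] q(2)] w u(2) by simp
      then have "cur c y v w = u" by - (rule epi_arrowD[OF cokernel_epi[OF q(1)]], use wc u(1) q(2) in
        \<open>simp_all add: Hom_ArrD\<close>)
      then show "w = evl V y v \<cdot> (u \<boxdot> Ide V y)" using evl_cur[OF y o(2) conjunct1[OF w]] by metis
    qed
  qed
  then show ?thesis unfolding is_cokernel_iff[OF h] using z by blast
qed

end

section \<open>Modules as right actions\<close>

context symmetric_closed_monoidal
begin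

lemma iso_epi_iff:
  assumes "iso_arrow V e" "f \<in> Arr V" "g \<in> Arr V" "Dom V f = Cod V e" "Dom V g = Cod V e"
  shows "f = g \<longleftrightarrow> f \<cdot> e = g \<cdot> e"
  using iso_epi_eq[OF assms] by auto

text \<open>The two laws differ by precomposition with \<open>?E\<close>, the total reversal of the
  three factors, which is an isomorphism. The four arrows are kept general because the equivalence
  serves both module actions, where the \<open>L\<close> act on objects, and composition itself,
  where all four are instances of \<open>eCmp\<close>.\<close>

lemma reverse_assoc:
  assumes o [simp]: "x \<in> Obj V" "y \<in> Obj V" "z \<in> Obj V"
    and L: "L1 \<in> Hom (y \<boxtimes> x) x1" "L2 \<in> Hom (z \<boxtimes> x1) w"
      "L3 \<in> Hom (t \<boxtimes> x) w" "m \<in> Hom (z \<boxtimes> y) t"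
  shows "(L2 \<cdot> swp V x1 z) \<cdot> ((L1 \<cdot> swp V x y) \<boxdot> Ide V z) = (L3 \<cdot> swp V x t)
    \<cdot> ((Ide V x \<boxdot> (m \<cdot> swp V y z)) \<cdot> asc V x y z)
    \<longleftrightarrow> L3 \<cdot> (m \<boxdot> Ide V x) = L2 \<cdot> ((Ide V z \<boxdot> L1) \<cdot> asc V z y x)"
proof -
  note [simp] = Hom_ArrD[OF L(1)] Hom_ArrD[OF L(2)] Hom_ArrD[OF L(3)] Hom_ArrD[OF L(4)] Hom_Obj[OF L(1)]
    Hom_Obj[OF L(2)] Hom_Obj[OF L(3)] Hom_Obj[OF L(4)]
  let ?E = "(swp V y z \<boxdot> Ide V x) \<cdot> (swp V x (y \<boxtimes> z) \<cdot> asc V x y z)"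
  have "(L2 \<cdot> swp V x1 z) \<cdot> ((L1 \<cdot> swp V x y) \<boxdot> Ide V z) = L2 \<cdot> (swp V x1 z
    \<cdot> ((L1 \<cdot> swp V x y) \<boxdot> Ide V z))" by simp
  also have "\<dots> = L2 \<cdot> ((Ide V z \<boxdot> (L1 \<cdot> swp V x y)) \<cdot> swp V (x \<boxtimes> y) z)"
    using swp_nat[of "L1 \<cdot> swp V x y" "Ide V z" x1 z] by simp
  also have "\<dots> = L2 \<cdot> ((Ide V z \<boxdot> L1) \<cdot> ((Ide V z \<boxdot> swp V x y) \<cdot> swp V
    (x \<boxtimes> y) z))"
    by (simp add: interchange')
  also have "\<dots> = (L2 \<cdot> ((Ide V z \<boxdot> L1) \<cdot> asc V z y x)) \<cdot> ?E"
    unfolding swp_reverse[OF o, symmetric] by simp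
  finally have 1: "(L2 \<cdot> swp V x1 z) \<cdot> ((L1 \<cdot> swp V x y) \<boxdot> Ide V z) = (L2 \<cdot>
    ((Ide V z \<boxdot> L1) \<cdot> asc V z y x)) \<cdot> ?E" .
  have "(L3 \<cdot> swp V x t) \<cdot> ((Ide V x \<boxdot> (m \<cdot> swp V y z)) \<cdot> asc V x y z) = L3
    \<cdot> ((swp V x t \<cdot> (Ide V x \<boxdot> (m \<cdot> swp V y z))) \<cdot> asc V x y z)"
    by simp
  also have "\<dots> = L3 \<cdot> ((((m \<cdot> swp V y z) \<boxdot> Ide V x) \<cdot> swp V x (y \<boxtimes>
    z)) \<cdot> asc V x y z)"
    using swp_nat[of "Ide V x" "m \<cdot> swp V y z" x t] by simp
  also have "\<dots> = (L3 \<cdot> (m \<boxdot> Ide V x)) \<cdot> ?E"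
    by (simp add: interchange')
  finally have 2: "(L3 \<cdot> swp V x t) \<cdot> ((Ide V x \<boxdot> (m \<cdot> swp V y z)) \<cdot> asc V x y
    z) = (L3 \<cdot> (m \<boxdot> Ide V x)) \<cdot> ?E" .
  have E: "iso_arrow V ?E" by (simp add: iso_Cmp iso_ten)
  show ?thesis unfolding 1 2
  proof
    assume "(L2 \<cdot> ((Ide V z \<boxdot> L1) \<cdot> asc V z y x)) \<cdot> ?E = (L3 \<cdot> (m \<boxdot>
      Ide V x)) \<cdot> ?E"
    then show "L3 \<cdot> (m \<boxdot> Ide V x) = L2 \<cdot> ((Ide V z \<boxdot> L1) \<cdot> asc V z y x)"
      by - (rule iso_epi_eq[OF E, symmetric], simp_all)
  qed simp
qed

lemma reverse_unit:
  assumes o [simp]: "x \<in> Obj V" and L: "L \<in> Hom (y \<boxtimes> x) w" "i \<in> Hom (unt V) y"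
  shows "(L \<cdot> swp V x y) \<cdot> (Ide V x \<boxdot> i) = L \<cdot> (i \<boxdot> Ide V x) \<cdot> swp V x (unt V)"
proof -
  note [simp] = Hom_ArrD[OF L(1)] Hom_ArrD[OF L(2)] Hom_Obj[OF L(1)] Hom_Obj[OF L(2)]
  show ?thesis using swp_nat[of "Ide V x" i x y] by simp
qed

lemma cancel_swp: "f \<in> Hom (x \<boxtimes> y) w \<Longrightarrow> x \<in> Obj V \<Longrightarrow> y \<in>
  Obj V \<Longrightarrow> f \<cdot> swp V y x \<cdot> swp V x y = f"
  by (simp add: homset_def swp_swp)

abbreviation "unc x y g \<equiv> evl V x y \<cdot> (g \<boxdot> Ide V x)"

lemma unc_Hom: "x \<in> Obj V \<Longrightarrow> y \<in> Obj V \<Longrightarrow> g \<in> Hom w (iho V x y)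
  \<Longrightarrow> unc x y g \<in> Hom (w \<boxtimes> x) y"
  by (simp add: homset_def)

lemma unc_Cmp:
  assumes "x \<in> Obj V" "y \<in> Obj V" "g \<in> Hom w (iho V x y)" "h \<in> Hom v w"
  shows "unc x y (g \<cdot> h) = unc x y g \<cdot> (h \<boxdot> Ide V x)"
  using assms by (simp add: homset_def interchange)

lemma cur_unc:
  assumes "x \<in> Obj V" "y \<in> Obj V" "g \<in> Hom w (iho V x y)"
  shows "cur w x y (unc x y g) = g"
  by (rule uncurry_inj[OF assms(1,2) cur_Hom[OF assms(1) Hom_Obj(1)[OF assms(3)] unc_Hom[OF assms]] assms(3)])
    (rule evl_cur[OF assms(1) Hom_Obj(1)[OF assms(3)] unc_Hom[OF assms]])

lemma self_simps [simp]: "eObj (self_enriched V) = Obj V" "eHom (self_enriched V) = iho V"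
  by (simp_all add: self_enriched_def)

lemma self_Cmp_Hom:
  assumes "x \<in> Obj V" "y \<in> Obj V" "z \<in> Obj V"
  shows "eCmp (self_enriched V) x y z \<in> Hom (iho V y z \<boxtimes> iho V x y) (iho V x z)"
  unfolding self_enriched_def using assms by (simp, intro cur_Hom) (simp_all add: homset_def)

text \<open>Composition in the self-enriched category is by definition the transpose of iterated
  evaluation; transposed back, a composite evaluates \<open>f\<close> first and \<open>g\<close>
  afterwards.\<close>

lemma unc_self_Cmp:
  assumes o [simp]: "x \<in> Obj V" "y \<in> Obj V" "z \<in> Obj V" and g: "g \<in> Hom w (iho V y z)" and f:
    "f \<in> Hom v (iho V x y)"
  shows "unc x z (eCmp (self_enriched V) x y z \<cdot> (g \<boxdot> f)) = unc y z g \<cdot> ((Ide V w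
    \<boxdot> unc x y f) \<cdot> asc V w v x)"
proof -
  note [simp] = Hom_ArrD[OF f] Hom_ArrD[OF g] Hom_Obj[OF f] Hom_Obj[OF g]
  let ?e = "evl V y z \<cdot> ((Ide V (iho V y z) \<boxdot> evl V x y) \<cdot> asc V (iho V y z) (iho V x y) x)"
  have e: "?e \<in> Hom ((iho V y z \<boxtimes> iho V x y) \<boxtimes> x) z" by (simp add: homset_def)
  have "unc x z (eCmp (self_enriched V) x y z \<cdot> (g \<boxdot> f)) = unc x z (eCmp (self_enriched V) x y
    z) \<cdot> ((g \<boxdot> f) \<boxdot> Ide V x)"
    by (rule unc_Cmp[OF o(1,3) self_Cmp_Hom[OF o] tenA_homset[OF g f]])
  also have "unc x z (eCmp (self_enriched V) x y z) = ?e"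
    using evl_cur[OF o(1) _ e] by (simp add: self_enriched_def)
  also have "?e \<cdot> ((g \<boxdot> f) \<boxdot> Ide V x) = evl V y z \<cdot> ((Ide V (iho V y z) \<boxdot>
    evl V x y) \<cdot> (asc V (iho V y z) (iho V x y) x \<cdot> ((g \<boxdot> f) \<boxdot> Ide V x)))"
    by simp
  also have "\<dots> = evl V y z \<cdot> ((Ide V (iho V y z) \<boxdot> evl V x y) \<cdot> ((g \<boxdot> (f
    \<boxdot> Ide V x)) \<cdot> asc V w v x))"
    using asc_nat[of g f "Ide V x" "iho V y z" "iho V x y" x] by simp
  also have "\<dots> = unc y z g \<cdot> ((Ide V w \<boxdot> unc x y f) \<cdot> asc V w v x)"
    by (simp add: interchange')
  finally show ?thesis .
qed

lemma self_Ide: "x \<in> Obj V \<Longrightarrow> eIde (self_enriched V) x = cur (unt V) x x (lun V x)"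
  by (simp add: self_enriched_def)

lemma lun_Hom [simp]: "x \<in> Obj V \<Longrightarrow> lun V x \<in> Hom (unt V \<boxtimes> x) x"
  by (rule lun_homset)

lemma self_Ide_Hom: "x \<in> Obj V \<Longrightarrow> eIde (self_enriched V) x \<in> Hom (unt V) (iho V x x)"
  and unc_self_Ide: "x \<in> Obj V \<Longrightarrow> unc x x (eIde (self_enriched V) x) = lun V x"
  using cur_Hom[OF _ unt_Obj lun_Hom, of x] evl_cur[OF _ unt_Obj lun_Hom, of x] self_Ide by simp_all

end

section \<open>Enriched functors into the cosmos as right modules\<close>

locale module_setting = abelian_monoidal V + enriched_category V C
  for V :: "('o, 'a, 'z) moncat_scheme" (structure) and C :: "('c, 'o, 'a) ecat"
begin

notation zero ("\<zero>\<^bsub>_,_\<^esub>") and hsub (infixl "\<ominus>" 65)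

abbreviation "\<C> \<equiv> eHom C"
abbreviation "Ob \<equiv> eObj C"
abbreviation "Mod \<equiv> Mod_cat V C"
abbreviation "act \<equiv> mod_action V C"

text \<open>Composition in diagrammatic order. It agrees with the order of the hom factors in a bar
  summand and is the multiplication for which covariant functors are right modules.\<close>

definition "\<kappa> a b c = eCmp C a b c \<cdot> swp V (\<C> a b) (\<C> b c)"

declare eHom_Obj [simp]

lemma kappa_Hom: "a \<in> Ob \<Longrightarrow> b \<in> Ob \<Longrightarrow> c \<in> Ob \<Longrightarrow>
  \<kappa> a b c \<in> Hom (\<C> a b \<boxtimes> \<C> b c) (\<C> a c)"
  unfolding \<kappa>_def using Cmp_homset[OF swp_homset eCmp_homset] eHom_Obj by blast

lemma kappa_assoc:
  assumes "a \<in> Ob" "b \<in> Ob" "c \<in> Ob" "d \<in> Ob"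
  shows "\<kappa> a c d \<cdot> (\<kappa> a b c \<boxdot> Ide V (\<C> c d)) = \<kappa> a b d \<cdot> ((Ide V
    (\<C> a b) \<boxdot> \<kappa> b c d) \<cdot> asc V (\<C> a b) (\<C> b c) (\<C> c d))"
  unfolding \<kappa>_def
  by (subst reverse_assoc[OF _ _ _ eCmp_homset eCmp_homset eCmp_homset eCmp_homset]) (use assms eCmp_assoc in simp_all)

lemma kappa_unit:
  assumes "a \<in> Ob" "b \<in> Ob"
  shows "\<kappa> a b b \<cdot> (Ide V (\<C> a b) \<boxdot> eIde C b) = run V (\<C> a b)"
    and "\<kappa> a a b \<cdot> (eIde C a \<boxdot> Ide V (\<C> a b)) = lun V (\<C> a b)"
proof -
  note h = Hom_ArrD[OF eCmp_homset[OF assms(1,2,2)]] Hom_ArrD[OF eCmp_homset[OF assms(1,1,2)]]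
    Hom_ArrD[OF eIde_homset[OF assms(1)]] Hom_ArrD[OF eIde_homset[OF assms(2)]]
  show "\<kappa> a b b \<cdot> (Ide V (\<C> a b) \<boxdot> eIde C b) = run V (\<C> a b)"
    unfolding \<kappa>_def
    using reverse_unit[OF _ eCmp_homset[OF assms(1,2,2)] eIde_homset[OF assms(2)]] eCmp_eIde_left[OF assms]
      lun_swp assms by simp
  have "\<kappa> a a b \<cdot> (eIde C a \<boxdot> Ide V (\<C> a b)) = eCmp C a a b \<cdot> ((Ide V (\<C> a b)
    \<boxdot> eIde C a) \<cdot> swp V (unt V) (\<C> a b))"
    unfolding \<kappa>_def using swp_nat[of "eIde C a" "Ide V (\<C> a b)" "\<C> a a" "\<C> a b"] h assms by simp
  also have "\<dots> = lun V (\<C> a b)"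
    using post[OF eCmp_eIde_right[OF assms], of "swp V (unt V) (\<C> a b)"] run_swp[of "\<C> a b"] h assms by simp
  finally show "\<kappa> a a b \<cdot> (eIde C a \<boxdot> Ide V (\<C> a b)) = lun V (\<C> a b)" .
qed

text \<open>Unit and associativity law of a right module, bracketed as in the bar summands. Only
  values at objects of \<open>C\<close> matter, so families may be arbitrary elsewhere.\<close>

definition rmod :: "('c \<Rightarrow> 'o) \<Rightarrow> ('c \<Rightarrow> 'c \<Rightarrow> 'a) \<Rightarrow> bool" where
  "rmod X \<rho> \<longleftrightarrow> (\<forall>a\<in>Ob. X a \<in> Obj V) \<and> (\<forall>a\<in>Ob.
    \<forall>b\<in>Ob. \<rho> a b \<in> Hom (X a \<boxtimes> \<C> a b) (X b))
    \<and> (\<forall>a\<in>Ob. \<rho> a a \<cdot> (Ide V (X a) \<boxdot> eIde C a) = run V (X a))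
    \<and> (\<forall>a\<in>Ob. \<forall>b\<in>Ob. \<forall>c\<in>Ob. \<rho> b c \<cdot> (\<rho> a b \<boxdot>
      Ide V (\<C> b c))
        = \<rho> a c \<cdot> ((Ide V (X a) \<boxdot> \<kappa> a b c) \<cdot> asc V (X a) (\<C> a b) (\<C> b c)))"

lemma rmodD:
  assumes "rmod X \<rho>" "a \<in> Ob" "b \<in> Ob"
  shows "X a \<in> Obj V" "\<rho> a b \<in> Hom (X a \<boxtimes> \<C> a b) (X b)"
    "\<rho> a a \<cdot> (Ide V (X a) \<boxdot> eIde C a) = run V (X a)"
    "c \<in> Ob \<Longrightarrow> \<rho> b c \<cdot> (\<rho> a b \<boxdot> Ide V (\<C> b c)) = \<rho> a c
      \<cdot> ((Ide V (X a) \<boxdot> \<kappa> a b c) \<cdot> asc V (X a) (\<C> a b) (\<C> b c))"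
  using assms unfolding rmod_def by auto

text \<open>The right action is swapped to a left one before it is transposed, undoing
  \<open>mod_action\<close>. The bounded abstractions provide the value \<open>undefined\<close> off
  the objects that enriched functors must have.\<close>

definition mk_mod :: "('c \<Rightarrow> 'o) \<Rightarrow> ('c \<Rightarrow> 'c \<Rightarrow> 'a) \<Rightarrow>
  ('c, 'o, 'a) efunc" where
  "mk_mod X \<rho> = \<lparr>EO = (\<lambda>c\<in>Ob. X c), EA = (\<lambda>a\<in>Ob. \<lambda>b\<in>Ob. cur
    (\<C> a b) (X a) (X b) (\<rho> a b \<cdot> swp V (\<C> a b) (X a)))\<rparr>"

lemma Mod_Obj: "M \<in> Obj Mod \<longleftrightarrow> enriched_functor V C (self_enriched V) M"
  by (simp add: Mod_cat_def enriched_functor_category_def)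

text \<open>Both functor axioms are equations between arrows into inner homs and may be checked
  after transposing. There they say that \<open>L\<close> is a unital and associative left action,
  which the symmetry turns into the right action \<open>act M\<close>.\<close>

lemma functor_iff:
  assumes X: "\<And>a. a \<in> Ob \<Longrightarrow> EO M a \<in> Obj V"
    and A: "\<And>a b. a \<in> Ob \<Longrightarrow> b \<in> Ob \<Longrightarrow> EA M a b \<in> Hom (\<C> a b)
      (iho V (EO M a) (EO M b))"
  shows "(\<forall>a\<in>Ob. EA M a a \<cdot> eIde C a = eIde (self_enriched V) (EO M a)) \<and>
     (\<forall>a\<in>Ob. \<forall>b\<in>Ob. \<forall>c\<in>Ob. EA M a c \<cdot> eCmp C a b c
          = eCmp (self_enriched V) (EO M a) (EO M b) (EO M c) \<cdot> (EA M b c \<boxdot> EA M a b))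
    \<longleftrightarrow> rmod (EO M) (act M)"
proof -
  define L where "L a b = unc (EO M a) (EO M b) (EA M a b)" for a b
  have L: "L a b \<in> Hom (\<C> a b \<boxtimes> EO M a) (EO M b)" if "a \<in> Ob" "b \<in> Ob" for a b
    unfolding L_def using unc_Hom[OF X[OF that(1)] X[OF that(2)] A[OF that]] .
  have act: "act M a b = L a b \<cdot> swp V (EO M a) (\<C> a b)" if "a \<in> Ob" "b \<in> Ob" for a b
    unfolding mod_action_def L_def using Hom_ArrD[OF A[OF that]] X that by simp
  have actH: "act M a b \<in> Hom (EO M a \<boxtimes> \<C> a b) (EO M b)" if "a \<in> Ob" "b \<in> Ob" for a b
    unfolding act[OF that] using Cmp_homset[OF swp_homset L] X that by simp
  have 1: "EA M a a \<cdot> eIde C a = eIde (self_enriched V) (EO M a) \<longleftrightarrow> act M a a \<cdot>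
    (Ide V (EO M a) \<boxdot> eIde C a) = run V (EO M a)"
    if a: "a \<in> Ob" for a
  proof -
    note xa [simp] = X[OF a]
    note e = eIde_homset[OF a]
    note Le = tenA_homset[OF e Ide_Hom[OF xa]]
    have "EA M a a \<cdot> eIde C a = eIde (self_enriched V) (EO M a) \<longleftrightarrow> L a a \<cdot>
      (eIde C a \<boxdot> Ide V (EO M a)) = lun V (EO M a)"
      using uncurry_inj[OF xa xa Cmp_homset[OF e A[OF a a]] self_Ide_Hom[OF xa]]
      unfolding unc_Cmp[OF xa xa A[OF a a] e] unc_self_Ide[OF xa] L_def by (metis unc_Cmp[OF xa xa A[OF a a]
        e] unc_self_Ide[OF xa])
    also have "\<dots> \<longleftrightarrow> (L a a \<cdot> (eIde C a \<boxdot> Ide V (EO M a))) \<cdot> swp V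
      (EO M a) (unt V) = lun V (EO M a) \<cdot> swp V (EO M a) (unt V)" (is "?l = ?r \<longleftrightarrow> _")
      by (rule iso_epi_iff) (use Hom_ArrD[OF L[OF a a]] Hom_ArrD[OF e] a in simp_all)
    also have "\<dots> \<longleftrightarrow> act M a a \<cdot> (Ide V (EO M a) \<boxdot> eIde C a) = run V (EO M a)"
      unfolding act[OF a a] reverse_unit[OF xa L[OF a a] e] lun_swp[OF xa] ..
    finally show ?thesis .
  qed
  have 2: "EA M a c \<cdot> eCmp C a b c = eCmp (self_enriched V) (EO M a) (EO M b) (EO M c) \<cdot> (EA M b c
    \<boxdot> EA M a b)
     \<longleftrightarrow> act M b c \<cdot> (act M a b \<boxdot> Ide V (\<C> b c)) = act M a c \<cdot> ((Ide
       V (EO M a) \<boxdot> \<kappa> a b c) \<cdot> asc V (EO M a) (\<C> a b) (\<C> b c))"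
    if abc: "a \<in> Ob" "b \<in> Ob" "c \<in> Ob" for a b c
  proof -
    note x = X[OF abc(1)] X[OF abc(2)] X[OF abc(3)]
    note AA = A[OF abc(2,3)] A[OF abc(1,2)] A[OF abc(1,3)]
    note e = eCmp_homset[OF abc]
    have u: "unc (EO M a) (EO M c) (EA M a c \<cdot> eCmp C a b c) = L a c \<cdot> (eCmp C a b c \<boxdot> Ide
      V (EO M a))"
      unfolding L_def by (rule unc_Cmp[OF x(1,3) AA(3) e])
    have u': "unc (EO M a) (EO M c) (eCmp (self_enriched V) (EO M a) (EO M b) (EO M c) \<cdot> (EA M b c
      \<boxdot> EA M a b))
       = L b c \<cdot> ((Ide V (\<C> b c) \<boxdot> L a b) \<cdot> asc V (\<C> b c) (\<C> a b) (EO M a))"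
      unfolding L_def by (rule unc_self_Cmp[OF x AA(1,2)])
    have "EA M a c \<cdot> eCmp C a b c = eCmp (self_enriched V) (EO M a) (EO M b) (EO M c) \<cdot> (EA M b c
      \<boxdot> EA M a b)
      \<longleftrightarrow> L a c \<cdot> (eCmp C a b c \<boxdot> Ide V (EO M a)) = L b c \<cdot> ((Ide V
        (\<C> b c) \<boxdot> L a b) \<cdot> asc V (\<C> b c) (\<C> a b) (EO M a))"
      using uncurry_inj[OF x(1,3) Cmp_homset[OF e AA(3)] Cmp_homset[OF tenA_homset[OF AA(1,2)] self_Cmp_Hom[OF
        x]]] u u' by metis
    also have "\<dots> \<longleftrightarrow> act M b c \<cdot> (act M a b \<boxdot> Ide V (\<C> b c)) = act M
      a c \<cdot> ((Ide V (EO M a) \<boxdot> \<kappa> a b c) \<cdot> asc V (EO M a) (\<C> a b) (\<C> b c))"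
      unfolding act[OF abc(2,3)] act[OF abc(1,2)] act[OF abc(1,3)] \<kappa>_def
      by (rule reverse_assoc[OF x(1) _ _ L L L e, symmetric]) (use abc in simp_all)
    finally show ?thesis .
  qed
  show ?thesis unfolding rmod_def using 1 2 X actH by simp
qed

lemma Mod_rmod:
  assumes "M \<in> Obj Mod" shows "rmod (EO M) (act M)"
proof -
  have M: "enriched_functor V C (self_enriched V) M" using assms Mod_Obj by simp
  show ?thesis by (subst functor_iff[symmetric]) (use M in \<open>auto simp: enriched_functor_def\<close>)
qed

lemma mk_mod_EO [simp]: "c \<in> Ob \<Longrightarrow> EO (mk_mod X \<rho>) c = X c"
  by (simp add: mk_mod_def)

lemma mk_mod_act [simp]:
  assumes "rmod X \<rho>" "a \<in> Ob" "b \<in> Ob" shows "act (mk_mod X \<rho>) a b = \<rho> a b"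
proof -
  note x = rmodD(1)[OF assms(1,2,2)] rmodD(1)[OF assms(1,3,3)] eHom_Obj[OF assms(2,3)]
  note r = rmodD(2)[OF assms]
  have "act (mk_mod X \<rho>) a b = unc (X a) (X b) (cur (\<C> a b) (X a) (X b) (\<rho> a b \<cdot> swp V
    (\<C> a b) (X a))) \<cdot> swp V (X a) (\<C> a b)"
    using Hom_ArrD[OF cur_Hom[OF x(1,3) Cmp_homset[OF swp_homset[OF x(3,1)] r]]] x assms(2,3)
    by (simp add: mod_action_def mk_mod_def)
  also have "\<dots> = \<rho> a b"
    unfolding evl_cur[OF x(1,3) Cmp_homset[OF swp_homset[OF x(3,1)] r]] by (rule cancel_swp[OF r x(1,3)])
  finally show ?thesis .
qed

lemma rmod_cong:
  "(\<And>a. a \<in> Ob \<Longrightarrow> X a = Y a) \<Longrightarrow> (\<And>a b. a \<in> Ob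
    \<Longrightarrow> b \<in> Ob \<Longrightarrow> \<rho> a b = \<sigma> a b) \<Longrightarrow> rmod X \<rho>
    \<longleftrightarrow> rmod Y \<sigma>"
  unfolding rmod_def by simp

lemma mk_mod_Mod:
  assumes r: "rmod X \<rho>" shows "mk_mod X \<rho> \<in> Obj Mod"
proof -
  let ?M = "mk_mod X \<rho>"
  have c: "EA ?M a b \<in> Hom (\<C> a b) (iho V (EO ?M a) (EO ?M b))" if ab: "a \<in> Ob" "b \<in> Ob" for a b
    using cur_Hom[OF rmodD(1)[OF r ab(1,1)] eHom_Obj[OF ab] Cmp_homset[OF swp_homset[OF eHom_Obj[OF ab]
      rmodD(1)[OF r ab(1,1)]] rmodD(2)[OF r ab]]] ab
    by (simp add: mk_mod_def)
  have "rmod (EO ?M) (act ?M)" using r rmod_cong[of "EO ?M" X "act ?M" \<rho>] mk_mod_act[OF r] by simp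
  then have *: "(\<forall>a\<in>Ob. EA ?M a a \<cdot> eIde C a = eIde (self_enriched V) (EO ?M a)) \<and>
     (\<forall>a\<in>Ob. \<forall>b\<in>Ob. \<forall>c\<in>Ob. EA ?M a c \<cdot> eCmp C a b c
          = eCmp (self_enriched V) (EO ?M a) (EO ?M b) (EO ?M c) \<cdot> (EA ?M b c \<boxdot> EA ?M a b))"
    by (subst functor_iff) (use c rmodD(1)[OF r] in auto)
  show ?thesis unfolding Mod_Obj enriched_functor_def
    using * c rmodD(1)[OF r] by (auto simp: mk_mod_def extensional_def)
qed

definition equivariant :: "('c, 'o, 'a) efunc \<Rightarrow> ('c \<Rightarrow> 'a) \<Rightarrow> ('c, 'o, 'a)
  efunc \<Rightarrow> bool" where
  "equivariant M f N \<longleftrightarrow> (\<forall>c\<in>Ob. f c \<in> Hom (EO M c) (EO N c))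
    \<and> (\<forall>a\<in>Ob. \<forall>b\<in>Ob. f b \<cdot> act M a b = act N a b \<cdot> (f a \<boxdot> Ide
      V (\<C> a b)))"

lemma equivariantD:
  "equivariant M f N \<Longrightarrow> c \<in> Ob \<Longrightarrow> f c \<in> Hom (EO M c) (EO N c)"
  "equivariant M f N \<Longrightarrow> a \<in> Ob \<Longrightarrow> b \<in> Ob \<Longrightarrow> f b \<cdot>
    act M a b = act N a b \<cdot> (f a \<boxdot> Ide V (\<C> a b))"
  unfolding equivariant_def by auto

text \<open>Components of arrows in the module category go from \<open>unt V\<close> to an inner
  hom. \<open>mor\<close> names ordinary arrows in this way and \<open>cmp\<close> recovers them, so
  that modules can be handled through plain components.\<close>

definition mor :: "('c, 'o, 'a) efunc \<Rightarrow> ('c \<Rightarrow> 'a) \<Rightarrow> ('c, 'o, 'a) efunc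
  \<Rightarrow> _" where
  "mor M f N = (M, \<lambda>c\<in>Ob. cur (unt V) (EO M c) (EO N c) (f c \<cdot> lun V (EO M c)), N)"

definition cmp :: "('c, 'o, 'a) efunc \<times> ('c \<Rightarrow> 'a) \<times> ('c, 'o, 'a) efunc \<Rightarrow>
  'c \<Rightarrow> 'a" where
  "cmp \<phi> c = (case \<phi> of (M, \<alpha>, N) \<Rightarrow> unc (EO M c) (EO N c) (\<alpha> c) \<cdot>
    inv_arrow V (lun V (EO M c)))"

lemma Mod_EO: "M \<in> Obj Mod \<Longrightarrow> c \<in> Ob \<Longrightarrow> EO M c \<in> Obj V"
  and Mod_EA: "M \<in> Obj Mod \<Longrightarrow> a \<in> Ob \<Longrightarrow> b \<in> Ob \<Longrightarrow> EA
    M a b \<in> Hom (\<C> a b) (iho V (EO M a) (EO M b))"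
  unfolding Mod_Obj enriched_functor_def by auto

lemma mor_cong: "(\<And>c. c \<in> Ob \<Longrightarrow> f c = g c) \<Longrightarrow> mor M f N = mor M g N"
  by (simp add: mor_def cong: restrict_cong)

lemma name_Hom:
  assumes "x \<in> Obj V" "f \<in> Hom x y"
  shows "cur (unt V) x y (f \<cdot> lun V x) \<in> Hom (unt V) (iho V x y)"
    and "unc x y (cur (unt V) x y (f \<cdot> lun V x)) = f \<cdot> lun V x"
  using closed'[OF assms(1) unt_Obj Cmp_homset[OF lun_Hom[OF assms(1)] assms(2)]] by auto

lemma cmp_mor:
  assumes "M \<in> Obj Mod" "c \<in> Ob" "f c \<in> Hom (EO M c) (EO N c)"
  shows "cmp (mor M f N) c = f c"
  using name_Hom[OF Mod_EO[OF assms(1,2)] assms(3)] assms(2) Hom_ArrD[OF assms(3)] Mod_EO[OF assms(1,2)]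
  by (simp add: cmp_def mor_def)

text \<open>Transposing both sides of enriched naturality removes the unit isomorphisms: one side
  becomes the component after the left action of \<open>M\<close>, the other the left action of
  \<open>N\<close> after the component. Precomposing with the symmetry gives equivariance.\<close>

lemma transformation_iff:
  assumes M: "M \<in> Obj Mod" and N: "N \<in> Obj Mod" and f:
    "\<And>c. c \<in> Ob \<Longrightarrow> f c \<in> Hom (EO M c) (EO N c)"
  shows "enriched_transformation V C (self_enriched V) M N (\<lambda>c\<in>Ob. cur (unt V) (EO M c) (EO N c)
    (f c \<cdot> lun V (EO M c)))
    \<longleftrightarrow> equivariant M f N"
proof -
  define \<alpha> where "\<alpha> = (\<lambda>c\<in>Ob. cur (unt V) (EO M c) (EO N c) (f c \<cdot> lun V (EO M c)))"
  have al: "\<alpha> c \<in> Hom (unt V) (iho V (EO M c) (EO N c))"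
    "unc (EO M c) (EO N c) (\<alpha> c) = f c \<cdot> lun V (EO M c)" if "c \<in> Ob" for c
    using name_Hom[OF Mod_EO[OF M that] f[OF that]] that by (simp_all add: \<alpha>_def)
  have "eCmp (self_enriched V) (EO M a) (EO M b) (EO N b) \<cdot> ((\<alpha> b \<boxdot> EA M a b) \<cdot>
    inv_arrow V (lun V (\<C> a b)))
      = eCmp (self_enriched V) (EO M a) (EO N a) (EO N b) \<cdot> ((EA N a b \<boxdot> \<alpha> a) \<cdot>
        inv_arrow V (run V (\<C> a b)))
     \<longleftrightarrow> f b \<cdot> act M a b = act N a b \<cdot> (f a \<boxdot> Ide V (\<C> a b))" (is "?l
       = ?r \<longleftrightarrow> _")
    if ab: "a \<in> Ob" "b \<in> Ob" for a b
  proof -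
    note [simp] = Mod_EO[OF M ab(1)] Mod_EO[OF M ab(2)] Mod_EO[OF N ab(1)] Mod_EO[OF N ab(2)] eHom_Obj[OF ab]
    note A = Mod_EA[OF M ab] Mod_EA[OF N ab]
    define LM LN where "LM = unc (EO M a) (EO M b) (EA M a b)" and "LN = unc (EO N a) (EO N b) (EA N a b)"
    have LM: "LM \<in> Hom (\<C> a b \<boxtimes> EO M a) (EO M b)" and LN:
      "LN \<in> Hom (\<C> a b \<boxtimes> EO N a) (EO N b)"
      unfolding LM_def LN_def using unc_Hom[OF _ _ A(1)] unc_Hom[OF _ _ A(2)] by auto
    note [simp] = Hom_ArrD[OF LM] Hom_ArrD[OF LN] Hom_ArrD[OF f[OF ab(1)]] Hom_ArrD[OF f[OF ab(2)]]
    have il: "inv_arrow V (lun V (\<C> a b)) \<in> Hom (\<C> a b) (unt V \<boxtimes> \<C> a b)"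
      "inv_arrow V (run V (\<C> a b)) \<in> Hom (\<C> a b) (\<C> a b \<boxtimes> unt V)"
      by (simp_all add: homset_def)
    note S = self_Cmp_Hom[of "EO M a" "EO M b" "EO N b"] self_Cmp_Hom[of "EO M a" "EO N a" "EO N b"]
    note t = tenA_homset[OF al(1)[OF ab(2)] A(1)] tenA_homset[OF A(2) al(1)[OF ab(1)]]
    have lH: "eCmp (self_enriched V) (EO M a) (EO M b) (EO N b) \<cdot> (\<alpha> b \<boxdot> EA M a b) \<in>
      Hom (unt V \<boxtimes> \<C> a b) (iho V (EO M a) (EO N b))"
      "eCmp (self_enriched V) (EO M a) (EO N a) (EO N b) \<cdot> (EA N a b \<boxdot> \<alpha> a) \<in> Hom
        (\<C> a b \<boxtimes> unt V) (iho V (EO M a) (EO N b))"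
      using Cmp_homset[OF t(1) S(1)] Cmp_homset[OF t(2) S(2)] by simp_all
    have l: "?l = (eCmp (self_enriched V) (EO M a) (EO M b) (EO N b) \<cdot> (\<alpha> b \<boxdot> EA M a b))
      \<cdot> inv_arrow V (lun V (\<C> a b))"
      using Cmp_assoc[OF il(1) t(1) S(1)] by simp
    have r: "?r = (eCmp (self_enriched V) (EO M a) (EO N a) (EO N b) \<cdot> (EA N a b \<boxdot> \<alpha> a))
      \<cdot> inv_arrow V (run V (\<C> a b))"
      using Cmp_assoc[OF il(2) t(2) S(2)] by simp
    have "unc (EO M a) (EO N b) ?l = (f b \<cdot> lun V (EO M b)) \<cdot> ((Ide V (unt V) \<boxdot> LM)
      \<cdot> asc V (unt V) (\<C> a b) (EO M a)) \<cdot> (inv_arrow V (lun V (\<C> a b)) \<boxdot> Ide V (EO M a))"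
      unfolding l unc_Cmp[OF Mod_EO[OF M ab(1)] Mod_EO[OF N ab(2)] lH(1) il(1)]
        unc_self_Cmp[OF Mod_EO[OF M ab(1)] Mod_EO[OF M ab(2)] Mod_EO[OF N ab(2)] al(1)[OF ab(2)] A(1)]
          al(2)[OF ab(2)] LM_def ..
    also have "\<dots> = f b \<cdot> (lun V (EO M b) \<cdot> ((Ide V (unt V) \<boxdot> LM) \<cdot> (asc V (unt
      V) (\<C> a b) (EO M a) \<cdot> (inv_arrow V (lun V (\<C> a b)) \<boxdot> Ide V (EO M a)))))"
      by simp
    also have "\<dots> = f b \<cdot> (LM \<cdot> (lun V (\<C> a b \<boxtimes> EO M a) \<cdot> (asc V (unt V)
      (\<C> a b) (EO M a) \<cdot> (inv_arrow V (lun V (\<C> a b)) \<boxdot> Ide V (EO M a)))))"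
      using post[OF lun_nat[of LM "EO M b"], of "asc V (unt V) (\<C> a b) (EO M a) \<cdot> (inv_arrow V (lun V
        (\<C> a b)) \<boxdot> Ide V (EO M a))"] by simp
    also have "\<dots> = f b \<cdot> LM"
      using post[OF lun_asc[of "\<C> a b" "EO M a"], of "inv_arrow V (lun V (\<C> a b)) \<boxdot> Ide V (EO M
        a)"] by (simp add: interchange)
    finally have ul: "unc (EO M a) (EO N b) ?l = f b \<cdot> LM" .
    have "unc (EO M a) (EO N b) ?r = LN \<cdot> ((Ide V (\<C> a b) \<boxdot> (f a \<cdot> lun V (EO M a)))
      \<cdot> asc V (\<C> a b) (unt V) (EO M a)) \<cdot> (inv_arrow V (run V (\<C> a b)) \<boxdot> Ide V (EO M a))"
      unfolding r unc_Cmp[OF Mod_EO[OF M ab(1)] Mod_EO[OF N ab(2)] lH(2) il(2)]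
        unc_self_Cmp[OF Mod_EO[OF M ab(1)] Mod_EO[OF N ab(1)] Mod_EO[OF N ab(2)] A(2) al(1)[OF ab(1)]]
          al(2)[OF ab(1)] LN_def ..
    also have "\<dots> = LN \<cdot> ((Ide V (\<C> a b) \<boxdot> f a) \<cdot> ((Ide V (\<C> a b) \<boxdot> lun
      V (EO M a)) \<cdot> (asc V (\<C> a b) (unt V) (EO M a) \<cdot> (inv_arrow V (run V (\<C> a b)) \<boxdot>
      Ide V (EO M a)))))"
      by (simp add: interchange')
    also have "\<dots> = LN \<cdot> (Ide V (\<C> a b) \<boxdot> f a)"
      using post[OF triangle[of "\<C> a b" "EO M a"], of "inv_arrow V (run V (\<C> a b)) \<boxdot> Ide V (EO M
        a)"] by (simp add: interchange)
    finally have ur: "unc (EO M a) (EO N b) ?r = LN \<cdot> (Ide V (\<C> a b) \<boxdot> f a)" .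
    have "?l = ?r \<longleftrightarrow> f b \<cdot> LM = LN \<cdot> (Ide V (\<C> a b) \<boxdot> f a)"
      using uncurry_inj[OF Mod_EO[OF M ab(1)] Mod_EO[OF N ab(2)] Cmp_homset[OF il(1) lH(1)] Cmp_homset[OF
        il(2) lH(2)]] l r ul ur by metis
    also have "\<dots> \<longleftrightarrow> (f b \<cdot> LM) \<cdot> swp V (EO M a) (\<C> a b) = (LN \<cdot>
      (Ide V (\<C> a b) \<boxdot> f a)) \<cdot> swp V (EO M a) (\<C> a b)"
      by (rule iso_epi_iff) simp_all
    also have "(f b \<cdot> LM) \<cdot> swp V (EO M a) (\<C> a b) = f b \<cdot> act M a b"
      unfolding mod_action_def LM_def using Hom_ArrD[OF A(1)] by simp
    also have "(LN \<cdot> (Ide V (\<C> a b) \<boxdot> f a)) \<cdot> swp V (EO M a) (\<C> a b) = LN \<cdot>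
      (swp V (EO N a) (\<C> a b) \<cdot> (f a \<boxdot> Ide V (\<C> a b)))"
      using swp_nat[of "f a" "Ide V (\<C> a b)" "EO N a" "\<C> a b"] by simp
    also have "\<dots> = act N a b \<cdot> (f a \<boxdot> Ide V (\<C> a b))"
      unfolding mod_action_def LN_def using Hom_ArrD[OF A(2)] by simp
    finally show ?thesis .
  qed
  then show ?thesis unfolding enriched_transformation_def equivariant_def \<alpha>_def[symmetric]
    using al f by (auto simp: \<alpha>_def extensional_def)
qed

lemma Mod_homset_iff: "(M', \<alpha>, N') \<in> homset Mod M N \<longleftrightarrow> M' = M \<and> N' = N
  \<and> M \<in> Obj Mod \<and> N \<in> Obj Mod
    \<and> enriched_transformation V C (self_enriched V) M N \<alpha>"
  unfolding homset_def Mod_Obj by (auto simp: Mod_cat_def enriched_functor_category_def)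

lemma mor_Hom: "M \<in> Obj Mod \<Longrightarrow> N \<in> Obj Mod \<Longrightarrow> equivariant M f N
  \<Longrightarrow> mor M f N \<in> homset Mod M N"
  unfolding mor_def Mod_homset_iff using transformation_iff[of M N f] equivariantD(1) by blast

lemma Hom_mor:
  assumes "\<phi> \<in> homset Mod M N"
  shows "\<phi> = mor M (cmp \<phi>) N" "equivariant M (cmp \<phi>) N" "M \<in> Obj Mod" "N \<in> Obj Mod"
proof -
  obtain \<alpha> where \<phi>: "\<phi> = (M, \<alpha>, N)" and M: "M \<in> Obj Mod" and N: "N \<in> Obj Mod"
    and t: "enriched_transformation V C (self_enriched V) M N \<alpha>"
    using assms Mod_homset_iff by (cases \<phi>) auto
  have al: "\<alpha> c \<in> Hom (unt V) (iho V (EO M c) (EO N c))" if "c \<in> Ob" for c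
    using t that unfolding enriched_transformation_def by simp
  have u: "unc (EO M c) (EO N c) (\<alpha> c) \<in> Hom (unt V \<boxtimes> EO M c) (EO N c)" if "c \<in> Ob" for c
    using unc_Hom[OF Mod_EO[OF M that] Mod_EO[OF N that] al[OF that]] .
  have cH: "cmp \<phi> c \<in> Hom (EO M c) (EO N c)" if "c \<in> Ob" for c
    unfolding cmp_def \<phi> using u[OF that] Mod_EO[OF M that] by (simp add: homset_def)
  have "cmp \<phi> c \<cdot> lun V (EO M c) = unc (EO M c) (EO N c) (\<alpha> c)" if "c \<in> Ob" for c
    unfolding cmp_def \<phi> prod.case using Hom_ArrD[OF al[OF that]] Mod_EO[OF M that] Mod_EO[OF N that] by simp
  then have "\<alpha> c = cur (unt V) (EO M c) (EO N c) (cmp \<phi> c \<cdot> lun V (EO M c))" if "c \<in> Ob" for c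
    using cur_unc[OF Mod_EO[OF M that] Mod_EO[OF N that] al[OF that]] that by simp
  moreover have "\<alpha> \<in> extensional Ob" using t unfolding enriched_transformation_def by simp
  ultimately have eq: "\<alpha> = (\<lambda>c\<in>Ob. cur (unt V) (EO M c) (EO N c) (cmp \<phi> c \<cdot> lun
    V (EO M c)))"
    by (intro ext) (auto simp: extensional_def)
  show "\<phi> = mor M (cmp \<phi>) N" unfolding mor_def using eq \<phi> by simp
  show "equivariant M (cmp \<phi>) N" using transformation_iff[OF M N cH] t eq by simp
qed (use assms Mod_homset_iff in \<open>cases \<phi>, auto\<close>)+

text \<open>Enriched composition passes through inner homs and the inverse of
  \<open>lun V (unt V)\<close>. After transposing, only unit isomorphisms stand between the
  components; naturality of \<open>lun\<close> and \<open>lun_asc\<close> remove them.\<close>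

lemma mor_Cmp:
  assumes M: "M \<in> Obj Mod" "N \<in> Obj Mod" "P \<in> Obj Mod" and f:
    "\<And>c. c \<in> Ob \<Longrightarrow> f c \<in> Hom (EO M c) (EO N c)"
    and g: "\<And>c. c \<in> Ob \<Longrightarrow> g c \<in> Hom (EO N c) (EO P c)"
  shows "mor N g P \<cdot>\<^bsub>Mod\<^esub> mor M f N = mor M (\<lambda>c. g c \<cdot> f c) P"
proof -
  have "eCmp (self_enriched V) (EO M c) (EO N c) (EO P c) \<cdot> ((cur (unt V) (EO N c) (EO P c) (g c \<cdot>
    lun V (EO N c)) \<boxdot>
      cur (unt V) (EO M c) (EO N c) (f c \<cdot> lun V (EO M c))) \<cdot> inv_arrow V (lun V (unt V)))
    = cur (unt V) (EO M c) (EO P c) ((g c \<cdot> f c) \<cdot> lun V (EO M c))" (is "?S \<cdot> ((?g \<boxdot>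
      ?f) \<cdot> ?i) = ?r") if c: "c \<in> Ob" for c
  proof -
    note [simp] = Mod_EO[OF M(1) c] Mod_EO[OF M(2) c] Mod_EO[OF M(3) c] Hom_ArrD[OF f[OF c]] Hom_ArrD[OF g[OF c]]
    note nf = name_Hom[OF Mod_EO[OF M(1) c] f[OF c]] and ng = name_Hom[OF Mod_EO[OF M(2) c] g[OF c]]
      and ngf = name_Hom[OF Mod_EO[OF M(1) c] Cmp_homset[OF f[OF c] g[OF c]]]
    have i: "?i \<in> Hom (unt V) (unt V \<boxtimes> unt V)" by (simp add: homset_def)
    have S: "?S \<in> Hom (iho V (EO N c) (EO P c) \<boxtimes> iho V (EO M c) (EO N c)) (iho V (EO M c) (EO P
      c))" by (rule self_Cmp_Hom) simp_all
    note t = tenA_homset[OF ng(1) nf(1)]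
    have lift: "lun V (EO N c) \<cdot> ((Ide V (unt V) \<boxdot> f c) \<cdot> (Ide V (unt V) \<boxdot> lun V
      (EO M c) ) \<cdot> h) = f c \<cdot> (lun V (EO M c) \<cdot> (lun V (unt V \<boxtimes> EO M c) \<cdot> h))"
      if h: "h \<in> Arr V" "Cod V h = unt V \<boxtimes> (unt V \<boxtimes> EO M c)" for h
      using post[OF lun_nat[of "f c" "EO N c"], of "(Ide V (unt V) \<boxdot> lun V (EO M c)) \<cdot> h"]
        post[OF lun_nat[of "lun V (EO M c)" "EO M c"], of h] h by simp
    have "unc (EO M c) (EO P c) (?S \<cdot> ((?g \<boxdot> ?f) \<cdot> ?i)) = unc (EO M c) (EO P c) ((?S
      \<cdot> (?g \<boxdot> ?f)) \<cdot> ?i)"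
      using Cmp_assoc[OF i t S] by simp
    also have "\<dots> = (g c \<cdot> lun V (EO N c)) \<cdot> ((Ide V (unt V) \<boxdot> (f c \<cdot> lun V (EO
      M c))) \<cdot> asc V (unt V) (unt V) (EO M c)) \<cdot> (?i \<boxdot> Ide V (EO M c))"
      unfolding unc_Cmp[OF Mod_EO[OF M(1) c] Mod_EO[OF M(3) c] Cmp_homset[OF t S] i]
        unc_self_Cmp[OF Mod_EO[OF M(1) c] Mod_EO[OF M(2) c] Mod_EO[OF M(3) c] ng(1) nf(1)] ng(2) nf(2) ..
    also have "\<dots> = g c \<cdot> (lun V (EO N c) \<cdot> ((Ide V (unt V) \<boxdot> f c) \<cdot> ((Ide V
      (unt V) \<boxdot> lun V (EO M c)) \<cdot> (asc V (unt V) (unt V) (EO M c) \<cdot> (?i \<boxdot> Ide V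
      (EO M c))))))"
      by (simp add: interchange')
    also have "\<dots> = g c \<cdot> (f c \<cdot> (lun V (EO M c) \<cdot> (lun V (unt V \<boxtimes> EO M c)
      \<cdot> (asc V (unt V) (unt V) (EO M c) \<cdot> (?i \<boxdot> Ide V (EO M c))))))"
      using lift[of "asc V (unt V) (unt V) (EO M c) \<cdot> (?i \<boxdot> Ide V (EO M c))"] by simp
    also have "\<dots> = (g c \<cdot> f c) \<cdot> lun V (EO M c)"
      using post[OF lun_asc[of "unt V" "EO M c"], of "?i \<boxdot> Ide V (EO M c)"] by (simp add: interchange)
    finally show ?thesis
      using uncurry_inj[OF Mod_EO[OF M(1) c] Mod_EO[OF M(3) c] Cmp_homset[OF Cmp_homset[OF i t] S] ngf(1)]
        ngf(2) by metis
  qed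
  then show ?thesis by (simp add: mor_def Mod_cat_def enriched_functor_category_def cong: restrict_cong)
qed

lemma mor_Ide: "M \<in> Obj Mod \<Longrightarrow> Ide Mod M = mor M (\<lambda>c. Ide V (EO M c)) M"
  using Mod_EO[of M] by (simp add: mor_def Mod_cat_def enriched_functor_category_def self_Ide cong: restrict_cong)

lemma equivariant_Ide:
  assumes M: "M \<in> Obj Mod" shows "equivariant M (\<lambda>c. Ide V (EO M c)) M"
  unfolding equivariant_def using Mod_EO[OF M] rmodD(2)[OF Mod_rmod[OF M]] by (simp add: homset_def)

lemma equivariant_Cmp:
  assumes f: "equivariant M f N" and g: "equivariant N g P" and M: "M \<in> Obj Mod" "N \<in> Obj Mod" "P \<in> Obj Mod"
  shows "equivariant M (\<lambda>c. g c \<cdot> f c) P"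
  unfolding equivariant_def
proof (intro conjI ballI)
  show "g c \<cdot> f c \<in> Hom (EO M c) (EO P c)" if "c \<in> Ob" for c using Cmp_homset[OF
    equivariantD(1)[OF f that] equivariantD(1)[OF g that]] .
  fix a b assume ab: "a \<in> Ob" "b \<in> Ob"
  note [simp] = Hom_ArrD[OF equivariantD(1)[OF f ab(1)]] Hom_ArrD[OF equivariantD(1)[OF f ab(2)]] Hom_ArrD[OF
    equivariantD(1)[OF g ab(1)]] Hom_ArrD[OF equivariantD(1)[OF g ab(2)]]
    Hom_ArrD[OF rmodD(2)[OF Mod_rmod[OF M(1)] ab]] Hom_ArrD[OF rmodD(2)[OF Mod_rmod[OF M(2)] ab]] Hom_ArrD[OF
      rmodD(2)[OF Mod_rmod[OF M(3)] ab]] eHom_Obj[OF ab]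
  have "(g b \<cdot> f b) \<cdot> act M a b = g b \<cdot> (act N a b \<cdot> (f a \<boxdot> Ide V (\<C> a
    b)))" using equivariantD(2)[OF f ab] by simp
  also have "\<dots> = act P a b \<cdot> ((g a \<boxdot> Ide V (\<C> a b)) \<cdot> (f a \<boxdot> Ide V (\<C> a b)))"
    using post[OF equivariantD(2)[OF g ab], of "f a \<boxdot> Ide V (\<C> a b)"] by simp
  finally show "(g b \<cdot> f b) \<cdot> act M a b = act P a b \<cdot> ((g a \<cdot> f a) \<boxdot> Ide V
    (\<C> a b))" by (simp add: interchange)
qed

lemma cmp_Cmp:
  assumes f: "f \<in> homset Mod M N" and g: "g \<in> homset Mod N P"
  shows "g \<cdot>\<^bsub>Mod\<^esub> f = mor M (\<lambda>c. cmp g c \<cdot> cmp f c) P"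
    "g \<cdot>\<^bsub>Mod\<^esub> f \<in> homset Mod M P"
    "c \<in> Ob \<Longrightarrow> cmp (g \<cdot>\<^bsub>Mod\<^esub> f) c = cmp g c \<cdot> cmp f c"
proof -
  note F = Hom_mor[OF f] and G = Hom_mor[OF g]
  show eq: "g \<cdot>\<^bsub>Mod\<^esub> f = mor M (\<lambda>c. cmp g c \<cdot> cmp f c) P"
    using mor_Cmp[OF F(3,4) G(4) equivariantD(1)[OF F(2)] equivariantD(1)[OF G(2)]] F(1) G(1) by simp
  show "g \<cdot>\<^bsub>Mod\<^esub> f \<in> homset Mod M P"
    unfolding eq by (rule mor_Hom[OF F(3) G(4) equivariant_Cmp[OF F(2) G(2) F(3,4) G(4)]])
  show "cmp (g \<cdot>\<^bsub>Mod\<^esub> f) c = cmp g c \<cdot> cmp f c" if c: "c \<in> Ob"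
    unfolding eq by (rule cmp_mor[OF F(3) c]) (rule Cmp_homset[OF equivariantD(1)[OF F(2) c]
      equivariantD(1)[OF G(2) c]])
qed

lemma Mod_arrow_eqI:
  assumes "f \<in> homset Mod M N" "g \<in> homset Mod M N" "\<And>c. c \<in> Ob \<Longrightarrow> cmp f c = cmp g c"
  shows "f = g"
  using Hom_mor(1)[OF assms(1)] Hom_mor(1)[OF assms(2)] mor_cong[of "cmp f" "cmp g" M N] assms(3) by simp

lemma Mod_arrD: "f \<in> Arr Mod \<Longrightarrow> f \<in> homset Mod (Dom Mod f) (Cod Mod f)"
  by (simp add: homset_def)

lemma cmp_Hom: "f \<in> homset Mod M N \<Longrightarrow> c \<in> Ob \<Longrightarrow> cmp f c \<in> Hom (EO M
  c) (EO N c)"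
  using Hom_mor(2) equivariantD(1) by blast

lemma cmp_Ide: "M \<in> Obj Mod \<Longrightarrow> c \<in> Ob \<Longrightarrow> cmp (Ide Mod M) c = Ide V (EO M c)"
  using cmp_mor[of M c "\<lambda>c. Ide V (EO M c)" M] Mod_EO by (simp add: mor_Ide)

lemma Ide_Mod_Hom: "M \<in> Obj Mod \<Longrightarrow> Ide Mod M \<in> homset Mod M M"
  using mor_Hom[OF _ _ equivariant_Ide] by (simp add: mor_Ide)

text \<open>An arrow of modules is determined by its components, so the category laws are inherited
  from \<open>V\<close> at each object.\<close>

lemma category_Mod: "category Mod"
proof
  fix f assume "f \<in> Arr Mod"
  then show "Dom Mod f \<in> Obj Mod" "Cod Mod f \<in> Obj Mod" using Hom_mor(3,4) Mod_arrD by blast+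
next
  fix M assume "M \<in> Obj Mod" then show "Ide Mod M \<in> homset Mod M M" by (rule Ide_Mod_Hom)
next
  fix f g M N P assume "f \<in> homset Mod M N" "g \<in> homset Mod N P"
  then show "g \<cdot>\<^bsub>Mod\<^esub> f \<in> homset Mod M P" by (rule cmp_Cmp(2))
next
  fix f M N assume f: "f \<in> homset Mod M N"
  note M = Hom_mor(3,4)[OF f]
  show "f \<cdot>\<^bsub>Mod\<^esub> Ide Mod M = f"
    by (rule Mod_arrow_eqI[OF cmp_Cmp(2)[OF Ide_Mod_Hom[OF M(1)] f] f])
      (use cmp_Cmp(3)[OF Ide_Mod_Hom[OF M(1)] f] cmp_Ide[OF M(1)] cmp_Hom[OF f] in \<open>simp add: homset_def\<close>)
  show "Ide Mod N \<cdot>\<^bsub>Mod\<^esub> f = f"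
    by (rule Mod_arrow_eqI[OF cmp_Cmp(2)[OF f Ide_Mod_Hom[OF M(2)]] f])
      (use cmp_Cmp(3)[OF f Ide_Mod_Hom[OF M(2)]] cmp_Ide[OF M(2)] cmp_Hom[OF f] in \<open>simp add: homset_def\<close>)
next
  fix f g h K M N P assume h: "f \<in> homset Mod K M" "g \<in> homset Mod M N" "h \<in> homset Mod N P"
  show "h \<cdot>\<^bsub>Mod\<^esub> g \<cdot>\<^bsub>Mod\<^esub> f = h \<cdot>\<^bsub>Mod\<^esub> (g
    \<cdot>\<^bsub>Mod\<^esub> f)"
  proof (rule Mod_arrow_eqI)
    show "h \<cdot>\<^bsub>Mod\<^esub> g \<cdot>\<^bsub>Mod\<^esub> f \<in> homset Mod K P"
      "h \<cdot>\<^bsub>Mod\<^esub> (g \<cdot>\<^bsub>Mod\<^esub> f) \<in> homset Mod K P" using h cmp_Cmp(2) by blast+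
    fix c assume c: "c \<in> Ob"
    show "cmp (h \<cdot>\<^bsub>Mod\<^esub> g \<cdot>\<^bsub>Mod\<^esub> f) c = cmp (h
      \<cdot>\<^bsub>Mod\<^esub> (g \<cdot>\<^bsub>Mod\<^esub> f)) c"
      unfolding cmp_Cmp(3)[OF h(1) cmp_Cmp(2)[OF h(2,3)] c] cmp_Cmp(3)[OF cmp_Cmp(2)[OF h(1,2)] h(3) c]
        cmp_Cmp(3)[OF h(1,2) c] cmp_Cmp(3)[OF h(2,3) c]
      by (rule Cmp_assoc[OF cmp_Hom[OF h(1) c] cmp_Hom[OF h(2) c] cmp_Hom[OF h(3) c]])
  qed
qed

end

section \<open>Exactness of modules is pointwise\<close>

context module_setting
begin

lemma Mod_act_Hom: "M \<in> Obj Mod \<Longrightarrow> a \<in> Ob \<Longrightarrow> b \<in> Ob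
  \<Longrightarrow> act M a b \<in> Hom (EO M a \<boxtimes> \<C> a b) (EO M b)"
  using rmodD(2)[OF Mod_rmod] .

text \<open>A constant zero object with zero action: each module law equates arrows into a zero
  object.\<close>

lemma zero_module: "\<exists>Z \<in> Obj Mod. \<forall>c \<in> Ob. zero_object V (EO Z c)"
proof -
  obtain z where z: "zero_object V z" using has_zero by blast
  then have zo: "z \<in> Obj V" by (simp add: zero_object_def)
  have eq: "f = g" if "f \<in> Hom x z" "g \<in> Hom x z" for f g x
    using z that Hom_Obj[OF that(1)] unfolding zero_object_def by blast
  have r: "rmod (\<lambda>_. z) (\<lambda>a b. \<zero>\<^bsub>z \<boxtimes> \<C> a b,z\<^esub>)"
    unfolding rmod_def
  proof (intro conjI ballI zo)
    fix a b c assume o [simp]: "a \<in> Ob" "b \<in> Ob" "c \<in> Ob"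
    note [simp] = Hom_ArrD[OF kappa_Hom[OF o]] zo
    show "\<zero>\<^bsub>z \<boxtimes> \<C> b c,z\<^esub> \<cdot> (\<zero>\<^bsub>z \<boxtimes> \<C> a
      b,z\<^esub> \<boxdot> Ide V (\<C> b c)) =
       \<zero>\<^bsub>z \<boxtimes> \<C> a c,z\<^esub> \<cdot> ((Ide V z \<boxdot> \<kappa> a b c) \<cdot> asc
         V z (\<C> a b) (\<C> b c))"
      by (rule eq[of _ "(z \<boxtimes> \<C> a b) \<boxtimes> \<C> b c"]) (simp_all add: homset_def)
  next
    fix a assume [simp]: "a \<in> Ob"
    note [simp] = Hom_ArrD[OF eIde_homset[of a]] zo
    show "\<zero>\<^bsub>z \<boxtimes> \<C> a a,z\<^esub> \<cdot> (Ide V z \<boxdot> eIde C a) = run V z"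
      by (rule eq[of _ "z \<boxtimes> unt V"]) (simp_all add: homset_def)
  qed (use zo in simp)
  show ?thesis by (rule bexI[OF _ mk_mod_Mod[OF r]]) (use z in simp)
qed

lemma equivariant_zero:
  assumes "M \<in> Obj Mod" "N \<in> Obj Mod"
  shows "equivariant M (\<lambda>c. \<zero>\<^bsub>EO M c,EO N c\<^esub>) N"
  unfolding equivariant_def
proof (intro conjI ballI)
  show "\<zero>\<^bsub>EO M c,EO N c\<^esub> \<in> Hom (EO M c) (EO N c)" if "c \<in> Ob" for c using Mod_EO
    assms that by simp
  fix a b assume ab: "a \<in> Ob" "b \<in> Ob"
  note [simp] = Mod_EO[OF assms(1) ab(1)] Mod_EO[OF assms(1) ab(2)] Mod_EO[OF assms(2) ab(1)] Mod_EO[OF assms(2) ab(2)]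
    Hom_ArrD[OF Mod_act_Hom[OF assms(1) ab]] Hom_ArrD[OF Mod_act_Hom[OF assms(2) ab]] eHom_Obj[OF ab]
  show "\<zero>\<^bsub>EO M b,EO N b\<^esub> \<cdot> act M a b = act N a b \<cdot> (\<zero>\<^bsub>EO M a,EO N
    a\<^esub> \<boxdot> Ide V (\<C> a b))" by simp
qed

lemma category_with_zero_Mod: "category_with_zero Mod"
proof -
  interpret Md: category Mod by (rule category_Mod)
  obtain Z where Z: "Z \<in> Obj Mod" "\<And>c. c \<in> Ob \<Longrightarrow> zero_object V (EO Z c)" using
    zero_module by blast
  have "zero_object Mod Z" unfolding zero_object_def
  proof (intro conjI ballI Z)
    fix M assume M: "M \<in> Obj Mod"
    have *: "f c = g c" if "c \<in> Ob" "(f c \<in> Hom (EO M c) (EO Z c) \<and> g c \<in> Hom (EO M c) (EO Z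
      c)) \<or> (f c \<in> Hom (EO Z c) (EO M c) \<and> g c \<in> Hom (EO Z c) (EO M c))"
      for f g :: "'c \<Rightarrow> 'a" and c
      using Z(2)[OF that(1)] that(2) Mod_EO[OF M that(1)] unfolding zero_object_def by blast
    show "\<exists>!f. f \<in> homset Mod M Z"
    proof (rule ex1I)
      show "mor M (\<lambda>c. \<zero>\<^bsub>EO M c,EO Z c\<^esub>) Z \<in> homset Mod M Z" by (rule
        mor_Hom[OF M Z(1) equivariant_zero[OF M Z(1)]])
      fix f assume f: "f \<in> homset Mod M Z"
      show "f = mor M (\<lambda>c. \<zero>\<^bsub>EO M c,EO Z c\<^esub>) Z"
        by (rule Mod_arrow_eqI[OF f mor_Hom[OF M Z(1) equivariant_zero[OF M Z(1)]]])
          (use * cmp_Hom[OF f] cmp_Hom[OF mor_Hom[OF M Z(1) equivariant_zero[OF M Z(1)]]] in blast)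
    qed
    show "\<exists>!f. f \<in> homset Mod Z M"
    proof (rule ex1I)
      show "mor Z (\<lambda>c. \<zero>\<^bsub>EO Z c,EO M c\<^esub>) M \<in> homset Mod Z M" by (rule
        mor_Hom[OF Z(1) M equivariant_zero[OF Z(1) M]])
      fix f assume f: "f \<in> homset Mod Z M"
      show "f = mor Z (\<lambda>c. \<zero>\<^bsub>EO Z c,EO M c\<^esub>) M"
        by (rule Mod_arrow_eqI[OF f mor_Hom[OF Z(1) M equivariant_zero[OF Z(1) M]]])
          (use * cmp_Hom[OF f] cmp_Hom[OF mor_Hom[OF Z(1) M equivariant_zero[OF Z(1) M]]] in blast)
    qed
  qed
  then show ?thesis by unfold_locales blast
qed

interpretation Md: category_with_zero Mod by (rule category_with_zero_Mod)

text \<open>The pointwise zero map factors through a zero module by pointwise zero maps, which is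
  what characterises the abstract zero arrow.\<close>

lemma Mod_zero: "M \<in> Obj Mod \<Longrightarrow> N \<in> Obj Mod \<Longrightarrow> zero_arrow Mod M N = mor
  M (\<lambda>c. \<zero>\<^bsub>EO M c,EO N c\<^esub>) N"
proof -
  assume M: "M \<in> Obj Mod" and N: "N \<in> Obj Mod"
  obtain Z where Z: "zero_object Mod Z" using Md.has_zero_object by blast
  then have Zo: "Z \<in> Obj Mod" by (simp add: zero_object_def)
  let ?f = "mor M (\<lambda>c. \<zero>\<^bsub>EO M c,EO N c\<^esub>) N"
  have f: "?f \<in> homset Mod M N" by (rule mor_Hom[OF M N equivariant_zero[OF M N]])
  have "mor Z (\<lambda>c. \<zero>\<^bsub>EO Z c,EO N c\<^esub>) N \<cdot>\<^bsub>Mod\<^esub> mor M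
    (\<lambda>c. \<zero>\<^bsub>EO M c,EO Z c\<^esub>) Z = mor M (\<lambda>c. \<zero>\<^bsub>EO Z c,EO N
    c\<^esub> \<cdot> \<zero>\<^bsub>EO M c,EO Z c\<^esub>) N"
    by (rule mor_Cmp[OF M Zo N]) (use Mod_EO M N Zo in auto)
  also have "\<dots> = ?f" by (rule mor_cong) (use Mod_EO M N Zo in simp)
  finally have eq: "?f = mor Z (\<lambda>c. \<zero>\<^bsub>EO Z c,EO N c\<^esub>) N \<cdot>\<^bsub>Mod\<^esub>
    mor M (\<lambda>c. \<zero>\<^bsub>EO M c,EO Z c\<^esub>) Z" by (rule sym)
  have "is_zero_arrow Mod ?f" unfolding is_zero_arrow_def Md.Hom_ArrD[OF f]
    by (intro conjI exI) (rule Md.Hom_ArrD(1)[OF f] Z mor_Hom[OF M Zo equivariant_zero[OF M Zo]] mor_Hom[OF Zo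
      N equivariant_zero[OF Zo N]] eq)+
  then show ?thesis using Md.is_zero_arrow_Hom_iff[OF f] by simp
qed

lemma cmp_zero: "M \<in> Obj Mod \<Longrightarrow> N \<in> Obj Mod \<Longrightarrow> c \<in> Ob
  \<Longrightarrow> cmp (zero_arrow Mod M N) c = \<zero>\<^bsub>EO M c,EO N c\<^esub>"
  unfolding Mod_zero by (rule cmp_mor) (use Mod_EO in auto)

lemma Mod_zero_iff:
  assumes f: "f \<in> homset Mod M N"
  shows "f = zero_arrow Mod M N \<longleftrightarrow> (\<forall>c\<in>Ob. cmp f c = \<zero>\<^bsub>EO M c,EO N
    c\<^esub>)"
  using cmp_zero[OF Hom_mor(3,4)[OF f]] Mod_arrow_eqI[OF f Md.zero_Hom[OF Hom_mor(3,4)[OF f]]] by auto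

lemma pointwise_mono:
  assumes k: "k \<in> homset Mod K M" and "\<And>c. c \<in> Ob \<Longrightarrow> mono_arrow V (cmp k c)"
    and "u \<in> homset Mod N K" "v \<in> homset Mod N K" "k \<cdot>\<^bsub>Mod\<^esub> u = k
      \<cdot>\<^bsub>Mod\<^esub> v"
  shows "u = v"
proof (rule Mod_arrow_eqI[OF assms(3,4)])
  fix c assume c: "c \<in> Ob"
  have "cmp k c \<cdot> cmp u c = cmp k c \<cdot> cmp v c" using cmp_Cmp(3)[OF assms(3) k c] cmp_Cmp(3)[OF
    assms(4) k c] assms(5) by simp
  then show "cmp u c = cmp v c"
    by - (rule mono_arrowD[OF assms(2)[OF c]], use cmp_Hom[OF k c] cmp_Hom[OF assms(3) c] cmp_Hom[OF assms(4)
      c] in \<open>simp_all add: homset_def\<close>)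
qed

lemma pointwise_epi:
  assumes k: "k \<in> homset Mod K M" and e: "\<And>c. c \<in> Ob \<Longrightarrow> epi_arrow V (cmp k c)"
  shows "epi_arrow Mod k"
  unfolding epi_arrow_def
proof (intro conjI allI ballI impI)
  show "k \<in> Arr Mod" using k by (simp add: homset_def)
  fix N u v assume "u \<in> homset Mod (Cod Mod k) N" "v \<in> homset Mod (Cod Mod k) N" and eq:
    "u \<cdot>\<^bsub>Mod\<^esub> k = v \<cdot>\<^bsub>Mod\<^esub> k"
  then have u: "u \<in> homset Mod M N" and v: "v \<in> homset Mod M N" using k by (simp_all add: homset_def)
  show "u = v"
  proof (rule Mod_arrow_eqI[OF u v])
    fix c assume c: "c \<in> Ob"
    have "cmp u c \<cdot> cmp k c = cmp v c \<cdot> cmp k c" using cmp_Cmp(3)[OF k u c] cmp_Cmp(3)[OF k v c] eq by simp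
    then show "cmp u c = cmp v c"
      by - (rule epi_arrowD[OF e[OF c]], use cmp_Hom[OF k c] cmp_Hom[OF u c] cmp_Hom[OF v c] in
        \<open>simp_all add: homset_def\<close>)
  qed
qed

text \<open>The pointwise factorisations through \<open>k\<close> form a module map because
  equivariance can be tested after the monomorphisms \<open>cmp k b\<close>.\<close>

lemma pointwise_kernel:
  assumes k: "k \<in> homset Mod K M" and g: "g \<in> homset Mod M N" and pw:
    "\<And>c. c \<in> Ob \<Longrightarrow> is_kernel V (cmp k c) (cmp g c)"
  shows "is_kernel Mod k g"
  unfolding Md.is_kernel_iff[OF k g]
proof (intro conjI allI impI)
  note o = Hom_mor(3,4)[OF k] Hom_mor(4)[OF g]
  show "g \<cdot>\<^bsub>Mod\<^esub> k = zero_arrow Mod K N"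
    unfolding Mod_zero_iff[OF cmp_Cmp(2)[OF k g]] using cmp_Cmp(3)[OF k g] kernel_zero[OF pw cmp_Hom[OF k]
      cmp_Hom[OF g]] by simp
  have mono: "\<And>c. c \<in> Ob \<Longrightarrow> mono_arrow V (cmp k c)" using kernel_mono[OF pw] .
  fix L h assume h: "h \<in> homset Mod L M \<and> g \<cdot>\<^bsub>Mod\<^esub> h = zero_arrow Mod L N"
  note hH = conjunct1[OF h]
  have "\<exists>u \<in> Hom (EO L c) (EO K c). cmp k c \<cdot> u = cmp h c" if c: "c \<in> Ob" for c
    by (rule kernel_lift[OF pw[OF c] cmp_Hom[OF k c] cmp_Hom[OF g c] cmp_Hom[OF hH c]])
      (use cmp_Cmp(3)[OF hH g c] h cmp_zero[OF Hom_mor(3)[OF hH] o(3) c] in simp)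
  then obtain u where u: "\<And>c. c \<in> Ob \<Longrightarrow> u c \<in> Hom (EO L c) (EO K c)"
    "\<And>c. c \<in> Ob \<Longrightarrow> cmp k c \<cdot> u c = cmp h c" by metis
  have "equivariant L u K"
    unfolding equivariant_def
  proof (intro conjI ballI u)
    fix a b assume ab: "a \<in> Ob" "b \<in> Ob"
    note [simp] = Hom_ArrD[OF u(1)[OF ab(1)]] Hom_ArrD[OF u(1)[OF ab(2)]] Hom_ArrD[OF cmp_Hom[OF k ab(1)]]
      Hom_ArrD[OF cmp_Hom[OF k ab(2)]]
      Hom_ArrD[OF Mod_act_Hom[OF o(1) ab]] Hom_ArrD[OF Mod_act_Hom[OF o(2) ab]] Hom_ArrD[OF Mod_act_Hom[OF
        Hom_mor(3)[OF hH] ab]] eHom_Obj[OF ab]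
    have "cmp k b \<cdot> (u b \<cdot> act L a b) = cmp h b \<cdot> act L a b" using post[OF u(2)[OF ab(2)],
      of "act L a b"] by simp
    also have "\<dots> = act M a b \<cdot> ((cmp k a \<cdot> u a) \<boxdot> Ide V (\<C> a b))" using
      equivariantD(2)[OF Hom_mor(2)[OF hH] ab] u(2)[OF ab(1)] by simp
    also have "\<dots> = act M a b \<cdot> ((cmp k a \<boxdot> Ide V (\<C> a b)) \<cdot> (u a \<boxdot> Ide V
      (\<C> a b)))" by (simp add: interchange)
    also have "\<dots> = cmp k b \<cdot> (act K a b \<cdot> (u a \<boxdot> Ide V (\<C> a b)))"
      using post[OF equivariantD(2)[OF Hom_mor(2)[OF k] ab, symmetric], of "u a \<boxdot> Ide V (\<C> a b)"] by simp
    finally show "u b \<cdot> act L a b = act K a b \<cdot> (u a \<boxdot> Ide V (\<C> a b))"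
      by - (rule mono_arrowD[OF mono[OF ab(2)]], simp_all)
  qed
  note uH = mor_Hom[OF Hom_mor(3)[OF hH] o(1) this]
  have eq: "k \<cdot>\<^bsub>Mod\<^esub> mor L u K = h"
    by (rule Mod_arrow_eqI[OF cmp_Cmp(2)[OF uH k] hH])
      (use cmp_Cmp(3)[OF uH k] cmp_mor[OF Hom_mor(3)[OF hH], where f = u and N = K] u in simp)
  show "\<exists>!u. u \<in> homset Mod L K \<and> k \<cdot>\<^bsub>Mod\<^esub> u = h"
    using uH eq pointwise_mono[OF k mono] by (intro ex1I[of _ "mor L u K"]) blast+
qed

text \<open>Dual to kernels with one more ingredient: equivariance is tested before
  \<open>cmp q a \<boxdot> Ide V (\<C> a b)\<close>, which is epi because tensoring preserves
  cokernels.\<close>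

lemma pointwise_cokernel:
  assumes q: "q \<in> homset Mod N Q" and f: "f \<in> homset Mod M N" and pw:
    "\<And>c. c \<in> Ob \<Longrightarrow> is_cokernel V (cmp q c) (cmp f c)"
  shows "is_cokernel Mod q f"
  unfolding Md.is_cokernel_iff[OF q f]
proof (intro conjI allI impI)
  note o = Hom_mor(3,4)[OF q] Hom_mor(3)[OF f]
  show "q \<cdot>\<^bsub>Mod\<^esub> f = zero_arrow Mod M Q"
    unfolding Mod_zero_iff[OF cmp_Cmp(2)[OF f q]] using cmp_Cmp(3)[OF f q] cokernel_zero[OF pw cmp_Hom[OF q]
      cmp_Hom[OF f]] by simp
  have epi: "\<And>c. c \<in> Ob \<Longrightarrow> epi_arrow V (cmp q c)" using cokernel_epi[OF pw] .
  fix L h assume h: "h \<in> homset Mod N L \<and> h \<cdot>\<^bsub>Mod\<^esub> f = zero_arrow Mod M L"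
  note hH = conjunct1[OF h]
  have "\<exists>u \<in> Hom (EO Q c) (EO L c). u \<cdot> cmp q c = cmp h c" if c: "c \<in> Ob" for c
    by (rule cokernel_desc[OF pw[OF c] cmp_Hom[OF q c] cmp_Hom[OF f c] cmp_Hom[OF hH c]])
      (use cmp_Cmp(3)[OF f hH c] h cmp_zero[OF o(3) Hom_mor(4)[OF hH] c] in simp)
  then obtain u where u: "\<And>c. c \<in> Ob \<Longrightarrow> u c \<in> Hom (EO Q c) (EO L c)"
    "\<And>c. c \<in> Ob \<Longrightarrow> u c \<cdot> cmp q c = cmp h c" by metis
  have "equivariant Q u L"
    unfolding equivariant_def
  proof (intro conjI ballI u)
    fix a b assume ab: "a \<in> Ob" "b \<in> Ob"
    note [simp] = Hom_ArrD[OF u(1)[OF ab(1)]] Hom_ArrD[OF u(1)[OF ab(2)]] Hom_ArrD[OF cmp_Hom[OF q ab(1)]]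
      Hom_ArrD[OF cmp_Hom[OF q ab(2)]]
      Hom_ArrD[OF Mod_act_Hom[OF o(1) ab]] Hom_ArrD[OF Mod_act_Hom[OF o(2) ab]] Hom_ArrD[OF Mod_act_Hom[OF
        Hom_mor(4)[OF hH] ab]] eHom_Obj[OF ab]
    have "(u b \<cdot> act Q a b) \<cdot> (cmp q a \<boxdot> Ide V (\<C> a b)) = u b \<cdot> (cmp q b \<cdot>
      act N a b)"
      using equivariantD(2)[OF Hom_mor(2)[OF q] ab] by simp
    also have "\<dots> = act L a b \<cdot> ((u a \<cdot> cmp q a) \<boxdot> Ide V (\<C> a b))"
      using post[OF u(2)[OF ab(2)], of "act N a b"] equivariantD(2)[OF Hom_mor(2)[OF hH] ab] u(2)[OF ab(1)] by simp
    also have "\<dots> = (act L a b \<cdot> (u a \<boxdot> Ide V (\<C> a b))) \<cdot> (cmp q a \<boxdot> Ide V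
      (\<C> a b))" by (simp add: interchange)
    finally show "u b \<cdot> act Q a b = act L a b \<cdot> (u a \<boxdot> Ide V (\<C> a b))"
      by - (rule epi_arrowD[OF cokernel_epi[OF ten_cokernel[OF pw[OF ab(1)] cmp_Hom[OF q ab(1)] cmp_Hom[OF f
        ab(1)] eHom_Obj[OF ab]]]], simp_all)
  qed
  note uH = mor_Hom[OF o(2) Hom_mor(4)[OF hH] this]
  have eq: "mor Q u L \<cdot>\<^bsub>Mod\<^esub> q = h"
    by (rule Mod_arrow_eqI[OF cmp_Cmp(2)[OF q uH] hH])
      (use cmp_Cmp(3)[OF q uH] cmp_mor[OF o(2), where f = u and N = L] u in simp)
  show "\<exists>!u. u \<in> homset Mod Q L \<and> u \<cdot>\<^bsub>Mod\<^esub> q = h"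
  proof (rule ex1I[of _ "mor Q u L"])
    fix v assume v: "v \<in> homset Mod Q L \<and> v \<cdot>\<^bsub>Mod\<^esub> q = h"
    show "v = mor Q u L"
      by (rule Md.epi_arrowD[OF pointwise_epi[OF q epi]]) (use v uH eq q in \<open>simp_all add: homset_def\<close>)
  qed (use uH eq in blast)
qed

text \<open>Acting on a point killed by \<open>g\<close> gives a point killed by \<open>g\<close>,
  so the action of \<open>M\<close> restricts to the pointwise kernels. The module laws hold after
  the monomorphisms \<open>k c\<close>, hence already before them.\<close>

lemma Mod_kernel_ex:
  assumes g: "g \<in> homset Mod M N"
  obtains K k where "k \<in> homset Mod K M" "\<And>c. c \<in> Ob \<Longrightarrow> is_kernel V (cmp k c) (cmp
    g c)" "is_kernel Mod k g"
proof -
  note o = Hom_mor(3,4)[OF g] and eqv = Hom_mor(2)[OF g]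
  have "\<exists>k. is_kernel V k (cmp g c)" if "c \<in> Ob" for c using has_kernels[OF Hom_ArrD(1)[OF
    cmp_Hom[OF g that]]] .
  then obtain k where ker: "\<And>c. c \<in> Ob \<Longrightarrow> is_kernel V (k c) (cmp g c)" by metis
  define K where "K c = Dom V (k c)" for c
  have k: "k c \<in> Hom (K c) (EO M c)" if "c \<in> Ob" for c using is_kernel_Hom[OF ker[OF that] cmp_Hom[OF
    g that]] by (simp add: K_def)
  have "\<exists>s \<in> Hom (K a \<boxtimes> \<C> a b) (K b). k b \<cdot> s = act M a b \<cdot> (k a
    \<boxdot> Ide V (\<C> a b))" if ab: "a \<in> Ob" "b \<in> Ob" for a b
  proof (rule kernel_lift[OF ker[OF ab(2)] k[OF ab(2)] cmp_Hom[OF g ab(2)]])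
    note [simp] = Hom_ArrD[OF k[OF ab(1)]] Hom_ArrD[OF cmp_Hom[OF g ab(1)]] Hom_ArrD[OF cmp_Hom[OF g ab(2)]]
      eHom_Obj[OF ab] Hom_Obj[OF k[OF ab(1)]]
       Hom_ArrD[OF Mod_act_Hom[OF o(1) ab]] Hom_ArrD[OF Mod_act_Hom[OF o(2) ab]] Hom_Obj[OF cmp_Hom[OF g
         ab(1)]] Hom_Obj[OF cmp_Hom[OF g ab(2)]]
    show "act M a b \<cdot> (k a \<boxdot> Ide V (\<C> a b)) \<in> Hom (K a \<boxtimes> \<C> a b) (EO M b)" by
      (simp add: homset_def)
    have "cmp g b \<cdot> (act M a b \<cdot> (k a \<boxdot> Ide V (\<C> a b))) = act N a b \<cdot> ((cmp g a
      \<boxdot> Ide V (\<C> a b)) \<cdot> (k a \<boxdot> Ide V (\<C> a b)))"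
      using post[OF equivariantD(2)[OF eqv ab], of "k a \<boxdot> Ide V (\<C> a b)"] by simp
    also have "\<dots> = \<zero>\<^bsub>K a \<boxtimes> \<C> a b,EO N b\<^esub>"
      using kernel_zero[OF ker[OF ab(1)] k[OF ab(1)] cmp_Hom[OF g ab(1)]] by (simp add: interchange)
    finally show "cmp g b \<cdot> (act M a b \<cdot> (k a \<boxdot> Ide V (\<C> a b))) = \<zero>\<^bsub>K a
      \<boxtimes> \<C> a b,EO N b\<^esub>" .
  qed
  then obtain s where s: "\<And>a b. a \<in> Ob \<Longrightarrow> b \<in> Ob \<Longrightarrow> s a b \<in> Hom
    (K a \<boxtimes> \<C> a b) (K b)"
    "\<And>a b. a \<in> Ob \<Longrightarrow> b \<in> Ob \<Longrightarrow> k b \<cdot> s a b = act M a b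
      \<cdot> (k a \<boxdot> Ide V (\<C> a b))" by metis
  have r: "rmod K s"
    unfolding rmod_def
  proof (intro conjI ballI)
    show "K a \<in> Obj V" if "a \<in> Ob" for a using Hom_Obj[OF k[OF that]] by simp
    show "s a b \<in> Hom (K a \<boxtimes> \<C> a b) (K b)" if "a \<in> Ob" "b \<in> Ob" for a b using s that by simp
  next
    fix a assume a: "a \<in> Ob"
    note [simp] = Hom_ArrD[OF k[OF a]] Hom_Obj[OF k[OF a]] Hom_ArrD[OF s(1)[OF a a]] Hom_ArrD[OF
      eIde_homset[OF a]] eHom_Obj[OF a a] Hom_ArrD[OF Mod_act_Hom[OF o(1) a a]]
    have "k a \<cdot> (s a a \<cdot> (Ide V (K a) \<boxdot> eIde C a)) = act M a a \<cdot> ((Ide V (EO M a)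
      \<boxdot> eIde C a) \<cdot> (k a \<boxdot> Ide V (unt V)))"
      using post[OF s(2)[OF a a], of "Ide V (K a) \<boxdot> eIde C a"] by (simp add: interchange)
    also have "\<dots> = k a \<cdot> run V (K a)"
      using post[OF rmodD(3)[OF Mod_rmod[OF o(1)] a a], of "k a \<boxdot> Ide V (unt V)"] run_nat[of "k a"
        "EO M a"] by simp
    finally show "s a a \<cdot> (Ide V (K a) \<boxdot> eIde C a) = run V (K a)"
      by - (rule mono_arrowD[OF kernel_mono[OF ker[OF a]]], simp_all)
  next
    fix a b c assume abc: "a \<in> Ob" "b \<in> Ob" "c \<in> Ob"
    note [simp] = Hom_ArrD[OF k[OF abc(1)]] Hom_Obj[OF k[OF abc(1)]] Hom_ArrD[OF k[OF abc(2)]] Hom_Obj[OF k[OF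
      abc(2)]] Hom_ArrD[OF k[OF abc(3)]]
      Hom_ArrD[OF s(1)[OF abc(1,2)]] Hom_ArrD[OF s(1)[OF abc(2,3)]] Hom_ArrD[OF s(1)[OF abc(1,3)]] eHom_Obj[OF
        abc(1,2)] eHom_Obj[OF abc(2,3)] eHom_Obj[OF abc(1,3)]
      Hom_ArrD[OF Mod_act_Hom[OF o(1) abc(1,2)]] Hom_ArrD[OF Mod_act_Hom[OF o(1) abc(2,3)]] Hom_ArrD[OF
        Mod_act_Hom[OF o(1) abc(1,3)]] Hom_ArrD[OF kappa_Hom[OF abc]]
    have "k c \<cdot> (s b c \<cdot> (s a b \<boxdot> Ide V (\<C> b c))) = act M b c \<cdot> ((k b \<cdot> s a
      b) \<boxdot> Ide V (\<C> b c))"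
      using post[OF s(2)[OF abc(2,3)], of "s a b \<boxdot> Ide V (\<C> b c)"] by (simp add: interchange)
    also have "\<dots> = (act M b c \<cdot> (act M a b \<boxdot> Ide V (\<C> b c))) \<cdot> ((k a \<boxdot>
      Ide V (\<C> a b)) \<boxdot> Ide V (\<C> b c))"
      unfolding s(2)[OF abc(1,2)] by (simp add: interchange)
    also have "\<dots> = act M a c \<cdot> ((Ide V (EO M a) \<boxdot> \<kappa> a b c) \<cdot> (asc V (EO M a)
      (\<C> a b) (\<C> b c) \<cdot> ((k a \<boxdot> Ide V (\<C> a b)) \<boxdot> Ide V (\<C> b c))))"
      unfolding rmodD(4)[OF Mod_rmod[OF o(1)] abc] by simp
    also have "\<dots> = act M a c \<cdot> ((k a \<boxdot> Ide V (\<C> a c)) \<cdot> ((Ide V (K a) \<boxdot>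
      \<kappa> a b c) \<cdot> asc V (K a) (\<C> a b) (\<C> b c)))"
      using asc_nat[of "k a" "Ide V (\<C> a b)" "Ide V (\<C> b c)" "EO M a" "\<C> a b" "\<C> b c"] by (simp
        add: interchange')
    also have "\<dots> = k c \<cdot> (s a c \<cdot> ((Ide V (K a) \<boxdot> \<kappa> a b c) \<cdot> asc V (K
      a) (\<C> a b) (\<C> b c)))"
      using post[OF s(2)[OF abc(1,3), symmetric], of "(Ide V (K a) \<boxdot> \<kappa> a b c) \<cdot> asc V (K
        a) (\<C> a b) (\<C> b c)"] by simp
    finally show "s b c \<cdot> (s a b \<boxdot> Ide V (\<C> b c)) = s a c \<cdot> ((Ide V (K a) \<boxdot>
      \<kappa> a b c) \<cdot> asc V (K a) (\<C> a b) (\<C> b c))"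
      by - (rule mono_arrowD[OF kernel_mono[OF ker[OF abc(3)]]], simp_all)
  qed
  let ?K = "mk_mod K s"
  note KM = mk_mod_Mod[OF r]
  have "equivariant ?K k M" unfolding equivariant_def using k s(2) mk_mod_act[OF r] by simp
  note kH = mor_Hom[OF KM o(1) this]
  have ck: "cmp (mor ?K k M) c = k c" if "c \<in> Ob" for c by (rule cmp_mor[OF KM that]) (use k that in simp)
  then have pw: "\<And>c. c \<in> Ob \<Longrightarrow> is_kernel V (cmp (mor ?K k M) c) (cmp g c)" using ker by simp
  show ?thesis by (rule that[OF kH pw pointwise_kernel[OF kH g pw]])
qed

text \<open>The action descends because the pointwise cokernels remain cokernels after tensoring
  with a hom object. Associativity is tested on \<open>q a\<close> tensored twice, which is still an
  epimorphism.\<close>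

lemma Mod_cokernel_ex:
  assumes f: "f \<in> homset Mod M N"
  obtains Q q where "q \<in> homset Mod N Q" "\<And>c. c \<in> Ob \<Longrightarrow> is_cokernel V (cmp q c)
    (cmp f c)" "is_cokernel Mod q f"
proof -
  note o = Hom_mor(3,4)[OF f] and eqv = Hom_mor(2)[OF f]
  have "\<exists>k. is_cokernel V k (cmp f c)" if "c \<in> Ob" for c using has_cokernels[OF Hom_ArrD(1)[OF
    cmp_Hom[OF f that]]] .
  then obtain q where cok: "\<And>c. c \<in> Ob \<Longrightarrow> is_cokernel V (q c) (cmp f c)" by metis
  define Q where "Q c = Cod V (q c)" for c
  have q: "q c \<in> Hom (EO N c) (Q c)" if "c \<in> Ob" for c using is_cokernel_Hom[OF cok[OF that]
    cmp_Hom[OF f that]] by (simp add: Q_def)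
  have tq: "is_cokernel V (q a \<boxdot> Ide V y) (cmp f a \<boxdot> Ide V y)" if "a \<in> Ob" "y \<in> Obj V" for a y
    using ten_cokernel[OF cok[OF that(1)] q[OF that(1)] cmp_Hom[OF f that(1)] that(2)] .
  have "\<exists>s \<in> Hom (Q a \<boxtimes> \<C> a b) (Q b). s \<cdot> (q a \<boxdot> Ide V (\<C> a b)) = q
    b \<cdot> act N a b" if ab: "a \<in> Ob" "b \<in> Ob" for a b
  proof (rule cokernel_desc[OF tq[OF ab(1) eHom_Obj[OF ab]]])
    note [simp] = Hom_ArrD[OF q[OF ab(1)]] Hom_ArrD[OF q[OF ab(2)]] Hom_ArrD[OF cmp_Hom[OF f ab(1)]]
      Hom_ArrD[OF cmp_Hom[OF f ab(2)]] eHom_Obj[OF ab] Hom_Obj[OF q[OF ab(2)]]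
       Hom_ArrD[OF Mod_act_Hom[OF o(1) ab]] Hom_ArrD[OF Mod_act_Hom[OF o(2) ab]] Hom_Obj[OF cmp_Hom[OF f
         ab(1)]] Hom_Obj[OF cmp_Hom[OF f ab(2)]]
    show "q a \<boxdot> Ide V (\<C> a b) \<in> Hom (EO N a \<boxtimes> \<C> a b) (Q a \<boxtimes> \<C> a b)"
      "cmp f a \<boxdot> Ide V (\<C> a b) \<in> Hom (EO M a \<boxtimes> \<C> a b) (EO N a \<boxtimes> \<C> a b)"
      "q b \<cdot> act N a b \<in> Hom (EO N a \<boxtimes> \<C> a b) (Q b)" by (simp_all add: homset_def)
    have "(q b \<cdot> act N a b) \<cdot> (cmp f a \<boxdot> Ide V (\<C> a b)) = q b \<cdot> (cmp f b \<cdot>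
      act M a b)"
      using equivariantD(2)[OF eqv ab] by simp
    also have "\<dots> = \<zero>\<^bsub>EO M a \<boxtimes> \<C> a b,Q b\<^esub>"
      using post[OF cokernel_zero[OF cok[OF ab(2)] q[OF ab(2)] cmp_Hom[OF f ab(2)]], of "act M a b"] by simp
    finally show "(q b \<cdot> act N a b) \<cdot> (cmp f a \<boxdot> Ide V (\<C> a b)) = \<zero>\<^bsub>EO M a
      \<boxtimes> \<C> a b,Q b\<^esub>" .
  qed
  then obtain s where s: "\<And>a b. a \<in> Ob \<Longrightarrow> b \<in> Ob \<Longrightarrow> s a b \<in> Hom
    (Q a \<boxtimes> \<C> a b) (Q b)"
    "\<And>a b. a \<in> Ob \<Longrightarrow> b \<in> Ob \<Longrightarrow> s a b \<cdot> (q a \<boxdot> Ide V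
      (\<C> a b)) = q b \<cdot> act N a b" by metis
  have r: "rmod Q s"
    unfolding rmod_def
  proof (intro conjI ballI)
    show "Q a \<in> Obj V" if "a \<in> Ob" for a using Hom_Obj[OF q[OF that]] by simp
    show "s a b \<in> Hom (Q a \<boxtimes> \<C> a b) (Q b)" if "a \<in> Ob" "b \<in> Ob" for a b using s that by simp
  next
    fix a assume a: "a \<in> Ob"
    note [simp] = Hom_ArrD[OF q[OF a]] Hom_Obj[OF q[OF a]] Hom_ArrD[OF s(1)[OF a a]] Hom_ArrD[OF
      eIde_homset[OF a]] eHom_Obj[OF a a] Hom_ArrD[OF Mod_act_Hom[OF o(2) a a]]
    have "(s a a \<cdot> (Ide V (Q a) \<boxdot> eIde C a)) \<cdot> (q a \<boxdot> Ide V (unt V)) = (s a a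
      \<cdot> (q a \<boxdot> Ide V (\<C> a a))) \<cdot> (Ide V (EO N a) \<boxdot> eIde C a)"
      by (simp add: interchange)
    also have "\<dots> = q a \<cdot> run V (EO N a)"
      unfolding s(2)[OF a a] using rmodD(3)[OF Mod_rmod[OF o(2)] a a] by simp
    also have "\<dots> = run V (Q a) \<cdot> (q a \<boxdot> Ide V (unt V))" using run_nat[of "q a" "Q a"] by simp
    finally show "s a a \<cdot> (Ide V (Q a) \<boxdot> eIde C a) = run V (Q a)"
      by - (rule epi_arrowD[OF cokernel_epi[OF tq[OF a unt_Obj]]], simp_all)
  next
    fix a b c assume abc: "a \<in> Ob" "b \<in> Ob" "c \<in> Ob"
    note [simp] = Hom_ArrD[OF q[OF abc(1)]] Hom_Obj[OF q[OF abc(1)]] Hom_ArrD[OF q[OF abc(2)]] Hom_Obj[OF q[OF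
      abc(2)]] Hom_ArrD[OF q[OF abc(3)]]
      Hom_ArrD[OF s(1)[OF abc(1,2)]] Hom_ArrD[OF s(1)[OF abc(2,3)]] Hom_ArrD[OF s(1)[OF abc(1,3)]] eHom_Obj[OF
        abc(1,2)] eHom_Obj[OF abc(2,3)] eHom_Obj[OF abc(1,3)]
      Hom_ArrD[OF Mod_act_Hom[OF o(2) abc(1,2)]] Hom_ArrD[OF Mod_act_Hom[OF o(2) abc(2,3)]] Hom_ArrD[OF
        Mod_act_Hom[OF o(2) abc(1,3)]] Hom_ArrD[OF kappa_Hom[OF abc]]
    let ?q = "(q a \<boxdot> Ide V (\<C> a b)) \<boxdot> Ide V (\<C> b c)"
    have "(s b c \<cdot> (s a b \<boxdot> Ide V (\<C> b c))) \<cdot> ?q = s b c \<cdot> ((s a b \<cdot> (q a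
      \<boxdot> Ide V (\<C> a b))) \<boxdot> Ide V (\<C> b c))"
      by (simp add: interchange)
    also have "\<dots> = (s b c \<cdot> (q b \<boxdot> Ide V (\<C> b c))) \<cdot> (act N a b \<boxdot> Ide V
      (\<C> b c))"
      unfolding s(2)[OF abc(1,2)] by (simp add: interchange)
    also have "\<dots> = q c \<cdot> (act N a c \<cdot> ((Ide V (EO N a) \<boxdot> \<kappa> a b c) \<cdot> asc
      V (EO N a) (\<C> a b) (\<C> b c)))"
      unfolding s(2)[OF abc(2,3)] rmodD(4)[OF Mod_rmod[OF o(2)] abc, symmetric] by simp
    also have "\<dots> = (s a c \<cdot> (q a \<boxdot> Ide V (\<C> a c))) \<cdot> ((Ide V (EO N a) \<boxdot>
      \<kappa> a b c) \<cdot> asc V (EO N a) (\<C> a b) (\<C> b c))"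
      unfolding s(2)[OF abc(1,3)] by simp
    also have "\<dots> = s a c \<cdot> ((Ide V (Q a) \<boxdot> \<kappa> a b c) \<cdot> (asc V (Q a) (\<C> a b)
      (\<C> b c) \<cdot> ?q))"
      using asc_nat[of "q a" "Ide V (\<C> a b)" "Ide V (\<C> b c)" "Q a" "\<C> a b" "\<C> b c"] by (simp add:
        interchange')
    finally have "(s b c \<cdot> (s a b \<boxdot> Ide V (\<C> b c))) \<cdot> ?q = (s a c \<cdot> ((Ide V (Q a)
      \<boxdot> \<kappa> a b c) \<cdot> asc V (Q a) (\<C> a b) (\<C> b c))) \<cdot> ?q" by simp
    moreover have "is_cokernel V ?q ((cmp f a \<boxdot> Ide V (\<C> a b)) \<boxdot> Ide V (\<C> b c))"
      using tenA_homset[OF q[OF abc(1)] Ide_Hom[OF eHom_Obj[OF abc(1,2)]]] tenA_homset[OF cmp_Hom[OF f abc(1)]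
        Ide_Hom[OF eHom_Obj[OF abc(1,2)]]]
      by (rule ten_cokernel[OF tq[OF abc(1) eHom_Obj[OF abc(1,2)]] _ _ eHom_Obj[OF abc(2,3)]])
    ultimately show "s b c \<cdot> (s a b \<boxdot> Ide V (\<C> b c)) = s a c \<cdot> ((Ide V (Q a) \<boxdot>
      \<kappa> a b c) \<cdot> asc V (Q a) (\<C> a b) (\<C> b c))"
      by - (rule epi_arrowD[OF cokernel_epi], assumption, simp_all)
  qed
  let ?Q = "mk_mod Q s"
  note QM = mk_mod_Mod[OF r]
  have "equivariant N q ?Q" unfolding equivariant_def using q s(2) mk_mod_act[OF r] by simp
  note qH = mor_Hom[OF o(2) QM this]
  have cq: "cmp (mor N q ?Q) c = q c" if "c \<in> Ob" for c by (rule cmp_mor[OF o(2) that]) (use q that in simp)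
  then have pw: "\<And>c. c \<in> Ob \<Longrightarrow> is_cokernel V (cmp (mor N q ?Q) c) (cmp f c)" using cok by simp
  show ?thesis by (rule that[OF qH pw pointwise_cokernel[OF qH f pw]])
qed

text \<open>The pointwise cokernel of \<open>e\<close> is also its cokernel in the module category,
  hence zero; so each component of \<open>e\<close> has zero cokernel.\<close>

lemma Mod_epi_pointwise:
  assumes e: "e \<in> homset Mod M N" "epi_arrow Mod e" and c: "c \<in> Ob"
  shows "epi_arrow V (cmp e c)"
proof -
  obtain Q q where q: "q \<in> homset Mod N Q" "\<And>c. c \<in> Ob \<Longrightarrow> is_cokernel V (cmp q c)
    (cmp e c)" "is_cokernel Mod q e"
    using Mod_cokernel_ex[OF e(1)] by blast
  note o = Hom_mor(3,4)[OF q(1)] Hom_mor(3)[OF e(1)]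
  have "q \<cdot>\<^bsub>Mod\<^esub> e = zero_arrow Mod N Q \<cdot>\<^bsub>Mod\<^esub> e"
    using Md.cokernel_zero[OF q(3,1) e(1)] Md.Hom_ArrD[OF e(1)] o by simp
  then have "q = zero_arrow Mod N Q"
    by - (rule Md.epi_arrowD[OF e(2)], use q(1) e(1) o in \<open>simp_all add: homset_def\<close>)
  then have qz: "cmp q c = \<zero>\<^bsub>EO N c,EO Q c\<^esub>" using Mod_zero_iff[OF q(1)] c by blast
  show ?thesis
  proof (rule epi_via_zero[OF cmp_Hom[OF e(1) c]])
    fix w a assume a: "a \<in> Hom (EO N c) w" "a \<cdot> cmp e c = \<zero>\<^bsub>EO M c,w\<^esub>"
    obtain t where "t \<in> Hom (EO Q c) w" "t \<cdot> cmp q c = a"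
      using cokernel_desc[OF q(2)[OF c] cmp_Hom[OF q(1) c] cmp_Hom[OF e(1) c] a] by blast
    then show "a = \<zero>\<^bsub>EO N c,w\<^esub>" using qz Mod_EO[OF o(1) c] by (auto simp: homset_def)
  qed
qed

text \<open>Exactness in the module category comes with an unspecified kernel and cokernel.
  Comparing them with pointwise ones through \<open>u\<close> and \<open>s\<close> shows that the
  pointwise cokernel of \<open>f\<close> kills the pointwise kernel of \<open>g\<close>; so a point
  killed by \<open>g\<close> is killed by the cokernel of \<open>f\<close> and lifts along
  \<open>f\<close>.\<close>

lemma Mod_exact_pointwise:
  assumes f: "f \<in> homset Mod M N" and g: "g \<in> homset Mod N P" and ex: "exact_at Mod f g" and c: "c \<in> Ob"
  shows "chase_exact (cmp f c) (cmp g c)"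
proof -
  obtain k q where q: "is_cokernel Mod q f" and k: "is_kernel Mod k q" "is_kernel Mod k g" using ex unfolding
    exact_at_def by blast
  obtain K where kH: "k \<in> homset Mod K N" using Md.is_kernel_Hom[OF k(2) g] by blast
  obtain Q where qH: "q \<in> homset Mod N Q" using Md.is_cokernel_Hom[OF q f] by blast
  obtain K' k' where k': "k' \<in> homset Mod K' N" "\<And>c. c \<in> Ob \<Longrightarrow> is_kernel V (cmp k'
    c) (cmp g c)" "is_kernel Mod k' g"
    using Mod_kernel_ex[OF g] by blast
  obtain Q' q' where q': "q' \<in> homset Mod N Q'" "\<And>c. c \<in> Ob \<Longrightarrow> is_cokernel V (cmp
    q' c) (cmp f c)" "is_cokernel Mod q' f"
    using Mod_cokernel_ex[OF f] by blast
  note o = Hom_mor(3,4)[OF f] Hom_mor(4)[OF g] Hom_mor(3)[OF kH] Hom_mor(4)[OF qH] Hom_mor(3)[OF k'(1)]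
    Hom_mor(4)[OF q'(1)]
  obtain u where u: "u \<in> homset Mod K' K" "k \<cdot>\<^bsub>Mod\<^esub> u = k'" using Md.kernel_lift[OF
    k(2) kH g k'(1) Md.kernel_zero[OF k'(3,1) g]] by blast
  obtain s where s: "s \<in> homset Mod Q Q'" "s \<cdot>\<^bsub>Mod\<^esub> q = q'" using Md.cokernel_desc[OF
    q qH f q'(1) Md.cokernel_zero[OF q'(3,1) f]] by blast
  obtain f' where f': "f' \<in> homset Mod M K" "k \<cdot>\<^bsub>Mod\<^esub> f' = f" using Md.kernel_lift[OF
    k(1) kH qH f Md.cokernel_zero[OF q qH f]] by blast
  have "g \<cdot>\<^bsub>Mod\<^esub> f = (g \<cdot>\<^bsub>Mod\<^esub> k) \<cdot>\<^bsub>Mod\<^esub> f'"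
    unfolding f'(2)[symmetric] using Md.Cmp_assoc[OF f'(1) kH g] by simp
  also have "\<dots> = zero_arrow Mod M P" using Md.kernel_zero[OF k(2) kH g] f'(1) o by (simp add: Md.Hom_ArrD)
  finally have gf: "cmp g c \<cdot> cmp f c = \<zero>\<^bsub>EO M c,EO P c\<^esub>" using Mod_zero_iff[OF
    cmp_Cmp(2)[OF f g]] cmp_Cmp(3)[OF f g] c by simp
  have "q' \<cdot>\<^bsub>Mod\<^esub> k' = s \<cdot>\<^bsub>Mod\<^esub> ((q \<cdot>\<^bsub>Mod\<^esub> k)
    \<cdot>\<^bsub>Mod\<^esub> u)" unfolding u(2)[symmetric] s(2)[symmetric] using u(1) s(1) qH kH by (simp
    add: homset_def)
  also have "\<dots> = zero_arrow Mod K' Q'" using Md.kernel_zero[OF k(1) kH qH] u(1) s(1) o by (simp add: Md.Hom_ArrD)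
  finally have qk: "cmp q' c \<cdot> cmp k' c = \<zero>\<^bsub>EO K' c,EO Q' c\<^esub>" using Mod_zero_iff[OF
    cmp_Cmp(2)[OF k'(1) q'(1)]] cmp_Cmp(3)[OF k'(1) q'(1)] c by simp
  show ?thesis
  proof (rule chase_exactI[OF cmp_Hom[OF f c] cmp_Hom[OF g c] gf])
    fix p h assume p: "projective V p" "h \<in> Hom p (EO N c)" "cmp g c \<cdot> h = \<zero>\<^bsub>p,EO P c\<^esub>"
    obtain h' where h': "h' \<in> Hom p (EO K' c)" "cmp k' c \<cdot> h' = h" using kernel_lift[OF k'(2)[OF c]
      cmp_Hom[OF k'(1) c] cmp_Hom[OF g c] p(2,3)] by blast
    have "cmp q' c \<cdot> h = \<zero>\<^bsub>p,EO Q' c\<^esub>"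
      using post[OF qk, of h'] h' cmp_Hom[OF k'(1) c] cmp_Hom[OF q'(1) c] Mod_EO[OF o(7) c] by (simp add: homset_def)
    then show "\<exists>x\<in>Hom p (EO M c). cmp f c \<cdot> x = h"
      using chase_exactD(2)[OF cokernel_chase_exact[OF q'(2)[OF c] cmp_Hom[OF q'(1) c] cmp_Hom[OF f c]]
        cmp_Hom[OF f c] cmp_Hom[OF q'(1) c] p(1,2)] by blast
  qed
qed

text \<open>The composites have the shape of consecutive differentials built from syzygies.
  Precomposing with the epimorphism \<open>p\<close> does not change the cokernel and composing with
  the monomorphism \<open>m\<close> does not change the kernel, so image and kernel are both
  \<open>k\<close>.\<close>

lemma pointwise_exact_at:
  assumes e: "e \<in> homset Mod P N" "\<And>c. c \<in> Ob \<Longrightarrow> epi_arrow V (cmp e c)"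
    and k: "k \<in> homset Mod K P" "\<And>c. c \<in> Ob \<Longrightarrow> is_kernel V (cmp k c) (cmp e c)"
    and p: "p \<in> homset Mod P' K" "\<And>c. c \<in> Ob \<Longrightarrow> epi_arrow V (cmp p c)"
    and m: "m \<in> homset Mod N L" "\<And>c. c \<in> Ob \<Longrightarrow> mono_arrow V (cmp m c)"
  shows "exact_at Mod (k \<cdot>\<^bsub>Mod\<^esub> p) (m \<cdot>\<^bsub>Mod\<^esub> e)"
  unfolding exact_at_def
proof (intro exI conjI)
  show "is_cokernel Mod e (k \<cdot>\<^bsub>Mod\<^esub> p)"
  proof (rule pointwise_cokernel[OF e(1) cmp_Cmp(2)[OF p(1) k(1)]])
    fix c assume c: "c \<in> Ob"
    note h = cmp_Hom[OF e(1) c] cmp_Hom[OF k(1) c] cmp_Hom[OF p(1) c]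
    note cok = epi_cokernel_of_kernel[OF e(2)[OF c] k(2)[OF c]]
    have *: "t \<cdot> (cmp k c \<cdot> cmp p c) = \<zero>\<^bsub>EO P' c,v\<^esub> \<longleftrightarrow> t
      \<cdot> cmp k c = \<zero>\<^bsub>EO K c,v\<^esub>" if t: "t \<in> Hom (EO P c) v" for t v
    proof
      assume "t \<cdot> (cmp k c \<cdot> cmp p c) = \<zero>\<^bsub>EO P' c,v\<^esub>"
      then have "(t \<cdot> cmp k c) \<cdot> cmp p c = \<zero>\<^bsub>EO K c,v\<^esub> \<cdot> cmp p c" using
        t h Hom_Obj[OF t] by (simp add: homset_def)
      then show "t \<cdot> cmp k c = \<zero>\<^bsub>EO K c,v\<^esub>"
        by - (rule epi_arrowD[OF p(2)[OF c]], use t h Hom_Obj[OF t] Hom_Obj[OF h(2)] in \<open>simp_all add: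
          homset_def\<close>)
    next
      assume "t \<cdot> cmp k c = \<zero>\<^bsub>EO K c,v\<^esub>"
      then show "t \<cdot> (cmp k c \<cdot> cmp p c) = \<zero>\<^bsub>EO P' c,v\<^esub>" using post[of t
        "cmp k c" _ "cmp p c"] t h Hom_Obj[OF t] by (simp add: homset_def)
    qed
    show "is_cokernel V (cmp e c) (cmp (k \<cdot>\<^bsub>Mod\<^esub> p) c)"
      using cok unfolding cmp_Cmp(3)[OF p(1) k(1) c] is_cokernel_iff[OF h(1) Cmp_homset[OF h(3,2)]]
        is_cokernel_iff[OF h(1,2)]
      using * h(1) by metis
  qed
  show "is_kernel Mod k e" by (rule pointwise_kernel[OF k(1) e(1) k(2)])
  show "is_kernel Mod k (m \<cdot>\<^bsub>Mod\<^esub> e)"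
  proof (rule pointwise_kernel[OF k(1) cmp_Cmp(2)[OF e(1) m(1)]])
    fix c assume c: "c \<in> Ob"
    note h = cmp_Hom[OF e(1) c] cmp_Hom[OF k(1) c] cmp_Hom[OF m(1) c]
    show "is_kernel V (cmp k c) (cmp (m \<cdot>\<^bsub>Mod\<^esub> e) c)"
      unfolding cmp_Cmp(3)[OF e(1) m(1) c] kernel_Cmp_mono[OF h(2,1,3) m(2)[OF c]] by (rule k(2)[OF c])
  qed
qed

end

section \<open>Coproducts, free modules and resolutions\<close>

definition (in category) coproducts_over :: "'i set \<Rightarrow> bool" where
  "coproducts_over I \<longleftrightarrow> (\<forall>X. (\<forall>i\<in>I. X i \<in> Obj C) \<longrightarrow>
    (\<exists>Q \<iota>. is_coproduct C I X Q \<iota>))"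

lemma (in category) coprod_is_coproduct:
  assumes "coproducts_over I" "\<And>i. i \<in> I \<Longrightarrow> X i \<in> Obj C"
  shows "is_coproduct C I X (fst (coprod C I X)) (snd (coprod C I X))"
proof -
  have "\<exists>p. case p of (Q, \<iota>) \<Rightarrow> is_coproduct C I X Q \<iota>" using assms unfolding
    coproducts_over_def by auto
  then show ?thesis unfolding coprod_def by (rule someI2_ex) (simp add: case_prod_beta)
qed

lemma (in category) coprod_desc_eq:
  assumes "coproducts_over I" "\<And>i. i \<in> I \<Longrightarrow> X i \<in> Obj C" "y \<in> Obj C"
    "\<And>i. i \<in> I \<Longrightarrow> f i \<in> Hom (X i) y"
  shows "coprod_desc C I X y f \<in> Hom (fst (coprod C I X)) y"
    and "i \<in> I \<Longrightarrow> coprod_desc C I X y f \<cdot> snd (coprod C I X) i = f i"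
proof -
  note c = coprod_is_coproduct[OF assms(1), of X, OF assms(2)]
  obtain u where u: "u \<in> Hom (fst (coprod C I X)) y" "\<forall>i\<in>I. u \<cdot> snd (coprod C I X) i = f i"
    using coproduct_desc[OF c assms(3), where f = f] assms(4) by blast
  have "\<exists>!u. u \<in> Hom (fst (coprod C I X)) y \<and> (\<forall>i\<in>I. u \<cdot> snd (coprod C I X) i = f i)"
    using u coproduct_eq[OF c] by (intro ex1I[of _ u]) auto
  from theI'[OF this] show "coprod_desc C I X y f \<in> Hom (fst (coprod C I X)) y"
    "i \<in> I \<Longrightarrow> coprod_desc C I X y f \<cdot> snd (coprod C I X) i = f i"
    unfolding coprod_desc_def by blast+
qed

text \<open>Cocompleteness and (AB4) speak of index sets inside \<open>'u\<close>. This lemma and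
  its converse transport a coproduct between an index set of another type and its image under an
  injection.\<close>

lemma (in category) coproduct_reindex:
  assumes inj: "inj_on \<phi> I" and Q: "is_coproduct C (\<phi> ` I) (\<lambda>j. X (inv_into I \<phi> j)) Q \<iota>"
  shows "is_coproduct C I X Q (\<lambda>i. \<iota> (\<phi> i))"
proof (rule coproductI[OF coproduct_Obj[OF Q]])
  have inv: "\<And>i. i \<in> I \<Longrightarrow> inv_into I \<phi> (\<phi> i) = i" using inj by simp
  show "\<iota> (\<phi> i) \<in> Hom (X i) Q" if "i \<in> I" for i using coproduct_Hom[OF Q, of "\<phi> i"]
    inv that by simp
  fix y assume y: "y \<in> Obj C"
  show "\<exists>u\<in>Hom Q y. \<forall>i\<in>I. u \<cdot> \<iota> (\<phi> i) = f i" if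
    "\<And>i. i \<in> I \<Longrightarrow> f i \<in> Hom (X i) y" for f
  proof -
    have "f (inv_into I \<phi> j) \<in> Hom (X (inv_into I \<phi> j)) y" if "j \<in> \<phi> ` I" for j using
      \<open>\<And>i. i \<in> I \<Longrightarrow> f i \<in> Hom (X i) y\<close> inv_into_into[OF that] .
    then obtain u where "u \<in> Hom Q y" "\<forall>j\<in>\<phi> ` I. u \<cdot> \<iota> j = f (inv_into I \<phi> j)"
      using coproduct_desc[OF Q y, where f = "\<lambda>j. f (inv_into I \<phi> j)"] by blast
    then show ?thesis using inv by (intro bexI[of _ u]) auto
  qed
  show "u = u'" if "u \<in> Hom Q y" "u' \<in> Hom Q y" "\<And>i. i \<in> I \<Longrightarrow> u \<cdot>
    \<iota> (\<phi> i) = u' \<cdot> \<iota> (\<phi> i)" for u u'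
    using coproduct_eq[OF Q that(1,2)] that(3) by blast
qed

lemma (in category) coproduct_reindex':
  assumes inj: "inj_on \<phi> I" and Q: "is_coproduct C I X Q \<iota>"
  shows "is_coproduct C (\<phi> ` I) (\<lambda>j. X (inv_into I \<phi> j)) Q (\<lambda>j. \<iota> (inv_into I
    \<phi> j))"
proof (rule coproductI[OF coproduct_Obj[OF Q]])
  have inv: "\<And>i. i \<in> I \<Longrightarrow> inv_into I \<phi> (\<phi> i) = i" using inj by simp
  show "\<iota> (inv_into I \<phi> j) \<in> Hom (X (inv_into I \<phi> j)) Q" if "j \<in> \<phi> ` I" for j
    using coproduct_Hom[OF Q] inv_into_into[OF that] .
  fix y assume y: "y \<in> Obj C"
  show "\<exists>u\<in>Hom Q y. \<forall>j\<in>\<phi> ` I. u \<cdot> \<iota> (inv_into I \<phi> j) = f j"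
    if f: "\<And>j. j \<in> \<phi> ` I \<Longrightarrow> f j \<in> Hom (X (inv_into I \<phi> j)) y" for f
  proof -
    have "f (\<phi> i) \<in> Hom (X i) y" if "i \<in> I" for i using f[of "\<phi> i"] inv that by simp
    then obtain u where "u \<in> Hom Q y" "\<forall>i\<in>I. u \<cdot> \<iota> i = f (\<phi> i)"
      using coproduct_desc[OF Q y, where f = "\<lambda>i. f (\<phi> i)"] by blast
    then show ?thesis using inv by (intro bexI[of _ u]) auto
  qed
  show "u = u'" if "u \<in> Hom Q y" "u' \<in> Hom Q y" "\<And>j. j \<in> \<phi> ` I \<Longrightarrow> u
    \<cdot> \<iota> (inv_into I \<phi> j) = u' \<cdot> \<iota> (inv_into I \<phi> j)" for u u'
    using coproduct_eq[OF Q that(1,2)] that(3) inv by (metis imageI)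
qed

text \<open>A coproduct is a colimit over a discrete category. In \<open>J\<close> every arrow is
  the identity named by its object, so only equal arrows compose and the cocone condition is a mere
  unit law.\<close>

lemma (in category) small_coproducts:
  fixes \<phi> :: "'i \<Rightarrow> 'u"
  assumes "small_cocomplete TYPE('u) C" and inj: "inj_on \<phi> I"
  shows "coproducts_over I"
  unfolding coproducts_over_def
proof (intro allI impI)
  fix X assume X: "\<forall>i\<in>I. X i \<in> Obj C"
  define K where "K = \<phi> ` I"
  define Y where "Y j = X (inv_into I \<phi> j)" for j
  have Y: "Y j \<in> Obj C" if "j \<in> K" for j using X inv_into_into[of j \<phi> I] that by (simp add: K_def Y_def)
  define J :: "('u, 'u) cat" where "J = \<lparr>Obj = K, Arr = K, Dom = id, Cod = id, Ide = id, Cmp =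
    (\<lambda>g f. f)\<rparr>"
  define F where "F = \<lparr>FO = Y, FA = (\<lambda>j. Ide C (Y j))\<rparr>"
  have "category J" by unfold_locales (auto simp: J_def homset_def)
  moreover have "is_functor J C F" using Y by (auto simp: is_functor_def J_def F_def homset_def)
  ultimately obtain Q \<iota> where Q: "is_colimit J C F Q \<iota>" using assms(1) unfolding
    small_cocomplete_def by blast
  have co: "(\<forall>k\<in>K. \<sigma> k \<cdot> Ide C (Y k) = \<sigma> k)" if
    "\<forall>j\<in>K. \<sigma> j \<in> Hom (Y j) x" for \<sigma> x using that by (simp add: homset_def)
  have "is_coproduct C K Y Q \<iota>" unfolding is_coproduct_def
    using Q co unfolding is_colimit_def Let_def by (simp add: J_def F_def)
  then show "\<exists>Q \<iota>. is_coproduct C I X Q \<iota>" using coproduct_reindex[OF inj, of X Q \<iota>]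
    unfolding K_def Y_def by blast
qed

text \<open>An infinite type is in bijection with its square; iterating this encodes tuples of a
  fixed length as single elements. Here infinitude of \<open>'u\<close> enters, and it makes the
  tuple-indexed coproducts of the bar construction small.\<close>

lemma inj_on_lists_of_length:
  assumes "infinite (UNIV :: 'u set)"
  shows "\<exists>\<phi> :: 'u list \<Rightarrow> 'u. inj_on \<phi> {cs. length cs = n}"
proof (induction n)
  case 0
  show ?case by (intro exI[of _ "\<lambda>_. undefined"]) (auto simp: inj_on_def)
next
  case (Suc n)
  then obtain \<phi> :: "'u list \<Rightarrow> 'u" where \<phi>: "inj_on \<phi> {cs. length cs = n}" by blast
  obtain p :: "'u \<times> 'u \<Rightarrow> 'u" where "bij_betw p (UNIV \<times> UNIV) UNIV"
    using card_of_Times_same_infinite[OF assms] card_of_ordIso[of "UNIV \<times> UNIV" UNIV] by blast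
  then have p: "inj p" using bij_betw_imp_inj_on by fastforce
  have "inj_on (\<lambda>cs. p (hd cs, \<phi> (tl cs))) {cs. length cs = Suc n}"
  proof (rule inj_onI)
    fix cs ds assume l: "cs \<in> {cs. length cs = Suc n}" "ds \<in> {cs. length cs = Suc n}" and
      "p (hd cs, \<phi> (tl cs)) = p (hd ds, \<phi> (tl ds))"
    then have "hd cs = hd ds" "\<phi> (tl cs) = \<phi> (tl ds)" using injD[OF p] by blast+
    then have "hd cs = hd ds" "tl cs = tl ds" using inj_onD[OF \<phi>, of "tl cs" "tl ds"] l by simp_all
    then show "cs = ds" using l by (cases cs; cases ds) simp_all
  qed
  then show ?case by blast
qed

lemma (in category) coproducts_over_bar_index:
  fixes E :: "('u, 'o, 'a) ecat"
  assumes "small_cocomplete TYPE('u) C" "infinite (UNIV :: 'u set)"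
  shows "coproducts_over (bar_index E n)"
proof -
  obtain \<phi> :: "'u list \<Rightarrow> 'u" where "inj_on \<phi> {cs. length cs = Suc n}" using
    inj_on_lists_of_length[OF assms(2)] by blast
  then have "inj_on \<phi> (bar_index E n)" by (rule inj_on_subset) (auto simp: bar_index_def)
  then show ?thesis by (rule small_coproducts[OF assms(1)])
qed

section \<open>Free modules and projective resolutions of modules\<close>

locale free_module_setting = module_setting V C
  for V :: "('o, 'a, 'z) moncat_scheme" (structure) and C :: "('u, 'o, 'a) ecat" +
  assumes coprods_Ob: "coproducts_over Ob"
begin

notation zero ("\<zero>\<^bsub>_,_\<^esub>") and hsub (infixl "\<ominus>" 65)

text \<open>Underlying objects of the free module on the family \<open>X\<close>, a sum of
  representables with coefficients \<open>X c\<close>; \<open>TI\<close> are the inclusions of the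
  summands.\<close>

definition "TO X c' = fst (coprod V Ob (\<lambda>c. X c \<boxtimes> \<C> c c'))"
definition "TI X c c' = snd (coprod V Ob (\<lambda>c. X c \<boxtimes> \<C> c c')) c"

context
  fixes X :: "'u \<Rightarrow> 'o"
  assumes X: "\<And>c. c \<in> Ob \<Longrightarrow> X c \<in> Obj V"
begin

lemma TO_coproduct: "c' \<in> Ob \<Longrightarrow> is_coproduct V Ob (\<lambda>c. X c \<boxtimes> \<C> c c')
  (TO X c') (\<lambda>c. TI X c c')"
  unfolding TO_def TI_def by (rule coprod_is_coproduct[OF coprods_Ob]) (use X in simp)

lemma TO_Obj: "c' \<in> Ob \<Longrightarrow> TO X c' \<in> Obj V"
  and TI_Hom: "c \<in> Ob \<Longrightarrow> c' \<in> Ob \<Longrightarrow> TI X c c' \<in> Hom (X c \<boxtimes>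
    \<C> c c') (TO X c')"
  using coproduct_Obj[OF TO_coproduct] coproduct_Hom[OF TO_coproduct] by auto

lemma TO_ten_coproduct:
  assumes "c' \<in> Ob" "y \<in> Obj V" "z \<in> Obj V"
  shows "is_coproduct V Ob (\<lambda>c. (X c \<boxtimes> \<C> c c') \<boxtimes> y) (TO X c' \<boxtimes> y)
    (\<lambda>c. TI X c c' \<boxdot> Ide V y)"
    and "is_coproduct V Ob (\<lambda>c. ((X c \<boxtimes> \<C> c c') \<boxtimes> y) \<boxtimes> z) ((TO X c'
      \<boxtimes> y) \<boxtimes> z) (\<lambda>c. (TI X c c' \<boxdot> Ide V y) \<boxdot> Ide V z)"
  by (rule ten_coproduct[OF TO_coproduct[OF assms(1)] assms(2)], rule ten_coproduct[OF ten_coproduct[OF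
    TO_coproduct[OF assms(1)] assms(2)] assms(3)])

text \<open>The action on a single representable summand. The same arrow reappears as the face of a
  bar summand that composes its first two homs, which is what links the free module to the
  decalage.\<close>

definition "gen a b c = (Ide V (X a) \<boxdot> \<kappa> a b c) \<cdot> asc V (X a) (\<C> a b) (\<C> b c)"

lemma gen_Hom:
  assumes "a \<in> Ob" "b \<in> Ob" "c \<in> Ob"
  shows "gen a b c \<in> Hom ((X a \<boxtimes> \<C> a b) \<boxtimes> \<C> b c) (X a \<boxtimes> \<C> a c)"
  unfolding gen_def using kappa_Hom[OF assms] X[OF assms(1)] assms by (simp add: homset_def)

text \<open>Tensoring with a hom object preserves the coproduct, so the action can be prescribed on
  each summand separately.\<close>

lemma Tact_ex:
  assumes ab: "a \<in> Ob" "b \<in> Ob"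
  shows "\<exists>u \<in> Hom (TO X a \<boxtimes> \<C> a b) (TO X b). \<forall>c\<in>Ob. u \<cdot> (TI X c a
    \<boxdot> Ide V (\<C> a b)) = TI X c b \<cdot> gen c a b"
  by (rule coproduct_desc[OF TO_ten_coproduct(1)[OF ab(1) eHom_Obj[OF ab] unt_Obj] TO_Obj[OF ab(2)]])
    (rule Cmp_homset[OF gen_Hom TI_Hom], use ab in simp_all)

definition "Tact a b = (SOME u. u \<in> Hom (TO X a \<boxtimes> \<C> a b) (TO X b) \<and> (\<forall>c\<in>Ob.
  u \<cdot> (TI X c a \<boxdot> Ide V (\<C> a b)) = TI X c b \<cdot> gen c a b))"

lemma Tact:
  assumes "a \<in> Ob" "b \<in> Ob"
  shows "Tact a b \<in> Hom (TO X a \<boxtimes> \<C> a b) (TO X b)"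
    and "c \<in> Ob \<Longrightarrow> Tact a b \<cdot> (TI X c a \<boxdot> Ide V (\<C> a b)) = TI X c b
      \<cdot> gen c a b"
  using someI_ex[OF Tact_ex[OF assms, unfolded Bex_def]] unfolding Tact_def by blast+

text \<open>Both laws are compared on the inclusions of the tensored coproduct, where they reduce to
  unitality and associativity of \<kappa>, the latter by way of the pentagon
  \<open>pent\<close>.\<close>

lemma T_rmod: "rmod (TO X) Tact"
  unfolding rmod_def
proof (intro conjI ballI TO_Obj Tact(1))
  fix a assume a: "a \<in> Ob"
  note [simp] = eHom_Obj[OF a a] TO_Obj[OF a] Hom_ArrD[OF Tact(1)[OF a a]] Hom_ArrD[OF eIde_homset[OF a]]
  show "Tact a a \<cdot> (Ide V (TO X a) \<boxdot> eIde C a) = run V (TO X a)"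
  proof (rule coproduct_eq[OF TO_ten_coproduct(1)[OF a unt_Obj unt_Obj]])
    show "Tact a a \<cdot> (Ide V (TO X a) \<boxdot> eIde C a) \<in> Hom (TO X a \<boxtimes> unt V) (TO X a)"
      by (simp add: homset_def)
    show "run V (TO X a) \<in> Hom (TO X a \<boxtimes> unt V) (TO X a)" by (simp add: homset_def)
    fix c assume c: "c \<in> Ob"
    note [simp] = eHom_Obj[OF c a] X[OF c] Hom_ArrD[OF TI_Hom[OF c a]] Hom_ArrD[OF kappa_Hom[OF c a a]]
      Hom_ArrD[OF gen_Hom[OF c a a]]
    have "(Tact a a \<cdot> (Ide V (TO X a) \<boxdot> eIde C a)) \<cdot> (TI X c a \<boxdot> Ide V (unt V))
      = (Tact a a \<cdot> (TI X c a \<boxdot> Ide V (\<C> a a))) \<cdot> (Ide V (X c \<boxtimes> \<C> c a)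
        \<boxdot> eIde C a)"
      by (simp add: interchange del: tenA_Ide)
    also have "\<dots> = TI X c a \<cdot> ((Ide V (X c) \<boxdot> \<kappa> c a a) \<cdot> (asc V (X c) (\<C> c
      a) (\<C> a a) \<cdot> ((Ide V (X c) \<boxdot> Ide V (\<C> c a)) \<boxdot> eIde C a)))"
      unfolding Tact(2)[OF a a c] by (simp add: gen_def)
    also have "\<dots> = TI X c a \<cdot> ((Ide V (X c) \<boxdot> (\<kappa> c a a \<cdot> (Ide V (\<C> c a)
      \<boxdot> eIde C a))) \<cdot> asc V (X c) (\<C> c a) (unt V))"
      by (subst asc_nat) (simp_all add: interchange')
    also have "\<dots> = TI X c a \<cdot> run V (X c \<boxtimes> \<C> c a)"
      unfolding kappa_unit(1)[OF c a] by (simp add: run_asc)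
    also have "\<dots> = run V (TO X a) \<cdot> (TI X c a \<boxdot> Ide V (unt V))" using run_nat[of
      "TI X c a" "TO X a"] by simp
    finally show "(Tact a a \<cdot> (Ide V (TO X a) \<boxdot> eIde C a)) \<cdot> (TI X c a \<boxdot> Ide V
      (unt V)) = run V (TO X a) \<cdot> (TI X c a \<boxdot> Ide V (unt V))" .
  qed
next
  fix a b d assume abd: "a \<in> Ob" "b \<in> Ob" "d \<in> Ob"
  note [simp] = eHom_Obj[OF abd(1,2)] eHom_Obj[OF abd(2,3)] eHom_Obj[OF abd(1,3)] TO_Obj[OF abd(1)] TO_Obj[OF
    abd(2)] TO_Obj[OF abd(3)] Hom_ArrD[OF kappa_Hom[OF abd]]
    Hom_ArrD[OF Tact(1)[OF abd(1,2)]] Hom_ArrD[OF Tact(1)[OF abd(2,3)]] Hom_ArrD[OF Tact(1)[OF abd(1,3)]]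
  show "Tact b d \<cdot> (Tact a b \<boxdot> Ide V (\<C> b d)) = Tact a d \<cdot> ((Ide V (TO X a) \<boxdot>
    \<kappa> a b d) \<cdot> asc V (TO X a) (\<C> a b) (\<C> b d))"
  proof (rule coproduct_eq[OF TO_ten_coproduct(2)[OF abd(1) eHom_Obj[OF abd(1,2)] eHom_Obj[OF abd(2,3)]]])
    show "Tact b d \<cdot> (Tact a b \<boxdot> Ide V (\<C> b d)) \<in> Hom ((TO X a \<boxtimes> \<C> a b)
      \<boxtimes> \<C> b d) (TO X d)" by (simp add: homset_def)
    show "Tact a d \<cdot> ((Ide V (TO X a) \<boxdot> \<kappa> a b d) \<cdot> asc V (TO X a) (\<C> a b) (\<C>
      b d)) \<in> Hom ((TO X a \<boxtimes> \<C> a b) \<boxtimes> \<C> b d) (TO X d)"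
      by (simp add: homset_def)
    fix c assume c: "c \<in> Ob"
    note [simp] = eHom_Obj[OF c abd(1)] eHom_Obj[OF c abd(2)] eHom_Obj[OF c abd(3)] X[OF c] Hom_ArrD[OF
      TI_Hom[OF c abd(1)]] Hom_ArrD[OF TI_Hom[OF c abd(2)]] Hom_ArrD[OF TI_Hom[OF c abd(3)]]
      Hom_ArrD[OF kappa_Hom[OF c abd(1,2)]] Hom_ArrD[OF kappa_Hom[OF c abd(2,3)]] Hom_ArrD[OF kappa_Hom[OF c abd(1,3)]]
      Hom_ArrD[OF gen_Hom[OF c abd(1,2)]] Hom_ArrD[OF gen_Hom[OF c abd(2,3)]] Hom_ArrD[OF gen_Hom[OF c abd(1,3)]]
    let ?t = "(TI X c a \<boxdot> Ide V (\<C> a b)) \<boxdot> Ide V (\<C> b d)"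
    have pent: "asc V (X c) (\<C> c a) (\<C> a b \<boxtimes> \<C> b d) \<cdot> asc V (X c \<boxtimes> \<C> c
      a) (\<C> a b) (\<C> b d)
      = (Ide V (X c) \<boxdot> asc V (\<C> c a) (\<C> a b) (\<C> b d)) \<cdot> (asc V (X c) (\<C> c a
        \<boxtimes> \<C> a b) (\<C> b d) \<cdot> (asc V (X c) (\<C> c a) (\<C> a b) \<boxdot> Ide V (\<C> b d)))"
      by (rule pentagon) simp_all
    have "(Tact b d \<cdot> (Tact a b \<boxdot> Ide V (\<C> b d))) \<cdot> ?t = Tact b d \<cdot> ((Tact a b
      \<cdot> (TI X c a \<boxdot> Ide V (\<C> a b))) \<boxdot> Ide V (\<C> b d))"
      by (simp add: interchange)
    also have "\<dots> = (Tact b d \<cdot> (TI X c b \<boxdot> Ide V (\<C> b d))) \<cdot> (gen c a b \<boxdot>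
      Ide V (\<C> b d))"
      unfolding Tact(2)[OF abd(1,2) c] by (simp add: interchange)
    also have "\<dots> = TI X c d \<cdot> ((Ide V (X c) \<boxdot> \<kappa> c b d) \<cdot> (asc V (X c) (\<C> c
      b) (\<C> b d) \<cdot> ((Ide V (X c) \<boxdot> \<kappa> c a b) \<boxdot> Ide V (\<C> b d)) \<cdot> (asc V
      (X c) (\<C> c a) (\<C> a b) \<boxdot> Ide V (\<C> b d))))"
      unfolding Tact(2)[OF abd(2,3) c] by (simp add: gen_def interchange)
    also have "\<dots> = TI X c d \<cdot> ((Ide V (X c) \<boxdot> (\<kappa> c b d \<cdot> (\<kappa> c a b
      \<boxdot> Ide V (\<C> b d)))) \<cdot> (asc V (X c) (\<C> c a \<boxtimes> \<C> a b) (\<C> b d) \<cdot>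
      (asc V (X c) (\<C> c a) (\<C> a b) \<boxdot> Ide V (\<C> b d))))"
      using asc_nat[of "Ide V (X c)" "\<kappa> c a b" "Ide V (\<C> b d)" "X c" "\<C> c b" "\<C> b d"] by (simp
        add: interchange')
    also have "\<dots> = TI X c d \<cdot> ((Ide V (X c) \<boxdot> \<kappa> c a d) \<cdot> ((Ide V (X c)
      \<boxdot> (Ide V (\<C> c a) \<boxdot> \<kappa> a b d)) \<cdot> (asc V (X c) (\<C> c a) (\<C> a b
      \<boxtimes> \<C> b d) \<cdot> asc V (X c \<boxtimes> \<C> c a) (\<C> a b) (\<C> b d))))"
      unfolding pent kappa_assoc[OF c abd] by (simp add: interchange')
    also have "\<dots> = (TI X c d \<cdot> gen c a d) \<cdot> ((Ide V (X c \<boxtimes> \<C> c a) \<boxdot>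
      \<kappa> a b d) \<cdot> asc V (X c \<boxtimes> \<C> c a) (\<C> a b) (\<C> b d))"
      using post[OF asc_nat[of "Ide V (X c)" "Ide V (\<C> c a)" "\<kappa> a b d" "X c" "\<C> c a" "\<C> a d"],
        of "asc V (X c \<boxtimes> \<C> c a) (\<C> a b) (\<C> b d)"] by (simp add: gen_def)
    also have "\<dots> = Tact a d \<cdot> ((TI X c a \<boxdot> \<kappa> a b d) \<cdot> asc V (X c \<boxtimes>
      \<C> c a) (\<C> a b) (\<C> b d))"
      unfolding Tact(2)[OF abd(1,3) c, symmetric] by (simp add: interchange' del: tenA_Ide)
    also have "\<dots> = Tact a d \<cdot> ((Ide V (TO X a) \<boxdot> \<kappa> a b d) \<cdot> (asc V (TO X a)
      (\<C> a b) (\<C> b d) \<cdot> ?t))"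
      using asc_nat[of "TI X c a" "Ide V (\<C> a b)" "Ide V (\<C> b d)" "TO X a" "\<C> a b" "\<C> b d"] by
        (simp add: interchange')
    finally show "(Tact b d \<cdot> (Tact a b \<boxdot> Ide V (\<C> b d))) \<cdot> ?t = (Tact a d \<cdot>
      ((Ide V (TO X a) \<boxdot> \<kappa> a b d) \<cdot> asc V (TO X a) (\<C> a b) (\<C> b d))) \<cdot> ?t" by simp
  qed
qed

definition "T = mk_mod (TO X) Tact"

lemma T_Mod: "T \<in> Obj Mod" and T_EO: "c \<in> Ob \<Longrightarrow> EO T c = TO X c" and T_act:
  "a \<in> Ob \<Longrightarrow> b \<in> Ob \<Longrightarrow> act T a b = Tact a b"
  unfolding T_def using mk_mod_Mod[OF T_rmod] mk_mod_act[OF T_rmod] by simp_all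

text \<open>The unit of the free-forgetful adjunction: \<open>X c\<close> is placed into the summand
  at \<open>c\<close> by means of the identity of \<open>c\<close>.\<close>

definition "Tunit c = TI X c c \<cdot> ((Ide V (X c) \<boxdot> eIde C c) \<cdot> inv_arrow V (run V (X c)))"

lemma Tunit_Hom: "c \<in> Ob \<Longrightarrow> Tunit c \<in> Hom (X c) (TO X c)"
  unfolding Tunit_def using Hom_ArrD[OF TI_Hom[of c c]] Hom_ArrD[OF eIde_homset[of c]] X[of c] by (simp add: homset_def)

text \<open>By the left unit law of \<kappa> and the triangle, acting on a generator recovers the
  whole inclusion of its summand; in this sense \<open>Tunit\<close> generates the free
  module.\<close>

lemma Tact_unit:
  assumes c: "c \<in> Ob" "b \<in> Ob" shows "Tact c b \<cdot> (Tunit c \<boxdot> Ide V (\<C> c b)) = TI X c b"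
proof -
  note [simp] = eHom_Obj[OF c] eHom_Obj[OF c(1,1)] X[OF c(1)] TO_Obj[OF c(1)] Hom_ArrD[OF Tact(1)[OF c]]
    Hom_ArrD[OF TI_Hom[OF c]] Hom_ArrD[OF TI_Hom[OF c(1,1)]]
    Hom_ArrD[OF eIde_homset[OF c(1)]] Hom_ArrD[OF kappa_Hom[OF c(1,1,2)]] Hom_ArrD[OF gen_Hom[OF c(1,1,2)]]
  have "Tact c b \<cdot> (Tunit c \<boxdot> Ide V (\<C> c b)) = (Tact c b \<cdot> (TI X c c \<boxdot> Ide V
    (\<C> c b))) \<cdot> (((Ide V (X c) \<boxdot> eIde C c) \<boxdot> Ide V (\<C> c b)) \<cdot> (inv_arrow V
    (run V (X c)) \<boxdot> Ide V (\<C> c b)))"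
    by (simp add: Tunit_def interchange)
  also have "\<dots> = TI X c b \<cdot> ((Ide V (X c) \<boxdot> \<kappa> c c b) \<cdot> ((asc V (X c) (\<C> c
    c) (\<C> c b) \<cdot> ((Ide V (X c) \<boxdot> eIde C c) \<boxdot> Ide V (\<C> c b))) \<cdot> (inv_arrow V
    (run V (X c)) \<boxdot> Ide V (\<C> c b))))"
    unfolding Tact(2)[OF c c(1)] by (simp add: gen_def)
  also have "\<dots> = TI X c b \<cdot> ((Ide V (X c) \<boxdot> (\<kappa> c c b \<cdot> (eIde C c \<boxdot>
    Ide V (\<C> c b)))) \<cdot> (asc V (X c) (unt V) (\<C> c b) \<cdot> (inv_arrow V (run V (X c)) \<boxdot>
    Ide V (\<C> c b))))"
    using asc_nat[of "Ide V (X c)" "eIde C c" "Ide V (\<C> c b)" "X c" "\<C> c c" "\<C> c b"] by (simp add: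
      interchange')
  also have "\<dots> = TI X c b \<cdot> ((run V (X c) \<boxdot> Ide V (\<C> c b)) \<cdot> (inv_arrow V (run V
    (X c)) \<boxdot> Ide V (\<C> c b)))"
    unfolding kappa_unit(2)[OF c] using post[OF triangle[of "X c" "\<C> c b"], of
      "inv_arrow V (run V (X c)) \<boxdot> Ide V (\<C> c b)"] by simp
  also have "\<dots> = TI X c b" by (simp add: interchange)
  finally show ?thesis .
qed

text \<open>On a summand the extension has to be the action on the image of the generator. This
  formula is kept beside the value on generators because the counit is later compared with the face
  d_0 summand by summand.\<close>

lemma T_extend:
  assumes M: "M \<in> Obj Mod" and h: "\<And>c. c \<in> Ob \<Longrightarrow> h c \<in> Hom (X c) (EO M c)"
  shows "\<exists>\<phi> \<in> homset Mod T M. (\<forall>c\<in>Ob. cmp \<phi> c \<cdot> Tunit c = h c) \<and>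
    (\<forall>c\<in>Ob. \<forall>c'\<in>Ob. cmp \<phi> c' \<cdot> TI X c c' = act M c c' \<cdot> (h c
      \<boxdot> Ide V (\<C> c c')))"
proof -
  have "\<exists>u \<in> Hom (TO X c') (EO M c'). \<forall>c\<in>Ob. u \<cdot> TI X c c' = act M c c' \<cdot>
    (h c \<boxdot> Ide V (\<C> c c'))" if c': "c' \<in> Ob" for c'
    by (rule coproduct_desc[OF TO_coproduct[OF c'] Mod_EO[OF M c']])
      (rule Cmp_homset[OF tenA_homset[OF h Ide_Hom] Mod_act_Hom[OF M]], use c' in simp_all)
  then obtain f where f: "\<And>c. c \<in> Ob \<Longrightarrow> f c \<in> Hom (TO X c) (EO M c)"
    "\<And>c c'. c \<in> Ob \<Longrightarrow> c' \<in> Ob \<Longrightarrow> f c' \<cdot> TI X c c' = act M c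
      c' \<cdot> (h c \<boxdot> Ide V (\<C> c c'))" by metis
  have "equivariant T f M" unfolding equivariant_def
  proof (intro conjI ballI)
    show "f c \<in> Hom (EO T c) (EO M c)" if "c \<in> Ob" for c using f(1) T_EO that by simp
    fix a b assume ab: "a \<in> Ob" "b \<in> Ob"
    note [simp] = eHom_Obj[OF ab] TO_Obj[OF ab(1)] TO_Obj[OF ab(2)] Hom_ArrD[OF Tact(1)[OF ab]] Hom_ArrD[OF
      f(1)[OF ab(1)]] Hom_ArrD[OF f(1)[OF ab(2)]]
      Hom_ArrD[OF Mod_act_Hom[OF M ab]] Mod_EO[OF M ab(1)] Mod_EO[OF M ab(2)]
    show "f b \<cdot> act T a b = act M a b \<cdot> (f a \<boxdot> Ide V (\<C> a b))" unfolding T_act[OF ab]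
    proof (rule coproduct_eq[OF TO_ten_coproduct(1)[OF ab(1) eHom_Obj[OF ab] unt_Obj]])
      show "f b \<cdot> Tact a b \<in> Hom (TO X a \<boxtimes> \<C> a b) (EO M b)"
        "act M a b \<cdot> (f a \<boxdot> Ide V (\<C> a b)) \<in> Hom (TO X a \<boxtimes> \<C> a b) (EO M b)"
        by (simp_all add: homset_def)
      fix c assume c: "c \<in> Ob"
      note [simp] = eHom_Obj[OF c ab(1)] eHom_Obj[OF c ab(2)] X[OF c] Hom_ArrD[OF TI_Hom[OF c ab(1)]]
        Hom_ArrD[OF TI_Hom[OF c ab(2)]]
        Hom_ArrD[OF kappa_Hom[OF c ab]] Hom_ArrD[OF gen_Hom[OF c ab]] Hom_ArrD[OF h[OF c]] Mod_EO[OF M c]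
        Hom_ArrD[OF Mod_act_Hom[OF M c ab(1)]] Hom_ArrD[OF Mod_act_Hom[OF M c ab(2)]]
      have "(f b \<cdot> Tact a b) \<cdot> (TI X c a \<boxdot> Ide V (\<C> a b)) = (f b \<cdot> TI X c b)
        \<cdot> gen c a b"
        using Tact(2)[OF ab c] by simp
      also have "\<dots> = act M c b \<cdot> ((Ide V (EO M c) \<boxdot> \<kappa> c a b) \<cdot> (asc V (EO M
        c) (\<C> c a) (\<C> a b) \<cdot> ((h c \<boxdot> Ide V (\<C> c a)) \<boxdot> Ide V (\<C> a b))))"
        unfolding f(2)[OF c ab(2)] using asc_nat[of "h c" "Ide V (\<C> c a)" "Ide V (\<C> a b)" "EO M c"
          "\<C> c a" "\<C> a b"] by (simp add: gen_def interchange')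
      also have "\<dots> = (act M a b \<cdot> (act M c a \<boxdot> Ide V (\<C> a b))) \<cdot> ((h c \<boxdot>
        Ide V (\<C> c a)) \<boxdot> Ide V (\<C> a b))"
        unfolding rmodD(4)[OF Mod_rmod[OF M] c ab] by simp
      also have "\<dots> = act M a b \<cdot> ((f a \<cdot> TI X c a) \<boxdot> Ide V (\<C> a b))"
        unfolding f(2)[OF c ab(1)] by (simp add: interchange)
      finally show "(f b \<cdot> Tact a b) \<cdot> (TI X c a \<boxdot> Ide V (\<C> a b)) = (act M a b \<cdot>
        (f a \<boxdot> Ide V (\<C> a b))) \<cdot> (TI X c a \<boxdot> Ide V (\<C> a b))"
        by (simp add: interchange)
    qed
  qed
  note \<phi> = mor_Hom[OF T_Mod M this]
  have cm: "cmp (mor T f M) c = f c" if "c \<in> Ob" for c using cmp_mor[OF T_Mod that, of f M] f(1)[OF that]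
    T_EO[OF that] by simp
  show ?thesis
  proof (intro bexI[OF _ \<phi>] conjI ballI)
    fix c assume c: "c \<in> Ob"
    note [simp] = eHom_Obj[OF c c] X[OF c] Hom_ArrD[OF TI_Hom[OF c c]] Hom_ArrD[OF h[OF c]] Mod_EO[OF M c]
      Hom_ArrD[OF f(1)[OF c]]
        Hom_ArrD[OF Mod_act_Hom[OF M c c]] Hom_ArrD[OF eIde_homset[OF c]]
    have "cmp (mor T f M) c \<cdot> Tunit c = (f c \<cdot> TI X c c) \<cdot> ((Ide V (X c) \<boxdot> eIde C c)
      \<cdot> inv_arrow V (run V (X c)))"
      unfolding cm[OF c] Tunit_def by simp
    also have "\<dots> = (act M c c \<cdot> (Ide V (EO M c) \<boxdot> eIde C c)) \<cdot> ((h c \<boxdot> Ide V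
      (unt V)) \<cdot> inv_arrow V (run V (X c)))"
      unfolding f(2)[OF c c] by (simp add: interchange')
    also have "\<dots> = h c" unfolding rmodD(3)[OF Mod_rmod[OF M] c c]
      using post[OF run_nat[of "h c" "EO M c"], of "inv_arrow V (run V (X c))"] by simp
    finally show "cmp (mor T f M) c \<cdot> Tunit c = h c" .
  next
    fix c c' assume "c \<in> Ob" "c' \<in> Ob"
    then show "cmp (mor T f M) c' \<cdot> TI X c c' = act M c c' \<cdot> (h c \<boxdot> Ide V (\<C> c c'))"
      using f(2) cm by simp
  qed
qed

text \<open>Equivariance together with \<open>Tact_unit\<close> expresses a map on each inclusion
  through its value on the generators.\<close>

lemma T_unique:
  assumes f: "f \<in> homset Mod T M" and g: "g \<in> homset Mod T M" and eq:
    "\<And>c. c \<in> Ob \<Longrightarrow> cmp f c \<cdot> Tunit c = cmp g c \<cdot> Tunit c"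
  shows "f = g"
proof (rule Mod_arrow_eqI[OF f g])
  fix b assume b: "b \<in> Ob"
  have *: "cmp f b \<cdot> TI X c b = act M c b \<cdot> ((cmp f c \<cdot> Tunit c) \<boxdot> Ide V (\<C> c
    b))" if f: "f \<in> homset Mod T M" and c: "c \<in> Ob" for f c
  proof -
    note [simp] = eHom_Obj[OF c b] Hom_ArrD[OF Tact(1)[OF c b]] Hom_ArrD[OF Tunit_Hom[OF c]] Hom_ArrD[OF
      cmp_Hom[OF f c]] Hom_ArrD[OF cmp_Hom[OF f b]]
      Hom_ArrD[OF Mod_act_Hom[OF Hom_mor(4)[OF f] c b]] T_EO[OF c] T_EO[OF b]
    have "cmp f b \<cdot> TI X c b = (cmp f b \<cdot> act T c b) \<cdot> (Tunit c \<boxdot> Ide V (\<C> c b))"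
      unfolding Tact_unit[OF c b, symmetric] T_act[OF c b] by simp
    then show ?thesis unfolding equivariantD(2)[OF Hom_mor(2)[OF f] c b] by (simp add: interchange)
  qed
  show "cmp f b = cmp g b"
    by (rule coproduct_eq[OF TO_coproduct[OF b]]) (use cmp_Hom[OF f b] cmp_Hom[OF g b] T_EO[OF b] *[OF f] *[OF
      g] eq in simp_all)
qed

text \<open>Maps out of the free module are families of arrows out of the \<open>X c\<close>, and
  epimorphisms of modules are pointwise epi, so the lifting is done at each generator.\<close>

lemma T_projective:
  assumes p: "\<And>c. c \<in> Ob \<Longrightarrow> projective V (X c)"
  shows "projective Mod T"
  unfolding projective_def
proof (intro conjI allI impI T_Mod)
  interpret Md: category Mod by (rule category_Mod)
  fix e f assume ef: "epi_arrow Mod e \<and> f \<in> homset Mod T (Cod Mod e)"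
  define M N where "M = Dom Mod e" "N = Cod Mod e"
  have "e \<in> Arr Mod" using ef unfolding epi_arrow_def by blast
  then have e: "e \<in> homset Mod M N" by (simp add: homset_def M_N_def)
  have f: "f \<in> homset Mod T N" using ef M_N_def by simp
  have "\<exists>h \<in> Hom (X c) (EO M c). cmp e c \<cdot> h = cmp f c \<cdot> Tunit c" if c: "c \<in> Ob" for c
    by (rule epi_lift[OF Mod_epi_pointwise[OF e _ c] cmp_Hom[OF e c] p[OF c]])
      (use ef Cmp_homset[OF Tunit_Hom[OF c], of "cmp f c"] cmp_Hom[OF f c] T_EO[OF c] in simp_all)
  then obtain h where h: "\<And>c. c \<in> Ob \<Longrightarrow> h c \<in> Hom (X c) (EO M c)"
    "\<And>c. c \<in> Ob \<Longrightarrow> cmp e c \<cdot> h c = cmp f c \<cdot> Tunit c" by metis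
  obtain \<phi> where \<phi>: "\<phi> \<in> homset Mod T M" "\<And>c. c \<in> Ob \<Longrightarrow> cmp \<phi>
    c \<cdot> Tunit c = h c"
    using T_extend[where h = h, OF Hom_mor(3)[OF e] h(1)] by blast
  have "e \<cdot>\<^bsub>Mod\<^esub> \<phi> = f"
  proof (rule T_unique[OF cmp_Cmp(2)[OF \<phi>(1) e] f])
    fix c assume c: "c \<in> Ob"
    show "cmp (e \<cdot>\<^bsub>Mod\<^esub> \<phi>) c \<cdot> Tunit c = cmp f c \<cdot> Tunit c"
      unfolding cmp_Cmp(3)[OF \<phi>(1) e c] using \<phi>(2)[OF c] h(2)[OF c] cmp_Hom[OF \<phi>(1) c]
        cmp_Hom[OF e c] Tunit_Hom[OF c] T_EO[OF c]
      by (simp add: homset_def)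
  qed
  then show "\<exists>f'\<in>homset Mod T (Dom Mod e). e \<cdot>\<^bsub>Mod\<^esub> f' = f" using \<phi>(1)
    M_N_def by blast
qed

end

text \<open>Projective covers of all the objects \<open>EO M c\<close> are extended freely. Each
  component is epi because its restriction to the generators already is.\<close>

lemma Mod_projective_cover:
  assumes M: "M \<in> Obj Mod"
  obtains P e where "projective Mod P" "e \<in> homset Mod P M"
    "\<And>c. c \<in> Ob \<Longrightarrow> epi_arrow V (cmp e c)"
proof -
  have "\<exists>p e. projective V p \<and> e \<in> Hom p (EO M c) \<and> epi_arrow V e" if "c \<in> Ob" for c
    using projective_cover[OF Mod_EO[OF M that]] by blast
  then obtain X h where X: "\<And>c. c \<in> Ob \<Longrightarrow> projective V (X c)"
    "\<And>c. c \<in> Ob \<Longrightarrow> h c \<in> Hom (X c) (EO M c)"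
    "\<And>c. c \<in> Ob \<Longrightarrow> epi_arrow V (h c)" by metis
  have Xo: "\<And>c. c \<in> Ob \<Longrightarrow> X c \<in> Obj V" using X(1) by (simp add: projective_def)
  obtain \<phi> where \<phi>: "\<phi> \<in> homset Mod (T X) M"
    "\<And>c. c \<in> Ob \<Longrightarrow> cmp \<phi> c \<cdot> Tunit X c = h c"
    using T_extend[of X M h, OF Xo M X(2)] by blast
  show ?thesis
  proof (rule that[OF T_projective[of X, OF Xo X(1)] \<phi>(1)])
    fix c assume c: "c \<in> Ob"
    have h: "cmp \<phi> c \<in> Hom (TO X c) (EO M c)" "Tunit X c \<in> Hom (X c) (TO X c)" using cmp_Hom[OF
      \<phi>(1) c] T_EO[of X, OF Xo c] Tunit_Hom[of X, OF Xo c] by auto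
    show "epi_arrow V (cmp \<phi> c)"
    proof (rule epi_via_zero[OF h(1)])
      fix w a assume a: "a \<in> Hom (EO M c) w" "a \<cdot> cmp \<phi> c = \<zero>\<^bsub>TO X c,w\<^esub>"
      have "a \<cdot> h c = \<zero>\<^bsub>EO M c,w\<^esub> \<cdot> h c"
        unfolding \<phi>(2)[OF c, symmetric] using post[OF a(2), of "Tunit X c"] a(1) h Hom_Obj[OF a(1)] by
          (simp add: homset_def)
      then show "a = \<zero>\<^bsub>EO M c,w\<^esub>"
        by - (rule epi_arrowD[OF X(3)[OF c]], use a(1) X(2)[OF c] Hom_Obj[OF a(1)] in \<open>simp_all add:
          homset_def\<close>)
    qed
  qed
qed

text \<open>Iterated syzygies: \<open>N (Suc n)\<close> is the kernel of the projective cover of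
  \<open>N n\<close>, and the differential \<open>d n\<close> covers this syzygy and then includes
  it. Covers and kernels are taken pointwise so that exactness can be checked pointwise.\<close>

lemma Mod_resolution_ex:
  assumes M: "M \<in> Obj Mod" shows "\<exists>P d e. projective_resolution Mod M P d e"
proof -
  interpret Md: category Mod by (rule category_Mod)
  have "\<exists>e. projective Mod (Dom Mod e) \<and> e \<in> homset Mod (Dom Mod e) N \<and>
    (\<forall>c\<in>Ob. epi_arrow V (cmp e c))" if N: "N \<in> Obj Mod" for N
    by (rule Mod_projective_cover[OF N]) (auto simp: homset_def)
  then obtain e where e: "\<And>N. N \<in> Obj Mod \<Longrightarrow> projective Mod (Dom Mod (e N)) \<and> e N
    \<in> homset Mod (Dom Mod (e N)) N \<and> (\<forall>c\<in>Ob. epi_arrow V (cmp (e N) c))"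
    by metis
  have "\<exists>k. k \<in> homset Mod (Dom Mod k) (Dom Mod (e N)) \<and> (\<forall>c\<in>Ob. is_kernel V (cmp
    k c) (cmp (e N) c))" if N: "N \<in> Obj Mod" for N
    by (rule Mod_kernel_ex[of "e N" "Dom Mod (e N)" N]) (use e[OF N] in \<open>auto simp: homset_def\<close>)
  then obtain k where k: "\<And>N. N \<in> Obj Mod \<Longrightarrow> k N \<in> homset Mod (Dom Mod (k N)) (Dom
    Mod (e N)) \<and> (\<forall>c\<in>Ob. is_kernel V (cmp (k N) c) (cmp (e N) c))"
    by metis
  define P K where "P N = Dom Mod (e N)" and "K N = Dom Mod (k N)" for N
  have *: "projective Mod (P N)" "e N \<in> homset Mod (P N) N"
    "\<And>c. c \<in> Ob \<Longrightarrow> epi_arrow V (cmp (e N) c)" "K N \<in> Obj Mod"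
    "k N \<in> homset Mod (K N) (P N)" "\<And>c. c \<in> Ob \<Longrightarrow> is_kernel V (cmp (k N) c) (cmp
      (e N) c)" if "N \<in> Obj Mod" for N
    using e[OF that] k[OF that] Md.Hom_Obj(1) unfolding P_def K_def by blast+
  define N where "N = rec_nat M (\<lambda>_. K)"
  have NS: "N (Suc n) = K (N n)" "N 0 = M" for n by (simp_all add: N_def)
  have N: "N n \<in> Obj Mod" for n by (induction n) (simp_all add: NS M *(4))
  define d where "d n = k (N n) \<cdot>\<^bsub>Mod\<^esub> e (N (Suc n))" for n
  have eS: "e (N (Suc n)) \<in> homset Mod (P (N (Suc n))) (K (N n))" for n using *(2)[OF N[of "Suc n"]] by
    (simp add: NS)
  have kS: "k (N n) \<in> homset Mod (N (Suc n)) (P (N n))" for n using *(5)[OF N[of n]] by (simp add: NS)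
  have "projective_resolution Mod M (\<lambda>n. P (N n)) d (e M)"
    unfolding projective_resolution_def
  proof (intro conjI allI)
    fix n
    show "projective Mod (P (N n))" using *(1) N .
    show "d n \<in> homset Mod (P (N (Suc n))) (P (N n))" unfolding d_def using cmp_Cmp(2)[OF eS *(5)[OF N]] .
    show "exact_at Mod (d (Suc n)) (d n)" unfolding d_def
      by (rule pointwise_exact_at[OF *(2)[OF N] *(3)[OF N] kS *(6)[OF N] *(2)[OF N] *(3)[OF N] kS
        kernel_mono[OF *(6)[OF N]]])
  next
    show "e M \<in> homset Mod (P (N 0)) M" using *(2)[OF M] by (simp add: NS)
    show "epi_arrow Mod (e M)" by (rule pointwise_epi[OF *(2)[OF M] *(3)[OF M]])
    \<comment> \<open>Composing with an identity brings the augmentation into the shape expected by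
      \<open>pointwise_exact_at\<close>, with the identity as the monomorphism.\<close>
    have "exact_at Mod (k M \<cdot>\<^bsub>Mod\<^esub> e (K M)) (Ide Mod M \<cdot>\<^bsub>Mod\<^esub> e M)"
    proof (rule pointwise_exact_at[OF *(2)[OF M] *(3)[OF M] *(5)[OF M] *(6)[OF M] *(2)[OF *(4)[OF M]] *(3)[OF
      *(4)[OF M]] Ide_Mod_Hom[OF M]])
      fix c assume "c \<in> Ob"
      then show "mono_arrow V (cmp (Ide Mod M) c)" using Mod_EO[OF M] by (auto simp: cmp_Ide[OF M]
        mono_arrow_def homset_def)
    qed
    then show "exact_at Mod (d 0) (e M)" using *(2)[OF M] by (simp add: d_def NS Md.Hom_ArrD)
  qed
  then show ?thesis by blast
qed

text \<open>The derived functor is computed from a chosen triple; as resolutions exist, the choice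
  may be treated as some projective resolution.\<close>

lemma left_derived_eq:
  assumes M: "M \<in> Obj Mod"
  obtains P d e where "projective_resolution Mod M P d e"
    "left_derived Mod V F n M = homology V (\<lambda>i. FO F (P i)) (\<lambda>i. FA F (d i)) n"
proof -
  obtain P d e where s: "(SOME (P, d, e). projective_resolution Mod M P d e) = (P, d, e)" by (metis prod_cases3)
  have "\<exists>p. case p of (P, d, e) \<Rightarrow> projective_resolution Mod M P d e" using
    Mod_resolution_ex[OF M] by auto
  from someI_ex[OF this] have "projective_resolution Mod M P d e" unfolding s by simp
  then show ?thesis by (rule that) (simp add: left_derived_def s)
qed

end

section \<open>The bar construction\<close>

context abelian_category
begin

text \<open>\<open>m\<close> is the kernel of some \<open>f\<close>, and \<open>f\<close> factors
  through the cokernel \<open>q\<close>; an arrow killed by \<open>q\<close> is therefore killed by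
  \<open>f\<close> and lifts along \<open>m\<close>.\<close>

lemma mono_kernel_of_cokernel:
  assumes m: "mono_arrow C m" and q: "is_cokernel C q m"
  shows "is_kernel C m q"
proof -
  obtain f where f: "is_kernel C m f" using mono_is_kernel[OF m] by blast
  define w x y z where "w = Cod C f" "x = Dom C m" "y = Cod C m" "z = Cod C q"
  have h: "f \<in> Hom y w" "m \<in> Hom x y" "q \<in> Hom y z" using f q by (auto simp: is_cokernel_def
    is_kernel_def homset_def w_x_y_z_def)
  obtain f' where f': "f' \<in> Hom z w" "f' \<cdot> q = f" using cokernel_desc[OF q h(3,2,1) kernel_zero[OF f
    h(2,1)]] by blast
  have ex: "\<exists>u. u \<in> Hom v x \<and> m \<cdot> u = t" if t: "t \<in> Hom v y"
    "q \<cdot> t = \<zero>\<^bsub>v,z\<^esub>" for v t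
  proof -
    have "f \<cdot> t = f' \<cdot> (q \<cdot> t)" using f'(1) f'(2)[symmetric] h(3) t(1) by (simp add: homset_def)
    also have "\<dots> = \<zero>\<^bsub>v,w\<^esub>" using t f' Hom_Obj[OF t(1)] by (simp add: Hom_ArrD)
    finally show ?thesis using kernel_lift[OF f h(2,1) t(1)] by blast
  qed
  have un: "u = u'" if "u \<in> Hom v x" "u' \<in> Hom v x" "m \<cdot> u = m \<cdot> u'" for u u' v
    by (rule mono_arrowD[OF m]) (use that h in \<open>auto simp: Hom_ArrD\<close>)
  show ?thesis unfolding is_kernel_iff[OF h(2,3)] using cokernel_zero[OF q h(3,2)] ex un by metis
qed

lemma short_exactI: "mono_arrow C f \<Longrightarrow> is_cokernel C g f \<Longrightarrow> short_exact C f g"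
  unfolding short_exact_def using mono_kernel_of_cokernel by blast

text \<open>All families are pulled back along \<open>inv_into I \<phi>\<close> to the image of
  \<phi>, an index set inside \<open>'u\<close> to which (AB4) applies.\<close>

lemma AB4_reindex:
  fixes \<phi> :: "'i \<Rightarrow> 'u"
  assumes AB4: "AB4 TYPE('u) C" and inj: "inj_on \<phi> I"
    and s: "\<And>i. i \<in> I \<Longrightarrow> f i \<in> Hom (X i) (Y i) \<and> g i \<in> Hom (Y i) (Z i)
      \<and> short_exact C (f i) (g i)"
    and Q: "is_coproduct C I X QX \<iota>X" "is_coproduct C I Y QY \<iota>Y" "is_coproduct C I Z QZ \<iota>Z"
    and F: "F \<in> Hom QX QY" "\<And>i. i \<in> I \<Longrightarrow> F \<cdot> \<iota>X i = \<iota>Y i \<cdot> f i"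
    and G: "G \<in> Hom QY QZ" "\<And>i. i \<in> I \<Longrightarrow> G \<cdot> \<iota>Y i = \<iota>Z i \<cdot> g i"
  shows "short_exact C F G"
proof -
  let ?v = "inv_into I \<phi>"
  have v: "?v j \<in> I" if "j \<in> \<phi> ` I" for j using inv_into_into[OF that] .
  show ?thesis
    using AB4[unfolded AB4_def, rule_format, of "\<phi> ` I" "\<lambda>j. f (?v j)" "\<lambda>j. X (?v j)"
      "\<lambda>j. Y (?v j)" "\<lambda>j. g (?v j)" "\<lambda>j. Z (?v j)"
        QX "\<lambda>j. \<iota>X (?v j)" QY "\<lambda>j. \<iota>Y (?v j)" QZ "\<lambda>j. \<iota>Z (?v j)" F G]
      s[OF v] F(1) F(2)[OF v] G(1) G(2)[OF v] coproduct_reindex'[OF inj Q(1)] coproduct_reindex'[OF inj Q(2)]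
        coproduct_reindex'[OF inj Q(3)]
    by blast
qed

end

section \<open>Exactness of the functors S_n on families of objects\<close>

locale augmented_setting = free_module_setting V C
  for V :: "('o, 'a, 'z) moncat_scheme" (structure) and C :: "('u, 'o, 'a) ecat" +
  fixes \<epsilon> :: "('u, unit, 'a) efunc"
  assumes cocomplete: "small_cocomplete TYPE('u) V" and infinite_index: "infinite (UNIV :: 'u set)"
    and AB4: "AB4 TYPE('u) V" and flat: "flat_ecat V C" and augmentation: "enriched_functor V C (pt V) \<epsilon>"
begin

notation zero ("\<zero>\<^bsub>_,_\<^esub>") and hsub (infixl "\<ominus>" 65)

abbreviation "Ix \<equiv> bar_index C"

text \<open>Only the entries up to \<open>n\<close> are constrained, not the length, so the
  predicate passes from \<open>Suc n\<close> to \<open>n\<close> in a recursion without shortening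
  the list.\<close>

definition "good cs n \<longleftrightarrow> (\<forall>k\<le>n. cs ! k \<in> Ob)"

lemma good_Ix: "cs \<in> Ix n \<Longrightarrow> good cs n" and Ix_length:
  "cs \<in> Ix n \<Longrightarrow> length cs = Suc n"
  unfolding good_def bar_index_def by (auto intro!: subsetD[OF _ nth_mem])

lemma good_nth [simp]: "good cs n \<Longrightarrow> k \<le> n \<Longrightarrow> cs ! k \<in> Ob"
  unfolding good_def by simp

lemma Ix_hd: "cs \<in> Ix n \<Longrightarrow> cs ! 0 \<in> Ob"
  using good_nth[OF good_Ix] by blast

lemma good_Suc: "good cs (Suc n) \<Longrightarrow> good cs n"
  unfolding good_def by simp

lemma Ix_Suc: "ds \<in> Ix (Suc n) \<longleftrightarrow> (\<exists>c cs. ds = c # cs \<and> c \<in> Ob \<and>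
  cs \<in> Ix n)"
  unfolding bar_index_def by (cases ds) auto

text \<open>\<open>bar_summand\<close> with an arbitrary object \<open>x\<close> in place of
  \<open>EO M (cs ! 0)\<close>. A free coefficient can absorb the first hom of a tuple.\<close>

primrec chain :: "'o \<Rightarrow> 'u list \<Rightarrow> nat \<Rightarrow> 'o" where
  "chain x cs 0 = x"
| "chain x cs (Suc n) = chain x cs n \<boxtimes> \<C> (cs ! n) (cs ! Suc n)"

primrec chainA :: "'a \<Rightarrow> 'u list \<Rightarrow> nat \<Rightarrow> 'a" where
  "chainA f cs 0 = f"
| "chainA f cs (Suc n) = chainA f cs n \<boxdot> Ide V (\<C> (cs ! n) (cs ! Suc n))"

lemma chain_Obj [simp]: "x \<in> Obj V \<Longrightarrow> good cs n \<Longrightarrow> chain x cs n \<in> Obj V"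
  by (induction n) (auto simp: good_Suc)

lemma chainA_Hom: "f \<in> Hom x y \<Longrightarrow> good cs n \<Longrightarrow> chainA f cs n \<in> Hom
  (chain x cs n) (chain y cs n)"
  by (induction n) (auto simp: good_Suc intro!: tenA_homset)

lemma chainA_Cmp:
  "f \<in> Hom x y \<Longrightarrow> g \<in> Hom y z \<Longrightarrow> good cs n \<Longrightarrow> chainA (g
    \<cdot> f) cs n = chainA g cs n \<cdot> chainA f cs n"
proof (induction n)
  case (Suc n)
  note g = good_Suc[OF Suc.prems(3)]
  show ?case using Suc chainA_Hom[OF Suc.prems(1) g] chainA_Hom[OF Suc.prems(2) g] g by (simp add: interchange
    homset_def)
qed simp

lemma chainA_Ide: "x \<in> Obj V \<Longrightarrow> good cs n \<Longrightarrow> chainA (Ide V x) cs n = Ide V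
  (chain x cs n)"
  by (induction n) (auto simp: good_Suc)

lemma chain_cong: "(\<And>k. k \<le> n \<Longrightarrow> cs ! k = ds ! k) \<Longrightarrow> chain x cs n = chain x ds n"
  and chainA_cong: "(\<And>k. k \<le> n \<Longrightarrow> cs ! k = ds ! k) \<Longrightarrow> chainA f cs n =
    chainA f ds n"
  by (induction n) auto

text \<open>The object part of the decalage: once \<open>c\<close> is removed from the tuple, its
  hom to the next object belongs to the coefficient.\<close>

lemma chain_Cons: "chain x (c # cs) (Suc n) = chain (x \<boxtimes> \<C> c (cs ! 0)) cs n"
  by (induction n) auto

text \<open>Flatness concerns tensoring with a hom object on the left, while chains tensor on the
  right. The symmetry transfers the monomorphism; the cokernel part is right exactness.\<close>

lemma ten_short_exact:
  assumes s: "short_exact V f g" and ab: "a \<in> Ob" "b \<in> Ob"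
  shows "short_exact V (f \<boxdot> Ide V (\<C> a b)) (g \<boxdot> Ide V (\<C> a b))"
proof (rule short_exactI)
  note [simp] = eHom_Obj[OF ab]
  have k: "is_kernel V f g" and c: "is_cokernel V g f" using s unfolding short_exact_def by auto
  define x y z where "x = Dom V f" "y = Dom V g" "z = Cod V g"
  have h: "f \<in> Hom x y" "g \<in> Hom y z" using k by (auto simp: is_kernel_def homset_def x_y_z_def)
  note [simp] = Hom_ArrD[OF h(1)] Hom_ArrD[OF h(2)] Hom_Obj[OF h(1)] Hom_Obj[OF h(2)]
  show "is_cokernel V (g \<boxdot> Ide V (\<C> a b)) (f \<boxdot> Ide V (\<C> a b))" by (rule ten_cokernel[OF
    c h(2,1)]) simp
  have "short_exact V (Ide V (\<C> a b) \<boxdot> f) (Ide V (\<C> a b) \<boxdot> g)"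
    using flat s ab unfolding flat_ecat_def exact_functor_def by simp
  then have m: "mono_arrow V (Ide V (\<C> a b) \<boxdot> f)" unfolding short_exact_def using kernel_mono by blast
  show "mono_arrow V (f \<boxdot> Ide V (\<C> a b))"
  proof (rule mono_via_zero)
    show "f \<boxdot> Ide V (\<C> a b) \<in> Hom (x \<boxtimes> \<C> a b) (y \<boxtimes> \<C> a b)" by (simp
      add: homset_def)
    fix w t assume t: "t \<in> Hom w (x \<boxtimes> \<C> a b)"
      "(f \<boxdot> Ide V (\<C> a b)) \<cdot> t = \<zero>\<^bsub>w,y \<boxtimes> \<C> a b\<^esub>"
    note [simp] = Hom_ArrD[OF t(1)] Hom_Obj[OF t(1)]
    have "(Ide V (\<C> a b) \<boxdot> f) \<cdot> (swp V x (\<C> a b) \<cdot> t) = swp V y (\<C> a b) \<cdot>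
      ((f \<boxdot> Ide V (\<C> a b)) \<cdot> t)"
      using post[OF swp_nat[of f "Ide V (\<C> a b)" y "\<C> a b"], of t] by simp
    also have "\<dots> = (Ide V (\<C> a b) \<boxdot> f) \<cdot> \<zero>\<^bsub>w,\<C> a b \<boxtimes>
      x\<^esub>" unfolding t(2) by simp
    finally have "swp V x (\<C> a b) \<cdot> t = \<zero>\<^bsub>w,\<C> a b \<boxtimes> x\<^esub>" by - (rule
      mono_arrowD[OF m], simp_all)
    also have "\<dots> = swp V x (\<C> a b) \<cdot> \<zero>\<^bsub>w,x \<boxtimes> \<C> a b\<^esub>" by simp
    finally show "t = \<zero>\<^bsub>w,x \<boxtimes> \<C> a b\<^esub>" by - (rule iso_mono_eq[of
      "swp V x (\<C> a b)"], simp_all)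
  qed
qed

lemma chain_short_exact: "short_exact V f g \<Longrightarrow> good cs n \<Longrightarrow> short_exact V
  (chainA f cs n) (chainA g cs n)"
  by (induction n) (auto simp: good_Suc intro!: ten_short_exact)

lemma chain_coproduct:
  "is_coproduct V I X Q \<iota> \<Longrightarrow> good cs n \<Longrightarrow> is_coproduct V I (\<lambda>i.
    chain (X i) cs n) (chain Q cs n) (\<lambda>i. chainA (\<iota> i) cs n)"
  by (induction n) (auto simp: good_Suc intro!: ten_coproduct)

text \<open>S_n of a module involves only its underlying family, not the action; so the exactness
  properties of S_n are proved for families and families of arrows.\<close>

definition "fam X \<longleftrightarrow> (\<forall>c\<in>Ob. X c \<in> Obj V)"
definition "famHom X Y f \<longleftrightarrow> (\<forall>c\<in>Ob. f c \<in> Hom (X c) (Y c))"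

lemma famD: "fam X \<Longrightarrow> c \<in> Ob \<Longrightarrow> X c \<in> Obj V" and famHomD:
  "famHom X Y f \<Longrightarrow> c \<in> Ob \<Longrightarrow> f c \<in> Hom (X c) (Y c)"
  unfolding fam_def famHom_def by auto

lemma famHom_fam: "famHom X Y f \<Longrightarrow> fam X" "famHom X Y f \<Longrightarrow> fam Y"
  unfolding fam_def famHom_def using Hom_Obj by blast+

definition "Bo X n = fst (coprod V (Ix n) (\<lambda>cs. chain (X (cs ! 0)) cs n))"
definition "inc X n = snd (coprod V (Ix n) (\<lambda>cs. chain (X (cs ! 0)) cs n))"

lemma coproducts_Ix: "coproducts_over (Ix n)"
  by (rule coproducts_over_bar_index[OF cocomplete infinite_index])

lemma B_coproduct: "fam X \<Longrightarrow> is_coproduct V (Ix n) (\<lambda>cs. chain (X (cs ! 0)) cs n) (Bo X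
  n) (inc X n)"
  unfolding Bo_def inc_def by (rule coprod_is_coproduct[OF coproducts_Ix]) (rule chain_Obj[OF famD[OF _ Ix_hd] good_Ix])

lemma Bo_Obj: "fam X \<Longrightarrow> Bo X n \<in> Obj V"
  and inc_Hom: "fam X \<Longrightarrow> cs \<in> Ix n \<Longrightarrow> inc X n cs \<in> Hom (chain (X (cs !
    0)) cs n) (Bo X n)"
  using coproduct_Obj[OF B_coproduct] coproduct_Hom[OF B_coproduct] by auto

lemma B_eq:
  "fam X \<Longrightarrow> u \<in> Hom (Bo X n) y \<Longrightarrow> u' \<in> Hom (Bo X n) y \<Longrightarrow>
    (\<And>cs. cs \<in> Ix n \<Longrightarrow> u \<cdot> inc X n cs = u' \<cdot> inc X n cs) \<Longrightarrow> u = u'"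
  by (rule coproduct_eq[OF B_coproduct])

lemma B_desc:
  assumes "fam X" "y \<in> Obj V" "\<And>cs. cs \<in> Ix n \<Longrightarrow> f cs \<in> Hom (chain (X (cs ! 0)) cs n) y"
  shows "coprod_desc V (Ix n) (\<lambda>cs. chain (X (cs ! 0)) cs n) y f \<in> Hom (Bo X n) y"
    and "cs \<in> Ix n \<Longrightarrow> coprod_desc V (Ix n) (\<lambda>cs. chain (X (cs ! 0)) cs n) y f
      \<cdot> inc X n cs = f cs"
proof -
  have o: "\<And>cs. cs \<in> Ix n \<Longrightarrow> chain (X (cs ! 0)) cs n \<in> Obj V" by (rule
    chain_Obj[OF famD[OF assms(1) Ix_hd] good_Ix])
  show "coprod_desc V (Ix n) (\<lambda>cs. chain (X (cs ! 0)) cs n) y f \<in> Hom (Bo X n) y"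
    "cs \<in> Ix n \<Longrightarrow> coprod_desc V (Ix n) (\<lambda>cs. chain (X (cs ! 0)) cs n) y f \<cdot>
      inc X n cs = f cs"
    unfolding Bo_def inc_def
    by (rule coprod_desc_eq[OF coproducts_Ix o assms(2,3)]; assumption)+
qed

definition "Smap X Y f n = coprod_desc V (Ix n) (\<lambda>cs. chain (X (cs ! 0)) cs n) (Bo Y n) (\<lambda>cs.
  inc Y n cs \<cdot> chainA (f (cs ! 0)) cs n)"

lemma Smap:
  assumes f: "famHom X Y f"
  shows "Smap X Y f n \<in> Hom (Bo X n) (Bo Y n)"
    and "cs \<in> Ix n \<Longrightarrow> Smap X Y f n \<cdot> inc X n cs = inc Y n cs \<cdot> chainA (f (cs ! 0)) cs n"
proof -
  have h: "inc Y n cs \<cdot> chainA (f (cs ! 0)) cs n \<in> Hom (chain (X (cs ! 0)) cs n) (Bo Y n)" if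
    "cs \<in> Ix n" for cs
    using Cmp_homset[OF chainA_Hom[OF famHomD[OF f] good_Ix[OF that]] inc_Hom[OF famHom_fam(2)[OF f] that]]
      good_Ix[OF that] by simp
  show "Smap X Y f n \<in> Hom (Bo X n) (Bo Y n)" "cs \<in> Ix n \<Longrightarrow> Smap X Y f n \<cdot> inc X
    n cs = inc Y n cs \<cdot> chainA (f (cs ! 0)) cs n"
    unfolding Smap_def by (rule B_desc[OF famHom_fam(1)[OF f] Bo_Obj[OF famHom_fam(2)[OF f]] h]; assumption)+
qed

lemma Smap_Cmp:
  assumes f: "famHom X Y f" and g: "famHom Y Z g" and h: "famHom X Z h" and eq:
    "\<And>c. c \<in> Ob \<Longrightarrow> h c = g c \<cdot> f c"
  shows "Smap X Z h n = Smap Y Z g n \<cdot> Smap X Y f n"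
proof (rule B_eq[OF famHom_fam(1)[OF f] Smap(1)[OF h] Cmp_homset[OF Smap(1)[OF f] Smap(1)[OF g]]])
  fix cs assume cs: "cs \<in> Ix n"
  note c = Ix_hd[OF cs]
  note F = chainA_Hom[OF famHomD[OF f c] good_Ix[OF cs]] and G = chainA_Hom[OF famHomD[OF g c] good_Ix[OF cs]]
  note [simp] = Hom_ArrD[OF Smap(1)[OF f, of n]] Hom_ArrD[OF Smap(1)[OF g, of n]] Hom_ArrD[OF F] Hom_ArrD[OF G]
    Hom_ArrD[OF inc_Hom[OF famHom_fam(1)[OF f] cs]] Hom_ArrD[OF inc_Hom[OF famHom_fam(2)[OF f] cs]]
      Hom_ArrD[OF inc_Hom[OF famHom_fam(2)[OF g] cs]]
  have "(Smap Y Z g n \<cdot> Smap X Y f n) \<cdot> inc X n cs = Smap Y Z g n \<cdot> (inc Y n cs \<cdot>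
    chainA (f (cs ! 0)) cs n)"
    using Smap(2)[OF f cs] by simp
  also have "\<dots> = inc Z n cs \<cdot> (chainA (g (cs ! 0)) cs n \<cdot> chainA (f (cs ! 0)) cs n)"
    using post[OF Smap(2)[OF g cs], of "chainA (f (cs ! 0)) cs n"] by simp
  finally show "Smap X Z h n \<cdot> inc X n cs = (Smap Y Z g n \<cdot> Smap X Y f n) \<cdot> inc X n cs"
    unfolding Smap(2)[OF h cs] eq[OF c] chainA_Cmp[OF famHomD[OF f c] famHomD[OF g c] good_Ix[OF cs]] by simp
qed

lemma Smap_Ide:
  assumes f: "famHom X X f" and eq: "\<And>c. c \<in> Ob \<Longrightarrow> f c = Ide V (X c)"
  shows "Smap X X f n = Ide V (Bo X n)"
proof (rule B_eq[OF famHom_fam(1)[OF f] Smap(1)[OF f] Ide_Hom[OF Bo_Obj[OF famHom_fam(1)[OF f]]]])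
  fix cs assume cs: "cs \<in> Ix n"
  note c = Ix_hd[OF cs]
  show "Smap X X f n \<cdot> inc X n cs = Ide V (Bo X n) \<cdot> inc X n cs"
    unfolding Smap(2)[OF f cs] eq[OF c] chainA_Ide[OF famD[OF famHom_fam(1)[OF f] c] good_Ix[OF cs]]
    using Hom_ArrD[OF inc_Hom[OF famHom_fam(1)[OF f] cs]] by simp
qed

text \<open>Flatness makes every summand exact, and (AB4) sums over the tuples once these are
  encoded as elements of \<open>'u\<close>.\<close>

lemma Smap_short_exact:
  assumes f: "famHom X Y f" and g: "famHom Y Z g" and s: "\<And>c. c \<in> Ob \<Longrightarrow> short_exact V
    (f c) (g c)"
  shows "short_exact V (Smap X Y f n) (Smap Y Z g n)"
proof -
  obtain \<phi> :: "'u list \<Rightarrow> 'u" where "inj_on \<phi> {cs. length cs = Suc n}" using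
    inj_on_lists_of_length[OF infinite_index] by blast
  then have inj: "inj_on \<phi> (Ix n)" by (rule inj_on_subset) (auto simp: bar_index_def)
  show ?thesis
  proof (rule AB4_reindex[OF AB4 inj _ B_coproduct[OF famHom_fam(1)[OF f]] B_coproduct[OF famHom_fam(2)[OF f]]
    B_coproduct[OF famHom_fam(2)[OF g]]
      Smap(1)[OF f] Smap(2)[OF f] Smap(1)[OF g] Smap(2)[OF g]])
    fix cs assume cs: "cs \<in> Ix n"
    note c = Ix_hd[OF cs]
    show "chainA (f (cs ! 0)) cs n \<in> Hom (chain (X (cs ! 0)) cs n) (chain (Y (cs ! 0)) cs n) \<and>
      chainA (g (cs ! 0)) cs n \<in> Hom (chain (Y (cs ! 0)) cs n) (chain (Z (cs ! 0)) cs n) \<and>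
        short_exact V (chainA (f (cs ! 0)) cs n) (chainA (g (cs ! 0)) cs n)"
      using chainA_Hom[OF famHomD[OF f c] good_Ix[OF cs]] chainA_Hom[OF famHomD[OF g c] good_Ix[OF cs]]
        chain_short_exact[OF s[OF c] good_Ix[OF cs]] by blast
  qed
qed

text \<open>The map is completed by its pointwise kernels to a short exact sequence, which S_n
  preserves.\<close>

lemma Smap_epi:
  assumes f: "famHom X Y f" and e: "\<And>c. c \<in> Ob \<Longrightarrow> epi_arrow V (f c)"
  shows "epi_arrow V (Smap X Y f n)"
proof -
  have "\<exists>k. is_kernel V k (f c)" if "c \<in> Ob" for c using has_kernels[OF Hom_ArrD(1)[OF famHomD[OF
    f that]]] .
  then obtain k where k: "\<And>c. c \<in> Ob \<Longrightarrow> is_kernel V (k c) (f c)" by metis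
  have kH: "famHom (\<lambda>c. Dom V (k c)) X k" unfolding famHom_def using is_kernel_Hom[OF k famHomD[OF f]] by blast
  have "short_exact V (k c) (f c)" if "c \<in> Ob" for c unfolding short_exact_def using k[OF that]
    epi_cokernel_of_kernel[OF e[OF that] k[OF that]] by blast
  then have "is_cokernel V (Smap X Y f n) (Smap (\<lambda>c. Dom V (k c)) X k n)" using Smap_short_exact[OF kH
    f] unfolding short_exact_def by blast
  then show ?thesis by (rule cokernel_epi)
qed

lemma Smap_mono:
  assumes f: "famHom X Y f" and e: "\<And>c. c \<in> Ob \<Longrightarrow> mono_arrow V (f c)"
  shows "mono_arrow V (Smap X Y f n)"
proof -
  have "\<exists>q. is_cokernel V q (f c)" if "c \<in> Ob" for c using has_cokernels[OF Hom_ArrD(1)[OF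
    famHomD[OF f that]]] .
  then obtain q where q: "\<And>c. c \<in> Ob \<Longrightarrow> is_cokernel V (q c) (f c)" by metis
  have qH: "famHom Y (\<lambda>c. Cod V (q c)) q" unfolding famHom_def using is_cokernel_Hom[OF q famHomD[OF
    f]] by blast
  have "short_exact V (f c) (q c)" if "c \<in> Ob" for c by (rule short_exactI[OF e[OF that] q[OF that]])
  then have "is_kernel V (Smap X Y f n) (Smap Y (\<lambda>c. Cod V (q c)) q n)" using Smap_short_exact[OF f
    qH] unfolding short_exact_def by blast
  then show ?thesis by (rule kernel_mono)
qed

text \<open>\<open>f\<close> is an epimorphism \<open>e\<close> onto the kernel \<open>k\<close> of
  \<open>g\<close>, and \<open>g\<close> is a monomorphism \<open>m'\<close> after an epimorphism
  \<open>e'\<close> with the same kernel. S_n preserves the short exact sequence of \<open>k\<close>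
  and \<open>e'\<close>, keeps \<open>e\<close> epi and \<open>m'\<close> mono, and thereby the
  factorisation that witnesses exactness.\<close>

lemma Smap_chase_exact:
  assumes f: "famHom X Y f" and g: "famHom Y Z g" and ex: "\<And>c. c \<in> Ob \<Longrightarrow> chase_exact
    (f c) (g c)"
  shows "chase_exact (Smap X Y f n) (Smap Y Z g n)"
proof -
  have "\<exists>k. is_kernel V k (g c)" if "c \<in> Ob" for c using has_kernels[OF Hom_ArrD(1)[OF famHomD[OF
    g that]]] .
  then obtain k where k: "\<And>c. c \<in> Ob \<Longrightarrow> is_kernel V (k c) (g c)" by metis
  define K where "K c = Dom V (k c)" for c
  have kH: "famHom K Y k" unfolding famHom_def K_def using is_kernel_Hom[OF k famHomD[OF g]] by blast
  have "\<exists>e\<in>Hom (X c) (K c). k c \<cdot> e = f c" if c: "c \<in> Ob" for c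
    by (rule kernel_lift[OF k[OF c] famHomD[OF kH c] famHomD[OF g c] famHomD[OF f c] chase_exactD(1)[OF ex[OF
      c] famHomD[OF f c] famHomD[OF g c]]])
  then obtain e where e: "\<And>c. c \<in> Ob \<Longrightarrow> e c \<in> Hom (X c) (K c)"
    "\<And>c. c \<in> Ob \<Longrightarrow> k c \<cdot> e c = f c" by metis
  have eH: "famHom X K e" unfolding famHom_def using e by blast
  \<comment> \<open>That \<open>e c\<close> is onto the kernel is read off from exactness at a
    projective cover \<open>t\<close> of \<open>K c\<close>: the cover factors through
    \<open>e c\<close>.\<close>
  have epi: "epi_arrow V (e c)" if c: "c \<in> Ob" for c
  proof -
    note kc = famHomD[OF kH c] and gc = famHomD[OF g c] and fc = famHomD[OF f c]
    obtain p t where t: "projective V p" "t \<in> Hom p (K c)" "epi_arrow V t" using projective_cover[OF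
      Hom_Obj(1)[OF kc]] .
    have "g c \<cdot> (k c \<cdot> t) = \<zero>\<^bsub>p,Z c\<^esub>"
      using post[OF kernel_zero[OF k[OF c] kc gc], of t] t(2) kc gc Hom_Obj[OF gc] by (simp add: homset_def)
    then obtain u where u: "u \<in> Hom p (X c)" "f c \<cdot> u = k c \<cdot> t"
      using chase_exactD(2)[OF ex[OF c] fc gc t(1) Cmp_homset[OF t(2) kc]] by blast
    have "k c \<cdot> (e c \<cdot> u) = k c \<cdot> t" using Cmp_assoc[OF u(1) e(1)[OF c] kc] e(2)[OF c] u(2) by simp
    then have eu: "e c \<cdot> u = t"
      by - (rule mono_arrowD[OF kernel_mono[OF k[OF c]]], use e(1)[OF c] u(1) t(2) kc in \<open>simp_all add:
        homset_def\<close>)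
    show ?thesis
    proof (rule epi_via_zero[OF e(1)[OF c]])
      fix w a assume a: "a \<in> Hom (K c) w" "a \<cdot> e c = \<zero>\<^bsub>X c,w\<^esub>"
      have "a \<cdot> t = \<zero>\<^bsub>K c,w\<^esub> \<cdot> t" unfolding eu[symmetric] using post[OF a(2),
        of u] a(1) e(1)[OF c] u(1) Hom_Obj[OF a(1)] by (simp add: homset_def)
      then show "a = \<zero>\<^bsub>K c,w\<^esub>"
        by - (rule epi_arrowD[OF t(3)], use a(1) t(2) Hom_Obj[OF a(1)] in \<open>simp_all add: homset_def\<close>)
    qed
  qed
  have "\<exists>e' m'. e' \<in> Hom (Y c) (Cod V e') \<and> m' \<in> Hom (Cod V e') (Z c) \<and> m' \<cdot>
    e' = g c \<and> epi_arrow V e' \<and> mono_arrow V m'" if c: "c \<in> Ob" for c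
    by (rule factor_epi_mono[OF famHomD[OF g c]]) (auto simp: homset_def)
  then obtain e' m' where em: "\<And>c. c \<in> Ob \<Longrightarrow> e' c \<in> Hom (Y c) (Cod V (e' c))
    \<and> m' c \<in> Hom (Cod V (e' c)) (Z c) \<and> m' c \<cdot> e' c = g c \<and> epi_arrow V (e' c) \<and>
    mono_arrow V (m' c)"
    by metis
  define W where "W c = Cod V (e' c)" for c
  have e'H: "famHom Y W e'" and m'H: "famHom W Z m'" unfolding famHom_def W_def using em by auto
  have ke: "is_kernel V (k c) (e' c)" if c: "c \<in> Ob" for c
    using k[OF c] em[OF c] kernel_Cmp_mono[OF famHomD[OF kH c] famHomD[OF e'H c] famHomD[OF m'H c]] by simp
  have "short_exact V (k c) (e' c)" if c: "c \<in> Ob" for c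
    unfolding short_exact_def using ke[OF c] epi_cokernel_of_kernel[OF _ ke[OF c]] em[OF c] by blast
  then have "is_kernel V (Smap K Y k n) (Smap Y W e' n)" using Smap_short_exact[OF kH e'H] unfolding
    short_exact_def by blast
  then have "is_kernel V (Smap K Y k n) (Smap W Z m' n \<cdot> Smap Y W e' n)"
    using kernel_Cmp_mono[OF Smap(1)[OF kH] Smap(1)[OF e'H] Smap(1)[OF m'H] Smap_mono[OF m'H]] em by blast
  then have "is_kernel V (Smap K Y k n) (Smap Y Z g n)" using Smap_Cmp[OF e'H m'H g] em by simp
  moreover have "Smap X Y f n = Smap K Y k n \<cdot> Smap X K e n" using Smap_Cmp[OF eH kH f] e(2) by simp
  ultimately show ?thesis
    using chase_exact_factor[OF Smap_epi[OF eH epi] Smap(1)[OF eH] _ Smap(1)[OF kH] Smap(1)[OF g]] by simp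
qed

section \<open>The augmentation and the faces on a single summand\<close>

definition "aug x a b = run V x \<cdot> (Ide V x \<boxdot> EA \<epsilon> a b)"

lemma aug_arrow: "a \<in> Ob \<Longrightarrow> b \<in> Ob \<Longrightarrow> EA \<epsilon> a b \<in> Hom (\<C>
  a b) (unt V)"
  and aug_unit: "a \<in> Ob \<Longrightarrow> EA \<epsilon> a a \<cdot> eIde C a = Ide V (unt V)"
  and aug_comp: "a \<in> Ob \<Longrightarrow> b \<in> Ob \<Longrightarrow> c \<in> Ob \<Longrightarrow> EA
    \<epsilon> a c \<cdot> eCmp C a b c = lun V (unt V) \<cdot> (EA \<epsilon> b c \<boxdot> EA \<epsilon> a b)"
  using augmentation unfolding enriched_functor_def pt_def by auto

lemma aug_Hom: "x \<in> Obj V \<Longrightarrow> a \<in> Ob \<Longrightarrow> b \<in> Ob \<Longrightarrow> aug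
  x a b \<in> Hom (x \<boxtimes> \<C> a b) x"
  unfolding aug_def using aug_arrow[of a b] by (simp add: homset_def)

lemma aug_natural:
  assumes f: "f \<in> Hom x y" and ab: "a \<in> Ob" "b \<in> Ob"
  shows "aug y a b \<cdot> (f \<boxdot> Ide V (\<C> a b)) = f \<cdot> aug x a b"
proof -
  note [simp] = Hom_ArrD[OF f] Hom_Obj[OF f] Hom_ArrD[OF aug_arrow[OF ab]] eHom_Obj[OF ab]
  have "aug y a b \<cdot> (f \<boxdot> Ide V (\<C> a b)) = run V y \<cdot> ((f \<boxdot> Ide V (unt V))
    \<cdot> (Ide V x \<boxdot> EA \<epsilon> a b))"
    unfolding aug_def by (simp add: interchange)
  then show ?thesis using post[OF run_nat[of f y], of "Ide V x \<boxdot> EA \<epsilon> a b"] by (simp add: aug_def)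
qed

text \<open>Functoriality of \<epsilon> gives \<open>ek\<close>; the rest is unit coherence. The
  equation makes \<open>aug x\<close> an action and also supplies the one simplicial identity that
  is computed directly.\<close>

lemma aug_assoc:
  assumes x: "x \<in> Obj V" and abc: "a \<in> Ob" "b \<in> Ob" "c \<in> Ob"
  shows "aug x b c \<cdot> (aug x a b \<boxdot> Ide V (\<C> b c)) = aug x a c \<cdot> ((Ide V x \<boxdot>
    \<kappa> a b c) \<cdot> asc V x (\<C> a b) (\<C> b c))"
proof -
  note [simp] = x Hom_ArrD[OF aug_arrow[OF abc(1,2)]] Hom_ArrD[OF aug_arrow[OF abc(2,3)]] Hom_ArrD[OF
    aug_arrow[OF abc(1,3)]] Hom_ArrD[OF kappa_Hom[OF abc]]
    eHom_Obj[OF abc(1,2)] eHom_Obj[OF abc(2,3)] eHom_Obj[OF abc(1,3)] Hom_ArrD[OF eCmp_homset[OF abc]]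
      Hom_ArrD[OF aug_Hom[OF x abc(1,2)]]
  let ?e = "EA \<epsilon>"
  have "?e a c \<cdot> \<kappa> a b c = lun V (unt V) \<cdot> ((?e b c \<boxdot> ?e a b) \<cdot> swp V (\<C> a
    b) (\<C> b c))"
    unfolding \<kappa>_def using post[OF aug_comp[OF abc], of "swp V (\<C> a b) (\<C> b c)"] by simp
  also have "\<dots> = lun V (unt V) \<cdot> (swp V (unt V) (unt V) \<cdot> (?e a b \<boxdot> ?e b c))"
    by (subst swp_nat) simp_all
  also have "\<dots> = run V (unt V) \<cdot> (?e a b \<boxdot> ?e b c)"
    by (subst post[OF lun_swp[OF unt_Obj]]) simp_all
  finally have ek: "?e a c \<cdot> \<kappa> a b c = run V (unt V) \<cdot> (?e a b \<boxdot> ?e b c)" .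
  have "aug x a c \<cdot> ((Ide V x \<boxdot> \<kappa> a b c) \<cdot> asc V x (\<C> a b) (\<C> b c)) = run V x
    \<cdot> ((Ide V x \<boxdot> (?e a c \<cdot> \<kappa> a b c)) \<cdot> asc V x (\<C> a b) (\<C> b c))"
    unfolding aug_def by (simp add: interchange')
  also have "\<dots> = run V x \<cdot> ((Ide V x \<boxdot> run V (unt V)) \<cdot> ((Ide V x \<boxdot> (?e a b
    \<boxdot> ?e b c)) \<cdot> asc V x (\<C> a b) (\<C> b c)))"
    unfolding ek by (simp add: interchange')
  also have "\<dots> = run V x \<cdot> ((Ide V x \<boxdot> run V (unt V)) \<cdot> (asc V x (unt V) (unt V)
    \<cdot> ((Ide V x \<boxdot> ?e a b) \<boxdot> ?e b c)))"
    by (subst asc_nat) simp_all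
  also have "\<dots> = run V x \<cdot> (run V (x \<boxtimes> unt V) \<cdot> ((Ide V x \<boxdot> ?e a b)
    \<boxdot> ?e b c))"
    by (subst post[OF run_asc[of x "unt V"]]) simp_all
  also have "\<dots> = run V x \<cdot> ((run V x \<boxdot> Ide V (unt V)) \<cdot> ((Ide V x \<boxdot> ?e a b)
    \<boxdot> ?e b c))"
    by (subst post[OF run_nat[of "run V x" x]]) simp_all
  also have "\<dots> = run V x \<cdot> ((Ide V x \<boxdot> ?e b c) \<cdot> (aug x a b \<boxdot> Ide V (\<C> b c)))"
    by (simp add: interchange) (simp add: aug_def)
  finally show ?thesis by (simp add: aug_def[of x b c])
qed

text \<open>The action on a trivial module is the same arrow as the last face of a bar summand; this
  coincidence identifies coinvariants with the cokernel of the first boundary.\<close>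

lemma aug_rmod: "x \<in> Obj V \<Longrightarrow> rmod (\<lambda>_. x) (aug x)"
  unfolding rmod_def
proof (intro conjI ballI)
  fix a assume x [simp]: "x \<in> Obj V" and a: "a \<in> Ob"
  note [simp] = Hom_ArrD[OF aug_arrow[OF a a]] Hom_ArrD[OF eIde_homset[OF a]]
  show "aug x a a \<cdot> (Ide V x \<boxdot> eIde C a) = run V x" unfolding aug_def by (simp add: interchange
    aug_unit[OF a])
qed (auto simp: aug_Hom aug_assoc)

text \<open>\<open>bar_face\<close> with a free coefficient \<open>x\<close> and a free arrow
  \<open>a\<close> as face 0. After the decalage the coefficient contains a hom object and face 0 is
  a composition instead of a module action, so both have to be parameters.\<close>

primrec pface :: "'a \<Rightarrow> 'o \<Rightarrow> 'u list \<Rightarrow> nat \<Rightarrow> nat \<Rightarrow> 'a" where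
  "pface a x cs 0 i = (if i = 0 then a else aug x (cs ! 0) (cs ! 1))"
| "pface a x cs (Suc n) i =
    (if i \<le> n then pface a x cs n i \<boxdot> Ide V (\<C> (cs ! Suc n) (cs ! Suc (Suc n)))
     else if i = Suc n then (Ide V (chain x cs n) \<boxdot> \<kappa> (cs ! n) (cs ! Suc n) (cs ! Suc (Suc n)))
         \<cdot> asc V (chain x cs n) (\<C> (cs ! n) (cs ! Suc n)) (\<C> (cs ! Suc n) (cs ! Suc (Suc n)))
     else aug (chain x cs (Suc n)) (cs ! Suc n) (cs ! Suc (Suc n)))"

lemma bar_summand_chain: "bar_summand V C M cs n = chain (EO M (cs ! 0)) cs n"
  by (induction n) auto

lemma bar_face_pface: "bar_face V C \<epsilon> M cs n i = pface (act M (cs ! 0) (cs ! 1)) (EO M (cs ! 0)) cs n i"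
  by (induction n) (auto simp: bar_summand_chain aug_def \<kappa>_def Let_def)

abbreviation "del i cs \<equiv> take i cs @ drop (Suc i) cs"

lemma del_nth: "i < length cs \<Longrightarrow> Suc k < length cs \<Longrightarrow> del i cs ! k = cs ! (if k
  < i then k else Suc k)"
  by (auto simp: nth_append)

lemma del_Ix: "cs \<in> Ix (Suc n) \<Longrightarrow> i \<le> Suc n \<Longrightarrow> del i cs \<in> Ix n"
  unfolding bar_index_def using set_take_subset[of i cs] set_drop_subset[of "Suc i" cs] by auto

text \<open>The target tuple \<open>ds\<close> is described only by its entries up to
  \<open>n\<close>, so that the same list serves at all stages of the induction. Face 0 alone
  changes the coefficient, from \<open>x\<close> to \<open>x'\<close>.\<close>

lemma pface_Hom:
  assumes a: "a \<in> Hom (x \<boxtimes> \<C> (cs ! 0) (cs ! 1)) x'" and x: "x \<in> Obj V"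
  shows "good cs (Suc n) \<Longrightarrow> i \<le> Suc n \<Longrightarrow> (\<And>k. k \<le> n
    \<Longrightarrow> ds ! k = cs ! (if k < i then k else Suc k))
    \<Longrightarrow> pface a x cs n i \<in> Hom (chain x cs (Suc n)) (chain (if i = 0 then x' else x) ds n)"
proof (induction n)
  case 0
  then show ?case using a aug_Hom[OF x, of "cs ! 0" "cs ! 1"] by auto
next
  case (Suc n)
  have g: "good cs n" "good cs (Suc n)" using Suc.prems good_Suc by auto
  have o: "cs ! n \<in> Ob" "cs ! Suc n \<in> Ob" "cs ! Suc (Suc n) \<in> Ob" using Suc.prems(1) by auto
  consider "i \<le> n" | "i = Suc n" | "i = Suc (Suc n)" using Suc.prems by linarith
  then show ?case
  proof cases
    case 1
    have d: "ds ! n = cs ! Suc n" "ds ! Suc n = cs ! Suc (Suc n)" using 1 Suc.prems(3)[of n] Suc.prems(3)[of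
      "Suc n"] by auto
    have "pface a x cs n i \<in> Hom (chain x cs (Suc n)) (chain (if i = 0 then x' else x) ds n)"
      by (rule Suc.IH) (use Suc.prems g 1 in auto)
    from tenA_homset[OF this Ide_Hom[OF eHom_Obj[OF o(2,3)]]] show ?thesis using 1 d by simp
  next
    case 2
    have d: "ds ! Suc n = cs ! Suc (Suc n)" "ds ! n = cs ! n" using 2 Suc.prems(3)[of "Suc n"] Suc.prems(3)[of
      n] by auto
    have "chain x ds n = chain x cs n" by (rule chain_cong) (use Suc.prems(3) 2 in auto)
    then show ?thesis using 2 d kappa_Hom[OF o] o x g by (simp add: homset_def)
  next
    case 3
    have "chain x ds (Suc n) = chain x cs (Suc n)" by (rule chain_cong) (use Suc.prems(3) 3 in auto)
    then show ?thesis using 3 aug_Hom[OF _ o(2,3), of "chain x cs (Suc n)"] x g o by simp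
  qed
qed

text \<open>The square \<open>ab\<close> at the first tensor factor propagates along the chain;
  after face 0 the coefficient map is \<open>f'\<close>, after any other face still
  \<open>f\<close>. It is used both for module maps and for the inclusions into a free
  module.\<close>

lemma pface_natural:
  assumes a: "a \<in> Hom (x \<boxtimes> \<C> (cs ! 0) (cs ! 1)) x'" and b:
    "b \<in> Hom (y \<boxtimes> \<C> (cs ! 0) (cs ! 1)) y'"
    and f: "f \<in> Hom x y" and f': "f' \<in> Hom x' y'" and ab:
      "b \<cdot> (f \<boxdot> Ide V (\<C> (cs ! 0) (cs ! 1))) = f' \<cdot> a"
  shows "good cs (Suc n) \<Longrightarrow> i \<le> Suc n \<Longrightarrow> (\<And>k. k \<le> n
    \<Longrightarrow> ds ! k = cs ! (if k < i then k else Suc k))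
    \<Longrightarrow> pface b y cs n i \<cdot> chainA f cs (Suc n) = chainA (if i = 0 then f' else f) ds n
      \<cdot> pface a x cs n i"
proof (induction n)
  case 0
  then show ?case using ab aug_natural[OF f, of "cs ! 0" "cs ! 1"] by auto
next
  case (Suc n)
  note xy = Hom_Obj[OF f]
  have g: "good cs n" "good cs (Suc n)" using Suc.prems good_Suc by auto
  have o: "cs ! n \<in> Ob" "cs ! Suc n \<in> Ob" "cs ! Suc (Suc n) \<in> Ob" using Suc.prems(1) by auto
  have ff: "(if i = 0 then f' else f) \<in> Hom (if i = 0 then x' else x) (if i = 0 then y' else y)" using f f' by simp
  note [simp] = eHom_Obj[OF o(1,2)] eHom_Obj[OF o(2,3)] eHom_Obj[OF o(1,3)] Hom_ArrD[OF kappa_Hom[OF o]]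
    Hom_ArrD[OF chainA_Hom[OF f g(1)]] g xy
  consider "i \<le> n" | "i = Suc n" | "i = Suc (Suc n)" using Suc.prems by linarith
  then show ?case
  proof cases
    case 1
    have d: "ds ! n = cs ! Suc n" "ds ! Suc n = cs ! Suc (Suc n)" using 1 Suc.prems(3)[of n] Suc.prems(3)[of
      "Suc n"] by auto
    have dsk: "\<And>k. k \<le> n \<Longrightarrow> ds ! k = cs ! (if k < i then k else Suc k)" using
      Suc.prems(3) by simp
    have gd: "good ds n" unfolding good_def
    proof (intro allI impI)
      fix k assume k: "k \<le> n"
      show "ds ! k \<in> Ob" using dsk[OF k] good_nth[OF Suc.prems(1), of k] good_nth[OF Suc.prems(1), of
        "Suc k"] k by simp
    qed
    have IH: "pface b y cs n i \<cdot> chainA f cs (Suc n) = chainA (if i = 0 then f' else f) ds n \<cdot>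
      pface a x cs n i"
      by (rule Suc.IH) (use Suc.prems g 1 in auto)
    have pa: "pface a x cs n i \<in> Hom (chain x cs (Suc n)) (chain (if i = 0 then x' else x) ds n)"
      and pb: "pface b y cs n i \<in> Hom (chain y cs (Suc n)) (chain (if i = 0 then y' else y) ds n)"
      using pface_Hom[OF a xy(1) g(2) _ dsk] pface_Hom[OF b xy(2) g(2) _ dsk] 1 by auto
    note F = chainA_Hom[OF ff gd]
    have "pface b y cs (Suc n) i \<cdot> chainA f cs (Suc (Suc n)) = (pface b y cs n i \<cdot> chainA f cs
      (Suc n)) \<boxdot> Ide V (\<C> (cs ! Suc n) (cs ! Suc (Suc n)))"
      using 1 Hom_ArrD[OF pb] by (simp add: interchange)
    also have "\<dots> = chainA (if i = 0 then f' else f) ds (Suc n) \<cdot> pface a x cs (Suc n) i"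
      unfolding IH using 1 Hom_ArrD[OF pa] Hom_ArrD[OF F] d by (simp add: interchange)
    finally show ?thesis .
  next
    case 2
    have d: "ds ! Suc n = cs ! Suc (Suc n)" "ds ! n = cs ! n" using 2 Suc.prems(3)[of "Suc n"] Suc.prems(3)[of
      n] by auto
    have c: "chainA f ds n = chainA f cs n" by (rule chainA_cong) (use Suc.prems(3) 2 in auto)
    have "pface b y cs (Suc n) i \<cdot> chainA f cs (Suc (Suc n)) = (Ide V (chain y cs n) \<boxdot> \<kappa>
      (cs ! n) (cs ! Suc n) (cs ! Suc (Suc n))) \<cdot>
       (asc V (chain y cs n) (\<C> (cs ! n) (cs ! Suc n)) (\<C> (cs ! Suc n) (cs ! Suc (Suc n))) \<cdot>
         ((chainA f cs n \<boxdot> Ide V (\<C> (cs ! n) (cs ! Suc n))) \<boxdot> Ide V (\<C> (cs ! Suc n) (cs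
           ! Suc (Suc n)))))" using 2 by simp
    also have "\<dots> = (chainA f cs n \<boxdot> Ide V (\<C> (cs ! n) (cs ! Suc (Suc n)))) \<cdot> ((Ide V
      (chain x cs n) \<boxdot> \<kappa> (cs ! n) (cs ! Suc n) (cs ! Suc (Suc n))) \<cdot>
       asc V (chain x cs n) (\<C> (cs ! n) (cs ! Suc n)) (\<C> (cs ! Suc n) (cs ! Suc (Suc n))))"
      by (subst asc_nat) (simp_all add: interchange')
    finally show ?thesis using 2 c d by simp
  next
    case 3
    have c: "chainA f ds (Suc n) = chainA f cs (Suc n)" by (rule chainA_cong) (use Suc.prems(3) 3 in auto)
    have "pface b y cs (Suc n) i \<cdot> chainA f cs (Suc (Suc n)) = chainA f cs (Suc n) \<cdot> aug (chain x
      cs (Suc n)) (cs ! Suc n) (cs ! Suc (Suc n))"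
      using aug_natural[OF chainA_Hom[OF f g(2)] o(2,3)] 3 by simp
    then show ?thesis using 3 c by simp
  qed
qed

text \<open>The arrow part of the decalage: composition of the first two homs takes over the role of
  the action, and the index of the face drops by one.\<close>

lemma pface_Cons:
  "pface a x (c # cs) (Suc n) (Suc i) = pface ((Ide V x \<boxdot> \<kappa> c (cs ! 0) (cs ! 1)) \<cdot> asc V
    x (\<C> c (cs ! 0)) (\<C> (cs ! 0) (cs ! 1))) (x \<boxtimes> \<C> c (cs ! 0)) cs n i"
  by (induction n) (auto simp: chain_Cons[symmetric])

lemma pface_Cons_0: "pface a x (c # cs) n 0 = chainA a cs n"
  by (induction n) auto

end

section \<open>Decalage and the extra degeneracy\<close>

lemma (in category) coproduct_iso:
  assumes Q: "is_coproduct C I X Q \<iota>" and Q': "is_coproduct C I X Q' \<iota>'"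
    and u: "u \<in> Hom Q Q'" "\<And>i. i \<in> I \<Longrightarrow> u \<cdot> \<iota> i = \<iota>' i"
  shows "iso_arrow C u"
proof -
  obtain v where v: "v \<in> Hom Q' Q" "\<forall>i\<in>I. v \<cdot> \<iota>' i = \<iota> i"
    using coproduct_desc[OF Q' coproduct_Obj[OF Q], where f = \<iota>] coproduct_Hom[OF Q] by blast
  have "v \<cdot> u = Ide C Q"
  proof (rule coproduct_eq[OF Q Cmp_homset[OF u(1) v(1)] Ide_Hom[OF coproduct_Obj[OF Q]]])
    fix i assume i: "i \<in> I"
    show "v \<cdot> u \<cdot> \<iota> i = Ide C Q \<cdot> \<iota> i"
      using Cmp_assoc[OF coproduct_Hom[OF Q i] u(1) v(1)] u(2)[OF i] v(2) i Hom_ArrD[OF coproduct_Hom[OF Q i]] by simp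
  qed
  moreover have "u \<cdot> v = Ide C Q'"
  proof (rule coproduct_eq[OF Q' Cmp_homset[OF v(1) u(1)] Ide_Hom[OF coproduct_Obj[OF Q']]])
    fix i assume i: "i \<in> I"
    show "u \<cdot> v \<cdot> \<iota>' i = Ide C Q' \<cdot> \<iota>' i"
      using Cmp_assoc[OF coproduct_Hom[OF Q' i] v(1) u(1)] u(2)[OF i] v(2) i Hom_ArrD[OF coproduct_Hom[OF Q' i]] by simp
  qed
  ultimately show ?thesis using iso_arrowI[OF u(1) v(1)] by blast
qed

context augmented_setting
begin

definition "bface M n i = face (bar_simplicial V C \<epsilon> M) n i"
definition "bd M n = alt_boundary V (bar_simplicial V C \<epsilon> M) n"
abbreviation "\<S> M n \<equiv> Bo (EO M) n"
definition "bmap M N \<phi> n = Smap (EO M) (EO N) (cmp \<phi>) n"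

lemma bar_coprod_simps: "fst (bar_coprod V C M n) = \<S> M n" "snd (bar_coprod V C M n) = inc (EO M) n"
  by (simp_all add: bar_coprod_def Bo_def inc_def bar_summand_chain)

lemma simp_ob_bar: "simp_ob (bar_simplicial V C \<epsilon> M) n = \<S> M n"
  by (simp add: bar_simplicial_def bar_coprod_simps)

lemma fam_EO: "M \<in> Obj Mod \<Longrightarrow> fam (EO M)"
  unfolding fam_def using Mod_EO by blast

lemma famHom_cmp: "\<phi> \<in> homset Mod M N \<Longrightarrow> famHom (EO M) (EO N) (cmp \<phi>)"
  unfolding famHom_def using cmp_Hom by blast

lemma S_Obj: "M \<in> Obj Mod \<Longrightarrow> \<S> M n \<in> Obj V"
  using Bo_Obj[OF fam_EO] .

lemma del_hd: "cs \<in> Ix (Suc n) \<Longrightarrow> i \<le> Suc n \<Longrightarrow> del i cs ! 0 = (if i = 0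
  then cs ! 1 else cs ! 0)"
  using del_nth[of i cs 0] Ix_length[of cs "Suc n"] by simp

lemma del_nth': "cs \<in> Ix (Suc n) \<Longrightarrow> i \<le> Suc n \<Longrightarrow> k \<le> n
  \<Longrightarrow> del i cs ! k = cs ! (if k < i then k else Suc k)"
  using del_nth[of i cs k] Ix_length[of cs "Suc n"] by simp

lemma Ix_nth: "cs \<in> Ix n \<Longrightarrow> k \<le> n \<Longrightarrow> cs ! k \<in> Ob"
  using good_nth[OF good_Ix] .

lemma bar_pface_Hom:
  assumes M: "M \<in> Obj Mod" and cs: "cs \<in> Ix (Suc n)" and i: "i \<le> Suc n"
  shows "pface (act M (cs ! 0) (cs ! 1)) (EO M (cs ! 0)) cs n i
    \<in> Hom (chain (EO M (cs ! 0)) cs (Suc n)) (chain (EO M (del i cs ! 0)) (del i cs) n)"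
proof -
  have o: "cs ! 0 \<in> Ob" "cs ! 1 \<in> Ob" using Ix_nth[OF cs, of 0] Ix_nth[OF cs, of 1] by simp_all
  show ?thesis
    using pface_Hom[OF Mod_act_Hom[OF M o] Mod_EO[OF M o(1)] good_Ix[OF cs] i del_nth'[OF cs i]] del_hd[OF cs
      i] by (simp split: if_splits)
qed

lemma face_props:
  assumes M: "M \<in> Obj Mod" and i: "i \<le> Suc n"
  shows "bface M n i \<in> Hom (\<S> M (Suc n)) (\<S> M n)"
    and "cs \<in> Ix (Suc n) \<Longrightarrow> bface M n i \<cdot> inc (EO M) (Suc n) cs = inc (EO M) n (del i
      cs) \<cdot> pface (act M (cs ! 0) (cs ! 1)) (EO M (cs ! 0)) cs n i"
proof -
  have h: "inc (EO M) n (del i cs) \<cdot> pface (act M (cs ! 0) (cs ! 1)) (EO M (cs ! 0)) cs n i \<in> Hom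
    (chain (EO M (cs ! 0)) cs (Suc n)) (\<S> M n)"
    if cs: "cs \<in> Ix (Suc n)" for cs
    using Cmp_homset[OF bar_pface_Hom[OF M cs i] inc_Hom[OF fam_EO[OF M] del_Ix[OF cs i]]] .
  have d: "bface M n i = coprod_desc V (Ix (Suc n)) (\<lambda>cs. chain (EO M (cs ! 0)) cs (Suc n)) (\<S> M n)
      (\<lambda>cs. inc (EO M) n (del i cs) \<cdot> pface (act M (cs ! 0) (cs ! 1)) (EO M (cs ! 0)) cs n i)"
    unfolding bface_def by (simp add: bar_simplicial_def bar_coprod_simps bar_summand_chain bar_face_pface)
  show "bface M n i \<in> Hom (\<S> M (Suc n)) (\<S> M n)" unfolding d by (rule B_desc(1)[OF fam_EO[OF M]
    S_Obj[OF M] h])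
  show "cs \<in> Ix (Suc n) \<Longrightarrow> bface M n i \<cdot> inc (EO M) (Suc n) cs = inc (EO M) n (del i
    cs) \<cdot> pface (act M (cs ! 0) (cs ! 1)) (EO M (cs ! 0)) cs n i"
    unfolding d by (rule B_desc(2)[OF fam_EO[OF M] S_Obj[OF M] h])
qed

lemma S_map:
  assumes "\<phi> \<in> homset Mod M N"
  shows "bmap M N \<phi> n \<in> Hom (\<S> M n) (\<S> N n)"
    and "cs \<in> Ix n \<Longrightarrow> bmap M N \<phi> n \<cdot> inc (EO M) n cs = inc (EO N) n cs \<cdot>
      chainA (cmp \<phi> (cs ! 0)) cs n"
  unfolding bmap_def using Smap[OF famHom_cmp[OF assms]] by auto

lemma S_Cmp:
  assumes f: "\<phi> \<in> homset Mod M N" and g: "\<psi> \<in> homset Mod N P"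
  shows "bmap M P (\<psi> \<cdot>\<^bsub>Mod\<^esub> \<phi>) n = bmap N P \<psi> n \<cdot> bmap M N \<phi> n"
  unfolding bmap_def by (rule Smap_Cmp[OF famHom_cmp[OF f] famHom_cmp[OF g] famHom_cmp[OF cmp_Cmp(2)[OF f g]]
    cmp_Cmp(3)[OF f g]])

lemma S_Ide: "M \<in> Obj Mod \<Longrightarrow> bmap M M (Ide Mod M) n = Ide V (\<S> M n)"
  unfolding bmap_def by (rule Smap_Ide[OF famHom_cmp[OF Ide_Mod_Hom] cmp_Ide])

lemma face_natural:
  assumes f: "\<phi> \<in> homset Mod M N" and i: "i \<le> Suc n"
  shows "bmap M N \<phi> n \<cdot> bface M n i = bface N n i \<cdot> bmap M N \<phi> (Suc n)"
proof -
  note M = Hom_mor(3)[OF f] and N = Hom_mor(4)[OF f]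
  note SH = S_map(1)[OF f] and dM = face_props(1)[OF M i] and dN = face_props(1)[OF N i]
  show ?thesis
  proof (rule B_eq[OF fam_EO[OF M] Cmp_homset[OF dM SH] Cmp_homset[OF SH dN]])
    fix cs assume cs: "cs \<in> Ix (Suc n)"
    have o: "cs ! 0 \<in> Ob" "cs ! 1 \<in> Ob" using Ix_nth[OF cs, of 0] Ix_nth[OF cs, of 1] by simp_all
    let ?D = "del i cs" let ?f = "cmp \<phi> (cs ! 0)"
    note D = del_Ix[OF cs i]
    note pM = bar_pface_Hom[OF M cs i] and pN = bar_pface_Hom[OF N cs i]
    note iM = inc_Hom[OF fam_EO[OF M] cs] inc_Hom[OF fam_EO[OF M] D] and iN = inc_Hom[OF fam_EO[OF N] cs]
      inc_Hom[OF fam_EO[OF N] D]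
    note cA = chainA_Hom[OF cmp_Hom[OF f o(1)] good_Ix[OF cs]] and cB = chainA_Hom[OF cmp_Hom[OF f Ix_hd[OF
      D]] good_Ix[OF D]]
    have "cmp \<phi> (?D ! 0) = (if i = 0 then cmp \<phi> (cs ! 1) else cmp \<phi> (cs ! 0))" using del_hd[OF
      cs i] by simp
    then have nat: "pface (act N (cs ! 0) (cs ! 1)) (EO N (cs ! 0)) cs n i \<cdot> chainA ?f cs (Suc n)
       = chainA (cmp \<phi> (?D ! 0)) ?D n \<cdot> pface (act M (cs ! 0) (cs ! 1)) (EO M (cs ! 0)) cs n i"
      using pface_natural[OF Mod_act_Hom[OF M o] Mod_act_Hom[OF N o] cmp_Hom[OF f o(1)] cmp_Hom[OF f o(2)]
        equivariantD(2)[OF Hom_mor(2)[OF f] o, symmetric] good_Ix[OF cs] i del_nth'[OF cs i]] by simp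
    have "(bmap M N \<phi> n \<cdot> bface M n i) \<cdot> inc (EO M) (Suc n) cs = bmap M N \<phi> n \<cdot>
      (inc (EO M) n ?D \<cdot> pface (act M (cs ! 0) (cs ! 1)) (EO M (cs ! 0)) cs n i)"
      unfolding Cmp_assoc[OF iM(1) dM SH] face_props(2)[OF M i cs] ..
    also have "\<dots> = inc (EO N) n ?D \<cdot> (chainA (cmp \<phi> (?D ! 0)) ?D n \<cdot> pface (act M (cs !
      0) (cs ! 1)) (EO M (cs ! 0)) cs n i)"
      unfolding Cmp_assoc[OF pM iM(2) SH, symmetric] S_map(2)[OF f D] Cmp_assoc[OF pM cB iN(2)] ..
    also have "\<dots> = (inc (EO N) n ?D \<cdot> pface (act N (cs ! 0) (cs ! 1)) (EO N (cs ! 0)) cs n i)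
      \<cdot> chainA ?f cs (Suc n)"
      unfolding nat[symmetric] Cmp_assoc[OF cA pN iN(2)] ..
    also have "\<dots> = bface N n i \<cdot> (inc (EO N) (Suc n) cs \<cdot> chainA ?f cs (Suc n))"
      unfolding face_props(2)[OF N i cs, symmetric] Cmp_assoc[OF cA iN(1) dN] ..
    also have "\<dots> = (bface N n i \<cdot> bmap M N \<phi> (Suc n)) \<cdot> inc (EO M) (Suc n) cs"
      unfolding S_map(2)[OF f cs, symmetric] Cmp_assoc[OF iM(1) SH dN] ..
    finally show "(bmap M N \<phi> n \<cdot> bface M n i) \<cdot> inc (EO M) (Suc n) cs = (bface N n i \<cdot>
      bmap M N \<phi> (Suc n)) \<cdot> inc (EO M) (Suc n) cs" .
  qed
qed

lemma bd_alt_sum: "bd M n = alt_sum (\<S> M (Suc n)) (\<S> M n) (bface M n) (Suc n)"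
  by (simp add: bd_def alt_boundary_def alt_sum_def simp_ob_bar bface_def[abs_def] Let_def)

lemma bd_Hom: "M \<in> Obj Mod \<Longrightarrow> bd M n \<in> Hom (\<S> M (Suc n)) (\<S> M n)"
  unfolding bd_alt_sum by (rule alt_sum_Hom[OF S_Obj S_Obj face_props(1)])

lemma bd_natural:
  assumes f: "\<phi> \<in> homset Mod M N"
  shows "bmap M N \<phi> n \<cdot> bd M n = bd N n \<cdot> bmap M N \<phi> (Suc n)"
proof -
  note M = Hom_mor(3)[OF f] and N = Hom_mor(4)[OF f]
  have "bmap M N \<phi> n \<cdot> bd M n = alt_sum (\<S> M (Suc n)) (\<S> N n) (\<lambda>i. bmap M N \<phi> n
    \<cdot> bface M n i) (Suc n)"
    unfolding bd_alt_sum by (rule Cmp_alt_sum[OF S_map(1)[OF f] face_props(1)[OF M] S_Obj[OF M]])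
  also have "\<dots> = alt_sum (\<S> M (Suc n)) (\<S> N n) (\<lambda>i. bface N n i \<cdot> bmap M N \<phi>
    (Suc n)) (Suc n)"
    by (rule alt_sum_cong[OF S_Obj[OF M] S_Obj[OF N] face_natural[OF f] Cmp_homset[OF S_map(1)[OF f]
      face_props(1)[OF N]]])
  also have "\<dots> = bd N n \<cdot> bmap M N \<phi> (Suc n)"
    unfolding bd_alt_sum by (rule alt_sum_Cmp[symmetric, OF S_map(1)[OF f] face_props(1)[OF N] S_Obj[OF N]])
  finally show ?thesis .
qed

section \<open>Decalage: the bar complex of a module and that of the free module on it\<close>

definition "TT M = T (EO M)"
abbreviation "ti M \<equiv> TI (EO M)"

context
  fixes M assumes M: "M \<in> Obj Mod"
begin

lemma TT_Mod: "TT M \<in> Obj Mod" and TT_EO: "c \<in> Ob \<Longrightarrow> EO (TT M) c = TO (EO M) c"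
  and TT_act: "a \<in> Ob \<Longrightarrow> b \<in> Ob \<Longrightarrow> act (TT M) a b = Tact (EO M) a b"
  unfolding TT_def using T_Mod[of "EO M"] T_EO[of "EO M"] T_act[of "EO M"] Mod_EO[OF M] by auto

lemma ti_Hom: "c \<in> Ob \<Longrightarrow> c' \<in> Ob \<Longrightarrow> ti M c c' \<in> Hom (EO M c
  \<boxtimes> \<C> c c') (EO (TT M) c')"
  using TI_Hom[of "EO M" c c'] Mod_EO[OF M] TT_EO by simp

lemma ti_chain_Hom:
  assumes c: "c \<in> Ob" and cs: "cs \<in> Ix n"
  shows "chainA (ti M c (cs ! 0)) cs n \<in> Hom (chain (EO M c) (c # cs) (Suc n)) (chain (EO (TT M) (cs ! 0)) cs n)"
  unfolding chain_Cons by (rule chainA_Hom[OF ti_Hom[OF c Ix_hd[OF cs]] good_Ix[OF cs]])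

text \<open>A chain preserves coproducts in its coefficient, so each summand of S_n of the free
  module splits according to the additional first object \<open>c\<close>.\<close>

lemma ti_coproduct:
  assumes cs: "cs \<in> Ix n"
  shows "is_coproduct V Ob (\<lambda>c. chain (EO M c) (c # cs) (Suc n)) (chain (EO (TT M) (cs ! 0)) cs n)
    (\<lambda>c. chainA (ti M c (cs ! 0)) cs n)"
  unfolding chain_Cons TT_EO[OF Ix_hd[OF cs]]
  by (rule chain_coproduct[OF TO_coproduct[of "EO M", OF Mod_EO[OF M] Ix_hd[OF cs]] good_Ix[OF cs]])

definition "shift_inc n ds = inc (EO (TT M)) n (tl ds) \<cdot> chainA (ti M (hd ds) (tl ds ! 0)) (tl ds) n"

text \<open>A coproduct over \<open>cs\<close> of coproducts over \<open>c\<close> is a coproduct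
  over the tuples \<open>c # cs\<close>; existence and uniqueness of the induced arrow are each
  obtained in these two stages.\<close>

lemma shift_coproduct: "is_coproduct V (Ix (Suc n)) (\<lambda>ds. chain (EO M (ds ! 0)) ds (Suc n)) (\<S> (TT
  M) n) (shift_inc n)"
proof (rule coproductI[OF S_Obj[OF TT_Mod]])
  fix ds assume "ds \<in> Ix (Suc n)"
  then obtain c cs where ds: "ds = c # cs" "c \<in> Ob" "cs \<in> Ix n" using Ix_Suc by auto
  show "shift_inc n ds \<in> Hom (chain (EO M (ds ! 0)) ds (Suc n)) (\<S> (TT M) n)"
    unfolding shift_inc_def ds(1) using Cmp_homset[OF ti_chain_Hom[OF ds(2,3)] inc_Hom[OF fam_EO[OF TT_Mod]
      ds(3)]] by (simp del: chain.simps)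
next
  note B = B_coproduct[OF fam_EO[OF TT_Mod], of n]
  fix y f assume y: "y \<in> Obj V" and f: "\<And>ds. ds \<in> Ix (Suc n) \<Longrightarrow> f ds \<in> Hom
    (chain (EO M (ds ! 0)) ds (Suc n)) y"
  have "\<exists>g \<in> Hom (chain (EO (TT M) (cs ! 0)) cs n) y. \<forall>c\<in>Ob. g \<cdot> chainA (ti M c
    (cs ! 0)) cs n = f (c # cs)" if cs: "cs \<in> Ix n" for cs
  proof (rule coproduct_desc[OF ti_coproduct[OF cs] y])
    fix c assume "c \<in> Ob"
    then have "c # cs \<in> Ix (Suc n)" using cs Ix_Suc by blast
    from f[OF this] show "f (c # cs) \<in> Hom (chain (EO M c) (c # cs) (Suc n)) y" by simp
  qed
  then obtain g where g: "\<And>cs. cs \<in> Ix n \<Longrightarrow> g cs \<in> Hom (chain (EO (TT M) (cs ! 0)) cs n) y"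
    "\<And>cs c. cs \<in> Ix n \<Longrightarrow> c \<in> Ob \<Longrightarrow> g cs \<cdot> chainA (ti M c (cs
      ! 0)) cs n = f (c # cs)" by metis
  obtain u where u: "u \<in> Hom (\<S> (TT M) n) y" "\<And>cs. cs \<in> Ix n \<Longrightarrow> u \<cdot> inc
    (EO (TT M)) n cs = g cs"
    using coproduct_desc[OF B y, where f = g] g(1) by blast
  have "u \<cdot> shift_inc n ds = f ds" if "ds \<in> Ix (Suc n)" for ds
  proof -
    obtain c cs where ds: "ds = c # cs" "c \<in> Ob" "cs \<in> Ix n" using \<open>ds \<in> Ix (Suc n)\<close>
      Ix_Suc by auto
    show ?thesis unfolding shift_inc_def ds(1) list.sel
      unfolding Cmp_assoc[OF ti_chain_Hom[OF ds(2,3)] inc_Hom[OF fam_EO[OF TT_Mod] ds(3)] u(1), symmetric]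
        u(2)[OF ds(3)] by (rule g(2)[OF ds(3,2)])
  qed
  then show "\<exists>u\<in>Hom (\<S> (TT M) n) y. \<forall>ds\<in>Ix (Suc n). u \<cdot> shift_inc n ds = f
    ds" using u(1) by blast
next
  note B = B_coproduct[OF fam_EO[OF TT_Mod], of n]
  fix y u u' assume u: "u \<in> Hom (\<S> (TT M) n) y" "u' \<in> Hom (\<S> (TT M) n) y" and eq:
    "\<And>ds. ds \<in> Ix (Suc n) \<Longrightarrow> u \<cdot> shift_inc n ds = u' \<cdot> shift_inc n ds"
  show "u = u'"
  proof (rule coproduct_eq[OF B u])
    fix cs assume cs: "cs \<in> Ix n"
    note i = inc_Hom[OF fam_EO[OF TT_Mod] cs]
    show "u \<cdot> inc (EO (TT M)) n cs = u' \<cdot> inc (EO (TT M)) n cs"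
    proof (rule coproduct_eq[OF ti_coproduct[OF cs] Cmp_homset[OF i u(1)] Cmp_homset[OF i u(2)]])
      fix c assume c: "c \<in> Ob"
      have "c # cs \<in> Ix (Suc n)" using c cs Ix_Suc by blast
      from eq[OF this] show "(u \<cdot> inc (EO (TT M)) n cs) \<cdot> chainA (ti M c (cs ! 0)) cs n = (u'
        \<cdot> inc (EO (TT M)) n cs) \<cdot> chainA (ti M c (cs ! 0)) cs n"
        unfolding Cmp_assoc[OF ti_chain_Hom[OF c cs] i u(1)] Cmp_assoc[OF ti_chain_Hom[OF c cs] i u(2)] by
          (simp add: shift_inc_def)
    qed
  qed
qed

text \<open>Removing \<open>c\<^sub>0\<close> identifies \<open>S\<^sub>n\<^sub>+\<^sub>1(M)\<close> with
  \<open>S\<^sub>n\<close> of the free module on \<open>M\<close>; this turns \<open>d\<^sub>0\<close>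
  into the counit and \<open>d\<^sub>i\<^sub>+\<^sub>1\<close> into \<open>d\<^sub>i\<close>.\<close>

definition "\<tau> n = coprod_desc V (Ix (Suc n)) (\<lambda>ds. chain (EO M (ds ! 0)) ds (Suc n)) (\<S> (TT M)
  n) (shift_inc n)"

lemma tau_Hom: "\<tau> n \<in> Hom (\<S> M (Suc n)) (\<S> (TT M) n)"
  and tau_shift_inc: "ds \<in> Ix (Suc n) \<Longrightarrow> \<tau> n \<cdot> inc (EO M) (Suc n) ds = shift_inc n ds"
  unfolding \<tau>_def by (rule B_desc[OF fam_EO[OF M] S_Obj[OF TT_Mod] coproduct_Hom[OF shift_coproduct]]; assumption)+

lemma tau_inc:
  assumes "c \<in> Ob" "cs \<in> Ix n"
  shows "\<tau> n \<cdot> inc (EO M) (Suc n) (c # cs) = inc (EO (TT M)) n cs \<cdot> chainA (ti M c (cs ! 0)) cs n"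
proof -
  have "c # cs \<in> Ix (Suc n)" using assms Ix_Suc by blast
  then show ?thesis using tau_shift_inc by (simp add: shift_inc_def)
qed

lemma tau_iso: "iso_arrow V (\<tau> n)"
  by (rule coproduct_iso[OF B_coproduct[OF fam_EO[OF M]] shift_coproduct tau_Hom tau_shift_inc])

definition "\<theta> n = inv_arrow V (\<tau> n)"

lemma theta: "\<theta> n \<in> Hom (\<S> (TT M) n) (\<S> M (Suc n))"
  "\<theta> n \<cdot> \<tau> n = Ide V (\<S> M (Suc n))" "\<tau> n \<cdot> \<theta> n = Ide V (\<S> (TT M) n)"
  using inv_arrow(1-5)[OF tau_iso[of n]] Hom_ArrD[OF tau_Hom[of n]] by (simp_all add: \<theta>_def homset_def)

text \<open>The free extension of the family of identities is the counit; its value on the inclusion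
  of a summand is the action of \<open>M\<close> itself.\<close>

lemma counit_ex: "\<exists>\<phi> \<in> homset Mod (TT M) M. (\<forall>c\<in>Ob. cmp \<phi> c \<cdot> Tunit
  (EO M) c = Ide V (EO M c))
    \<and> (\<forall>c\<in>Ob. \<forall>c'\<in>Ob. cmp \<phi> c' \<cdot> ti M c c' = act M c c')"
proof -
  have "act M c c' \<cdot> (Ide V (EO M c) \<boxdot> Ide V (\<C> c c')) = act M c c'" if "c \<in> Ob"
    "c' \<in> Ob" for c c'
    using Hom_ArrD[OF Mod_act_Hom[OF M that]] Mod_EO[OF M that(1)] that by simp
  moreover have "\<exists>\<phi> \<in> homset Mod (TT M) M. (\<forall>c\<in>Ob. cmp \<phi> c \<cdot> Tunit (EO
    M) c = Ide V (EO M c))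
    \<and> (\<forall>c\<in>Ob. \<forall>c'\<in>Ob. cmp \<phi> c' \<cdot> ti M c c' = act M c c' \<cdot> (Ide V
      (EO M c) \<boxdot> Ide V (\<C> c c')))"
    unfolding TT_def by (rule T_extend[of "EO M" M "\<lambda>c. Ide V (EO M c)", OF Mod_EO[OF M] M]) (use
      Mod_EO[OF M] in simp_all)
  ultimately show ?thesis by (metis (no_types, lifting))
qed

definition "cu = (SOME \<phi>. \<phi> \<in> homset Mod (TT M) M \<and> (\<forall>c\<in>Ob. cmp \<phi> c
  \<cdot> Tunit (EO M) c = Ide V (EO M c))
    \<and> (\<forall>c\<in>Ob. \<forall>c'\<in>Ob. cmp \<phi> c' \<cdot> ti M c c' = act M c c'))"

lemma cu: "cu \<in> homset Mod (TT M) M" "c \<in> Ob \<Longrightarrow> cmp cu c \<cdot> Tunit (EO M) c = Ide V (EO M c)"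
  "c \<in> Ob \<Longrightarrow> c' \<in> Ob \<Longrightarrow> cmp cu c' \<cdot> ti M c c' = act M c c'"
  using someI_ex[OF counit_ex[unfolded Bex_def]] unfolding cu_def by blast+

text \<open>On a summand d_0 acts with the first hom. Writing the action as the counit after the
  inclusion \<open>ti\<close> separates it into \<tau> and the map induced by the counit.\<close>

lemma face_0: "bface M n 0 = bmap (TT M) M cu n \<cdot> \<tau> n"
proof (rule B_eq[OF fam_EO[OF M] face_props(1)[OF M le0] Cmp_homset[OF tau_Hom S_map(1)[OF cu(1)]]])
  fix ds assume ds: "ds \<in> Ix (Suc n)"
  then obtain c cs where d: "ds = c # cs" and c: "c \<in> Ob" and cs: "cs \<in> Ix n" using Ix_Suc by auto
  note h = Ix_hd[OF cs]
  note tH = ti_chain_Hom[OF c cs] and iT = inc_Hom[OF fam_EO[OF TT_Mod] cs] and iM = inc_Hom[OF fam_EO[OF M] cs]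
  note cH = chainA_Hom[OF cmp_Hom[OF cu(1) h] good_Ix[OF cs]]
  have "(bmap (TT M) M cu n \<cdot> \<tau> n) \<cdot> inc (EO M) (Suc n) ds = bmap (TT M) M cu n \<cdot> (inc
    (EO (TT M)) n cs \<cdot> chainA (ti M c (cs ! 0)) cs n)"
    unfolding Cmp_assoc[OF inc_Hom[OF fam_EO[OF M] ds] tau_Hom S_map(1)[OF cu(1)]] unfolding d tau_inc[OF c cs] ..
  also have "\<dots> = inc (EO M) n cs \<cdot> (chainA (cmp cu (cs ! 0)) cs n \<cdot> chainA (ti M c (cs ! 0)) cs n)"
    unfolding Cmp_assoc[OF tH iT S_map(1)[OF cu(1)], symmetric] S_map(2)[OF cu(1) cs] Cmp_assoc[OF tH cH iM] ..
  also have "\<dots> = inc (EO M) n cs \<cdot> chainA (act M c (cs ! 0)) cs n"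
    unfolding chainA_Cmp[OF ti_Hom[OF c h] cmp_Hom[OF cu(1) h] good_Ix[OF cs], symmetric] cu(3)[OF c h] ..
  also have "\<dots> = bface M n 0 \<cdot> inc (EO M) (Suc n) ds"
    unfolding face_props(2)[OF M le0 ds] unfolding d by (simp add: pface_Cons_0)
  finally show "bface M n 0 \<cdot> inc (EO M) (Suc n) ds = (bmap (TT M) M cu n \<cdot> \<tau> n) \<cdot> inc
    (EO M) (Suc n) ds" by (rule sym)
qed

text \<open>On each summand this is \<open>pface_Cons\<close> combined with naturality of the faces
  along the inclusions \<open>ti\<close>, which intertwine composition of homs with the free
  action.\<close>

lemma face_Suc:
  assumes i: "i \<le> Suc n"
  shows "\<tau> n \<cdot> bface M (Suc n) (Suc i) = bface (TT M) n i \<cdot> \<tau> (Suc n)"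
proof -
  have i': "Suc i \<le> Suc (Suc n)" using i by simp
  note dM = face_props(1)[OF M i'] and dT = face_props(1)[OF TT_Mod i]
  show ?thesis
  proof (rule B_eq[OF fam_EO[OF M] Cmp_homset[OF dM tau_Hom] Cmp_homset[OF tau_Hom dT]])
    fix ds assume ds: "ds \<in> Ix (Suc (Suc n))"
    then obtain c cs where d: "ds = c # cs" and c: "c \<in> Ob" and cs: "cs \<in> Ix (Suc n)" using Ix_Suc by auto
    have o: "cs ! 0 \<in> Ob" "cs ! 1 \<in> Ob" using Ix_nth[OF cs, of 0] Ix_nth[OF cs, of 1] by simp_all
    let ?D = "del i cs"
    note D = del_Ix[OF cs i]
    have D': "del (Suc i) ds = c # ?D" unfolding d by simp
    have D'': "c # ?D \<in> Ix (Suc n)" using c D Ix_Suc by blast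
    let ?pM = "pface (act M (ds ! 0) (ds ! 1)) (EO M (ds ! 0)) ds (Suc n) (Suc i)"
    let ?pT = "pface (act (TT M) (cs ! 0) (cs ! 1)) (EO (TT M) (cs ! 0)) cs n i"
    note iM = inc_Hom[OF fam_EO[OF M] ds] inc_Hom[OF fam_EO[OF M] D''] and iT = inc_Hom[OF fam_EO[OF TT_Mod]
      cs] inc_Hom[OF fam_EO[OF TT_Mod] D]
    have iM2: "inc (EO M) (Suc n) (c # ?D) \<in> Hom (chain (EO M c) (c # ?D) (Suc n)) (\<S> M (Suc n))"
      using iM(2) by (simp del: chain.simps)
    have pM: "?pM \<in> Hom (chain (EO M c) ds (Suc (Suc n))) (chain (EO M c) (c # ?D) (Suc n))"
      using bar_pface_Hom[OF M ds i'] unfolding D' unfolding d by (simp del: chain.simps pface.simps)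
    note pT = bar_pface_Hom[OF TT_Mod cs i]
    have tD: "chainA (ti M c (?D ! 0)) ?D n \<in> Hom (chain (EO M c) (c # ?D) (Suc n)) (chain (EO (TT M) (?D
      ! 0)) ?D n)"
      by (rule ti_chain_Hom[OF c D])
    have tc: "chainA (ti M c (cs ! 0)) cs (Suc n) \<in> Hom (chain (EO M c) ds (Suc (Suc n))) (chain (EO (TT
      M) (cs ! 0)) cs (Suc n))"
      unfolding d by (rule ti_chain_Hom[OF c cs])
    have g: "gen (EO M) c (cs ! 0) (cs ! 1) \<in> Hom ((EO M c \<boxtimes> \<C> c (cs ! 0)) \<boxtimes> \<C>
      (cs ! 0) (cs ! 1)) (EO M c \<boxtimes> \<C> c (cs ! 1))"
      by (rule gen_Hom[of "EO M", OF Mod_EO[OF M] c o])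
    have pf: "?pM = pface (gen (EO M) c (cs ! 0) (cs ! 1)) (EO M c \<boxtimes> \<C> c (cs ! 0)) cs n i"
      unfolding d using pface_Cons[of _ "EO M c" c cs n i] by (simp add: gen_def[of "EO M", OF Mod_EO[OF M]]
        del: pface.simps)
    have "ti M c (?D ! 0) = (if i = 0 then ti M c (cs ! 1) else ti M c (cs ! 0))" using del_hd[OF cs i] by simp
    moreover have "act (TT M) (cs ! 0) (cs ! 1) \<cdot> (ti M c (cs ! 0) \<boxdot> Ide V (\<C> (cs ! 0) (cs !
      1))) = ti M c (cs ! 1) \<cdot> gen (EO M) c (cs ! 0) (cs ! 1)"
      unfolding TT_act[OF o] by (rule Tact(2)[of "EO M", OF Mod_EO[OF M] o c])
    ultimately have nat: "?pT \<cdot> chainA (ti M c (cs ! 0)) cs (Suc n) = chainA (ti M c (?D ! 0)) ?D n \<cdot> ?pM"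
      unfolding pf using pface_natural[OF g Mod_act_Hom[OF TT_Mod o] ti_Hom[OF c o(1)] ti_Hom[OF c o(2)] _
        good_Ix[OF cs] i del_nth'[OF cs i]] by simp
    have "(\<tau> n \<cdot> bface M (Suc n) (Suc i)) \<cdot> inc (EO M) (Suc (Suc n)) ds = \<tau> n \<cdot>
      (inc (EO M) (Suc n) (c # ?D) \<cdot> ?pM)"
      unfolding Cmp_assoc[OF iM(1) dM tau_Hom] face_props(2)[OF M i' ds] D' ..
    also have "\<dots> = inc (EO (TT M)) n ?D \<cdot> (chainA (ti M c (?D ! 0)) ?D n \<cdot> ?pM)"
      unfolding Cmp_assoc[OF pM iM2 tau_Hom, symmetric] tau_inc[OF c D] Cmp_assoc[OF pM tD iT(2)] ..
    also have "\<dots> = (inc (EO (TT M)) n ?D \<cdot> ?pT) \<cdot> chainA (ti M c (cs ! 0)) cs (Suc n)"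
      unfolding nat[symmetric] using Cmp_assoc[OF tc pT iT(2)] by simp
    also have "\<dots> = bface (TT M) n i \<cdot> (inc (EO (TT M)) (Suc n) cs \<cdot> chainA (ti M c (cs ! 0))
      cs (Suc n))"
      unfolding face_props(2)[OF TT_Mod i cs, symmetric] Cmp_assoc[OF tc iT(1) dT] ..
    also have "\<dots> = (bface (TT M) n i \<cdot> \<tau> (Suc n)) \<cdot> inc (EO M) (Suc (Suc n)) ds"
      unfolding Cmp_assoc[OF iM(1) tau_Hom dT] unfolding d tau_inc[OF c cs] ..
    finally show "(\<tau> n \<cdot> bface M (Suc n) (Suc i)) \<cdot> inc (EO M) (Suc (Suc n)) ds = (bface (TT
      M) n i \<cdot> \<tau> (Suc n)) \<cdot> inc (EO M) (Suc (Suc n)) ds" .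
  qed
qed

lemma face_Suc': "i \<le> Suc n \<Longrightarrow> bface M (Suc n) (Suc i) = (\<theta> n \<cdot> bface (TT M) n
  i) \<cdot> \<tau> (Suc n)"
proof -
  assume i: "i \<le> Suc n"
  then have "Suc i \<le> Suc (Suc n)" by simp
  note dM = face_props(1)[OF M this] and dT = face_props(1)[OF TT_Mod i]
  have "\<theta> n \<cdot> (\<tau> n \<cdot> bface M (Suc n) (Suc i)) = bface M (Suc n) (Suc i)"
    using Cmp_assoc[OF dM tau_Hom theta(1)] theta(2) Hom_ArrD[OF dM] by simp
  then show ?thesis unfolding face_Suc[OF i] using Cmp_assoc[OF tau_Hom dT theta(1)] by simp
qed

lemma bd_tail:
  "alt_sum (\<S> M (Suc (Suc n))) (\<S> M (Suc n)) (\<lambda>i. bface M (Suc n) (Suc i)) (Suc n) = (\<theta> n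
    \<cdot> bd (TT M) n) \<cdot> \<tau> (Suc n)"
proof -
  have h: "\<theta> n \<cdot> bface (TT M) n i \<in> Hom (\<S> (TT M) (Suc n)) (\<S> M (Suc n))" if
    "i \<le> Suc n" for i
    using Cmp_homset[OF face_props(1)[OF TT_Mod that] theta(1)] .
  have "alt_sum (\<S> M (Suc (Suc n))) (\<S> M (Suc n)) (\<lambda>i. bface M (Suc n) (Suc i)) (Suc n)
    = alt_sum (\<S> M (Suc (Suc n))) (\<S> M (Suc n)) (\<lambda>i. (\<theta> n \<cdot> bface (TT M) n i)
      \<cdot> \<tau> (Suc n)) (Suc n)"
    by (rule alt_sum_cong[OF S_Obj[OF M] S_Obj[OF M] face_Suc' Cmp_homset[OF tau_Hom h]])
  also have "\<dots> = alt_sum (\<S> (TT M) (Suc n)) (\<S> M (Suc n)) (\<lambda>i. \<theta> n \<cdot> bface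
    (TT M) n i) (Suc n) \<cdot> \<tau> (Suc n)"
    by (rule alt_sum_Cmp[symmetric, OF tau_Hom h S_Obj[OF M]])
  also have "alt_sum (\<S> (TT M) (Suc n)) (\<S> M (Suc n)) (\<lambda>i. \<theta> n \<cdot> bface (TT M) n i)
    (Suc n) = \<theta> n \<cdot> bd (TT M) n"
    unfolding bd_alt_sum by (rule Cmp_alt_sum[symmetric, OF theta(1) face_props(1)[OF TT_Mod] S_Obj[OF TT_Mod]])
  finally show ?thesis .
qed

text \<open>Splitting d_0 from the alternating sum and transporting along \<theta> expresses the
  boundary of \<open>M\<close> through the counit and the boundary of the free module one degree
  lower. Both \<open>bd_bd\<close> and the contracting homotopy rest on this identity.\<close>

lemma bd_theta: "bd M (Suc n) \<cdot> \<theta> (Suc n) = bmap (TT M) M cu (Suc n) \<ominus> \<theta> n \<cdot>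
  bd (TT M) n"
proof -
  note t = tau_Hom[of "Suc n"] and th = theta(1)[of "Suc n"]
  note s = S_map(1)[OF cu(1), of "Suc n"] and r = Cmp_homset[OF bd_Hom[OF TT_Mod] theta(1), of n]
  have "bd M (Suc n) = bmap (TT M) M cu (Suc n) \<cdot> \<tau> (Suc n) \<ominus> (\<theta> n \<cdot> bd (TT M)
    n) \<cdot> \<tau> (Suc n)"
    unfolding bd_alt_sum[of M] by (subst alt_sum_Suc[OF S_Obj[OF M] S_Obj[OF M] face_props(1)[OF M]])
      (simp_all only: bd_tail face_0)
  also have "\<dots> = (bmap (TT M) M cu (Suc n) \<ominus> \<theta> n \<cdot> bd (TT M) n) \<cdot> \<tau> (Suc n)"
    by (rule hsub_distrib(2)[symmetric, OF t s r])
  finally have "bd M (Suc n) \<cdot> \<theta> (Suc n) = (bmap (TT M) M cu (Suc n) \<ominus> \<theta> n \<cdot>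
    bd (TT M) n) \<cdot> (\<tau> (Suc n) \<cdot> \<theta> (Suc n))"
    using Cmp_assoc[OF th t hsub_Hom[OF s r]] by simp
  then show ?thesis unfolding theta(3) using Hom_ArrD[OF hsub_Hom[OF s r]] by simp
qed

end

section \<open>The bar complex: vanishing of the squared boundary, contraction on
  projectives\<close>

lemma bd_0: assumes M: "M \<in> Obj Mod" shows "bd M 0 = bface M 0 0 \<ominus> bface M 0 1"
proof -
  have "bd M 0 = bface M 0 0 \<ominus> alt_sum (\<S> M (Suc 0)) (\<S> M 0) (\<lambda>i. bface M 0 (Suc i)) 0"
    unfolding bd_alt_sum by (rule alt_sum_Suc[OF S_Obj[OF M] S_Obj[OF M] face_props(1)[OF M]])
  then show ?thesis using alt_sum_0[of "\<lambda>i. bface M 0 (Suc i)", OF face_props(1)[OF M, of 1 0,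
    simplified]] by simp
qed

lemma Ix_cases2:
  assumes "cs \<in> Ix (Suc (Suc 0))" shows "\<exists>a b c. cs = [a, b, c] \<and> a \<in> Ob \<and> b \<in>
    Ob \<and> c \<in> Ob"
proof -
  obtain a as where "cs = a # as" "a \<in> Ob" "as \<in> Ix (Suc 0)" using assms Ix_Suc by auto
  moreover then obtain b bs where "as = b # bs" "b \<in> Ob" "bs \<in> Ix 0" using Ix_Suc by auto
  moreover then obtain c where "bs = [c]" "c \<in> Ob" unfolding bar_index_def by (cases bs) auto
  ultimately show ?thesis by blast
qed

text \<open>Augmenting a composite agrees with augmenting its two factors in turn, by
  \<open>aug_assoc\<close> and \<open>aug_natural\<close>. This computed identity starts the
  induction for \<open>bd_bd\<close>.\<close>

lemma face_1_1: assumes M: "M \<in> Obj Mod" shows "bface M 0 1 \<cdot> bface M 1 1 = bface M 0 1 \<cdot> bface M 1 2"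
proof -
  have d: "bface M 0 1 \<in> Hom (\<S> M 1) (\<S> M 0)" "bface M 1 1 \<in> Hom (\<S> M (Suc 1)) (\<S> M 1)"
    "bface M 1 2 \<in> Hom (\<S> M (Suc 1)) (\<S> M 1)"
    using face_props(1)[OF M, of 1 0] face_props(1)[OF M, of 1 1] face_props(1)[OF M, of 2 1] by simp_all
  show ?thesis
  proof (rule B_eq[OF fam_EO[OF M] Cmp_homset[OF d(2,1)] Cmp_homset[OF d(3,1)]])
    fix cs assume cs: "cs \<in> Ix (Suc 1)"
    then obtain a b c where abc: "cs = [a, b, c]" and o: "a \<in> Ob" "b \<in> Ob" "c \<in> Ob" using
      Ix_cases2[of cs] by auto
    note x = Mod_EO[OF M o(1)]
    have I: "[a, c] \<in> Ix (Suc 0)" "[a, b] \<in> Ix (Suc 0)" "[a] \<in> Ix 0" using o by (auto simp: bar_index_def)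
    have f0: "bface M 0 1 \<cdot> inc (EO M) 1 [a, e] = inc (EO M) 0 [a] \<cdot> aug (EO M a) a e" if
      "[a, e] \<in> Ix (Suc 0)" for e
      using face_props(2)[OF M, of 1 0, OF _ that] by simp
    have iH: "inc (EO M) 1 [a, e] \<in> Hom (EO M a \<boxtimes> \<C> a e) (\<S> M 1)" if "[a, e] \<in> Ix (Suc 0)" for e
      using inc_Hom[OF fam_EO[OF M] that] by simp
    have i0: "inc (EO M) 0 [a] \<in> Hom (EO M a) (\<S> M 0)" using inc_Hom[OF fam_EO[OF M] I(3)] by simp
    let ?g = "(Ide V (EO M a) \<boxdot> \<kappa> a b c) \<cdot> asc V (EO M a) (\<C> a b) (\<C> b c)" and ?h =
      "aug (EO M a \<boxtimes> \<C> a b) b c"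
    have g: "?g \<in> Hom ((EO M a \<boxtimes> \<C> a b) \<boxtimes> \<C> b c) (EO M a \<boxtimes> \<C> a c)"
      using kappa_Hom[OF o] x o by (simp add: homset_def)
    have h: "?h \<in> Hom ((EO M a \<boxtimes> \<C> a b) \<boxtimes> \<C> b c) (EO M a \<boxtimes> \<C> a b)"
      using aug_Hom[OF _ o(2,3)] x o by simp
    have 1: "bface M 1 1 \<cdot> inc (EO M) (Suc 1) cs = inc (EO M) 1 [a, c] \<cdot> ?g"
      "bface M 1 2 \<cdot> inc (EO M) (Suc 1) cs = inc (EO M) 1 [a, b] \<cdot> ?h"
      using face_props(2)[OF M, of 1 1, OF _ cs] face_props(2)[OF M, of 2 1, OF _ cs] by (simp_all add: abc)
    note ic = inc_Hom[OF fam_EO[OF M] cs]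
    have "(bface M 0 1 \<cdot> bface M 1 1) \<cdot> inc (EO M) (Suc 1) cs = inc (EO M) 0 [a] \<cdot> (aug (EO
      M a) a c \<cdot> ?g)"
      using Cmp_assoc[OF ic d(2,1)] 1(1) Cmp_assoc[OF g iH[OF I(1)] d(1)] f0[OF I(1)] Cmp_assoc[OF g
        aug_Hom[OF x o(1,3)] i0] by simp
    also have "aug (EO M a) a c \<cdot> ?g = aug (EO M a) b c \<cdot> (aug (EO M a) a b \<boxdot> Ide V (\<C>
      b c))" by (rule aug_assoc[OF x o, symmetric])
    also have "\<dots> = aug (EO M a) a b \<cdot> ?h" by (rule aug_natural[OF aug_Hom[OF x o(1,2)] o(2,3)])
    also have "inc (EO M) 0 [a] \<cdot> (aug (EO M a) a b \<cdot> ?h) = (bface M 0 1 \<cdot> bface M 1 2)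
      \<cdot> inc (EO M) (Suc 1) cs"
      using Cmp_assoc[OF ic d(3,1)] 1(2) Cmp_assoc[OF h iH[OF I(2)] d(1)] f0[OF I(2)] Cmp_assoc[OF h
        aug_Hom[OF x o(1,2)] i0] by simp
    finally show "(bface M 0 1 \<cdot> bface M 1 1) \<cdot> inc (EO M) (Suc 1) cs = (bface M 0 1 \<cdot> bface
      M 1 2) \<cdot> inc (EO M) (Suc 1) cs" .
  qed
qed

text \<open>The induction runs over the degree with \<open>M\<close> arbitrary, since the step
  passes to the free module. After composing with \<theta>, \<open>bd_theta\<close> leaves two
  terms. Naturality of the boundary along the counit moves the first one; applying
  \<open>bd_theta\<close> again to the second gives the same arrow, because the induction hypothesis
  for the free module kills what remains.\<close>

lemma bd_bd: "M \<in> Obj Mod \<Longrightarrow> bd M n \<cdot> bd M (Suc n) = \<zero>\<^bsub>\<S> M (Suc (Suc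
  n)), \<S> M n\<^esub>"
proof (induction n arbitrary: M)
  case (0 M)
  note M = 0 and T = TT_Mod[OF 0]
  note th = theta[OF M] and t = tau_Hom[OF M] and cu' = cu(1)[OF M] and b = bd_Hom[OF M] bd_Hom[OF T]
  have d: "bface M 0 0 \<in> Hom (\<S> M (Suc 0)) (\<S> M 0)"
    "bface M 0 1 \<in> Hom (\<S> M (Suc 0)) (\<S> M 0)" using face_props(1)[OF M] by auto
  note s = S_map(1)[OF cu']
  \<comment> \<open>The bracketed arrow is d_1 - d_2, the tail of the boundary in the next degree,
    so \<open>face_1_1\<close> annihilates it.\<close>
  have "bface M 0 1 \<cdot> ((\<theta> M 0 \<cdot> bd (TT M) 0) \<cdot> \<tau> M (Suc 0)) =
    \<zero>\<^bsub>\<S> M (Suc (Suc 0)), \<S> M 0\<^esub>"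
  proof -
    have f: "bface M (Suc 0) (Suc i) \<in> Hom (\<S> M (Suc (Suc 0))) (\<S> M (Suc 0))" if "i \<le> Suc 0" for
      i using face_props(1)[OF M, of "Suc i" "Suc 0"] that by simp
    have "(\<theta> M 0 \<cdot> bd (TT M) 0) \<cdot> \<tau> M (Suc 0) = bface M (Suc 0) (Suc 0) \<ominus>
      bface M (Suc 0) (Suc (Suc 0))"
      unfolding bd_tail[OF M, symmetric] using alt_sum_Suc[OF S_Obj[OF M] S_Obj[OF M], of "0"
        "\<lambda>i. bface M (Suc 0) (Suc i)"] f
      by (simp add: alt_sum_0[of "\<lambda>i. bface M (Suc 0) (Suc (Suc i))", OF f[of "Suc 0"]])
    then have "bface M 0 1 \<cdot> ((\<theta> M 0 \<cdot> bd (TT M) 0) \<cdot> \<tau> M (Suc 0)) = bface M 0 1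
      \<cdot> bface M (Suc 0) (Suc 0) \<ominus> bface M 0 1 \<cdot> bface M (Suc 0) (Suc (Suc 0))"
      using hsub_distrib(1)[OF f[of 0] f[of "Suc 0"] d(2)] by simp
    also have "\<dots> = \<zero>\<^bsub>\<S> M (Suc (Suc 0)), \<S> M 0\<^esub>"
      using hsub_eq_zero_iff[OF Cmp_homset[OF f[of 0] d(2)] Cmp_homset[OF f[of "Suc 0"] d(2)]] face_1_1[OF M]
        by (simp add: numeral_2_eq_2)
    finally show ?thesis .
  qed
  note z = this
  have tt: "\<theta> M 0 \<cdot> bd (TT M) 0 \<in> Hom (\<S> (TT M) (Suc 0)) (\<S> M (Suc 0))" using
    Cmp_homset[OF b(2) th(1)] .
  have z': "bface M 0 1 \<cdot> (\<theta> M 0 \<cdot> bd (TT M) 0) = \<zero>\<^bsub>\<S> (TT M) (Suc 0), \<S>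
    M 0\<^esub>"
  proof -
    have "(bface M 0 1 \<cdot> (\<theta> M 0 \<cdot> bd (TT M) 0)) \<cdot> \<tau> M (Suc 0) =
      \<zero>\<^bsub>\<S> (TT M) (Suc 0), \<S> M 0\<^esub> \<cdot> \<tau> M (Suc 0)"
      using z Cmp_assoc[OF t tt d(2)] Hom_ArrD[OF t[of "Suc 0"]] S_Obj[OF M] by simp
    then show ?thesis
      by - (rule iso_epi_eq[OF tau_iso[OF M, of "Suc 0"]], use t[of "Suc 0"] Cmp_homset[OF tt d(2)] S_Obj[OF
        M] S_Obj[OF T] in \<open>simp_all add: Hom_ArrD\<close>)
  qed
  \<comment> \<open>As d_0 is the counit map after \<tau>, the pair \<tau>, \<theta> cancels, and
    naturality moves the boundary past the counit.\<close>
  have "bface M 0 0 \<cdot> (\<theta> M 0 \<cdot> bd (TT M) 0) = bd M 0 \<cdot> bmap (TT M) M (cu M) (Suc 0)"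
    unfolding bd_natural[OF cu', symmetric] unfolding face_0[OF M]
    unfolding Cmp_assoc[OF tt t s] Cmp_assoc[OF b(2) th(1) t, symmetric] th(3) using Hom_ArrD[OF b(2)[of 0]] by simp
  moreover have "bd M 0 \<cdot> (\<theta> M 0 \<cdot> bd (TT M) 0) = bface M 0 0 \<cdot> (\<theta> M 0 \<cdot>
    bd (TT M) 0)"
    unfolding bd_0[OF M] hsub_distrib(2)[OF tt d] z' by (rule hsub_zero[OF Cmp_homset[OF tt d(1)]])
  ultimately have "bd M 0 \<cdot> (bd M (Suc 0) \<cdot> \<theta> M (Suc 0)) = \<zero>\<^bsub>\<S> (TT M) (Suc
    0), \<S> M 0\<^esub>"
    unfolding bd_theta[OF M] hsub_distrib(1)[OF s tt b(1)]
    using hsub_eq_zero_iff[OF Cmp_homset[OF s b(1)] Cmp_homset[OF tt b(1)]] by simp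
  then have "(bd M 0 \<cdot> bd M (Suc 0)) \<cdot> \<theta> M (Suc 0) \<cdot> \<tau> M (Suc 0) =
    \<zero>\<^bsub>\<S> M (Suc (Suc 0)), \<S> M 0\<^esub>"
    using Cmp_assoc[OF th(1) b(1) b(1)] Hom_ArrD[OF t[of "Suc 0"]] S_Obj[OF M] by simp
  then show ?case using Cmp_assoc[OF t th(1) Cmp_homset[OF b(1) b(1)]] th(2) Hom_ArrD[OF Cmp_homset[OF b(1)
    b(1), of 0]] by simp
next
  case (Suc n M)
  note M = Suc.prems and T = TT_Mod[OF Suc.prems]
  note th = theta[OF M] and t = tau_Hom[OF M] and cu' = cu(1)[OF M] and b = bd_Hom[OF M] bd_Hom[OF T]
  note s = S_map(1)[OF cu']
  have tt: "\<theta> M k \<cdot> bd (TT M) k \<in> Hom (\<S> (TT M) (Suc k)) (\<S> M (Suc k))" for k using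
    Cmp_homset[OF b(2) th(1)] .
  have "bd M (Suc n) \<cdot> (\<theta> M (Suc n) \<cdot> bd (TT M) (Suc n)) = (bmap (TT M) M (cu M) (Suc n)
    \<ominus> \<theta> M n \<cdot> bd (TT M) n) \<cdot> bd (TT M) (Suc n)"
    unfolding Cmp_assoc[OF b(2) th(1) b(1), symmetric] bd_theta[OF M] ..
  also have "\<dots> = bmap (TT M) M (cu M) (Suc n) \<cdot> bd (TT M) (Suc n) \<ominus> \<theta> M n \<cdot>
    (bd (TT M) n \<cdot> bd (TT M) (Suc n))"
    unfolding hsub_distrib(2)[OF b(2) s tt] Cmp_assoc[OF b(2) b(2) th(1)] ..
  also have "\<dots> = bmap (TT M) M (cu M) (Suc n) \<cdot> bd (TT M) (Suc n)"
    unfolding Suc.IH[OF T] using hsub_zero[OF Cmp_homset[OF b(2) s]] Hom_ArrD[OF th(1)[of n]] S_Obj[OF T] by simp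
  also have "\<dots> = bd M (Suc n) \<cdot> bmap (TT M) M (cu M) (Suc (Suc n))" by (rule bd_natural[OF cu'])
  finally have "bd M (Suc n) \<cdot> (bd M (Suc (Suc n)) \<cdot> \<theta> M (Suc (Suc n))) =
    \<zero>\<^bsub>\<S> (TT M) (Suc (Suc n)), \<S> M (Suc n)\<^esub>"
    unfolding bd_theta[OF M] hsub_distrib(1)[OF s tt b(1)]
    using hsub_eq_zero_iff[OF Cmp_homset[OF s b(1)] Cmp_homset[OF s b(1)]] by simp
  then have "(bd M (Suc n) \<cdot> bd M (Suc (Suc n))) \<cdot> \<theta> M (Suc (Suc n)) \<cdot> \<tau> M (Suc
    (Suc n)) = \<zero>\<^bsub>\<S> M (Suc (Suc (Suc n))), \<S> M (Suc n)\<^esub>"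
    using Cmp_assoc[OF th(1) b(1) b(1)] Hom_ArrD[OF t[of "Suc (Suc n)"]] S_Obj[OF M] by simp
  then show ?case using Cmp_assoc[OF t th(1) Cmp_homset[OF b(1) b(1)]] th(2) Hom_ArrD[OF Cmp_homset[OF b(1)
    b(1), of "Suc n"]] by simp
qed

text \<open>The counit is pointwise split by \<open>Tunit\<close>, hence epi, and projectivity gives
  a section \<sigma> of it. The map \<open>h\<close> built from \<theta> and \<sigma> is the extra
  degeneracy: by \<open>bd_theta\<close> it satisfies bd h + h bd = id in positive degrees, so every
  cycle bounds.\<close>

lemma projective_bar_exact:
  assumes P: "projective Mod P"
  shows "chase_exact (bd P (Suc n)) (bd P n)"
proof -
  interpret Md: category Mod by (rule category_Mod)
  have M: "P \<in> Obj Mod" using P by (simp add: projective_def)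
  note T = TT_Mod[OF M] and cu' = cu[OF M]
  have "epi_arrow Mod (cu P)"
  proof (rule pointwise_epi[OF cu'(1)])
    fix c assume c: "c \<in> Ob"
    show "epi_arrow V (cmp (cu P) c)"
      by (rule split_epi[OF cmp_Hom[OF cu'(1) c] _ cu'(2)[OF c]]) (use Tunit_Hom[of "EO P", OF Mod_EO[OF M] c]
        TT_EO[OF M c] in simp)
  qed
  then obtain \<sigma> where \<sigma>: "\<sigma> \<in> homset Mod P (TT P)"
    "cu P \<cdot>\<^bsub>Mod\<^esub> \<sigma> = Ide Mod P"
    using P Ide_Mod_Hom[OF M] Md.Hom_ArrD[OF cu'(1)] unfolding projective_def by metis
  note th = theta(1)[OF M] and b = bd_Hom[OF M] bd_Hom[OF T] and s = S_map(1)[OF cu'(1)] S_map(1)[OF \<sigma>(1)]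
  define h where "h k = \<theta> P k \<cdot> bmap P (TT P) \<sigma> k" for k
  have h: "h k \<in> Hom (\<S> P k) (\<S> P (Suc k))" for k unfolding h_def using Cmp_homset[OF s(2) th] .
  have tt: "\<theta> P n \<cdot> bd (TT P) n \<in> Hom (\<S> (TT P) (Suc n)) (\<S> P (Suc n))" using
    Cmp_homset[OF b(2) th] .
  have "bd P (Suc n) \<cdot> h (Suc n) = (bmap (TT P) P (cu P) (Suc n) \<ominus> \<theta> P n \<cdot> bd (TT
    P) n) \<cdot> bmap P (TT P) \<sigma> (Suc n)"
    unfolding h_def Cmp_assoc[OF s(2) th b(1), symmetric] bd_theta[OF M] ..
  also have "\<dots> = Ide V (\<S> P (Suc n)) \<ominus> \<theta> P n \<cdot> (bmap P (TT P) \<sigma> n \<cdot> bd P n)"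
    unfolding hsub_distrib(2)[OF s(2) s(1) tt] S_Cmp[OF \<sigma>(1) cu'(1), symmetric] \<sigma>(2) S_Ide[OF M]
      Cmp_assoc[OF s(2) b(2) th] bd_natural[OF \<sigma>(1)] ..
  also have "\<dots> = Ide V (\<S> P (Suc n)) \<ominus> h n \<cdot> bd P n" unfolding h_def Cmp_assoc[OF b(1)
    s(2) th] ..
  finally have key: "bd P (Suc n) \<cdot> h (Suc n) = Ide V (\<S> P (Suc n)) \<ominus> h n \<cdot> bd P n" .
  show ?thesis
  proof (rule chase_exactI[OF b(1) b(1) bd_bd[OF M]])
    fix p z assume z: "z \<in> Hom p (\<S> P (Suc n))" "bd P n \<cdot> z = \<zero>\<^bsub>p,\<S> P n\<^esub>"
    have "bd P (Suc n) \<cdot> (h (Suc n) \<cdot> z) = (Ide V (\<S> P (Suc n)) \<ominus> h n \<cdot> bd P n) \<cdot> z"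
      unfolding key[symmetric] by (rule Cmp_assoc[symmetric, OF z(1) h b(1)])
    also have "\<dots> = z \<ominus> h n \<cdot> \<zero>\<^bsub>p,\<S> P n\<^esub>"
      unfolding hsub_distrib(2)[OF z(1) Ide_Hom[OF S_Obj[OF M]] Cmp_homset[OF b(1) h]] Cmp_assoc[OF z(1) b(1)
        h] z(2) using Hom_ArrD[OF z(1)] by simp
    also have "\<dots> = z" using hsub_zero[OF z(1)] Hom_ArrD[OF h[of n]] Hom_Obj[OF z(1)] by simp
    finally show "\<exists>u\<in>Hom p (\<S> P (Suc (Suc n))). bd P (Suc n) \<cdot> u = z" using Cmp_homset[OF
      z(1) h] by blast
  qed
qed

end

section \<open>Coinvariants and the comparison\<close>

text \<open>The action of the adjoint on arrows is forced by the universal property, and uniqueness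
  yields functoriality. The lemma provides the existence without which the choice in
  \<open>Coinv\<close> would be void.\<close>

lemma left_adjoint_from_universal_arrows:
  assumes C: "category C" and D: "category D" and G: "is_functor D C G"
    and Fo: "\<And>x. x \<in> Obj C \<Longrightarrow> Fo x \<in> Obj D"
    and \<eta>: "\<And>x. x \<in> Obj C \<Longrightarrow> \<eta> x \<in> homset C x (FO G (Fo x))"
    and univ: "\<And>x y g. x \<in> Obj C \<Longrightarrow> y \<in> Obj D \<Longrightarrow> g \<in> homset C x (FO G y)
      \<Longrightarrow> \<exists>!f. f \<in> homset D (Fo x) y \<and> FA G f \<cdot>\<^bsub>C\<^esub> \<eta> x = g"
  shows "\<exists>F. left_adjoint C D F G"
proof -
  interpret C: category C by fact
  interpret D: category D by fact
  define Fa where "Fa f = (THE u. u \<in> homset D (Fo (Dom C f)) (Fo (Cod C f)) \<and> FA G u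
    \<cdot>\<^bsub>C\<^esub> \<eta> (Dom C f) = \<eta> (Cod C f) \<cdot>\<^bsub>C\<^esub> f)" for f
  have GH: "FA G u \<in> homset C (FO G x) (FO G y)" if "u \<in> homset D x y" for u x y
    using G that unfolding is_functor_def by blast
  have ex: "\<exists>!u. u \<in> homset D (Fo x) (Fo y) \<and> FA G u \<cdot>\<^bsub>C\<^esub> \<eta> x =
    \<eta> y \<cdot>\<^bsub>C\<^esub> f" if f: "f \<in> homset C x y" for f x y
    using univ[OF C.Hom_Obj(1)[OF f] Fo[OF C.Hom_Obj(2)[OF f]] C.Cmp_homset[OF f \<eta>[OF C.Hom_Obj(2)[OF f]]]] .
  have Fa: "Fa f \<in> homset D (Fo x) (Fo y)" "FA G (Fa f) \<cdot>\<^bsub>C\<^esub> \<eta> x = \<eta> y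
    \<cdot>\<^bsub>C\<^esub> f" if f: "f \<in> homset C x y" for f x y
    using theI'[OF ex[OF f]] C.Hom_ArrD[OF f] unfolding Fa_def by auto
  have Fa_eq: "Fa f = u" if f: "f \<in> homset C x y" and u: "u \<in> homset D (Fo x) (Fo y)"
    "FA G u \<cdot>\<^bsub>C\<^esub> \<eta> x = \<eta> y \<cdot>\<^bsub>C\<^esub> f" for f u x y
    using ex[OF f] Fa[OF f] u by blast
  have "is_functor C D \<lparr>FO = Fo, FA = Fa\<rparr>"
    unfolding is_functor_def func.simps
  proof (intro conjI ballI allI)
    fix x assume x: "x \<in> Obj C"
    show "Fo x \<in> Obj D" by (rule Fo[OF x])
    have "FA G (Ide D (Fo x)) = Ide C (FO G (Fo x))" using G Fo[OF x] unfolding is_functor_def by blast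
    then show "Fa (Ide C x) = Ide D (Fo x)"
      by (intro Fa_eq[OF C.Ide_Hom[OF x] D.Ide_Hom[OF Fo[OF x]]])
        (simp add: C.Cmp_Ide_left[OF \<eta>[OF x]] C.Cmp_Ide_right[OF \<eta>[OF x]])
  next
    fix x y f assume f: "f \<in> homset C x y"
    show "Fa f \<in> homset D (Fo x) (Fo y)" by (rule Fa(1)[OF f])
  next
    fix x y z f g assume f: "f \<in> homset C x y" and g: "g \<in> homset C y z"
    have e: "\<eta> x \<in> homset C x (FO G (Fo x))" "\<eta> y \<in> homset C y (FO G (Fo y))"
      "\<eta> z \<in> homset C z (FO G (Fo z))"
      using \<eta> C.Hom_Obj[OF f] C.Hom_Obj[OF g] by auto
    have "FA G (Fa g \<cdot>\<^bsub>D\<^esub> Fa f) = FA G (Fa g) \<cdot>\<^bsub>C\<^esub> FA G (Fa f)" using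
      G Fa(1)[OF f] Fa(1)[OF g] unfolding is_functor_def by blast
    then have "FA G (Fa g \<cdot>\<^bsub>D\<^esub> Fa f) \<cdot>\<^bsub>C\<^esub> \<eta> x = FA G (Fa g)
      \<cdot>\<^bsub>C\<^esub> (\<eta> y \<cdot>\<^bsub>C\<^esub> f)"
      using C.Cmp_assoc[OF e(1) GH[OF Fa(1)[OF f]] GH[OF Fa(1)[OF g]]] Fa(2)[OF f] by simp
    also have "\<dots> = \<eta> z \<cdot>\<^bsub>C\<^esub> (g \<cdot>\<^bsub>C\<^esub> f)"
      using C.Cmp_assoc[OF f e(2) GH[OF Fa(1)[OF g]]] Fa(2)[OF g] C.Cmp_assoc[OF f g e(3)] by simp
    finally show "Fa (g \<cdot>\<^bsub>C\<^esub> f) = Fa g \<cdot>\<^bsub>D\<^esub> Fa f"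
      by (rule Fa_eq[OF C.Cmp_homset[OF f g] D.Cmp_homset[OF Fa(1)[OF f] Fa(1)[OF g]]])
  qed
  then have "left_adjoint C D \<lparr>FO = Fo, FA = Fa\<rparr> G"
    unfolding left_adjoint_def func.simps using G \<eta> Fa(2)[symmetric] univ by (intro conjI exI[of _ \<eta>]) auto
  then show ?thesis by blast
qed

text \<open>Vertical maps compose to zero and the augmentation \<open>a\<close> is epi. This shows
  that the coinvariants of a resolution form a complex without computing with them.\<close>

lemma (in abelian_enough_projectives) biresolution_complex:
  assumes bi: "biresolution X dh dv A a da B b db"
  shows "da n \<cdot> da (Suc n) = \<zero>\<^bsub>A (Suc (Suc n)), A n\<^esub>"
proof -
  note s = bi_simps[OF bi]
  have "(da n \<cdot> da (Suc n)) \<cdot> a (Suc (Suc n)) = da n \<cdot> (a (Suc n) \<cdot> dv 0 (Suc n))"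
    unfolding Cmp_assoc[OF s(8) s(11) s(11)] s(12) ..
  also have "\<dots> = a n \<cdot> (dv 0 n \<cdot> dv 0 (Suc n))"
    unfolding Cmp_assoc[OF s(3) s(8) s(11), symmetric] s(12)[symmetric] Cmp_assoc[OF s(3) s(3) s(8)] ..
  also have "\<dots> = \<zero>\<^bsub>A (Suc (Suc n)), A n\<^esub> \<cdot> a (Suc (Suc n))"
    using chase_exactD(1)[OF s(6) s(3) s(3)] Hom_ArrD[OF s(8)[of n]] Hom_ArrD[OF s(8)[of "Suc (Suc n)"]] s(1,7) by simp
  finally show ?thesis
    by - (rule epi_arrowD[OF s(9)[of "Suc (Suc n)"]], use Cmp_homset[OF s(11)[of "Suc n"] s(11)[of n]] s(7)
      Hom_ArrD[OF s(8)[of "Suc (Suc n)"]] in \<open>simp_all add: Hom_ArrD\<close>)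
qed

context augmented_setting
begin

section \<open>Trivial modules, and coinvariants as the cokernel of the first boundary\<close>

definition "triv x = mk_mod (\<lambda>_. x) (aug x)"

lemma triv_Mod: "x \<in> Obj V \<Longrightarrow> triv x \<in> Obj Mod" and triv_EO:
  "c \<in> Ob \<Longrightarrow> EO (triv x) c = x"
  and triv_act: "x \<in> Obj V \<Longrightarrow> a \<in> Ob \<Longrightarrow> b \<in> Ob \<Longrightarrow> act
    (triv x) a b = aug x a b"
  unfolding triv_def using mk_mod_Mod[OF aug_rmod] mk_mod_act[OF aug_rmod] by simp_all

text \<open>Transposing the identity of \<open>x\<close> after \<epsilon> gives the left unit
  isomorphism on the augmented factor; swapping the unit past \<open>x\<close> turns this into
  \<open>aug\<close>.\<close>

lemma Triv_FO: assumes x: "x \<in> Obj V" shows "FO (Triv V C \<epsilon>) x = triv x"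
proof -
  have "eIde (self_enriched V) x \<cdot> EA \<epsilon> a b = cur (\<C> a b) x x (aug x a b \<cdot> swp V (\<C>
    a b) x)" if ab: "a \<in> Ob" "b \<in> Ob" for a b
  proof -
    note [simp] = x Hom_ArrD[OF aug_arrow[OF ab]] eHom_Obj[OF ab]
    have "aug x a b \<cdot> swp V (\<C> a b) x = run V x \<cdot> (swp V (unt V) x \<cdot> (EA \<epsilon> a b
      \<boxdot> Ide V x))"
      unfolding aug_def by (subst swp_nat) simp_all
    also have "\<dots> = lun V x \<cdot> (EA \<epsilon> a b \<boxdot> Ide V x)" by (subst post[OF run_swp[OF
      x]]) simp_all
    finally show ?thesis unfolding self_Ide[OF x] cur_Cmp[OF x lun_Hom[OF x] aug_arrow[OF ab]] by simp
  qed
  then show ?thesis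
    by (simp add: Triv_def comp_func_def restriction_def to_Mod_pt_def restrict_efunc_def pt_module_def
      triv_def mk_mod_def cong: restrict_cong)
qed

lemma Triv_FA: assumes f: "f \<in> Hom x y" shows "FA (Triv V C \<epsilon>) f = mor (triv x) (\<lambda>_. f) (triv y)"
proof -
  have r: "restrict_efunc V C \<epsilon> (pt_module V z) = triv z" if "z \<in> Obj V" for z
    using Triv_FO[OF that] by (simp add: Triv_def comp_func_def restriction_def to_Mod_pt_def)
  show ?thesis using r[OF Hom_Obj(1)[OF f]] r[OF Hom_Obj(2)[OF f]] Hom_ArrD[OF f]
    by (simp add: Triv_def comp_func_def restriction_def to_Mod_pt_def mor_def triv_EO cong: restrict_cong)
qed

text \<open>Naturality of \<open>aug\<close> moves the augmentation from the target to
  \<open>M\<close>, so that equivariance compares the two faces d_0 and d_1 on a bar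
  summand.\<close>

lemma equivariant_triv:
  assumes M: "M \<in> Obj Mod" and y: "y \<in> Obj V"
  shows "equivariant M f (triv y) \<longleftrightarrow> (\<forall>c\<in>Ob. f c \<in> Hom (EO M c) y) \<and>
    (\<forall>a\<in>Ob. \<forall>b\<in>Ob. f b \<cdot> act M a b = f a \<cdot> aug (EO M a) a b)"
  unfolding equivariant_def using aug_natural[of "f _" "EO M _" y] triv_EO[of _ y] triv_act[OF y] by auto

lemma equivariant_const: assumes f: "f \<in> Hom x y" shows "equivariant (triv x) (\<lambda>_. f) (triv y)"
  using equivariant_triv[OF triv_Mod[OF Hom_Obj(1)[OF f]] Hom_Obj(2)[OF f], of "\<lambda>_. f"] f triv_EO
    triv_act[OF Hom_Obj(1)[OF f]] by simp

lemma Triv_functor: "is_functor V Mod (Triv V C \<epsilon>)"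
  unfolding is_functor_def
proof (intro conjI ballI allI)
  show "FO (Triv V C \<epsilon>) x \<in> Obj Mod" if "x \<in> Obj V" for x using triv_Mod[OF that] Triv_FO[OF
    that] by simp
  show "FA (Triv V C \<epsilon>) f \<in> homset Mod (FO (Triv V C \<epsilon>) x) (FO (Triv V C \<epsilon>) y)"
    if f: "f \<in> Hom x y" for x y f
    unfolding Triv_FA[OF f] Triv_FO[OF Hom_Obj(1)[OF f]] Triv_FO[OF Hom_Obj(2)[OF f]]
    by (rule mor_Hom[OF triv_Mod[OF Hom_Obj(1)[OF f]] triv_Mod[OF Hom_Obj(2)[OF f]] equivariant_const[OF f]])
  show "FA (Triv V C \<epsilon>) (Ide V x) = Ide Mod (FO (Triv V C \<epsilon>) x)" if x: "x \<in> Obj V" for x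
    unfolding Triv_FA[OF Ide_Hom[OF x]] Triv_FO[OF x] mor_Ide[OF triv_Mod[OF x]] by (rule mor_cong) (simp add: triv_EO)
  show "FA (Triv V C \<epsilon>) (g \<cdot> f) = FA (Triv V C \<epsilon>) g \<cdot>\<^bsub>Mod\<^esub> FA
    (Triv V C \<epsilon>) f" if f: "f \<in> Hom x y" and g: "g \<in> Hom y z" for x y z f g
    unfolding Triv_FA[OF f] Triv_FA[OF g] Triv_FA[OF Cmp_homset[OF f g]]
    by (rule mor_Cmp[symmetric, OF triv_Mod[OF Hom_Obj(1)[OF f]] triv_Mod[OF Hom_Obj(1)[OF g]] triv_Mod[OF
      Hom_Obj(2)[OF g]]])
      (use f g triv_EO in simp_all)
qed

lemma inc0_Hom: "M \<in> Obj Mod \<Longrightarrow> c \<in> Ob \<Longrightarrow> inc (EO M) 0 [c] \<in> Hom (EO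
  M c) (\<S> M 0)"
  using inc_Hom[OF fam_EO, of M "[c]" 0] by (simp add: bar_index_def)

lemma Ix_0: "cs \<in> Ix 0 \<longleftrightarrow> (\<exists>c \<in> Ob. cs = [c])"
  unfolding bar_index_def by (cases cs) auto

lemma Ix_1: "cs \<in> Ix (Suc 0) \<longleftrightarrow> (\<exists>a \<in> Ob. \<exists>b \<in> Ob. cs = [a, b])"
  unfolding Ix_Suc Ix_0 by auto

lemma S0_eq:
  assumes "M \<in> Obj Mod" "u \<in> Hom (\<S> M 0) y" "u' \<in> Hom (\<S> M 0) y"
    "\<And>c. c \<in> Ob \<Longrightarrow> u \<cdot> inc (EO M) 0 [c] = u' \<cdot> inc (EO M) 0 [c]"
  shows "u = u'"
  by (rule B_eq[OF fam_EO[OF assms(1)] assms(2,3)]) (use assms(4) Ix_0 in auto)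

lemma S0_desc:
  assumes M: "M \<in> Obj Mod" and "y \<in> Obj V" "\<And>c. c \<in> Ob \<Longrightarrow> f c \<in> Hom (EO M c) y"
  shows "\<exists>u \<in> Hom (\<S> M 0) y. \<forall>c\<in>Ob. u \<cdot> inc (EO M) 0 [c] = f c"
proof -
  have "\<exists>u \<in> Hom (\<S> M 0) y. \<forall>cs\<in>Ix 0. u \<cdot> inc (EO M) 0 cs = f (cs ! 0)"
    by (rule coproduct_desc[OF B_coproduct[OF fam_EO[OF M]] assms(2)]) (use assms(3) Ix_0 in auto)
  then obtain u where u: "u \<in> Hom (\<S> M 0) y" "\<And>cs. cs \<in> Ix 0 \<Longrightarrow> u \<cdot> inc
    (EO M) 0 cs = f (cs ! 0)" by blast
  have "u \<cdot> inc (EO M) 0 [c] = f c" if "c \<in> Ob" for c using u(2)[of "[c]"] that Ix_0 by simp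
  then show ?thesis using u(1) by blast
qed

text \<open>On the summand at \<open>[a, b]\<close>, d_0 is the action and d_1 the augmentation, and
  their agreement after \<open>u\<close> is equivariance. Hence the cokernel of
  \<open>bd M 0\<close> represents the maps from \<open>M\<close> into trivial modules.\<close>

lemma bd0_zero_iff:
  assumes M: "M \<in> Obj Mod" and u: "u \<in> Hom (\<S> M 0) y"
  shows "u \<cdot> bd M 0 = \<zero>\<^bsub>\<S> M (Suc 0), y\<^esub> \<longleftrightarrow> equivariant M
    (\<lambda>c. u \<cdot> inc (EO M) 0 [c]) (triv y)"
proof -
  have d: "bface M 0 0 \<in> Hom (\<S> M (Suc 0)) (\<S> M 0)"
    "bface M 0 1 \<in> Hom (\<S> M (Suc 0)) (\<S> M 0)" using face_props(1)[OF M] by auto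
  note ud = Cmp_homset[OF d(1) u] Cmp_homset[OF d(2) u]
  have *: "(u \<cdot> bface M 0 0) \<cdot> inc (EO M) (Suc 0) [a, b] = (u \<cdot> inc (EO M) 0 [b]) \<cdot> act M a b"
    "(u \<cdot> bface M 0 1) \<cdot> inc (EO M) (Suc 0) [a, b] = (u \<cdot> inc (EO M) 0 [a]) \<cdot> aug (EO
      M a) a b" if ab: "a \<in> Ob" "b \<in> Ob" for a b
  proof -
    have I: "[a, b] \<in> Ix (Suc 0)" using ab Ix_1 by blast
    note i = inc_Hom[OF fam_EO[OF M] I]
    have "bface M 0 0 \<cdot> inc (EO M) (Suc 0) [a, b] = inc (EO M) 0 [b] \<cdot> act M a b"
      "bface M 0 1 \<cdot> inc (EO M) (Suc 0) [a, b] = inc (EO M) 0 [a] \<cdot> aug (EO M a) a b"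
      using face_props(2)[OF M _ I, of 0] face_props(2)[OF M _ I, of 1] by simp_all
    then show "(u \<cdot> bface M 0 0) \<cdot> inc (EO M) (Suc 0) [a, b] = (u \<cdot> inc (EO M) 0 [b])
      \<cdot> act M a b"
      "(u \<cdot> bface M 0 1) \<cdot> inc (EO M) (Suc 0) [a, b] = (u \<cdot> inc (EO M) 0 [a]) \<cdot> aug
        (EO M a) a b"
      unfolding Cmp_assoc[OF i d(1) u] Cmp_assoc[OF i d(2) u] Cmp_assoc[OF Mod_act_Hom[OF M ab] inc0_Hom[OF M ab(2)] u]
        Cmp_assoc[OF aug_Hom[OF Mod_EO[OF M ab(1)] ab] inc0_Hom[OF M ab(1)] u] by simp_all
  qed
  have "u \<cdot> bd M 0 = \<zero>\<^bsub>\<S> M (Suc 0), y\<^esub> \<longleftrightarrow> u \<cdot> bface M 0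
    0 = u \<cdot> bface M 0 1"
    unfolding bd_0[OF M] hsub_distrib(1)[OF d u] by (rule hsub_eq_zero_iff[OF ud])
  also have "\<dots> \<longleftrightarrow> (\<forall>a\<in>Ob. \<forall>b\<in>Ob. (u \<cdot> inc (EO M) 0 [b])
    \<cdot> act M a b = (u \<cdot> inc (EO M) 0 [a]) \<cdot> aug (EO M a) a b)"
  proof
    assume "u \<cdot> bface M 0 0 = u \<cdot> bface M 0 1"
    then show "\<forall>a\<in>Ob. \<forall>b\<in>Ob. (u \<cdot> inc (EO M) 0 [b]) \<cdot> act M a b = (u
      \<cdot> inc (EO M) 0 [a]) \<cdot> aug (EO M a) a b" using * by metis
  next
    assume eq: "\<forall>a\<in>Ob. \<forall>b\<in>Ob. (u \<cdot> inc (EO M) 0 [b]) \<cdot> act M a b = (u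
      \<cdot> inc (EO M) 0 [a]) \<cdot> aug (EO M a) a b"
    show "u \<cdot> bface M 0 0 = u \<cdot> bface M 0 1"
      by (rule B_eq[OF fam_EO[OF M] ud]) (use eq * Ix_1 in metis)
  qed
  also have "\<dots> \<longleftrightarrow> equivariant M (\<lambda>c. u \<cdot> inc (EO M) 0 [c]) (triv y)"
    unfolding equivariant_triv[OF M Hom_Obj(2)[OF u]] using Cmp_homset[OF inc0_Hom[OF M] u] by blast
  finally show ?thesis .
qed

lemma Triv_Cmp:
  assumes f: "f \<in> Hom x y" and g: "g \<in> homset Mod M (triv x)"
  shows "FA (Triv V C \<epsilon>) f \<cdot>\<^bsub>Mod\<^esub> g = mor M (\<lambda>c. f \<cdot> cmp g c) (triv
    y)" "FA (Triv V C \<epsilon>) f \<cdot>\<^bsub>Mod\<^esub> g \<in> homset Mod M (triv y)"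
    "c \<in> Ob \<Longrightarrow> cmp (FA (Triv V C \<epsilon>) f \<cdot>\<^bsub>Mod\<^esub> g) c = f \<cdot> cmp g c"
proof -
  have F: "FA (Triv V C \<epsilon>) f \<in> homset Mod (triv x) (triv y)"
    unfolding Triv_FA[OF f] by (rule mor_Hom[OF triv_Mod[OF Hom_Obj(1)[OF f]] triv_Mod[OF Hom_Obj(2)[OF f]]
      equivariant_const[OF f]])
  have c: "cmp (FA (Triv V C \<epsilon>) f) c = f" if "c \<in> Ob" for c
    unfolding Triv_FA[OF f] using cmp_mor[OF triv_Mod[OF Hom_Obj(1)[OF f]] that, of "\<lambda>_. f" "triv y"]
      f triv_EO[OF that] by simp
  show "FA (Triv V C \<epsilon>) f \<cdot>\<^bsub>Mod\<^esub> g = mor M (\<lambda>c. f \<cdot> cmp g c) (triv y)"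
    unfolding cmp_Cmp(1)[OF g F] by (rule mor_cong) (simp add: c)
  show "FA (Triv V C \<epsilon>) f \<cdot>\<^bsub>Mod\<^esub> g \<in> homset Mod M (triv y)" by (rule
    cmp_Cmp(2)[OF g F])
  show "c \<in> Ob \<Longrightarrow> cmp (FA (Triv V C \<epsilon>) f \<cdot>\<^bsub>Mod\<^esub> g) c = f
    \<cdot> cmp g c" using cmp_Cmp(3)[OF g F] c by simp
qed

text \<open>Cokernels of \<open>bd M 0\<close>, with the unit \<eta> induced by the inclusions into
  S_0, form universal arrows to \<open>Triv\<close>; so the choice in \<open>Coinv\<close> ranges
  over a nonempty set of left adjoints.\<close>

lemma Coinv_adjoint: "left_adjoint Mod V (Coinv V C \<epsilon>) (Triv V C \<epsilon>)"
proof -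
  have "\<exists>q. is_cokernel V q (bd M 0)" if "M \<in> Obj Mod" for M using has_cokernels[OF Hom_ArrD(1)[OF
    bd_Hom[OF that]]] .
  then obtain q where q: "\<And>M. M \<in> Obj Mod \<Longrightarrow> is_cokernel V (q M) (bd M 0)" by metis
  define Q where "Q M = Cod V (q M)" for M
  have qH: "q M \<in> Hom (\<S> M 0) (Q M)" if "M \<in> Obj Mod" for M
    using is_cokernel_Hom[OF q[OF that] bd_Hom[OF that]] by (simp add: Q_def)
  define \<eta> where "\<eta> M = mor M (\<lambda>c. q M \<cdot> inc (EO M) 0 [c]) (triv (Q M))" for M
  have QO: "Q M \<in> Obj V" if "M \<in> Obj Mod" for M using Hom_Obj(2)[OF qH[OF that]] .
  have \<eta>: "\<eta> M \<in> homset Mod M (triv (Q M))" if M: "M \<in> Obj Mod" for M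
    unfolding \<eta>_def using bd0_zero_iff[OF M qH[OF M]] cokernel_zero[OF q[OF M] qH[OF M] bd_Hom[OF M]]
    by (intro mor_Hom[OF M triv_Mod[OF QO[OF M]]]) simp
  have c\<eta>: "cmp (\<eta> M) c = q M \<cdot> inc (EO M) 0 [c]" if M: "M \<in> Obj Mod" and c: "c \<in> Ob" for M c
    unfolding \<eta>_def using cmp_mor[OF M c, of "\<lambda>c. q M \<cdot> inc (EO M) 0 [c]" "triv (Q M)"]
      Cmp_homset[OF inc0_Hom[OF M c] qH[OF M]] triv_EO[OF c] by simp
  have "\<exists>F. left_adjoint Mod V F (Triv V C \<epsilon>)"
  proof (rule left_adjoint_from_universal_arrows[OF category_Mod category_axioms Triv_functor, where Fo = Q
    and \<eta> = \<eta>])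
    fix M assume M: "M \<in> Obj Mod"
    show "Q M \<in> Obj V" by (rule QO[OF M])
    show "\<eta> M \<in> homset Mod M (FO (Triv V C \<epsilon>) (Q M))" using \<eta>[OF M] Triv_FO[OF QO[OF M]] by simp
    fix y g assume y: "y \<in> Obj V" and "g \<in> homset Mod M (FO (Triv V C \<epsilon>) y)"
    then have g: "g \<in> homset Mod M (triv y)" using Triv_FO[OF y] by simp
    have gH: "cmp g c \<in> Hom (EO M c) y" if "c \<in> Ob" for c using cmp_Hom[OF g that] triv_EO[OF that] by simp
    obtain u where u: "u \<in> Hom (\<S> M 0) y" "\<forall>c\<in>Ob. u \<cdot> inc (EO M) 0 [c] = cmp g c"
      using S0_desc[OF M y gH] by blast
    have "equivariant M (\<lambda>c. u \<cdot> inc (EO M) 0 [c]) (triv y)"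
      using Hom_mor(2)[OF g] u(2) unfolding equivariant_def by simp
    then have "u \<cdot> bd M 0 = \<zero>\<^bsub>\<S> M (Suc 0), y\<^esub>" using bd0_zero_iff[OF M u(1)] by simp
    then obtain f where f: "f \<in> Hom (Q M) y" "f \<cdot> q M = u" using cokernel_desc[OF q[OF M] qH[OF M]
      bd_Hom[OF M] u(1)] by blast
    \<comment> \<open>S_0 is the coproduct of the objects \<open>EO M c\<close>, so a module map
      into a trivial module and an arrow out of S_0 carry the same components; the two factorisation
      problems therefore coincide.\<close>
    have iff: "FA (Triv V C \<epsilon>) f' \<cdot>\<^bsub>Mod\<^esub> \<eta> M = g \<longleftrightarrow> f'
      \<cdot> q M = u" if f': "f' \<in> Hom (Q M) y" for f'
    proof -
      have c: "cmp (FA (Triv V C \<epsilon>) f' \<cdot>\<^bsub>Mod\<^esub> \<eta> M) c = (f' \<cdot> q M)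
        \<cdot> inc (EO M) 0 [c]" if "c \<in> Ob" for c
        unfolding Triv_Cmp(3)[OF f' \<eta>[OF M] that] c\<eta>[OF M that] by (rule Cmp_assoc[symmetric, OF
          inc0_Hom[OF M that] qH[OF M] f'])
      show ?thesis
      proof
        assume "FA (Triv V C \<epsilon>) f' \<cdot>\<^bsub>Mod\<^esub> \<eta> M = g"
        then show "f' \<cdot> q M = u" using c u(2) by (intro S0_eq[OF M Cmp_homset[OF qH[OF M] f'] u(1)]) simp
      next
        assume "f' \<cdot> q M = u"
        then show "FA (Triv V C \<epsilon>) f' \<cdot>\<^bsub>Mod\<^esub> \<eta> M = g"
          using c u(2) by (intro Mod_arrow_eqI[OF Triv_Cmp(2)[OF f' \<eta>[OF M]] g]) simp
      qed
    qed
    show "\<exists>!f. f \<in> Hom (Q M) y \<and> FA (Triv V C \<epsilon>) f \<cdot>\<^bsub>Mod\<^esub> \<eta> M = g"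
    proof (rule ex1I[of _ f])
      show "f \<in> Hom (Q M) y \<and> FA (Triv V C \<epsilon>) f \<cdot>\<^bsub>Mod\<^esub> \<eta> M = g"
        using f iff by blast
      fix f' assume "f' \<in> Hom (Q M) y \<and> FA (Triv V C \<epsilon>) f' \<cdot>\<^bsub>Mod\<^esub> \<eta> M = g"
      then have f': "f' \<in> Hom (Q M) y" "f' \<cdot> q M = f \<cdot> q M" using iff f(2) by auto
      show "f' = f"
        by (rule epi_arrowD[OF cokernel_epi[OF q[OF M]] _ _ _ _ _ f'(2)]) (use f'(1) f(1) qH[OF M] in
          \<open>simp_all add: Hom_ArrD\<close>)
    qed
  qed
  then show ?thesis unfolding Coinv_def by (rule someI_ex)
qed

text \<open>For the chosen adjoint, whatever it is, the components of its unit assemble to an arrow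
  out of S_0. The universal property of the unit makes this arrow a cokernel of
  \<open>bd M 0\<close>, and naturality of the unit makes it natural. These arrows augment the rows
  of the double complex.\<close>

lemma Coinv_cokernel:
  obtains p where "\<And>M. M \<in> Obj Mod \<Longrightarrow> p M \<in> Hom (\<S> M 0) (FO (Coinv V C \<epsilon>) M)"
    "\<And>M. M \<in> Obj Mod \<Longrightarrow> is_cokernel V (p M) (bd M 0)"
    "\<And>M N \<phi>. \<phi> \<in> homset Mod M N \<Longrightarrow> p N \<cdot> bmap M N \<phi> 0 = FA (Coinv
      V C \<epsilon>) \<phi> \<cdot> p M"
    "\<And>M N \<phi>. \<phi> \<in> homset Mod M N \<Longrightarrow> FA (Coinv V C \<epsilon>) \<phi> \<in>
      Hom (FO (Coinv V C \<epsilon>) M) (FO (Coinv V C \<epsilon>) N)"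
proof -
  let ?F = "Coinv V C \<epsilon>" and ?G = "Triv V C \<epsilon>"
  obtain \<eta> where F: "is_functor Mod V ?F"
    and \<eta>0: "\<And>M. M \<in> Obj Mod \<Longrightarrow> \<eta> M \<in> homset Mod M (FO ?G (FO ?F M))"
    and nat: "\<And>M N \<phi>. \<phi> \<in> homset Mod M N \<Longrightarrow> \<eta> N
      \<cdot>\<^bsub>Mod\<^esub> \<phi> = FA ?G (FA ?F \<phi>) \<cdot>\<^bsub>Mod\<^esub> \<eta> M"
    and univ: "\<And>M y g. M \<in> Obj Mod \<Longrightarrow> y \<in> Obj V \<Longrightarrow> g \<in> homset
      Mod M (FO ?G y) \<Longrightarrow> \<exists>!f. f \<in> Hom (FO ?F M) y \<and> FA ?G f
      \<cdot>\<^bsub>Mod\<^esub> \<eta> M = g"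
    using Coinv_adjoint unfolding left_adjoint_def by (elim conjE exE) (rule that, assumption, blast+)
  have FO: "FO ?F M \<in> Obj V" if "M \<in> Obj Mod" for M using F that unfolding is_functor_def by blast
  have FA: "FA ?F \<phi> \<in> Hom (FO ?F M) (FO ?F N)" if "\<phi> \<in> homset Mod M N" for M N \<phi> using
    F that unfolding is_functor_def by blast
  have \<eta>: "\<eta> M \<in> homset Mod M (triv (FO ?F M))" if M: "M \<in> Obj Mod" for M using \<eta>0[OF
    M] Triv_FO[OF FO[OF M]] by simp
  have eH: "cmp (\<eta> M) c \<in> Hom (EO M c) (FO ?F M)" if M: "M \<in> Obj Mod" and c: "c \<in> Ob" for M c
    using cmp_Hom[OF \<eta>[OF M] c] triv_EO[OF c] by simp
  have "\<exists>p \<in> Hom (\<S> M 0) (FO ?F M). \<forall>c\<in>Ob. p \<cdot> inc (EO M) 0 [c] = cmp (\<eta>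
    M) c" if M: "M \<in> Obj Mod" for M
    by (rule S0_desc[OF M FO[OF M] eH[OF M]])
  then obtain p where p: "\<And>M. M \<in> Obj Mod \<Longrightarrow> p M \<in> Hom (\<S> M 0) (FO ?F M)"
    "\<And>M c. M \<in> Obj Mod \<Longrightarrow> c \<in> Ob \<Longrightarrow> p M \<cdot> inc (EO M) 0 [c] =
      cmp (\<eta> M) c" by metis
  show ?thesis
  proof (rule that[OF p(1) _ _ FA])
    fix M assume M: "M \<in> Obj Mod"
    have "equivariant M (\<lambda>c. p M \<cdot> inc (EO M) 0 [c]) (triv (FO ?F M))"
      using Hom_mor(2)[OF \<eta>[OF M]] p(2)[OF M] unfolding equivariant_def by simp
    then have z: "p M \<cdot> bd M 0 = \<zero>\<^bsub>\<S> M (Suc 0), FO ?F M\<^esub>" using bd0_zero_iff[OF M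
      p(1)[OF M]] by simp
    have "\<exists>!u. u \<in> Hom (FO ?F M) v \<and> u \<cdot> p M = h" if h: "h \<in> Hom (\<S> M 0) v"
      "h \<cdot> bd M 0 = \<zero>\<^bsub>\<S> M (Suc 0), v\<^esub>" for v h
    proof -
      note v = Hom_Obj(2)[OF h(1)]
      define g where "g = mor M (\<lambda>c. h \<cdot> inc (EO M) 0 [c]) (triv v)"
      have g: "g \<in> homset Mod M (triv v)" unfolding g_def using bd0_zero_iff[OF M h(1)] h(2) by (intro
        mor_Hom[OF M triv_Mod[OF v]]) simp
      have cg: "cmp g c = h \<cdot> inc (EO M) 0 [c]" if c: "c \<in> Ob" for c
        unfolding g_def using cmp_mor[OF M c, of "\<lambda>c. h \<cdot> inc (EO M) 0 [c]" "triv v"]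
          Cmp_homset[OF inc0_Hom[OF M c] h(1)] triv_EO[OF c] by simp
      have iff: "FA ?G u \<cdot>\<^bsub>Mod\<^esub> \<eta> M = g \<longleftrightarrow> u \<cdot> p M = h" if
        u: "u \<in> Hom (FO ?F M) v" for u
      proof -
        have c: "cmp (FA ?G u \<cdot>\<^bsub>Mod\<^esub> \<eta> M) c = (u \<cdot> p M) \<cdot> inc (EO M) 0
          [c]" if "c \<in> Ob" for c
          unfolding Triv_Cmp(3)[OF u \<eta>[OF M] that] p(2)[OF M that, symmetric] by (rule
            Cmp_assoc[symmetric, OF inc0_Hom[OF M that] p(1)[OF M] u])
        show ?thesis
        proof
          assume "FA ?G u \<cdot>\<^bsub>Mod\<^esub> \<eta> M = g"
          then show "u \<cdot> p M = h" using c cg by (intro S0_eq[OF M Cmp_homset[OF p(1)[OF M] u] h(1)]) simp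
        next
          assume "u \<cdot> p M = h"
          then show "FA ?G u \<cdot>\<^bsub>Mod\<^esub> \<eta> M = g" using c cg by (intro Mod_arrow_eqI[OF
            Triv_Cmp(2)[OF u \<eta>[OF M]] g]) simp
        qed
      qed
      have "\<exists>!u. u \<in> Hom (FO ?F M) v \<and> FA ?G u \<cdot>\<^bsub>Mod\<^esub> \<eta> M = g" by
        (rule univ[OF M v]) (use g Triv_FO[OF v] in simp)
      then show ?thesis using iff by metis
    qed
    then show "is_cokernel V (p M) (bd M 0)" unfolding is_cokernel_iff[OF p(1)[OF M] bd_Hom[OF M]] using z by blast
  next
    fix M N \<phi> assume f: "\<phi> \<in> homset Mod M N"
    note M = Hom_mor(3)[OF f] and N = Hom_mor(4)[OF f]
    show "p N \<cdot> bmap M N \<phi> 0 = FA ?F \<phi> \<cdot> p M"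
    proof (rule S0_eq[OF M Cmp_homset[OF S_map(1)[OF f] p(1)[OF N]] Cmp_homset[OF p(1)[OF M] FA[OF f]]])
      fix c assume c: "c \<in> Ob"
      note i = inc0_Hom[OF M c] inc0_Hom[OF N c]
      have I: "[c] \<in> Ix 0" using c Ix_0 by blast
      have "(p N \<cdot> bmap M N \<phi> 0) \<cdot> inc (EO M) 0 [c] = p N \<cdot> (inc (EO N) 0 [c] \<cdot>
        cmp \<phi> c)"
        unfolding Cmp_assoc[OF i(1) S_map(1)[OF f] p(1)[OF N]] S_map(2)[OF f I] by simp
      also have "\<dots> = cmp (\<eta> N) c \<cdot> cmp \<phi> c" unfolding Cmp_assoc[OF cmp_Hom[OF f c] i(2)
        p(1)[OF N], symmetric] p(2)[OF N c] ..
      also have "\<dots> = FA ?F \<phi> \<cdot> cmp (\<eta> M) c"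
        unfolding cmp_Cmp(3)[OF f \<eta>[OF N] c, symmetric] nat[OF f] by (rule Triv_Cmp(3)[OF FA[OF f] \<eta>[OF M] c])
      also have "\<dots> = (FA ?F \<phi> \<cdot> p M) \<cdot> inc (EO M) 0 [c]" unfolding Cmp_assoc[OF i(1)
        p(1)[OF M] FA[OF f]] p(2)[OF M c] ..
      finally show "(p N \<cdot> bmap M N \<phi> 0) \<cdot> inc (EO M) 0 [c] = (FA ?F \<phi> \<cdot> p M)
        \<cdot> inc (EO M) 0 [c]" .
    qed
  qed
qed

theorem homology_bar:
  assumes M: "M \<in> Obj Mod"
  shows "isomorphic V (enriched_homology V C \<epsilon> n M) (simplicial_homology V (bar_simplicial V C
    \<epsilon> M) n)"
proof -
  let ?F = "Coinv V C \<epsilon>"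
  obtain P d e where res: "projective_resolution Mod M P d e"
    and ld: "left_derived Mod V ?F n M = homology V (\<lambda>i. FO ?F (P i)) (\<lambda>i. FA ?F (d i)) n"
    using left_derived_eq[OF M] by blast
  have P: "projective Mod (P j)" "d j \<in> homset Mod (P (Suc j)) (P j)" "exact_at Mod (d (Suc j)) (d j)" for j
    using res unfolding projective_resolution_def by auto
  have e: "e \<in> homset Mod (P 0) M" "epi_arrow Mod e" "exact_at Mod (d 0) e" using res unfolding
    projective_resolution_def by auto
  have PO: "P j \<in> Obj Mod" for j using P(1)[of j] by (simp add: projective_def)
  obtain p where p: "\<And>M. M \<in> Obj Mod \<Longrightarrow> p M \<in> Hom (\<S> M 0) (FO ?F M)"
    "\<And>M. M \<in> Obj Mod \<Longrightarrow> is_cokernel V (p M) (bd M 0)"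
    "\<And>M N \<phi>. \<phi> \<in> homset Mod M N \<Longrightarrow> p N \<cdot> bmap M N \<phi> 0 = FA ?F
      \<phi> \<cdot> p M"
    "\<And>M N \<phi>. \<phi> \<in> homset Mod M N \<Longrightarrow> FA ?F \<phi> \<in> Hom (FO ?F M) (FO ?F N)"
    by (rule Coinv_cokernel) blast
  \<comment> \<open>Position \<open>i\<close>, \<open>j\<close> holds S_i of the j-th projective.
    Along \<open>i\<close> run the bar complexes, augmented by the cokernels \<open>p\<close> to the
    coinvariants of the resolution; along \<open>j\<close> runs S_i of the resolution, augmented by
    \<open>e\<close> to the bar complex of \<open>M\<close>.\<close>
  have bi: "biresolution (\<lambda>i j. \<S> (P j) i) (\<lambda>i j. bd (P j) i) (\<lambda>i j. bmap (P (Suc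
    j)) (P j) (d j) i)
      (\<lambda>j. FO ?F (P j)) (\<lambda>j. p (P j)) (\<lambda>j. FA ?F (d j)) (\<lambda>i. \<S> M i)
        (\<lambda>i. bmap (P 0) M e i) (\<lambda>i. bd M i)"
    unfolding biresolution_def
  proof (intro conjI allI)
    fix i j
    show "\<S> (P j) i \<in> Obj V" "\<S> M j \<in> Obj V" using S_Obj PO M by auto
    show "bd (P j) i \<in> Hom (\<S> (P j) (Suc i)) (\<S> (P j) i)"
      "bd M j \<in> Hom (\<S> M (Suc j)) (\<S> M j)" using bd_Hom PO M by auto
    show "bmap (P (Suc j)) (P j) (d j) i \<in> Hom (\<S> (P (Suc j)) i) (\<S> (P j) i)" by (rule S_map(1)[OF P(2)])
    show "bd (P j) i \<cdot> bmap (P (Suc j)) (P j) (d j) (Suc i) = bmap (P (Suc j)) (P j) (d j) i \<cdot> bd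
      (P (Suc j)) i"
      by (rule bd_natural[symmetric, OF P(2)])
    show "chase_exact (bd (P j) (Suc i)) (bd (P j) i)" by (rule projective_bar_exact[OF P(1)])
    show "chase_exact (bmap (P (Suc (Suc j))) (P (Suc j)) (d (Suc j)) i) (bmap (P (Suc j)) (P j) (d j) i)"
      unfolding bmap_def by (rule Smap_chase_exact[OF famHom_cmp[OF P(2)] famHom_cmp[OF P(2)]
        Mod_exact_pointwise[OF P(2) P(2) P(3)]])
    show "p (P j) \<in> Hom (\<S> (P j) 0) (FO ?F (P j))" by (rule p(1)[OF PO])
    then show "FO ?F (P j) \<in> Obj V" by (rule Hom_Obj(2))
    show "epi_arrow V (p (P j))" by (rule cokernel_epi[OF p(2)[OF PO]])
    show "chase_exact (bd (P j) 0) (p (P j))" by (rule cokernel_chase_exact[OF p(2)[OF PO] p(1)[OF PO] bd_Hom[OF PO]])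
    show "FA ?F (d j) \<in> Hom (FO ?F (P (Suc j))) (FO ?F (P j))" by (rule p(4)[OF P(2)])
    show "p (P j) \<cdot> bmap (P (Suc j)) (P j) (d j) 0 = FA ?F (d j) \<cdot> p (P (Suc j))" by (rule p(3)[OF P(2)])
    show "bmap (P 0) M e j \<in> Hom (\<S> (P 0) j) (\<S> M j)" by (rule S_map(1)[OF e(1)])
    show "epi_arrow V (bmap (P 0) M e j)" unfolding bmap_def by (rule Smap_epi[OF famHom_cmp[OF e(1)]
      Mod_epi_pointwise[OF e(1,2)]])
    show "chase_exact (bmap (P (Suc 0)) (P 0) (d 0) j) (bmap (P 0) M e j)"
      unfolding bmap_def by (rule Smap_chase_exact[OF famHom_cmp[OF P(2)] famHom_cmp[OF e(1)]
        Mod_exact_pointwise[OF P(2) e(1) e(3)]])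
    show "bmap (P 0) M e j \<cdot> bd (P 0) j = bd M j \<cdot> bmap (P 0) M e (Suc j)" by (rule bd_natural[OF e(1)])
  qed
  \<comment> \<open>That the chosen object is a homology object presupposes a complex; this is read
    off from the double complex by \<open>biresolution_complex\<close>.\<close>
  have HA: "is_homology V (\<lambda>i. FO ?F (P i)) (\<lambda>i. FA ?F (d i)) n (enriched_homology V C \<epsilon> n M)"
    unfolding enriched_homology_def ld
    by (rule is_homology_ex[where X = "\<lambda>i. FO ?F (P i)" and d = "\<lambda>i. FA ?F (d i)", OF
      bi_simps(7)[OF bi] bi_simps(11)[OF bi] biresolution_complex[OF bi]])
  have HB: "is_homology V (\<lambda>i. \<S> M i) (\<lambda>i. bd M i) n (homology V (\<lambda>i. \<S> M i)
    (\<lambda>i. bd M i) n)"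
    by (rule is_homology_ex[where X = "\<lambda>i. \<S> M i" and d = "\<lambda>i. bd M i", OF S_Obj[OF M]
      bd_Hom[OF M] bd_bd[OF M]])
  have "simplicial_homology V (bar_simplicial V C \<epsilon> M) n = homology V (\<lambda>i. \<S> M i)
    (\<lambda>i. bd M i) n"
    unfolding simplicial_homology_def by (simp add: simp_ob_bar[abs_def] bd_def[abs_def])
  then show ?thesis using balancing[OF bi HA HB] by simp
qed

end

theorem theorem3p15:
  fixes V :: "('o, 'a) moncat"
    and C :: "('u, 'o, 'a) ecat"
    and \<epsilon> :: "('u, unit, 'a) efunc"
    and M :: "('u, 'o, 'a) efunc"
    and n :: nat
  assumes "infinite (UNIV :: 'u set)"
    and "abelian_cosmos TYPE('u) V"
    and "enough_projectives V"
    and "augmented_category V C \<epsilon>"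
    and "flat_ecat V C"
    and "M \<in> Obj (Mod_cat V C)"
  shows "isomorphic V (enriched_homology V C \<epsilon> n M)
           (simplicial_homology V (bar_simplicial V C \<epsilon> M) n)"
proof -
  interpret symmetric_closed_monoidal V using assms(2) by (simp add: abelian_cosmos_def benabou_cosmos_def)
  interpret abelian_category V using assms(2) by (simp add: abelian_cosmos_def)
  interpret abelian_monoidal V by unfold_locales (fact assms(3))
  interpret enriched_category V C using assms(4) by (simp add: augmented_category_def)
  have small: "small_cocomplete TYPE('u) V" "AB4 TYPE('u) V"
    using assms(2) by (simp_all add: abelian_cosmos_def benabou_cosmos_def)
  interpret module_setting V C by unfold_locales
  \<comment> \<open>The objects of \<open>C\<close> are themselves elements of \<open>'u\<close>, so
    the identity serves as the injection of the index set.\<close>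
  interpret free_module_setting V C
    by unfold_locales (rule small_coproducts[OF small(1) inj_on_id])
  interpret augmented_setting V C \<epsilon>
    using assms(1,4,5) small by unfold_locales (simp_all add: augmented_category_def)
  show ?thesis by (rule homology_bar[OF assms(6)])
qed

end
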